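(* Let $X\subset \mathbb P^4$ be an integral projective variety of dimension $3$. Let $D_1,\dots,D_l$ be pairwise distinct effective Cartier divisors of $X$, each an integral surface linearly equivalent to a multiple of the general hyperplane section $H$ of $X$, with degrees $s_1\leq s_2\leq\dots\leq s_l$; let $r_1,\dots,r_l$ be positive integers, and let $$S=r_1D_1+r_2D_2+\dots+r_lD_l.$$ Put $s=s_1$ and $\deg S=r_1s_1+\dots+r_ls_l$. If $\deg X>1$, assume that $D_1$ is a hyperplane section of $X$. Let $C\subset S$ be a curve of degree $d>30(\deg S)^7$ and arithmetic genus $p_a(C)$. Then $$p_a(C)\leq \frac{d^2}{2s}+\frac{d}{2}(s-4)+1-\epsilon_1,$$ where $$\epsilon_1=\frac{(s-1-\epsilon)(1+\epsilon)(s-1)}{2s}$$ and $\epsilon$ is defined by dividing $d-1=ms+\epsilon$, $0\leq\epsilon\leq s-1$. Moreover the bound is sharp, in the sense that there exist an integral projective variety $X\subset\mathbb P^4$ of dimension $3$, an effective Cartier divisor $S=r_1D_1+\dots+r_lD_l$ of $X$ (with $r_1,\dots,r_l$ positive integers and $D_1,\dots,D_l$ pairwise distinct effective Cartier divisors of $X$, each an integral surface linearly equivalent to a multiple of the general hyperplane section of $X$, of degrees $s=s_1\leq s_2\leq\dots\leq s_l$, and with $D_1$ a hyperplane section of $X$ if $\deg X>1$), an integer $d>30(\deg S)^7$, and a curve $C\subset S$ of degree $d$, for which equality $p_a(C)=\frac{d^2}{2s}+\frac{d}{2}(s-4)+1-\epsilon_1$ holds.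
   Context: The base field is $\mathbb C$. A curve is a projective scheme of dimension $1$ (not necessarily reduced, irreducible, or Cohen-Macaulay); its arithmetic genus is $p_a(C)=1-\chi(\mathcal O_C)$. Degrees are taken with respect to the given embedding in $\mathbb P^4$. Effective Cartier divisors of $X$ are identified with the associated closed subschemes of $X$. If $f_i$ is a local generator of the ideal sheaf of $D_i$ in $X$, then $S=r_1D_1+\dots+r_lD_l$ denotes the effective Cartier divisor with local generator $f_1^{r_1}f_2^{r_2}\cdots f_l^{r_l}$, regarded as a closed subscheme (a projective surface) of $X$; $C\subset S$ means that $C$ is a closed subscheme of $S$. *)

theory Defs
  imports
    Complex_Main
    "HOL-Library.Poly_Mapping"
    "HOL-Library.Numeral_Type"
    "HOL-Library.Function_Algebras"
    "HOL-Computational_Algebra.Polynomial"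
    "HOL-Computational_Algebra.Fraction_Field"
begin

section \<open>The homogeneous coordinate ring of projective 4-space\<close>

text \<open>
  \<open>mpoly\<close> is \<open>\<complex>[x\<^sub>0,\<dots>,x\<^sub>4]\<close>; the variables are indexed by the five-element type \<open>5\<close>, and a
  monomial is its exponent vector. The \<open>fract\<close> type over it is the field of rational functions.
\<close>

type_synonym mpoly = "(5 \<Rightarrow>\<^sub>0 nat) \<Rightarrow>\<^sub>0 complex"

definition var :: "5 \<Rightarrow> mpoly" where
  "var i = Poly_Mapping.single (Poly_Mapping.single i 1) 1"

definition const :: "complex \<Rightarrow> mpoly" where
  "const c = Poly_Mapping.single 0 c"

text \<open>The zero polynomial is homogeneous of every degree.\<close>

definition homog :: "nat \<Rightarrow> mpoly \<Rightarrow> bool" where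
  "homog e f \<longleftrightarrow> (\<forall>m\<in>Poly_Mapping.keys f. (\<Sum>i\<in>UNIV. Poly_Mapping.lookup m i) = e)"

text \<open>
  For a ring regarded as a module over itself, \<open>module.subspace (*)\<close> says ``is an ideal'' and
  \<open>module.span (*)\<close> is the ideal generated by a set.
\<close>

definition homog_ideal :: "mpoly set \<Rightarrow> bool" where
  "homog_ideal I \<longleftrightarrow> module.subspace (*) I \<and> I = module.span (*) {f \<in> I. \<exists>e. homog e f}"

definition saturation :: "mpoly set \<Rightarrow> mpoly set" where
  "saturation I = {f. \<forall>i. \<exists>n. var i ^ n * f \<in> I}"


section \<open>Closed subschemes of projective 4-space\<close>

text \<open>
  A closed subscheme is represented by its saturated homogeneous ideal; this is the standard
  bijection between closed subschemes of projective space and such ideals. It reverses inclusions: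
  \<open>Y\<close> is a closed subscheme of \<open>Z\<close> iff the ideal of \<open>Z\<close> is contained in that of \<open>Y\<close>. The unit
  ideal represents the empty scheme.
\<close>

definition closed_subscheme :: "mpoly set \<Rightarrow> bool" where
  "closed_subscheme I \<longleftrightarrow> homog_ideal I \<and> saturation I = I"

definition subscheme_of :: "mpoly set \<Rightarrow> mpoly set \<Rightarrow> bool" where
  "subscheme_of Y Z \<longleftrightarrow> closed_subscheme Y \<and> closed_subscheme Z \<and> Z \<subseteq> Y"

definition relevant_prime :: "mpoly set \<Rightarrow> bool" where
  "relevant_prime P \<longleftrightarrow> homog_ideal P \<and> (\<exists>i. var i \<notin> P) \<and>
     (\<forall>a b. a * b \<in> P \<longrightarrow> a \<in> P \<or> b \<in> P)"

text \<open>The points of \<open>Proj\<close>; \<open>Q\<close> is a specialization of \<open>P\<close> iff \<open>P \<subseteq> Q\<close>.\<close>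

definition points :: "mpoly set \<Rightarrow> mpoly set set" where
  "points Y = {P. relevant_prime P \<and> Y \<subseteq> P}"

definition integral_subscheme :: "mpoly set \<Rightarrow> bool" where
  "integral_subscheme Y \<longleftrightarrow> closed_subscheme Y \<and> relevant_prime Y"

text \<open>Krull dimension: a chain of irreducible closed subsets is a chain of their generic points.\<close>

definition has_chain :: "mpoly set \<Rightarrow> nat \<Rightarrow> bool" where
  "has_chain Y n \<longleftrightarrow> (\<exists>P :: nat \<Rightarrow> mpoly set.
     (\<forall>i\<le>n. P i \<in> points Y) \<and> (\<forall>i<n. P i \<subset> P (Suc i)))"

definition has_dim :: "mpoly set \<Rightarrow> nat \<Rightarrow> bool" where
  "has_dim Y n \<longleftrightarrow> has_chain Y n \<and> \<not> has_chain Y (Suc n)"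

definition curve :: "mpoly set \<Rightarrow> bool" where
  "curve C \<longleftrightarrow> closed_subscheme C \<and> has_dim C 1"


section \<open>Degree\<close>

text \<open>
  The dimension of \<open>V / W\<close> for subspaces \<open>W \<subseteq> V\<close>, as the cardinality of a finite \<open>B \<subseteq> V\<close> that
  induces a basis of the quotient. It is used only where the quotient is finite-dimensional.
\<close>

definition quotient_dim ::
    "(complex \<Rightarrow> 'b \<Rightarrow> 'b) \<Rightarrow> 'b::ab_group_add set \<Rightarrow> 'b set \<Rightarrow> nat" where
  "quotient_dim scale V W = (THE n. \<exists>B\<subseteq>V. finite B \<and> card B = n \<and>
     V \<subseteq> module.span scale (B \<union> W) \<and>
     (\<forall>c. (\<Sum>b\<in>B. scale (c b) b) \<in> W \<longrightarrow> (\<forall>b\<in>B. c b = 0)))"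

definition hilbert_function :: "mpoly set \<Rightarrow> nat \<Rightarrow> nat" where
  "hilbert_function Y n =
     quotient_dim (\<lambda>c f. const c * f) {f. homog n f} {f \<in> Y. homog n f}"

definition hilbert_poly :: "mpoly set \<Rightarrow> real poly" where
  "hilbert_poly Y =
     (THE p. \<exists>n0. \<forall>n\<ge>n0. poly p (real n) = real (hilbert_function Y n))"

text \<open>
  If \<open>Y\<close> has dimension \<open>n\<close>, its Hilbert polynomial has degree \<open>n\<close>, and the degree of \<open>Y\<close> in
  projective space is \<open>n!\<close> times the leading coefficient.
\<close>

definition proj_degree :: "mpoly set \<Rightarrow> real" where
  "proj_degree Y = fact (degree (hilbert_poly Y)) * lead_coeff (hilbert_poly Y)"


section \<open>Sections on basic opens\<close>

definition basic_open :: "mpoly \<Rightarrow> bool" where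
  "basic_open u \<longleftrightarrow> u \<noteq> 0 \<and> (\<exists>e>0. homog e u)"

text \<open>
  Sections over \<open>D\<^sub>+(u)\<close> of the ideal sheaf associated with \<open>I\<close>. For \<open>I = UNIV\<close> these are the
  sections of the structure sheaf of projective space, and \<open>sections UNIV u / sections Y u\<close> is
  \<open>\<O>\<^sub>Y(D\<^sub>+(u))\<close>.
\<close>

definition sections :: "mpoly set \<Rightarrow> mpoly \<Rightarrow> mpoly fract set" where
  "sections I u =
     {Fract f (u ^ n) | f n e. 0 < e \<and> homog e u \<and> f \<in> I \<and> homog (n * e) f}"


section \<open>Euler characteristic and arithmetic genus\<close>

text \<open>
  Cohomology of \<open>\<O>\<^sub>Y\<close> is Cech cohomology for the standard affine cover by the \<open>D\<^sub>+(x\<^sub>i)\<close>. A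
  \<open>k\<close>-cochain is a function on index sets which vanishes off those with \<open>k + 1\<close> elements; the value
  at \<open>J\<close> lies over the intersection of the \<open>D\<^sub>+(x\<^sub>j)\<close>, \<open>j \<in> J\<close>. Cochains with values in \<open>\<O>\<^sub>Y\<close> are
  \<open>cech UNIV k / cech Y k\<close>, so the cocycles and coboundaries below are preimages in \<open>cech UNIV k\<close>.
\<close>

definition cech :: "mpoly set \<Rightarrow> nat \<Rightarrow> (5 set \<Rightarrow> mpoly fract) set" where
  "cech I k = {c. \<forall>J. if card J = Suc k then c J \<in> sections I (\<Prod>j\<in>J. var j) else c J = 0}"

definition cech_diff :: "(5 set \<Rightarrow> mpoly fract) \<Rightarrow> 5 set \<Rightarrow> mpoly fract" where
  "cech_diff c J = (\<Sum>j\<in>J. (-1) ^ card {i\<in>J. i < j} * c (J - {j}))"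

definition cocycles :: "mpoly set \<Rightarrow> nat \<Rightarrow> (5 set \<Rightarrow> mpoly fract) set" where
  "cocycles Y k = {c \<in> cech UNIV k. cech_diff c \<in> cech Y (Suc k)}"

definition coboundaries :: "mpoly set \<Rightarrow> nat \<Rightarrow> (5 set \<Rightarrow> mpoly fract) set" where
  "coboundaries Y k = {a + b | a b. a \<in> cech Y k \<and>
     b \<in> (case k of 0 \<Rightarrow> {0} | Suc j \<Rightarrow> cech_diff ` cech UNIV j)}"

definition cohomology_dim :: "mpoly set \<Rightarrow> nat \<Rightarrow> nat" where
  "cohomology_dim Y k =
     quotient_dim (\<lambda>z c J. Fract (const z) 1 * c J) (cocycles Y k) (coboundaries Y k)"

text \<open>The cover has five members, so the cohomology vanishes above degree 4.\<close>

definition euler_char :: "mpoly set \<Rightarrow> int" where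
  "euler_char Y = (\<Sum>k\<le>4. (-1) ^ k * int (cohomology_dim Y k))"

definition arith_genus :: "mpoly set \<Rightarrow> int" where
  "arith_genus C = 1 - euler_char C"


section \<open>Effective Cartier divisors\<close>

text \<open>
  \<open>\<phi>\<close> represents a non-zero-divisor of \<open>\<O>\<^sub>X(D\<^sub>+(u))\<close> that generates the ideal of \<open>D\<close>. Over
  \<open>D\<^sub>+(u)\<close> the ideals of \<open>D\<close> and of \<open>(\<phi>)\<close> are compared after taking preimages in the coordinate
  ring of \<open>D\<^sub>+(u)\<close>.
\<close>

definition local_generator :: "mpoly set \<Rightarrow> mpoly set \<Rightarrow> mpoly \<Rightarrow> mpoly fract \<Rightarrow> bool" where
  "local_generator X D u \<phi> \<longleftrightarrow> basic_open u \<and> \<phi> \<in> sections UNIV u \<and>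
     sections D u = {a * \<phi> + b | a b. a \<in> sections UNIV u \<and> b \<in> sections X u} \<and>
     (\<forall>a\<in>sections UNIV u. a * \<phi> \<in> sections X u \<longrightarrow> a \<in> sections X u)"

definition effective_cartier :: "mpoly set \<Rightarrow> mpoly set \<Rightarrow> bool" where
  "effective_cartier X D \<longleftrightarrow> subscheme_of D X \<and>
     (\<forall>P\<in>points X. \<exists>u \<phi>. u \<notin> P \<and> local_generator X D u \<phi>)"

text \<open>\<open>E = \<Sum>i\<in>A. r i * D i\<close> as effective Cartier divisors of \<open>X\<close>.\<close>

definition divisor_sum ::
    "mpoly set \<Rightarrow> 'i set \<Rightarrow> ('i \<Rightarrow> nat) \<Rightarrow> ('i \<Rightarrow> mpoly set) \<Rightarrow> mpoly set \<Rightarrow> bool" where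
  "divisor_sum X A r D E \<longleftrightarrow> effective_cartier X E \<and>
     (\<forall>u \<phi>. basic_open u \<and> (\<forall>i\<in>A. local_generator X (D i) u (\<phi> i)) \<longrightarrow>
        local_generator X E u (\<Prod>i\<in>A. \<phi> i ^ r i))"

text \<open>
  For integral \<open>X\<close>: the local ring of projective space at the generic point of \<open>X\<close> and its maximal
  ideal. Their quotient is the function field of \<open>X\<close>.
\<close>

definition generic_ring :: "mpoly set \<Rightarrow> mpoly fract set" where
  "generic_ring X = {Fract a b | a b e. homog e a \<and> homog e b \<and> b \<notin> X}"

definition generic_max :: "mpoly set \<Rightarrow> mpoly fract set" where
  "generic_max X = {Fract a b | a b e. homog e a \<and> homog e b \<and> a \<in> X \<and> b \<notin> X}"

text \<open>\<open>D - E\<close> is the divisor of the nonzero rational function on \<open>X\<close> represented by \<open>\<psi>\<close>.\<close>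

definition lin_equiv :: "mpoly set \<Rightarrow> mpoly set \<Rightarrow> mpoly set \<Rightarrow> bool" where
  "lin_equiv X D E \<longleftrightarrow> effective_cartier X D \<and> effective_cartier X E \<and>
     (\<exists>\<psi>\<in>generic_ring X - generic_max X. \<forall>P\<in>points X. \<exists>u \<phi> \<phi>'. u \<notin> P \<and>
        local_generator X D u \<phi> \<and> local_generator X E u \<phi>' \<and> \<phi> - \<psi> * \<phi>' \<in> generic_max X)"

definition hyperplane_section :: "mpoly set \<Rightarrow> mpoly set \<Rightarrow> bool" where
  "hyperplane_section X H \<longleftrightarrow>
     (\<exists>h. homog 1 h \<and> h \<notin> X \<and> H = saturation (module.span (*) (insert h X)))"

text \<open>
  All hyperplane sections of an integral \<open>X\<close> are linearly equivalent, so which one is used to name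
  the class of the general one is immaterial. The multiplicity may be taken in \<open>nat\<close>: no nonempty
  effective divisor is equivalent to a multiple \<open>k * H\<close> with \<open>k \<le> 0\<close>.
\<close>

definition equiv_hyperplane_multiple :: "mpoly set \<Rightarrow> mpoly set \<Rightarrow> bool" where
  "equiv_hyperplane_multiple X D \<longleftrightarrow> (\<exists>(k::nat) H E. hyperplane_section X H \<and>
     divisor_sum X {()} (\<lambda>_. k) (\<lambda>_. H) E \<and> lin_equiv X D E)"


section \<open>The setting and the genus bound\<close>

definition divisor_setting ::
    "mpoly set \<Rightarrow> nat \<Rightarrow> (nat \<Rightarrow> mpoly set) \<Rightarrow> (nat \<Rightarrow> nat) \<Rightarrow> (nat \<Rightarrow> nat) \<Rightarrow> mpoly set \<Rightarrow> bool"
where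
  "divisor_setting X l D r s S \<longleftrightarrow>
     integral_subscheme X \<and> has_dim X 3 \<and> 1 \<le> l \<and> inj_on D {1..l} \<and>
     (\<forall>i\<in>{1..l}. effective_cartier X (D i) \<and> integral_subscheme (D i) \<and> has_dim (D i) 2 \<and>
        equiv_hyperplane_multiple X (D i) \<and> proj_degree (D i) = real (s i) \<and> 0 < r i) \<and>
     mono_on {1..l} s \<and>
     (proj_degree X > 1 \<longrightarrow> hyperplane_section X (D 1)) \<and>
     divisor_sum X {1..l} r D S"

definition genus_bound :: "nat \<Rightarrow> nat \<Rightarrow> real" where
  "genus_bound d s =
     (let \<epsilon> = real ((d - 1) mod s);
          \<epsilon>\<^sub>1 = (real s - 1 - \<epsilon>) * (1 + \<epsilon>) * (real s - 1) / (2 * real s)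
      in (real d)\<^sup>2 / (2 * real s) + real d / 2 * (real s - 4) + 1 - \<epsilon>\<^sub>1)"

end

theory Submission
  imports Defs "HOL-Computational_Algebra.Polynomial_Factorial" "HOL-Computational_Algebra.Field_as_Ring"
begin

text \<open>
  The divisors are cut out by single forms, \<open>X = V(G)\<close> and \<open>D\<^sub>i = V(G, H\<^sub>i)\<close>, because a complete
  intersection of two hypersurfaces is saturated; so \<open>G\<close> and \<open>F = \<Prod>H\<^sub>i ^ r\<^sub>i\<close> vanish on \<open>C\<close>. The genus is
  \<open>1 - c\<^sub>0\<close>, where \<open>d n + c\<^sub>0\<close> is the Hilbert polynomial of \<open>C\<close>.

  In general coordinates the pencil spanned by \<open>x\<^sub>0\<close> and \<open>x\<^sub>1\<close> produces numbers \<open>b\<^sub>j\<close> with \<open>\<Sum>b\<^sub>j = d\<close> and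
  \<open>c\<^sub>0 \<ge> d - \<Sum>j b\<^sub>j\<close>. Over the field \<open>\<complex>(x\<^sub>0, x\<^sub>1, x\<^sub>2)\<close> the number \<open>b\<^sub>n\<close> is the dimension of the polynomials in
  \<open>x\<^sub>3, x\<^sub>4\<close> of degree at most \<open>n\<close> modulo those that come from equations of \<open>C\<close> of bounded degree. As long as these
  equations together with \<open>G\<close> and \<open>F\<close> do not generate the unit ideal over this field, they vanish on some
  \<open>D\<^sub>i\<close>, which becomes a set of at least \<open>s\<close> points there, and \<open>b\<^sub>n \<ge> min (n + 1) s\<close>. Once they do generate it, the
  regular sequence \<open>G, F\<close> forces \<open>b\<close> to decrease strictly to zero; the lower bound on \<open>d\<close> excludes that this
  happens before degree \<open>deg G + deg F - 2\<close>. Among all such sequences with sum \<open>d\<close> the weighted sum \<open>\<Sum>j b\<^sub>j\<close>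
  is largest for an explicit one, which gives the bound.
\<close>

section \<open>Dimension of a quotient\<close>

text \<open>The curve may be nonreduced, reducible and have embedded points, so there is no general
  position for its hyperplane sections; equations of bounded degree take the place of points. The
  number b_n is the first difference of the Hilbert function of the section by the generic
  hyperplane of the pencil, a scheme of length d over \<open>\<complex>(x0, x1)\<close>. Monomials
  representing it, multiplied by forms in x0 and x1, stay independent on the curve, whence the
  inequality for c_0. As x2 is a nonzerodivisor too, b_n can be computed modulo x2, and linear
  algebra moves the count from x2 = 0 to x2 transcendental. Over this larger field the curve has no
  points left, while its equations up to a given degree may still have zeros; this is why a bounded
  degree is kept throughout. Were the unit ideal reached early, d would be the sum of a few crudely
  bounded terms and a strictly decreasing tail. Cohomology is needed only because the genus is
  defined by it: classes are torsion under forms of high degree, and two generic linear cuts compare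
  the Euler characteristic with the Hilbert function.\<close>

definition qindep :: "('a::field => 'b => 'b) => 'b::ab_group_add set => 'b set => bool" where
  "qindep sc B W \<longleftrightarrow> finite B & (ALL c. (SUM b:B. sc (c b) b) : W --> (ALL b:B. c b = 0))"

text \<open>A relation instead of a value: the witnessing basis asserts finite dimension together
  with the number, so no separate finiteness hypothesis travels through the exact sequences.\<close>

definition qd :: "('a::field => 'b => 'b) => 'b::ab_group_add set => 'b set => nat => bool" where
  "qd sc V W n \<longleftrightarrow>
     (EX B<=V. qindep sc B W & card B = n & V \<subseteq> module.span sc (B Un W))"

lemma qindepD: "qindep sc B W ==> (SUM b:B. sc (c b) b) : W ==> b : B ==> c b = 0"
  unfolding qindep_def by blast

lemma qindep_finite: "qindep sc B W ==> finite B"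
  unfolding qindep_def by blast

lemma ex_maximal_nat:
  fixes f :: "'a => nat"
  assumes "P a" "!!x. P x ==> f x <= b"
  shows "EX x. P x & (ALL y. P y --> f y <= f x)"
  using ex_has_greatest_nat[of P a f "Suc b"] assms by (auto simp: less_Suc_eq_le)

context vector_space
begin

lemma span_Un_subspace:
  assumes "subspace W" shows "span (B Un W) = {x + w | x w. x : span B & w : W}"
  unfolding span_Un span_eq_iff[THEN iffD2, OF assms] ..

lemma qindep_empty [simp]: "qindep scale {} W"
  by (simp add: qindep_def)

lemma qindep_mono: "qindep scale B W ==> A \<subseteq> B ==> qindep scale A W"
proof -
  assume a: "qindep scale B W" "A \<subseteq> B"
  have fin: "finite B" using a(1) by (rule qindep_finite)
  show ?thesis unfolding qindep_def
  proof (intro conjI allI impI)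
    show "finite A" using a fin finite_subset by auto
    fix c assume s: "(SUM b:A. scale (c b) b) : W"
    have "(SUM b:B. scale (if b : A then c b else 0) b) : W" using fin a s by (simp add: sum.mono_neutral_cong_right)
    from qindepD[OF a(1) this] show "ALL b:A. c b = 0" using a(2) by fastforce
  qed
qed

lemma qindep_insert:
  assumes "qindep scale B W" "subspace W" "a ~: span (B Un W)"
  shows "qindep scale (insert a B) W" "a ~: B"
proof -
  show an: "a ~: B" using assms(3) span_base[of a "B Un W"] by blast
  have fin: "finite B" using assms(1) by (rule qindep_finite)
  show "qindep scale (insert a B) W" unfolding qindep_def
  proof (intro conjI allI impI)
    show "finite (insert a B)" using fin by simp
    fix c assume s: "(SUM b:insert a B. scale (c b) b) : W"
    have e: "scale (c a) a + (SUM b:B. scale (c b) b) : W" using s an fin by simp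
    have "c a = 0"
    proof (rule ccontr)
      assume n: "c a ~= 0"
      have "scale (c a) a : span (B Un W)"
      proof -
        have "scale (c a) a + (SUM b:B. scale (c b) b) - (SUM b:B. scale (c b) b) : span (B Un W)" using e by (fastforce intro: span_base span_sum span_scale span_diff)
        then show ?thesis by simp
      qed
      then have "scale (inverse (c a)) (scale (c a) a) : span (B Un W)" by (rule span_scale)
      with n assms(3) show False by simp
    qed
    moreover from this have "ALL b:B. c b = 0" using e qindepD[OF assms(1), of c] by simp
    ultimately show "ALL b:insert a B. c b = 0" by auto
  qed
qed

lemma qindep_trans:
  assumes "qindep scale B W" "subspace W"  "qindep scale A (span (B Un W))"
  shows "qindep scale (A Un B) W" "A Int B = {}"
proof -
  have fin: "finite A" "finite B" using assms(1,3)[THEN qindep_finite] by simp_all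
  show dis: "A Int B = {}"
  proof (rule ccontr)
    assume "A Int B ~= {}"
    then obtain x where x: "x : A" "x : B" by auto
    have "(SUM b:A. scale (if b = x then 1 else 0) b) = (SUM b:A. if b = x then x else 0)"
      by (rule sum.cong) auto
    also have "... = x" using x fin by simp
    finally have "(SUM b:A. scale (if b = x then 1 else 0) b) : span (B Un W)"
      using x(2) by (simp only:) (simp add: span_base)
    then show False using qindepD[OF assms(3), of "%b. if b = x then 1 else 0" x] x by simp
  qed
  show "qindep scale (A Un B) W" unfolding qindep_def
  proof (intro conjI allI impI)
    show "finite (A Un B)" using fin by simp
    fix c assume s: "(SUM b:A Un B. scale (c b) b) : W"
    have e: "(SUM b:A. scale (c b) b) + (SUM b:B. scale (c b) b) : W" using s fin dis
      by (simp add: sum.union_disjoint)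
    have "(SUM b:A. scale (c b) b) + (SUM b:B. scale (c b) b) - (SUM b:B. scale (c b) b) : span (B Un W)" using e by (fastforce intro: span_sum span_scale span_base span_diff)
    then have cA: "ALL b:A. c b = 0" using qindepD[OF assms(3), of c] by auto
    then have "(SUM b:A. scale (c b) b) = 0" by simp
    with e have "ALL b:B. c b = 0" using qindepD[OF assms(1), of c] by simp
    with cA show "ALL b:A Un B. c b = 0" by auto
  qed
qed

lemma span_span_Un: "span (A Un span C) = span (A Un C)"
  unfolding span_Un span_span ..

text \<open>Steinitz exchange modulo \<open>W\<close>, by induction on the number of elements of
  \<open>A\<close> outside \<open>B\<close>: such an element is not in the span of the others and
  \<open>W\<close>, so some element of \<open>B\<close> can take its place without losing
  independence.\<close>

lemma qindep_card_le:
  assumes "qindep scale A W" "subspace W" "finite B" "A \<subseteq> span (B Un W)"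
  shows "card A <= card B"
  using assms(3,1,4)
proof (induction "card (A - B)" arbitrary: A B rule: less_induct)
  case less
  show ?case
  proof (cases "A \<subseteq> B")
    case True then show ?thesis using less card_mono by blast
  next
    case False
    then obtain a where a: "a : A" "a ~: B" by auto
    have finA: "finite A" using less(3) by (rule qindep_finite)
    define A' where "A' = A - {a}"
    have qA': "qindep scale A' W" using qindep_mono less(3) A'_def by blast
    have aA': "a ~: span (A' Un W)"
    proof
      assume "a : span (A' Un W)"
      then obtain x w where xw: "a = x + w" "x : span A'" "w : W" using span_Un_subspace[OF assms(2)] by auto
      obtain u where u: "x = (SUM v:A'. scale (u v) v)" using finA xw(2) A'_def span_finite by auto
      have "(SUM b:A. scale (if b = a then 1 else - u b) b) = a + (SUM b:A'. scale (if b = a then 1 else - u b) b)"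
        using finA a unfolding A'_def by (subst sum.remove[of _ a]) auto
      also have "(SUM b:A'. scale (if b = a then 1 else - u b) b) = - x" unfolding u
        by (auto simp: A'_def sum_negf[symmetric] intro!: sum.cong)
      finally have "(SUM b:A. scale (if b = a then 1 else - u b) b) : W" using xw by simp
      then show False using qindepD[OF less(3), of "%b. if b = a then 1 else - u b" a] a by simp
    qed
    have "EX b:B - A. b ~: span (A' Un W)"
    proof (rule ccontr)
      assume "~ ?thesis"
      moreover have "b : span (A' Un W)" if "b : B" "b : A" for b
        using that a by (intro span_base) (auto simp: A'_def)
      ultimately have "B \<subseteq> span (A' Un W)" by blast
      then have "span (B Un W) \<subseteq> span (A' Un W)"
        by (intro span_minimal) (auto intro: span_base)
      then show False using less(4) a(1) aA' by (meson subsetD)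
    qed
    then obtain b where b: "b : B" "b ~: A" "b ~: span (A' Un W)" by auto
    have q2: "qindep scale (insert b A') W" using qindep_insert[OF qA' assms(2) b(3)] by auto
    have "insert b A' \<subseteq> span (B Un W)" using less(4) b by (auto simp: A'_def intro: span_base)
    moreover have "card (insert b A' - B) < card (A - B)"
    proof -
      have "insert b A' - B \<subseteq> A - B" "a : A - B" "a ~: insert b A' - B" using b a A'_def by auto
      then show ?thesis using finA by (metis finite_Diff psubsetI psubset_card_mono)
    qed
    ultimately have "card (insert b A') <= card B" using less(1)[OF _ less(2) q2] by auto
    moreover have "card (insert b A') = card A" using b a finA A'_def
      by (metis DiffE card_insert_disjoint card.remove finite_Diff)
    ultimately show ?thesis by simp
  qed
qed

lemma qd_unique:
  assumes "qd scale V W m" "qd scale V W n" "subspace W" shows "m = n"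
proof -
  obtain A where A: "A \<subseteq> V" "qindep scale A W" "card A = m" "V \<subseteq> span (A Un W)" using assms(1) by (auto simp: qd_def)
  obtain B where B: "B \<subseteq> V" "qindep scale B W" "card B = n" "V \<subseteq> span (B Un W)" using assms(2) by (auto simp: qd_def)
  have "card A <= card B & card B <= card A"
    using qindep_card_le[OF A(2) assms(3), of B] qindep_card_le[OF B(2) assms(3), of A] A B
      qindep_finite[OF A(2)] qindep_finite[OF B(2)] by blast
  then show ?thesis using A B by auto
qed

lemma qindep_le_qd:
  assumes "qindep scale A W" "A \<subseteq> V" "qd scale V W n" "subspace W" shows "card A <= n"
proof -
  obtain B where B: "B \<subseteq> V" "qindep scale B W" "card B = n" "V \<subseteq> span (B Un W)" using assms(3) by (auto simp: qd_def)
  then show ?thesis using qindep_card_le[OF assms(1,4), of B] assms(2) qindep_finite[OF B(2)] by blast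
qed

lemma qd_self: "qd scale V V 0"
  unfolding qd_def by (rule exI[of _ "{}"]) (auto intro: span_base)

text \<open>The basis is chosen inside the given spanning set \<open>S\<close>; this is what later
  makes bases of monomials possible.\<close>

lemma qd_exists:
  assumes "finite S" "S \<subseteq> V" "V \<subseteq> span (S Un W)" "subspace W"
  shows "EX B<=S. qindep scale B W & V \<subseteq> span (B Un W)"
proof -
  define P where "P B \<longleftrightarrow> B \<subseteq> S & qindep scale B W" for B
  have "P {}" by (simp add: P_def)
  moreover have "P B ==> card B <= card S" for B using assms(1) by (auto simp: P_def card_mono)
  ultimately obtain B where B: "P B" "ALL C. P C --> card C <= card B"
    using ex_maximal_nat[of P "{}" card "card S"] by blast
  have "S \<subseteq> span (B Un W)"
  proof
    fix a assume a: "a : S"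
    show "a : span (B Un W)"
    proof (rule ccontr)
      assume n: "a ~: span (B Un W)"
      have q: "qindep scale B W" using B by (simp add: P_def)
      have "P (insert a B)" using qindep_insert(1)[OF q assms(4) n] a B by (simp add: P_def)
      then show False using B qindep_insert(2)[OF q assms(4) n] qindep_finite[OF q] by auto
    qed
  qed
  then have "span (S Un W) \<subseteq> span (B Un W)" by (intro span_minimal) (auto intro: span_base)
  then show ?thesis using B assms(3) P_def by auto
qed

lemma qd_ex_bound:
  assumes "finite S" "V \<subseteq> span (S Un W)" "subspace W" "subspace V" "W \<subseteq> V"
  shows "EX n<=card S. qd scale V W n"
proof -
  define P where "P B \<longleftrightarrow> B \<subseteq> V & qindep scale B W" for B
  have le: "P B ==> card B <= card S" for B
    using qindep_card_le[of B W S] assms by (auto simp: P_def)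
  obtain B where B: "P B" "ALL C. P C --> card C <= card B" using le P_def ex_maximal_nat[of P "{}" card "card S"] by auto
  have q: "qindep scale B W" using B by (simp add: P_def)
  have "V \<subseteq> span (B Un W)"
  proof
    fix a assume a: "a : V"
    show "a : span (B Un W)"
    proof (rule ccontr)
      assume n: "a ~: span (B Un W)"
      have "P (insert a B)" using qindep_insert(1)[OF q assms(3) n] a B by (simp add: P_def)
      then show False using B qindep_insert(2)[OF q assms(3) n] qindep_finite[OF q] by auto
    qed
  qed
  then show ?thesis by (metis B le qd_def P_def)
qed

lemma qd_add:
  assumes "qd scale V W m" "qd scale U V n" "subspace W" "subspace V" "W \<subseteq> V" "V \<subseteq> U"
  shows "qd scale U W (m + n)"
proof -
  obtain B where B: "B \<subseteq> V" "qindep scale B W" "card B = m" "V \<subseteq> span (B Un W)" using assms(1) by (auto simp: qd_def)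
  obtain A where A: "A \<subseteq> U" "qindep scale A V" "card A = n" "U \<subseteq> span (A Un V)" using assms(2) by (auto simp: qd_def)
  have sp: "span (B Un W) = V"
    using B(1,4) assms(4,5) by (intro antisym span_minimal) simp_all
  have q: "qindep scale (A Un B) W" "A Int B = {}" using qindep_trans[OF B(2) assms(3), of A] A(2) unfolding sp by blast+
  have "U \<subseteq> span (A Un span (B Un W))" unfolding sp by (rule A(4))
  also have "... = span (A Un (B Un W))" by (rule span_span_Un)
  finally have "U \<subseteq> span (A Un B Un W)" by (simp add: Un_assoc)
  moreover have "card (A Un B) = m + n"
    using q(2) A(3) B(3) qindep_finite[OF A(2)] qindep_finite[OF B(2)] by (simp add: card_Un_disjoint)
  moreover have "A Un B \<subseteq> U" using A(1) B(1) assms(6) by blast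
  ultimately show ?thesis unfolding qd_def using q(1) by blast
qed

lemma qd_split:
  assumes "qd scale U W k" "subspace W" "subspace V" "subspace U" "W \<subseteq> V" "V \<subseteq> U"
  shows "EX m n. qd scale V W m & qd scale U V n & k = m + n"
proof -
  obtain B where B: "B \<subseteq> U" "qindep scale B W" "card B = k" "U \<subseteq> span (B Un W)" using assms(1) by (auto simp: qd_def)
  have fin: "finite B" using B(2) by (rule qindep_finite)
  obtain m where m: "qd scale V W m" using qd_ex_bound[OF fin _ assms(2,3,5)] B assms by blast
  obtain n where n: "qd scale U V n" using B assms(5) span_mono[of "B Un W" "B Un V"] qd_ex_bound[OF fin _ assms(3,4,6)] by auto
  show ?thesis using m n qd_unique[OF assms(1) qd_add[OF m n assms(2,3,5,6)] assms(2)] by auto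
qed

end

lemma quotient_dim_qd:
  assumes "vector_space sc" "qd sc V W n" "module.subspace sc W"
  shows "quotient_dim sc V W = n"
proof -
  interpret vector_space sc by fact
  have "qd sc V W m \<longleftrightarrow> (EX B<=V. finite B & card B = m & V \<subseteq> span (B Un W) &
     (ALL c. (SUM b:B. sc (c b) b) : W --> (ALL b:B. c b = 0)))" for m
    by (auto simp: qd_def qindep_def)
  then have "quotient_dim sc V W = (THE m. qd sc V W m)" unfolding quotient_dim_def by presburger
  then show ?thesis using assms(2,3) qd_unique by (metis the_equality)
qed

text \<open>The two quotients are matched by a linear relation rather than a map, because a
  connecting homomorphism is defined on representatives only up to choices. \<open>ker\<close> says
  that the relation is well defined and injective on classes.\<close>

lemma qd_transfer:
  fixes s1 :: "'a::field => 'b::ab_group_add => 'b" and s2 :: "'a => 'c::ab_group_add => 'c"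
    and R :: "'b => 'c => bool"
  assumes vs: "vector_space s1" "vector_space s2"
    and W: "module.subspace s1 W" "module.subspace s2 W'"
    and V: "module.subspace s1 V" "module.subspace s2 V'"
    and WV: "W \<subseteq> V" "W' \<subseteq> V'"
    and Radd: "!!x y x' y'. R x x' ==> R y y' ==> R (x + y) (x' + y')"
    and Rsc: "!!c x x'. R x x' ==> R (s1 c x) (s2 c x')"
    and tot: "!!x. x : V ==> EX x':V'. R x x'"
    and sur: "!!x'. x' : V' ==> EX x:V. R x x'"
    and ker: "!!x x'. x : V ==> x' : V' ==> R x x' ==> x : W \<longleftrightarrow> x' : W'"
    and q: "qd s1 V W n"
  shows "qd s2 V' W' n"
proof -
  interpret v1: vector_space s1 by fact
  interpret v2: vector_space s2 by fact
  obtain B where B: "B \<subseteq> V" "qindep s1 B W" "card B = n" "V \<subseteq> v1.span (B Un W)"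
    using q by (auto simp: qd_def)
  have fin: "finite B" using B(2) by (rule qindep_finite)
  obtain g where g: "!!b. b : B ==> g b : V' & R b (g b)" using tot B(1) by (metis subsetD)
  have R0: "R 0 0" using tot[of 0] v1.subspace_0[OF V(1)] Rsc[of 0 _ 0] by force
  have Rsum: "R (SUM b:A. s1 (c b) b) (SUM b:A. s2 (c b) (g b))" if "A \<subseteq> B" for c A
    using finite_subset[OF that fin] that
    by (induction A rule: finite_induct) (auto simp: R0 intro!: Radd Rsc g[THEN conjunct2])
  have memV: "(SUM b:B. s1 (c b) b) : V" for c
    using B(1) by (intro v1.subspace_sum[OF V(1)] v1.subspace_scale[OF V(1)]) auto
  have memV': "(SUM b:B. s2 (c b) (g b)) : V'" for c
    using g by (intro v2.subspace_sum[OF V(2)] v2.subspace_scale[OF V(2)]) auto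
  have ind: "ALL b:B. c b = 0" if "(SUM b:B. s2 (c b) (g b)) : W'" for c
    using ker[OF memV memV' Rsum[of B c]] that qindepD[OF B(2), of c] by simp
  have inj: "inj_on g B"
  proof (rule inj_onI, rule ccontr)
    fix x y assume xy: "x : B" "y : B" "g x = g y" "x ~= y"
    define c :: "'b => 'a" where "c b = (if b = x then 1 else if b = y then -1 else 0)" for b
    have "(SUM b:B. s2 (c b) (g b)) = (SUM b:{x,y}. s2 (c b) (g b))"
      by (rule sum.mono_neutral_right) (use fin xy in \<open>auto simp: c_def\<close>)
    also have "... = 0" using xy by (simp add: c_def)
    finally have "ALL b:B. c b = 0" using ind v2.subspace_0[OF W(2)] by metis
    then show False using xy by (auto simp: c_def)
  qed
  have "qindep s2 (g ` B) W'" unfolding qindep_def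
  proof (intro conjI allI impI)
    show "finite (g ` B)" using fin by simp
    fix c assume "(SUM b:g ` B. s2 (c b) b) : W'"
    then have "(SUM b:B. s2 (c (g b)) (g b)) : W'" by (simp add: sum.reindex[OF inj])
    then show "ALL b:g ` B. c b = 0" using ind[of "c \<circ> g"] by auto
  qed
  moreover have "V' \<subseteq> v2.span (g ` B Un W')"
  proof
    fix v' assume v': "v' : V'"
    then obtain v where v: "v : V" "R v v'" using sur by blast
    then obtain x w where xw: "v = x + w" "x : v1.span B" "w : W"
      using B(4) v1.span_Un_subspace[OF W(1)] by blast
    then obtain u where u: "x = (SUM b:B. s1 (u b) b)" using fin by (auto simp: v1.span_finite)
    define x' where "x' = (SUM b:B. s2 (u b) (g b))"
    have "R (v + s1 (-1) x) (v' + s2 (-1) x')" by (intro Radd Rsc v) (auto simp: u x'_def intro: Rsum)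
    then have "v' - x' : W'" using xw v' V ker xw(3) WV by (fastforce simp: memV' x'_def v2.subspace_diff)
    moreover have "x' : v2.span (g ` B Un W')" unfolding x'_def
      by (intro v2.span_sum v2.span_scale v2.span_base) auto
    ultimately have "x' + (v' - x') : v2.span (g ` B Un W')"
      by (intro v2.span_add) (auto intro: v2.span_base)
    then show "v' : v2.span (g ` B Un W')" by simp
  qed
  moreover have "card (g ` B) = n" using inj B by (simp add: card_image)
  ultimately show ?thesis using g by (auto simp: qd_def intro!: exI[of _ "g ` B"])
qed

text \<open>The case of a map that induces an isomorphism of the quotients. \<open>W\<close> is a
  subspace because it is the preimage of \<open>W'\<close> in \<open>V\<close>.\<close>

lemma qd_iso:
  assumes f: "Vector_Spaces.linear s1 s2 f" and sub: "module.subspace s1 V" "module.subspace s2 V'" "module.subspace s2 W'"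
    and WV: "W \<subseteq> V" "W' \<subseteq> V'" and mem: "!!x. x : V ==> f x : V'"
    and ker: "!!x. x : V ==> x : W \<longleftrightarrow> f x : W'" and sur: "!!x'. x' : V' ==> EX x:V. x' - f x : W'"
  shows "qd s1 V W n \<longleftrightarrow> qd s2 V' W' n"
proof -
  interpret f: Vector_Spaces.linear s1 s2 f by fact
  let ?R = "%x x'. x' - f x : W'"
  have "W = V Int f -` W'" using WV ker by blast
  then have W: "f.vs1.subspace W" using f.vs1.subspace_inter[OF sub(1) f.subspace_vimage[OF sub(3)]] by simp
  have add: "?R x x' ==> ?R y y' ==> ?R (x + y) (x' + y')" for x x' y y'
    using f.vs2.subspace_add[OF sub(3), of "x' - f x" "y' - f y"] by (simp add: f.add algebra_simps)
  have sc: "?R x x' ==> ?R (s1 c x) (s2 c x')" for c x x'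
    using f.vs2.subspace_scale[OF sub(3), of "x' - f x" c] by (simp add: f.scale f.vs2.scale_right_diff_distrib)
  have tot: "x : V ==> EX x':V'. ?R x x'" for x using mem f.vs2.subspace_0[OF sub(3)] by force
  have iff: "x : W \<longleftrightarrow> x' : W'" if "x : V" "?R x x'" for x x'
    using ker[OF that(1)] f.vs2.subspace_add[OF sub(3) that(2), of "f x"] f.vs2.subspace_diff[OF sub(3) _ that(2), of x'] by auto
  note vs = f.vs1.vector_space_axioms f.vs2.vector_space_axioms
  show ?thesis
    using qd_transfer[OF vs W sub(3,1,2) WV, of ?R n] qd_transfer[OF vs(2,1) sub(3) W sub(2,1) WV(2,1), of "%x' x. ?R x x'" n]
      add sc tot sur iff by blast
qed

section \<open>Polynomials, gradings and homogeneous ideals\<close>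

abbreviation lk :: "('a \<Rightarrow>\<^sub>0 'b::zero) => 'a => 'b" where "lk \<equiv> Poly_Mapping.lookup"
abbreviation supp :: "('a \<Rightarrow>\<^sub>0 'b::zero) => 'a set" where "supp \<equiv> Poly_Mapping.keys"
abbreviation sng :: "'a => 'b::zero => ('a \<Rightarrow>\<^sub>0 'b)" where "sng \<equiv> Poly_Mapping.single"

type_synonym mon = "5 \<Rightarrow>\<^sub>0 nat"

abbreviation ideal :: "'a::comm_ring_1 set => bool" where "ideal \<equiv> module.subspace (*)"
abbreviation gen :: "'a::comm_ring_1 set => 'a set" where "gen \<equiv> module.span (*)"

interpretation rm: module "(*) :: 'a::comm_ring_1 => 'a => 'a"
  by unfold_locales (auto simp: algebra_simps)

declare rm.scale_scale [simp del]

lemma UNIV_5: "(UNIV :: 5 set) = {0, 1, 2, 3, 4}"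
proof -
  have "card {0, 1, 2, 3, 4 :: 5} = card (UNIV :: 5 set)" by simp
  then show ?thesis by (metis card_subset_eq finite subset_UNIV)
qed

lemma all_5: "(ALL i::5. P i) \<longleftrightarrow> P 0 & P 1 & P 2 & P 3 & P 4"
  using UNIV_5 by (metis UNIV_I empty_iff insert_iff)

lemma neq_5 [simp]: "(0::5) ~= 1" "(0::5) ~= 2" "(0::5) ~= 3" "(0::5) ~= 4" "(1::5) ~= 2" "(1::5) ~= 3"
   "(1::5) ~= 4" "(2::5) ~= 3" "(2::5) ~= 4" "(3::5) ~= 4"
  by simp_all

lemma pm_decomp: "f = (SUM m:supp f. sng m (lk f m))"
  by (rule poly_mapping_eqI) (auto simp: lookup_sum lookup_single when_def in_keys_iff)

lemma pm_decomp_superset: "finite A ==> supp f \<subseteq> A ==> f = (SUM m:A. sng m (lk f m))"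
  by (subst pm_decomp) (auto intro!: sum.mono_neutral_left simp: in_keys_iff)

text \<open>One operator for several gradings: \<open>Q\<close> is a condition on the degree, on a
  weight or on the variables of a monomial. It also splits exponent vectors, which are finitely
  supported maps themselves.\<close>

definition part :: "('a => bool) => ('a \<Rightarrow>\<^sub>0 'b::comm_monoid_add) => ('a \<Rightarrow>\<^sub>0 'b)" where
  "part Q f = (SUM m:{m:supp f. Q m}. sng m (lk f m))"

lemma lk_part: "lk (part Q f) m = (if Q m then lk f m else 0)"
  by (auto simp: part_def lookup_sum lookup_single when_def in_keys_iff)

lemma supp_part: "supp (part Q f) = {m:supp f. Q m}"
  by (rule set_eqI) (simp add: in_keys_iff lk_part)

lemma part_add: "part Q (f + g) = part Q f + part Q g"
  by (rule poly_mapping_eqI) (simp add: lk_part lookup_add)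

lemma part_zero [simp]: "part Q 0 = 0"
  by (rule poly_mapping_eqI) (simp add: lk_part)

lemma part_sum: "part Q (SUM i:A. f i) = (SUM i:A. part Q (f i))"
  by (induction A rule: infinite_finite_induct) (auto simp: part_add)

lemma part_id: "(!!m. m : supp f ==> Q m) ==> part Q f = f"
  by (rule poly_mapping_eqI) (auto simp: lk_part in_keys_iff)

lemma part_none: "(!!m. m : supp f ==> ~ Q m) ==> part Q f = 0"
  by (rule poly_mapping_eqI) (auto simp: lk_part in_keys_iff)

lemma part_split: "f = part Q f + part (%m. ~ Q m) f"
  by (rule poly_mapping_eqI) (simp add: lk_part lookup_add)

lemma supp_mult: "m : supp (f * g) ==> EX a:supp f. EX b:supp g. m = a + b"
  using keys_mult[of f g] by blast

lemma supp_addD: "m : supp (f + g) ==> m : supp f | m : supp g"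
  using Poly_Mapping.keys_add[of f g] by auto

lemma supp_sumD: "m : supp (SUM i:A. f i) ==> EX i:A. m : supp (f i)"
  using keys_sum[of f A] by auto

lemma part_mult:
  fixes f g :: "'a::cancel_comm_monoid_add \<Rightarrow>\<^sub>0 'b::comm_ring_1"
  assumes "!!a b. dg (a + b) = dg a + (dg b :: nat)" "!!m. m : supp f ==> dg m = e"
  shows "part (%m. dg m = n + e) (g * f) = part (%m. dg m = n) g * f"
proof -
  let ?h = "part (%m. dg m = n) g" let ?k = "part (%m. ~ dg m = n) g"
  have "g * f = ?h * f + ?k * f" by (metis part_split distrib_right)
  moreover have "part (%m. dg m = n + e) (?h * f) = ?h * f"
    by (rule part_id) (use assms in \<open>force dest!: supp_mult simp: supp_part\<close>)
  moreover have "part (%m. dg m = n + e) (?k * f) = 0"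
    by (rule part_none) (use assms in \<open>force dest!: supp_mult simp: supp_part\<close>)
  ultimately show ?thesis by (simp add: part_add)
qed

lemma part_mult_small:
  fixes f g :: "'a::cancel_comm_monoid_add \<Rightarrow>\<^sub>0 'b::comm_ring_1"
  assumes "!!a b. dg (a + b) = dg a + (dg b :: nat)" "!!m. m : supp f ==> dg m = e" "n < e"
  shows "part (%m. dg m = n) (g * f) = 0"
  by (rule part_none) (use assms in \<open>force dest!: supp_mult\<close>)

definition mdeg :: "mon => nat" where "mdeg m = (SUM i:UNIV. lk m i)"

lemma mdeg_add: "mdeg (a + b) = mdeg a + mdeg b"
  by (simp add: mdeg_def lookup_add sum.distrib)

lemma mdeg_0 [simp]: "mdeg 0 = 0" by (simp add: mdeg_def)

lemma mdeg_single: "mdeg (sng i k) = k"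
  by (simp add: mdeg_def lookup_single when_def)

lemma homog_mdeg: "homog e f \<longleftrightarrow> (ALL m:supp f. mdeg m = e)"
  by (simp add: homog_def mdeg_def)

definition hc :: "nat => mpoly => mpoly" where "hc n f = part (%m. mdeg m = n) f"

lemma homog_hc [simp]: "homog n (hc n f)"
  by (simp add: homog_mdeg hc_def supp_part)

lemma hc_add: "hc n (f + g) = hc n f + hc n g" by (simp add: hc_def part_add)
lemma hc_0 [simp]: "hc n 0 = 0" by (simp add: hc_def)
lemma hc_sum: "hc n (SUM i:A. f i) = (SUM i:A. hc n (f i))" by (simp add: hc_def part_sum)

lemma hc_homog: "homog e f ==> hc n f = (if n = e then f else 0)"
  by (auto simp: hc_def homog_mdeg intro: part_id part_none)

lemma hc_mult: "homog e f ==> hc (n + e) (g * f) = hc n g * f"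
  unfolding hc_def homog_mdeg by (rule part_mult) (auto simp: mdeg_add)

lemma hc_mult': "homog e f ==> n >= e ==> hc n (g * f) = hc (n - e) g * f"
  using hc_mult[of e f "n - e" g] by simp

lemma hc_mult_small: "homog e f ==> n < e ==> hc n (g * f) = 0"
  unfolding hc_def homog_mdeg by (rule part_mult_small) (auto simp: mdeg_add)

lemma lk_hc: "lk (hc n f) m = (if mdeg m = n then lk f m else 0)"
  by (simp add: hc_def lk_part)

definition tdeg :: "mpoly => nat" where "tdeg f = Max (insert 0 (mdeg ` supp f))"

lemma tdeg_ge: "m : supp f ==> mdeg m <= tdeg f"
  by (simp add: tdeg_def)

lemma sum_hc: "N >= tdeg f ==> f = (SUM n<=N. hc n f)"
proof (rule poly_mapping_eqI)
  fix m assume N: "N >= tdeg f"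
  have "lk (SUM n<=N. hc n f) m = (SUM n<=N. if n = mdeg m then lk f m else 0)"
    by (simp add: lookup_sum lk_hc eq_commute)
  also have "... = (if mdeg m <= N then lk f m else 0)" by simp
  also have "... = lk f m" using tdeg_ge[of m f] N by (cases "lk f m = 0") (auto simp: in_keys_iff)
  finally show "lk f m = lk (SUM n<=N. hc n f) m" by simp
qed

lemma homog_0 [simp]: "homog e 0" by (simp add: homog_def)
lemma homog_add: "homog e f ==> homog e g ==> homog e (f + g)"
  by (auto simp: homog_mdeg dest!: supp_addD)
lemma homog_uminus: "homog e f ==> homog e (- f)"
  by (simp add: homog_mdeg)
lemma homog_diff: "homog e f ==> homog e g ==> homog e (f - g)"
  using homog_add[of e f "- g"] homog_uminus[of e g] by simp
lemma homog_sum: "(!!i. i : A ==> homog e (f i)) ==> homog e (SUM i:A. f i)"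
  by (induction A rule: infinite_finite_induct) (auto intro: homog_add)
lemma homog_mult: "homog a f ==> homog b g ==> homog (a + b) (f * g)"
  by (fastforce simp: homog_mdeg mdeg_add dest!: supp_mult)
lemma homog_single: "homog (mdeg m) (sng m c)" by (simp add: homog_mdeg)
lemma homog_const [simp]: "homog 0 (const c)" by (auto simp: homog_mdeg const_def)
lemma homog_1 [simp]: "homog 0 1" using homog_const[of 1] by (simp add: const_def)
lemma homog_var [simp]: "homog (Suc 0) (var i)" by (auto simp: homog_mdeg var_def mdeg_single)
lemma homog_power: "homog e f ==> homog (n * e) (f ^ n)"
  by (induction n) (auto intro: homog_mult)
lemma homog_prod: "(!!i. i : A ==> homog (e i) (f i)) ==> homog (SUM i:A. e i) (PROD i:A. f i)"
  by (induction A rule: infinite_finite_induct) (auto intro: homog_mult)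
lemma homog_var_power [simp]: "homog n (var i ^ n)" using homog_power[OF homog_var, of n i] by simp
lemma homog_const_mult: "homog n f ==> homog n (const c * f)" using homog_mult[OF homog_const, of n f] by simp

lemma homog_unique: "homog a f ==> homog b f ==> f ~= 0 ==> a = b"
  by (metis hc_homog)

lemma const_0 [simp]: "const 0 = 0" by (simp add: const_def)
lemma const_1 [simp]: "const 1 = 1" by (simp add: const_def)
lemma const_add: "const (a + b) = const a + const b" by (simp add: const_def single_add)
lemma const_mult: "const (a * b) = const a * const b" by (simp add: const_def mult_single)
lemma const_uminus: "const (- a) = - const a" by (simp add: const_def single_uminus)
lemma const_inj: "const a = const b \<longleftrightarrow> a = b" by (metis const_def lookup_single_eq)
lemma const_eq_0: "const a = 0 \<longleftrightarrow> a = 0" using const_inj[of a 0] by simp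

lemma const_mult_single: "const c * sng m a = sng m (c * a)" by (simp add: const_def mult_single)

lemma homog_0_const: "homog 0 f ==> f = const (lk f 0)"
proof (rule poly_mapping_eqI)
  fix m assume "homog 0 f"
  then have "mdeg m ~= 0 ==> lk f m = 0" by (metis homog_mdeg in_keys_iff)
  moreover have "mdeg m = 0 ==> m = 0" by (rule poly_mapping_eqI) (simp add: mdeg_def)
  ultimately have "m ~= 0 ==> lk f m = 0" by blast
  then show "lk f m = lk (const (lk f 0)) m" by (auto simp: const_def lookup_single when_def)
qed

interpretation mv: vector_space "%c (f::mpoly). const c * f"
proof (rule vector_space.intro)
  fix a b :: complex and x y :: mpoly
  show "const a * (x + y) = const a * x + const a * y" by (rule distrib_left)
  show "const (a + b) * x = const a * x + const b * x" by (simp only: const_add distrib_right)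
  show "const a * (const b * x) = const (a * b) * x" by (simp only: const_mult mult.assoc)
  show "const 1 * x = x" by simp
qed

lemma var_nz [simp]: "var i ~= 0"
  by (metis var_def keys_single keys_zero insert_not_empty one_neq_zero)

lemma ideal_gen [simp]: "ideal (gen S)" by (rule rm.subspace_span)

lemma gen_empty [simp]: "gen ({} :: 'a::comm_ring_1 set) = {0}" by simp

lemma ideal_0: "ideal I ==> 0 : I" by (rule rm.subspace_0)
lemma ideal_add: "ideal I ==> a : I ==> b : I ==> a + b : I" by (rule rm.subspace_add)
lemma ideal_diff: "ideal I ==> a : I ==> b : I ==> a - b : I" by (rule rm.subspace_diff)
lemma ideal_mult: "ideal I ==> a : I ==> r * a : I" by (rule rm.subspace_scale)
lemma ideal_mult': "ideal I ==> a : I ==> a * r : I" using ideal_mult by (metis mult.commute)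
lemma ideal_sum: "ideal I ==> (!!i. i : A ==> f i : I) ==> sum f A : I" by (rule rm.subspace_sum)
lemma ideal_UNIV: "ideal I ==> 1 : I ==> I = UNIV" using ideal_mult by fastforce
lemma gen_insert: "ideal I ==> gen (insert f I) = {a * f + b | a b. b : I}"
proof -
  assume I: "ideal I"
  have "gen (insert f I) = gen ({f} Un I)" by simp
  also have "... = {x + y | x y. x : gen {f} & y : gen I}" by (rule rm.span_Un)
  also have "gen I = I" using I by simp
  also have "gen {f} = range (%k. k * f)" by (rule rm.span_singleton)
  finally show ?thesis by auto
qed

lemma gen_insertE:
  assumes "x : gen (insert f I)" "ideal I"
  obtains a b where "x = a * f + b" "b : I"
  using assms gen_insert by blast

lemma gen_insertI: "ideal I ==> b : I ==> a * f + b : gen (insert f I)"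
  using gen_insert by blast

lemma gen_insert_sup: "ideal I ==> I \<subseteq> gen (insert f I)" "f : gen (insert f I)"
  using rm.span_superset by blast+

lemma gen_2: "gen {f, g} = {a * f + b * g | a b. True}"
proof -
  have "gen {f, g} = gen ({f} Un {g})" by (simp add: insert_commute)
  also have "... = {x + y | x y. x : gen {f} & y : gen {g}}" by (rule rm.span_Un)
  finally show ?thesis by (auto simp: rm.span_singleton)
qed

lemma ideal_mv: "ideal I ==> mv.subspace I"
  by (auto simp: mv.subspace_def ideal_0 ideal_add ideal_mult)

lemma mv_subspace_homog [simp]: "mv.subspace {f. homog n f}"
  by (auto simp: mv.subspace_def homog_add homog_const_mult)

lemma mv_subspace_ideal_homog: "ideal I ==> mv.subspace {f : I. homog n f}"
  by (auto simp: mv.subspace_def homog_add homog_const_mult ideal_0 ideal_add ideal_mult)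

lemma homog_ideal_hc: "homog_ideal I \<longleftrightarrow> ideal I & (ALL f:I. ALL n. hc n f : I)"
proof
  assume h: "homog_ideal I"
  then have I: "ideal I" and g: "I = gen {f : I. EX e. homog e f}" by (auto simp: homog_ideal_def)
  have "hc n f : I" if "f : gen {f : I. EX e. homog e f}" for f n
    using that
  proof (induction rule: rm.span_induct_alt)
    case base then show ?case using I by (simp add: ideal_0)
  next
    case (step c x y)
    then obtain e where e: "homog e x" "x : I" by auto
    have "hc n (c * x) : I"
      using hc_mult'[OF e(1), of n c] hc_mult_small[OF e(1), of n c] ideal_mult[OF I e(2)] ideal_0[OF I]
      by (cases "n >= e") auto
    then show ?case using step I by (simp add: hc_add ideal_add)
  qed
  then show "ideal I & (ALL f:I. ALL n. hc n f : I)" using I g by auto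
next
  assume h: "ideal I & (ALL f:I. ALL n. hc n f : I)"
  have "f : gen {f : I. EX e. homog e f}" if "f : I" for f
  proof -
    have "(SUM n<=tdeg f. hc n f) : gen {f : I. EX e. homog e f}"
      using that h homog_hc by (intro rm.span_sum rm.span_base) blast
    then show ?thesis using sum_hc[OF order_refl, of f] by simp
  qed
  moreover have "gen {f : I. EX e. homog e f} \<subseteq> I" using h by (intro rm.span_minimal) auto
  ultimately show "homog_ideal I" using h by (auto simp: homog_ideal_def)
qed

lemma homog_ideal_ideal: "homog_ideal I ==> ideal I" by (simp add: homog_ideal_def)
lemma homog_idealD: "homog_ideal I ==> f : I ==> hc n f : I" by (simp add: homog_ideal_hc)

lemma homog_ideal_gen:
  assumes "!!f. f : S ==> EX e. homog e f" shows "homog_ideal (gen S)"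
proof -
  have "hc n f : gen S" if "f : gen S" for f n using that
  proof (induction rule: rm.span_induct_alt)
    case base then show ?case by (simp add: rm.span_zero)
  next
    case (step c x y)
    then obtain e where e: "homog e x" "x : S" using assms by auto
    have "hc n (c * x) : gen S"
      using hc_mult'[OF e(1), of n c] hc_mult_small[OF e(1), of n c] rm.span_base[OF e(2)]
      by (cases "n >= e") (auto intro: rm.span_scale rm.span_zero)
    then show ?case using step by (simp add: hc_add rm.span_add)
  qed
  then show ?thesis by (simp add: homog_ideal_hc)
qed

lemma homog_ideal_insert:
  assumes "homog_ideal I" "homog e f" shows "homog_ideal (gen (insert f I))"
proof -
  have I: "ideal I" using assms(1) by (rule homog_ideal_ideal)
  have "hc n x : gen (insert f I)" if xg: "x : gen (insert f I)" for x n
  proof -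
    obtain a b where x: "x = a * f + b" "b : I" using xg I by (rule gen_insertE)
    show ?thesis
    proof (cases "n >= e")
      case True
      then show ?thesis using gen_insertI[OF I homog_idealD[OF assms(1) x(2), of n]]
        by (simp add: x(1) hc_add hc_mult'[OF assms(2)])
    next
      case False
      then show ?thesis using gen_insertI[OF I homog_idealD[OF assms(1) x(2), of n], of 0]
        by (simp add: x(1) hc_add hc_mult_small[OF assms(2)])
    qed
  qed
  then show ?thesis by (simp add: homog_ideal_hc)
qed

text \<open>Take components of matching degree on both sides. For \<open>n < e\<close> the
  coefficient is 0; the truncated difference \<open>n - e\<close> would wrongly suggest a
  constant.\<close>

lemma gen_insert_homogE:
  assumes "homog_ideal I" "homog e f" "x : gen (insert f I)" "homog n x"
  obtains a b where "x = a * f + b" "b : I" "homog n b" "n >= e ==> homog (n - e) a" "n < e ==> a = 0"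
proof -
  obtain a b where x: "x = a * f + b" "b : I" using assms(3) homog_ideal_ideal[OF assms(1)] by (rule gen_insertE)
  have h: "x = hc n x" using assms(4) by (simp add: hc_homog)
  have b: "hc n b : I" using homog_idealD[OF assms(1) x(2)] .
  show thesis
  proof (cases "n >= e")
    case True
    then have "x = hc (n - e) a * f + hc n b" by (subst h) (simp add: x(1) hc_add hc_mult'[OF assms(2)])
    from that[OF this b] True show ?thesis by simp
  next
    case False
    then have "x = 0 * f + hc n b" by (subst h) (simp add: x(1) hc_add hc_mult_small[OF assms(2)])
    from that[OF this b] False show ?thesis by simp
  qed
qed

section \<open>Saturation\<close>

lemma saturation_ideal_up:
  assumes "ideal I" "var i ^ n * f : I" "m >= n" shows "var i ^ m * f : I"
  by (metis assms(3) le_add_diff_inverse2 power_add mult.assoc ideal_mult[OF assms(1,2), of "var i ^ (m - n)"])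

lemma ideal_saturation: "ideal I ==> ideal (saturation I)"
proof -
  assume I: "ideal I"
  note up = saturation_ideal_up[OF I]
  show ?thesis
  proof (rule rm.subspaceI)
    show "0 : saturation I" using I by (simp add: saturation_def ideal_0)
  next
    fix f g assume fg: "f : saturation I" "g : saturation I"
    show "f + g : saturation I" unfolding saturation_def
    proof (clarify)
      fix i
      obtain m n where "var i ^ m * f : I" "var i ^ n * g : I" using fg unfolding saturation_def by blast
      then have "var i ^ (max m n) * (f + g) : I" using up I by (simp add: distrib_left ideal_add)
      then show "EX n. var i ^ n * (f + g) : I" ..
    qed
  next
    fix c f assume f: "f : saturation I"
    show "c * f : saturation I" unfolding saturation_def
    proof clarify
      fix i
      obtain n where "var i ^ n * f : I" using f unfolding saturation_def by blast
      from ideal_mult[OF I this, of c] have "var i ^ n * (c * f) : I" by (simp add: mult.left_commute)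
      then show "EX n. var i ^ n * (c * f) : I" ..
    qed
  qed
qed

lemma saturation_sup: "I \<subseteq> saturation I"
  unfolding saturation_def by (auto intro!: exI[of _ 0])

lemma saturation_mono: "I \<subseteq> J ==> saturation I \<subseteq> saturation J"
  unfolding saturation_def by blast

lemma homog_ideal_saturation:
  assumes "homog_ideal I" shows "homog_ideal (saturation I)"
  unfolding homog_ideal_hc
proof (intro conjI ballI allI)
  show "ideal (saturation I)" using assms by (intro ideal_saturation homog_ideal_ideal)
  fix f n assume f: "f : saturation I"
  show "hc n f : saturation I" unfolding saturation_def
  proof clarify
    fix i
    obtain k where "f * var i ^ k : I" using f unfolding saturation_def by (auto simp: mult.commute)
    then have "var i ^ k * hc n f : I" by (metis homog_idealD[OF assms] hc_mult[OF homog_var_power] mult.commute)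
    then show "EX k. var i ^ k * hc n f : I" ..
  qed
qed

lemma saturation_uniform:
  assumes "ideal I" "f : saturation I"
  obtains N where "!!i. var i ^ N * f : I"
proof -
  obtain n where n: "!!i. var i ^ n i * f : I" using assms(2) unfolding saturation_def by (auto) metis
  have "var i ^ Max (range n) * f : I" for i
    by (rule saturation_ideal_up[OF assms(1) n]) simp
  then show thesis using that by blast
qed

lemma saturation_idem: "ideal I ==> saturation (saturation I) = saturation I"
proof
  assume I: "ideal I"
  show "saturation (saturation I) \<subseteq> saturation I"
  proof
    fix f assume f: "f : saturation (saturation I)"
    show "f : saturation I" unfolding saturation_def
    proof clarify
      fix i
      obtain n where "var i ^ n * f : saturation I" using f unfolding saturation_def[of "saturation I"] by auto
      then obtain m where "var i ^ m * (var i ^ n * f) : I" unfolding saturation_def by auto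
      then show "EX n. var i ^ n * f : I" by (metis power_add mult.assoc)
    qed
  qed
  show "saturation I \<subseteq> saturation (saturation I)" by (rule saturation_sup)
qed

lemma closed_saturation: "homog_ideal I ==> closed_subscheme (saturation I)"
  by (simp add: closed_subscheme_def homog_ideal_saturation saturation_idem homog_ideal_ideal)

text \<open>Pigeonhole over the five variables; the factor 5 in later degree bounds comes from
  here.\<close>

lemma monomial_high:
  assumes "mdeg m >= 5 * N" shows "EX i. N <= lk m i"
proof (rule ccontr)
  assume "~ ?thesis"
  then have l: "lk m i < N" for i by (auto simp: not_le)
  then have "mdeg m < (SUM i:(UNIV::5 set). N)" unfolding mdeg_def
    by (intro sum_strict_mono) auto
  with assms show False by simp
qed

lemma single_var_split:
  assumes "N <= lk m i" shows "EX g. sng m (c::complex) = g * var i ^ N"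
proof -
  have vp: "var i ^ N = sng (sng i N) 1"
    by (induction N) (auto simp: var_def mult_single single_add[symmetric] simp flip: single_one)
  have "m = (m - sng i N) + sng i N"
    by (rule poly_mapping_eqI) (use assms in \<open>auto simp: lookup_add lookup_minus lookup_single when_def\<close>)
  then show ?thesis by (metis vp mult_single mult.right_neutral)
qed

lemma homog_high_in_ideal:
  assumes "ideal I" "!!i. var i ^ N * g : I" "homog n f" "n >= 5 * N"
  shows "f * g : I"
proof -
  have "sng m (lk f m) * g : I" if "m : supp f" for m
  proof -
    have "mdeg m >= 5 * N" using assms that by (auto simp: homog_mdeg)
    then obtain i h where "sng m (lk f m) = h * var i ^ N"
      using monomial_high single_var_split by metis
    then show ?thesis using ideal_mult[OF assms(1) assms(2)[of i], of h] by (simp add: mult.assoc)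
  qed
  then have "(SUM m:supp f. sng m (lk f m) * g) : I" by (intro ideal_sum assms(1))
  then show ?thesis by (simp flip: sum_distrib_right pm_decomp)
qed

section \<open>Evaluation homomorphisms, noetherianity and unique factorization\<close>

definition rhom :: "('a::comm_ring_1 => 'b::comm_ring_1) => bool" where
  "rhom h \<longleftrightarrow> h 1 = 1 & (ALL a b. h (a + b) = h a + h b) & (ALL a b. h (a * b) = h a * h b)"

lemma rhom_1: "rhom h ==> h 1 = 1" and rhom_add: "rhom h ==> h (a + b) = h a + h b"
  and rhom_mult: "rhom h ==> h (a * b) = h a * h b"
  by (auto simp: rhom_def)

lemma rhom_0: "rhom h ==> h 0 = 0"
  using rhom_add[of h 0 0] by simp

lemma rhom_uminus: "rhom h ==> h (- a) = - h a"
  using rhom_add[of h a "- a"] rhom_0[of h] by (simp add: add_eq_0_iff)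

lemma rhom_diff: "rhom h ==> h (a - b) = h a - h b"
  using rhom_add[of h a "- b"] rhom_uminus[of h b] by simp

lemma rhom_sum: "rhom h ==> h (sum f A) = (SUM i:A. h (f i))"
  by (induction A rule: infinite_finite_induct) (auto simp: rhom_0 rhom_add)

lemma rhom_prod: "rhom h ==> h (prod f A) = (PROD i:A. h (f i))"
  by (induction A rule: infinite_finite_induct) (auto simp: rhom_1 rhom_mult)

lemma rhom_power: "rhom h ==> h (a ^ n) = h a ^ n"
  by (induction n) (auto simp: rhom_1 rhom_mult)

lemma rhom_comp: "rhom g ==> rhom h ==> rhom (%x. g (h x))"
  by (auto simp: rhom_def)

lemma rhom_id: "rhom (%x. x)" by (simp add: rhom_def)

lemma rhom_const: "rhom const"
  by (simp add: rhom_def const_add const_mult)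

lemma rhom_pconst: "rhom (%a. [:a:])"
  by (simp add: rhom_def one_pCons)

lemma rhom_field_inj: "rhom (h :: 'a::field => 'b::comm_ring_1) ==> (1::'b) ~= 0 ==> h a = 0 \<longleftrightarrow> a = 0"
proof -
  assume h: "rhom h" "(1::'b) ~= 0"
  have "h a * h (inverse a) = 1" if "a ~= 0"
    using that rhom_mult[OF h(1), of a "inverse a"] by (simp add: rhom_1[OF h(1)])
  then show "h a = 0 \<longleftrightarrow> a = 0" using h(2) rhom_0[OF h(1)] by force
qed

definition meval :: "(5 => 'a::comm_ring_1) => mon => 'a" where
  "meval phi m = (PROD i:UNIV. phi i ^ lk m i)"

definition ev :: "(complex => 'a::comm_ring_1) => (5 => 'a) => mpoly => 'a" where
  "ev ka phi f = (SUM m:supp f. ka (lk f m) * meval phi m)"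

lemma meval_add: "meval phi (a + b) = meval phi a * meval phi b"
  by (simp add: meval_def lookup_add power_add prod.distrib)

lemma meval_0 [simp]: "meval phi 0 = 1" by (simp add: meval_def)

lemma meval_single: "meval phi (sng i k) = phi i ^ k"
proof -
  have "meval phi (sng i k) = (PROD j:UNIV. if j = i then phi i ^ k else 1)"
    unfolding meval_def by (rule prod.cong) (auto simp: lookup_single when_def)
  then show ?thesis by simp
qed

lemma sng_meval: "sng m 1 = meval var m"
proof -
  have vp: "var i ^ k = sng (sng i k) 1" for i k
    by (induction k) (auto simp: var_def mult_single single_add[symmetric])
  have "meval var m = (PROD i:UNIV. sng (sng i (lk m i)) 1)" unfolding meval_def vp ..
  also have "... = sng (SUM i:UNIV. sng i (lk m i)) 1"
  proof -
    have "(PROD i:A. sng (g i) (1::complex)) = sng (SUM i:A. g i) 1" if "finite A" for A :: "5 set" and g :: "5 => mon"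
      using that by (induction A rule: finite_induct) (auto simp: mult_single)
    then show ?thesis by simp
  qed
  also have "(SUM i:UNIV. sng i (lk m i)) = m"
    using pm_decomp_superset[of UNIV m] by simp
  finally show ?thesis by simp
qed

lemma sng_const_meval: "sng m c = const c * meval var m"
  using const_mult_single[of c m 1] by (simp add: sng_meval)

lemma mpoly_expand: "f = (SUM m:supp f. const (lk f m) * meval var m)"
  using pm_decomp[of f] by (simp add: sng_const_meval)

lemma ev_superset:
  assumes "rhom ka" "finite A" "supp f \<subseteq> A"
  shows "ev ka phi f = (SUM m:A. ka (lk f m) * meval phi m)"
  unfolding ev_def by (rule sum.mono_neutral_left) (use assms in \<open>auto simp: in_keys_iff rhom_0\<close>)

lemma ev_add: assumes "rhom ka" shows "ev ka phi (f + g) = ev ka phi f + ev ka phi g"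
proof -
  let ?A = "supp f Un supp g"
  have s: "supp (f + g) \<subseteq> ?A" by (rule Poly_Mapping.keys_add)
  show ?thesis
    by (subst ev_superset[OF assms _ s], simp, subst ev_superset[OF assms, of ?A f], simp, simp,
        subst ev_superset[OF assms, of ?A g], simp, simp)
      (simp add: lookup_add rhom_add[OF assms] distrib_right sum.distrib)
qed

lemma ev_0: "ev ka phi 0 = 0" by (simp add: ev_def)

lemma ev_sum: assumes "rhom ka" shows "ev ka phi (sum f A) = (SUM i:A. ev ka phi (f i))"
  by (induction A rule: infinite_finite_induct) (auto simp: ev_add[OF assms] ev_0)

lemma ev_single: assumes "rhom ka" shows "ev ka phi (sng m c) = ka c * meval phi m"
  using ev_superset[OF assms, of "{m}" "sng m c" phi] by simp

lemma ev_rhom: assumes "rhom ka" shows "rhom (ev ka phi)"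
proof -
  have "ev ka phi (f * g) = ev ka phi f * ev ka phi g" for f g
  proof -
    have "f * g = (SUM a:supp f. SUM b:supp g. sng (a + b) (lk f a * lk g b))"
      by (subst pm_decomp[of f], subst pm_decomp[of g]) (simp add: sum_product mult_single)
    then have "ev ka phi (f * g) = (SUM a:supp f. SUM b:supp g. ev ka phi (sng (a + b) (lk f a * lk g b)))"
      by (simp add: ev_sum[OF assms])
    also have "... = (SUM a:supp f. SUM b:supp g. (ka (lk f a) * meval phi a) * (ka (lk g b) * meval phi b))"
      by (simp add: ev_single[OF assms] rhom_mult[OF assms] meval_add mult_ac)
    also have "... = ev ka phi f * ev ka phi g" by (simp add: ev_def sum_product)
    finally show ?thesis .
  qed
  moreover have "ev ka phi 1 = 1" using ev_single[OF assms, of phi 0 1] rhom_1[OF assms] by simp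
  ultimately show ?thesis by (simp add: rhom_def ev_add[OF assms])
qed

lemma ev_const: "rhom ka ==> ev ka phi (const c) = ka c"
  by (simp add: const_def ev_single)

lemma ev_var: "rhom ka ==> ev ka phi (var i) = phi i"
  by (simp add: var_def ev_single meval_single rhom_1)

lemma rhom_meval: "rhom h ==> h (meval phi m) = meval (%i. h (phi i)) m"
  by (simp add: meval_def rhom_prod rhom_power)

lemma rhom_eq_ev:
  assumes "rhom h" shows "h f = ev (%c. h (const c)) (%i. h (var i)) f"
  by (subst mpoly_expand) (simp add: ev_def rhom_sum[OF assms] rhom_mult[OF assms] rhom_meval[OF assms])

lemma rhom_ext:
  assumes "rhom g" "rhom h" "!!c. g (const c) = h (const c)" "!!i. g (var i) = h (var i)"
  shows "g f = h f"
  using assms(3,4) by (subst rhom_eq_ev[OF assms(1)], subst rhom_eq_ev[OF assms(2)]) simp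

definition pe :: "('a::comm_ring_1 => 'b::comm_ring_1) => 'b => 'a poly => 'b" where
  "pe psi x p = poly (map_poly psi p) x"

lemma pe_0 [simp]: "pe psi x 0 = 0" by (simp add: pe_def)

lemma pe_pCons: "rhom psi ==> pe psi x (pCons a p) = psi a + x * pe psi x p"
  by (simp add: pe_def map_poly_pCons rhom_0)

lemma pe_const: "rhom psi ==> pe psi x [:a:] = psi a"
  by (simp add: pe_pCons)

lemma pe_rhom: assumes "rhom psi" shows "rhom (pe psi x)"
proof -
  have add: "pe psi x (p + q) = pe psi x p + pe psi x q" for p q
    by (induction p q rule: poly_induct2) (simp_all add: pe_pCons[OF assms] rhom_add[OF assms] algebra_simps)
  have sm: "pe psi x (smult a q) = psi a * pe psi x q" for a q
    by (induction q) (simp_all add: pe_pCons[OF assms] rhom_mult[OF assms] algebra_simps)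
  have "pe psi x (p * q) = pe psi x p * pe psi x q" for p q
    by (induction p) (simp_all add: pe_pCons[OF assms] add sm rhom_0[OF assms] algebra_simps)
  moreover have "pe psi x 1 = 1" by (simp add: one_pCons pe_pCons[OF assms] rhom_1[OF assms])
  ultimately show ?thesis by (simp add: rhom_def add)
qed

lemma rhom_pe: "rhom psi ==> rhom g ==> g (pe psi x p) = pe (%a. g (psi a)) (g x) p"
  by (induction p) (simp_all add: pe_pCons rhom_comp rhom_add rhom_mult rhom_0)

lemma pe_self: "pe (%a. [:a:]) [:0, 1:] p = p"
  by (induction p) (simp_all add: pe_pCons rhom_pconst)

lemma pe_emb: assumes "rhom g" shows "pe (%a. g [:a:]) (g [:0, 1:]) p = g p"
  using rhom_pe[OF rhom_pconst assms, of "[:0, 1:]" p] by (simp add: pe_self)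

text \<open>Iterated univariate polynomials, x0 innermost and x4 outermost. Unique factorization
  comes from the univariate theory, and polynomials in x0, x1 or in x0, x1, x2 sit inside as nested
  constants, which is how the coefficient fields are embedded later.\<close>

type_synonym T5 = "complex poly poly poly poly poly"

definition from5 :: "T5 => mpoly" where
  "from5 = pe (pe (pe (pe (pe const (var 0)) (var 1)) (var 2)) (var 3)) (var 4)"

definition v5 :: "5 => T5" where
  "v5 i = (if i = 0 then [:[:[:[:[:0, 1:]:]:]:]:] else if i = 1 then [:[:[:[:0, 1:]:]:]:]
     else if i = 2 then [:[:[:0, 1:]:]:] else if i = 3 then [:[:0, 1:]:] else [:0, 1:])"

definition to5 :: "mpoly => T5" where
  "to5 = ev (%c. [:[:[:[:[:c:]:]:]:]:]) v5"

lemma rhom_nest: "rhom (%a. [:[:a:]:])" "rhom (%a. [:[:[:a:]:]:])" "rhom (%a. [:[:[:[:a:]:]:]:])"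
    "rhom (%a. [:[:[:[:[:a:]:]:]:]:])"
  by (auto simp: rhom_def one_pCons)

lemma rhom_to5: "rhom to5" unfolding to5_def by (intro ev_rhom rhom_nest)

lemma rhom_from5: "rhom from5" unfolding from5_def by (intro pe_rhom rhom_const)

lemma to5_from5: "to5 (from5 p) = p"
proof -
  note r = pe_rhom rhom_const rhom_to5
  have v: "to5 (var i) = v5 i" for i unfolding to5_def by (rule ev_var[OF rhom_nest(4)])
  have 1: "to5 (pe const (var 0) p) = [:[:[:[:p:]:]:]:]" for p using r v by (simp add: to5_def ev_const[OF rhom_nest(4)] rhom_pe v5_def pe_emb[OF rhom_nest(3)])
  have 2: "to5 (pe (pe const (var 0)) (var 1) p) = [:[:[:p:]:]:]" for p
    by (subst rhom_pe) (auto intro!: r simp: 1 v v5_def pe_emb[OF rhom_nest(2)])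
  have 3: "to5 (pe (pe (pe const (var 0)) (var 1)) (var 2) p) = [:[:p:]:]" for p
    by (subst rhom_pe) (auto intro!: r simp: 2 v v5_def pe_emb[OF rhom_nest(1)])
  have 4: "to5 (pe (pe (pe (pe const (var 0)) (var 1)) (var 2)) (var 3) p) = [:p:]" for p
    by (subst rhom_pe) (auto intro!: r simp: 3 v v5_def pe_emb[OF rhom_pconst])
  show ?thesis unfolding from5_def
    by (subst rhom_pe) (auto intro!: r simp: 4 v v5_def pe_self)
qed

lemma from5_to5: "from5 (to5 f) = f"
proof (rule rhom_ext[where g = "%f. from5 (to5 f)" and h = "%f. f"])
  show "rhom (%f. from5 (to5 f))" by (rule rhom_comp[OF rhom_from5 rhom_to5])
  show "rhom (%f::mpoly. f)" by (rule rhom_id)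
  note r = pe_rhom rhom_const
  show "from5 (to5 (const c)) = const c" for c
    unfolding to5_def from5_def by (simp add: ev_const[OF rhom_nest(4)] pe_const r)
  show "from5 (to5 (var i)) = var i" for i
  proof -
    have "from5 (v5 i) = var i"
      using all_5[of "%i. from5 (v5 i) = var i"]
      by (simp add: from5_def v5_def pe_const pe_pCons r rhom_0 rhom_1)
    then show ?thesis by (simp add: to5_def ev_var[OF rhom_nest(4)])
  qed
qed

section \<open>Noetherian rings and prime factors\<close>

definition noeth :: "'a::comm_ring_1 itself => bool" where
  "noeth _ \<longleftrightarrow> (ALL I :: nat => 'a set. (ALL k. ideal (I k) & I k \<subseteq> I (Suc k)) --> (EX N. ALL k>=N. I k = I N))"

lemma noeth_field: "noeth TYPE('a::field)"
  unfolding noeth_def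
proof (intro allI impI)
  fix I :: "nat => 'a set" assume I: "ALL k. ideal (I k) & I k \<subseteq> I (Suc k)"
  have mono: "i <= j ==> I i \<subseteq> I j" for i j using I lift_Suc_mono_le[of I i j] by auto
  have dich: "I k = {0} | I k = UNIV" for k
  proof (rule disjCI)
    assume "I k ~= UNIV"
    have "x = 0" if "x : I k" for x
    proof (rule ccontr)
      assume "x ~= 0"
      then show False using I that \<open>I k ~= UNIV\<close> ideal_mult[of "I k" x "inverse x"] ideal_UNIV by auto
    qed
    moreover have "0 : I k" using I ideal_0 by blast
    ultimately show "I k = {0}" by auto
  qed
  show "EX N. ALL k>=N. I k = I N"
  proof (cases "EX N. I N = UNIV")
    case True
    then show ?thesis using mono by blast
  next
    case False
    then show ?thesis using dich by metis
  qed
qed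

text \<open>Hilbert's basis theorem. \<open>L n (I k)\<close>, the ideal of coefficients of degree
  \<open>n\<close> of members of degree at most \<open>n\<close>, increases in \<open>n\<close> and
  in \<open>k\<close>. The diagonal becomes stationary at \<open>N\<close>, and so does each of the
  finitely many rows below \<open>N\<close>.\<close>

lemma noeth_poly:
  assumes "noeth TYPE('a::comm_ring_1)" shows "noeth TYPE('a poly)"
  unfolding noeth_def
proof (intro allI impI)
  fix I :: "nat => 'a poly set" assume I: "ALL k. ideal (I k) & I k \<subseteq> I (Suc k)"
  have idI: "ideal (I k)" for k using I by blast
  have mono: "i <= j ==> I i \<subseteq> I j" for i j using I lift_Suc_mono_le[of I i j] by auto
  define L where "L n J = {coeff p n | p. p : J & degree p <= n}" for n and J :: "'a poly set"
  have Lideal: "ideal (L n (I k))" for n k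
  proof (rule rm.subspaceI)
    show "0 : L n (I k)" unfolding L_def using ideal_0[OF idI] by (auto intro!: exI[of _ 0])
  next
    fix x y assume "x : L n (I k)" "y : L n (I k)"
    then obtain p q where "p : I k" "q : I k" "degree p <= n" "degree q <= n" "x = coeff p n" "y = coeff q n"
      unfolding L_def by auto
    then show "x + y : L n (I k)" unfolding L_def
      by (auto intro!: exI[of _ "p + q"] ideal_add[OF idI] degree_add_le)
  next
    fix c x assume "x : L n (I k)"
    then obtain p where "p : I k" "degree p <= n" "x = coeff p n" unfolding L_def by auto
    moreover from this(1) have "[:c:] * p : I k" using ideal_mult[OF idI] by blast
    ultimately show "c * x : L n (I k)" unfolding L_def
      by (auto intro!: exI[of _ "smult c p"] order_trans[OF degree_smult_le])
  qed
  have Lmono1: "L n (I j) \<subseteq> L n (I k)" if "j <= k" for n j k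
    unfolding L_def using mono[OF that] by blast
  have LSuc: "L n (I k) \<subseteq> L (Suc n) (I k)" for n k
  proof
    fix x assume "x : L n (I k)"
    then obtain p where p: "p : I k" "degree p <= n" "x = coeff p n" unfolding L_def by auto
    have "[:0, 1:] * p : I k" using ideal_mult[OF idI p(1)] .
    then have "pCons 0 p : I k" by simp
    moreover have "degree (pCons 0 p) <= Suc n" using p(2) by (metis degree_pCons_le le_trans Suc_le_mono)
    ultimately show "x : L (Suc n) (I k)" unfolding L_def using p(3) by (auto intro!: exI[of _ "pCons 0 p"])
  qed
  have Lmono: "L n (I j) \<subseteq> L m (I k)" if "n <= m" "j <= k" for n m j k using LSuc that(1) lift_Suc_mono_le[of "%n. L n (I k)"] Lmono1[OF that(2)] by blast
  obtain N where N: "!!k. k >= N ==> L k (I k) = L N (I N)" using assms[unfolded noeth_def, rule_format, of "%k. L k (I k)"] Lideal Lmono by auto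
  have big: "L n (I k) = L N (I N)" if "n >= N" "k >= N" for n k
    using Lmono[of N n N k] Lmono[of n "max n k" k "max n k"] N[of "max n k"] that by auto
  have "EX M. ALL k>=M. L n (I k) = L n (I M)" for n
    using assms[unfolded noeth_def, rule_format, of "%k. L n (I k)"] Lideal Lmono1 by auto
  then obtain M where M: "!!n k. k >= M n ==> L n (I k) = L n (I (M n))" by metis
  define K where "K = Max (insert N (M ` {..N}))"
  have KN: "K >= N" "n <= N ==> K >= M n" for n
    unfolding K_def by (rule Max_ge; simp)+
  have eqL: "L n (I k) = L n (I K)" if "k >= K" for n k
  proof (cases "n >= N")
    case True then show ?thesis using big[of n k] big[of n K] that KN by auto
  next
    case False then show ?thesis using M[of n k] M[of n K] that KN(2)[of n] by auto
  qed
  show "EX N. ALL k>=N. I k = I N"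
  proof (intro exI[of _ K] allI impI)
    fix k assume k: "k >= K"
    have "p : I K" if "p : I k" for p using that
    proof (induction "degree p" arbitrary: p rule: less_induct)
      case less
      obtain q where q: "q : I K" "degree q <= degree p" "coeff p (degree p) = coeff q (degree p)" using less.prems eqL[OF k] L_def by blast
      have d: "p - q : I k" using less.prems q(1) mono[OF k] ideal_diff[OF idI] by blast
      have "p - q : I K"
      proof (cases "p - q = 0")
        case True then show ?thesis using ideal_0[OF idI] by simp
      next
        case False
        have "degree (p - q) < degree p"
        proof (rule ccontr)
          assume n: "~ ?thesis"
          have "degree (p - q) <= degree p" using q(2) by (simp add: degree_diff_le)
          with n have e: "degree (p - q) = degree p" by simp
          then have "coeff (p - q) (degree (p - q)) = 0" using q(3) by simp
          then show False using False leading_coeff_0_iff by blast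
        qed
        then show ?thesis using less.hyps d by blast
      qed
      then have "(p - q) + q : I K" using ideal_add[OF idI _ q(1)] by blast
      then show ?case by simp
    qed
    then show "I k = I K" using mono[OF k] by blast
  qed
qed

lemma noeth_mpoly: "noeth TYPE(mpoly)"
  unfolding noeth_def
proof (intro allI impI)
  have n5: "noeth TYPE(T5)" by (intro noeth_poly noeth_field)
  fix I :: "nat => mpoly set" assume I: "ALL k. ideal (I k) & I k \<subseteq> I (Suc k)"
  define J where "J k = to5 ` I k" for k
  have "ideal (J k)" for k
  proof (rule rm.subspaceI)
    show "0 : J k" unfolding J_def using I ideal_0 rhom_0[OF rhom_to5] by (metis image_eqI)
    show "x + y : J k" if "x : J k" "y : J k" for x y
      using that I ideal_add[of "I k"] unfolding J_def by (auto simp flip: rhom_add[OF rhom_to5])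
    show "c * x : J k" if "x : J k" for c x
    proof -
      obtain f where f: "f : I k" "x = to5 f" using \<open>x : J k\<close> unfolding J_def by blast
      have "c * x = to5 (from5 c * f)" by (simp add: rhom_mult[OF rhom_to5] to5_from5 f)
      moreover have "from5 c * f : I k" using f(1) I ideal_mult[of "I k"] by blast
      ultimately show ?thesis unfolding J_def by simp
    qed
  qed
  moreover have "J k \<subseteq> J (Suc k)" for k using I by (auto simp: J_def)
  ultimately obtain N where N: "ALL k>=N. J k = J N" using n5 unfolding noeth_def by blast
  have "I k = from5 ` J k" for k by (simp add: J_def image_image from5_to5)
  then show "EX N. ALL k>=N. I k = I N" using N by metis
qed

lemma noeth_maximal:
  fixes I :: "mpoly set"
  assumes "P I" "ALL I. P I --> ideal I"
  shows "EX M. P M & I \<subseteq> M & (ALL J. P J & M \<subseteq> J --> J = M)"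
proof (rule ccontr)
  assume n: "~ ?thesis"
  have "EX J. (P J & I \<subseteq> J) & M \<subset> J" if PM: "P M & I \<subseteq> M" for M by (metis allI impI PM n ccontr subset_trans psubset_eq)
  then obtain f where f: "!!n. P (f n)" "!!n. f n \<subset> f (Suc n)" by (metis assms(1) dependent_nat_choice[of "%n M. (P M & I \<subseteq> M) & (n = 0 --> M = I)" "%n M J. M \<subset> J"] Zero_not_Suc subset_refl)
  have "EX N. ALL k>=N. f k = f N" by (metis allI assms(2)[rule_format, OF f(1)] mp conjI psubset_imp_subset[OF f(2)] noeth_mpoly noeth_def allE[of _ f])
  then obtain N where "ALL k>=N. f k = f N" by (rule exE)
  then have "f (Suc N) = f N" by (elim allE[of _ "Suc N"] mp) simp
  then show False using f(2)[of N] by simp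
qed

lemma prime_ideal_prod_mset:
  assumes "ALL a b. a * b : P --> a : P | b : P" "1 ~: P" "prod_mset A : P"
  shows "EX x:set_mset A. x : P"
  using assms(3) by (induction A) (use assms in auto)

text \<open>Factor \<open>f\<close> in \<open>T5\<close>: its prime factors multiply to an associate
  of \<open>f\<close>, which lies in the ideal, so one of them does.\<close>

lemma prime_ideal_has_prime_elem:
  fixes P :: "mpoly set"
  assumes "ideal P" "ALL a b. a * b : P --> a : P | b : P" "1 ~: P" "f : P" "f ~= 0"
  shows "EX p:P. prime_elem p & p dvd f"
proof -
  define Q where "Q = to5 ` P"
  have iff: "x : Q \<longleftrightarrow> from5 x : P" for x unfolding Q_def using from5_to5 to5_from5 by (metis imageE image_eqI)
  obtain A where A: "!!x. x \<in># A ==> prime_elem x" "normalize (prod_mset A) = normalize (to5 f)" by (metis assms(5) from5_to5 rhom_0[OF rhom_from5] prime_factorization_exists[of "to5 f"])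
  obtain c where "prod_mset A = to5 f * c" by (metis A(2) dvdE associated_iff_dvd)
  then have "from5 (prod_mset A) = f * from5 c" by (simp add: rhom_mult[OF rhom_from5] from5_to5)
  then have "prod_mset A : Q" using ideal_mult'[OF assms(1,4)] by (simp add: iff)
  moreover have "ALL a b. a * b : Q --> a : Q | b : Q" using assms(2) by (simp add: iff rhom_mult[OF rhom_from5])
  moreover have "1 ~: Q" using assms(3) by (simp add: iff rhom_1[OF rhom_from5])
  ultimately obtain x where x: "x \<in># A" "x : Q" using prime_ideal_prod_mset by blast
  have pr: "prime_elem x" using A x by blast
  have dv: "from5 x dvd g \<longleftrightarrow> x dvd to5 g" for g
    by (metis dvd_def from5_to5 rhom_mult[OF rhom_from5] rhom_mult[OF rhom_to5] to5_from5)
  have "prime_elem (from5 x)" by (metis allI impI pr dv prime_elem_def conjI prime_elem_not_zeroI rhom_0[OF rhom_to5] to5_from5 rhom_1[OF rhom_to5] prime_elem_not_unit rhom_mult[OF rhom_to5] prime_elem_dvd_mult_iff)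
  moreover have "x dvd to5 f" using x(1) A(2) by (auto simp: dvd_prod_mset associated_iff_dvd)
  moreover have "from5 x : P" using x(2) iff by simp
  ultimately show ?thesis by (intro bexI[of _ "from5 x"]) (simp_all add: dv)
qed

section \<open>Homogeneous primes and generic linear forms\<close>

lemma hc_low:
  assumes "!!k. k : supp a ==> n <= mdeg k" "!!k. k : supp b ==> m <= mdeg k"
  shows "hc (n + m) (a * b) = hc n a * hc m b"
proof -
  let ?a = "part (%k. ~ mdeg k = n) a" let ?b = "part (%k. ~ mdeg k = m) b"
  have a: "a = hc n a + ?a" and b: "b = hc m b + ?b" unfolding hc_def by (rule part_split)+
  have sa: "!!k. k : supp ?a ==> n < mdeg k" and sb: "!!k. k : supp ?b ==> m < mdeg k"
    using assms by (force simp: supp_part)+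
  have "a * b = hc n a * hc m b + (hc n a * ?b + ?a * b)"
    using arg_cong2[OF a b, of "%x y. x * y"] arg_cong[OF b, of "%x. hc n a * x"]
    by (metis (no_types, lifting) a add.assoc distrib_left distrib_right)
  moreover have "hc (n + m) (?a * b) = 0" unfolding hc_def
    by (rule part_none) (use sa assms(2) in \<open>fastforce dest!: supp_mult simp: mdeg_add\<close>)
  moreover have "hc (n + m) (hc n a * ?b) = 0" unfolding hc_def
    by (rule part_none) (use sb in \<open>fastforce dest!: supp_mult simp: mdeg_add supp_part\<close>)
  moreover have "homog (n + m) (hc n a * hc m b)" by (intro homog_mult homog_hc)
  ultimately show ?thesis by (simp add: hc_add hc_homog)
qed

lemma hc_high:
  assumes "!!k. k : supp a ==> mdeg k <= n" "!!k. k : supp b ==> mdeg k <= m"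
  shows "hc (n + m) (a * b) = hc n a * hc m b"
proof -
  let ?a = "part (%k. ~ mdeg k = n) a" let ?b = "part (%k. ~ mdeg k = m) b"
  have a: "a = hc n a + ?a" and b: "b = hc m b + ?b" unfolding hc_def by (rule part_split)+
  have sa: "!!k. k : supp ?a ==> mdeg k < n" and sb: "!!k. k : supp ?b ==> mdeg k < m"
    using assms by (force simp: supp_part)+
  have "a * b = hc n a * hc m b + (hc n a * ?b + ?a * b)"
    using arg_cong2[OF a b, of "%x y. x * y"] arg_cong[OF b, of "%x. hc n a * x"]
    by (metis (no_types, lifting) a add.assoc distrib_left distrib_right)
  moreover have "hc (n + m) (?a * b) = 0" unfolding hc_def
    by (rule part_none) (use sa assms(2) in \<open>fastforce dest!: supp_mult simp: mdeg_add\<close>)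
  moreover have "hc (n + m) (hc n a * ?b) = 0" unfolding hc_def
    by (rule part_none) (use sb in \<open>fastforce dest!: supp_mult simp: mdeg_add supp_part\<close>)
  moreover have "homog (n + m) (hc n a * hc m b)" by (intro homog_mult homog_hc)
  ultimately show ?thesis by (simp add: hc_add hc_homog)
qed

lemma hc_eq_0_iff: "(ALL n. hc n f = 0) \<longleftrightarrow> f = 0"
  by (metis hc_0 order_refl sum.neutral sum_hc)

text \<open>Lowest components multiply to the lowest component of the product, highest to the
  highest. Both products have degree \<open>e\<close>, so lowest and highest degree agree in each
  factor.\<close>

lemma homog_factor:
  assumes "homog e (a * b)" "a * b ~= 0" shows "EX n m. homog n a & homog m b & e = n + m"
proof -
  have ab: "a ~= 0" "b ~= 0" using assms by auto
  define La where "La = Min (mdeg ` supp a)" define Ha where "Ha = Max (mdeg ` supp a)"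
  define Lb where "Lb = Min (mdeg ` supp b)" define Hb where "Hb = Max (mdeg ` supp b)"
  have ne: "supp a ~= {}" "supp b ~= {}" using ab by auto
  have bd: "!!k. k : supp a ==> La <= mdeg k & mdeg k <= Ha" "!!k. k : supp b ==> Lb <= mdeg k & mdeg k <= Hb"
    by (auto simp: La_def Ha_def Lb_def Hb_def)
  have mem: "La : mdeg ` supp a" "Ha : mdeg ` supp a" "Lb : mdeg ` supp b" "Hb : mdeg ` supp b"
    unfolding La_def Ha_def Lb_def Hb_def using ne by (intro Min_in Max_in; simp)+
  have nz: "n : mdeg ` supp f ==> hc n f ~= 0" for n f
  proof
    assume "n : mdeg ` supp f" "hc n f = 0"
    then obtain k where "k : supp f" "mdeg k = n" by auto
    then have "lk (hc n f) k ~= 0" by (simp add: lk_hc in_keys_iff)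
    then show False using \<open>hc n f = 0\<close> by simp
  qed
  have "hc (La + Lb) (a * b) ~= 0" using hc_low[of a La b Lb] bd nz mem by simp
  then have 1: "La + Lb = e" using hc_homog[OF assms(1)] by metis
  have "hc (Ha + Hb) (a * b) ~= 0" using hc_high[of a Ha b Hb] bd nz mem by simp
  then have 2: "Ha + Hb = e" using hc_homog[OF assms(1)] by metis
  have "La <= Ha" "Lb <= Hb" using bd mem by (auto intro: order_trans)
  then have "La = Ha" "Lb = Hb" using 1 2 by auto
  then have "homog La a" "homog Lb b" using bd by (auto simp: homog_mdeg intro: antisym)
  then show ?thesis using 1 by blast
qed

lemma homog_ideal_memI: "ideal I ==> (!!n. hc n f : I) ==> f : I"
  by (subst sum_hc[OF order_refl]) (auto intro: ideal_sum)

definition prime_set :: "mpoly set => bool" where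
  "prime_set P \<longleftrightarrow> (ALL a b. a * b : P --> a : P | b : P)"

text \<open>Subtract from each factor the components below the first one outside \<open>M\<close>;
  the product of the new lowest components is a component of an element of \<open>M\<close>, so
  testing forms is enough.\<close>

lemma prime_homogI:
  assumes M: "homog_ideal M"
    and pr: "!!a b n m. homog n a ==> homog m b ==> a * b : M ==> a : M | b : M"
  shows "prime_set M"
  unfolding prime_set_def
proof (intro allI impI, rule ccontr)
  fix a b assume ab: "a * b : M" "~ (a : M | b : M)"
  have id: "ideal M" using M by (rule homog_ideal_ideal)
  have low: "EX n c. c : M & hc n (f - c) ~: M & (ALL k:supp (f - c). n <= mdeg k)" if "f ~: M" for f
  proof -
    have ex: "EX n. hc n f ~: M" using homog_ideal_memI[OF id, of f] \<open>f ~: M\<close> by blast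
    define n where "n = (LEAST n. hc n f ~: M)"
    have n: "hc n f ~: M" unfolding n_def using ex by (rule LeastI_ex)
    have l: "hc i f : M" if "i < n" for i using not_less_Least[of i "%n. hc n f ~: M"] \<open>i < n\<close> by (simp add: n_def)
    let ?c = "part (%k. mdeg k < n) f"
    have "?c : M"
    proof (rule homog_ideal_memI[OF id])
      fix i
      have "hc i ?c = (if i < n then hc i f else 0)"
        by (rule poly_mapping_eqI) (auto simp: lk_hc lk_part)
      then show "hc i ?c : M" using l ideal_0[OF id] by simp
    qed
    moreover have "hc n (f - ?c) = hc n f"
      by (rule poly_mapping_eqI) (auto simp: lk_hc lk_part lookup_minus)
    moreover have "ALL k:supp (f - ?c). n <= mdeg k"
      by (auto simp: in_keys_iff lookup_minus lk_part split: if_splits)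
    ultimately show ?thesis using n by (metis (no_types, lifting))
  qed
  obtain n c where c: "c : M" "hc n (a - c) ~: M" "ALL k:supp (a - c). n <= mdeg k" using low ab by blast
  obtain m d where d: "d : M" "hc m (b - d) ~: M" "ALL k:supp (b - d). m <= mdeg k" using low ab by blast
  have "(a - c) * (b - d) : M" using ab(1) c(1) d(1) by (simp add: algebra_simps ideal_diff[OF id] ideal_add[OF id] ideal_mult[OF id] ideal_mult'[OF id])
  then have "hc n (a - c) * hc m (b - d) : M" by (metis c(3) d(3) homog_idealD[OF M] hc_low[of "a - c" n "b - d" m])
  then show False using pr[OF homog_hc homog_hc] c(2) d(2) by blast
qed

text \<open>A homogeneous ideal that is maximal among those disjoint from a multiplicative set of
  forms is prime: adjoining a form outside it makes it meet the set.\<close>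

lemma homog_prime_avoid:
  assumes A: "homog_ideal A" and S: "!!s. s : S ==> EX e. homog e s" "!!s t. s : S ==> t : S ==> s * t : S" "1 : S"
    and dis: "A Int S = {}"
  shows "EX P. homog_ideal P & prime_set P & A \<subseteq> P & P Int S = {}"
proof -
  define Q where "Q M \<longleftrightarrow> homog_ideal M & M Int S = {}" for M
  have h: "Q A" "ALL M. Q M --> ideal M" using A dis by (simp_all add: Q_def homog_ideal_ideal)
  obtain M where M: "Q M" "A \<subseteq> M" "ALL J. Q J & M \<subseteq> J --> J = M"
    using noeth_maximal[of Q, OF h] by (elim exE conjE)
  have hM: "homog_ideal M" and id: "ideal M" using M(1) by (auto simp: Q_def homog_ideal_ideal)
  have "prime_set M"
  proof (rule prime_homogI[OF hM], rule ccontr)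
    fix a b n m assume ab: "homog n a" "homog m b" "a * b : M" "~ (a : M | b : M)"
    have ex: "EX c d. c * f + d : S & d : M" if "homog k f" "f ~: M" for k f
    proof (rule ccontr)
      assume n: "~ ?thesis"
      have "Q (gen (insert f M))" unfolding Q_def using homog_ideal_insert[OF hM that(1)] n gen_insert[OF id] by auto
      then show False by (metis M(3) that(2) gen_insert_sup(1)[OF id] gen_insert_sup(2)[of f M])
    qed
    obtain c d where cd: "c * a + d : S" "d : M" using ex ab by blast
    obtain c' d' where cd': "c' * b + d' : S" "d' : M" using ex ab by blast
    have "(c * a + d) * (c' * b + d') = (c * c') * (a * b) + (d * (c' * b + d') + (c * a) * d')"
      by (simp add: algebra_simps)
    also have "... : M" using ab(3) cd(2) cd'(2)
      by (auto intro!: ideal_add[OF id] intro: ideal_mult[OF id] ideal_mult'[OF id])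
    finally show False using S(2)[OF cd(1) cd'(1)] M(1) by (auto simp: Q_def)
  qed
  then show ?thesis using hM M(1,2) Q_def by blast
qed

lemma relevant_prime_alt: "relevant_prime P \<longleftrightarrow> homog_ideal P & (EX i. var i ~: P) & prime_set P"
  by (simp add: relevant_prime_def prime_set_def)

lemma rp_ideal: "relevant_prime P ==> ideal P" and rp_homog: "relevant_prime P ==> homog_ideal P"
  by (auto simp: relevant_prime_def homog_ideal_ideal)

lemma rp_mult: "relevant_prime P ==> a * b : P \<longleftrightarrow> a : P | b : P"
  using rp_ideal ideal_mult ideal_mult' unfolding relevant_prime_def by blast

lemma rp_1: "relevant_prime P ==> 1 ~: P"
  using ideal_UNIV[OF rp_ideal] unfolding relevant_prime_def by blast

lemma rp_0: "relevant_prime P ==> 0 : P"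
  by (rule ideal_0[OF rp_ideal])

lemma rp_power: "relevant_prime P ==> a ^ n : P \<longleftrightarrow> a : P & n > 0"
proof -
  assume P: "relevant_prime P"
  show ?thesis by (induction n) (auto simp: rp_1[OF P] rp_mult[OF P])
qed

lemma rp_prod: "relevant_prime P ==> finite A ==> prod f A : P \<longleftrightarrow> (EX i:A. f i : P)"
proof -
  assume P: "relevant_prime P" and "finite A"
  from this(2) show ?thesis by (induction A rule: finite_induct) (auto simp: rp_1[OF P] rp_mult[OF P])
qed

lemma rp_saturated: "relevant_prime P ==> saturation P = P"
proof
  assume P: "relevant_prime P"
  then obtain i where i: "var i ~: P" by (auto simp: relevant_prime_def)
  show "saturation P \<subseteq> P" using i saturation_def rp_mult[OF P] rp_power[OF P] by auto
qed (rule saturation_sup)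

lemma points_saturation: "points (saturation I) = points I"
proof -
  have "saturation I \<subseteq> P" if "relevant_prime P" "I \<subseteq> P" for P
    using saturation_mono[OF that(2)] rp_saturated[OF that(1)] by simp
  then show ?thesis using saturation_sup[of I] unfolding points_def by blast
qed

lemma rp_closed: "relevant_prime P ==> closed_subscheme P"
  by (simp add: closed_subscheme_def rp_homog rp_saturated)

text \<open>Projective Nullstellensatz: if no power of \<open>var i\<close> lay in \<open>A\<close>,
  a homogeneous prime above \<open>A\<close> avoiding these powers would be a point.\<close>

lemma irrelevant_power:
  assumes A: "homog_ideal A" and n: "points A = {}"
  shows "EX N. ALL i. var i ^ N : A"
proof -
  have "EX n. var i ^ n : A" for i
  proof (rule ccontr)
    assume "~ ?thesis"
    then have 4: "A Int range (%n. var i ^ n) = {}" by auto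
    have 1: "EX e. homog e s" if "s : range (%n. var i ^ n)" for s
      using that homog_var_power by blast
    have 2: "s * t : range (%n. var i ^ n)" if "s : range (%n. var i ^ n)" "t : range (%n. var i ^ n)" for s t
    proof -
      from that(1) obtain k where "s = var i ^ k" by (elim rangeE)
      moreover from that(2) obtain l where "t = var i ^ l" by (elim rangeE)
      ultimately have "s * t = var i ^ (k + l)" by (simp add: power_add)
      then show ?thesis by blast
    qed
    have 3: "1 : range (%n. var i ^ n)" by (rule range_eqI[of _ _ 0]) simp
    obtain P where P: "homog_ideal P" "prime_set P" "A \<subseteq> P" "P Int range (%n. var i ^ n) = {}"
      using homog_prime_avoid[OF A 1 2 3 4] by blast
    have "var i ~: P" using P(4) by (auto simp: range_eqI[of _ _ 1])
    then show False using P n points_def relevant_prime_alt by auto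
  qed
  then obtain n where n: "!!i. var i ^ n i : A" by metis
  have "var i ^ Max (range n) : A" for i
    using saturation_ideal_up[OF homog_ideal_ideal[OF A], of i "n i" 1 "Max (range n)"] n by simp
  then show ?thesis by blast
qed

section \<open>Zero divisors and associated primes\<close>

definition nzd :: "mpoly => mpoly set => bool" where
  "nzd y I \<longleftrightarrow> (ALL f. y * f : I --> f : I)"

lemma nzdD: "nzd y I ==> y * f : I ==> f : I" by (simp add: nzd_def)

lemma nzd_power: "nzd y I ==> nzd (y ^ n) I"
proof -
  assume y: "nzd y I"
  have "f : I" if "y ^ n * f : I" for f n using that
    by (induction n) (simp_all add: mult.assoc nzdD[OF y])
  then show ?thesis by (simp add: nzd_def)
qed

lemma nzd_prime: "prime_set P ==> y ~: P ==> nzd y P"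
  by (auto simp: nzd_def prime_set_def)

lemma homog_ideal_colon:
  assumes A: "homog_ideal A" and f: "homog e f"
  shows "homog_ideal {c. c * f : A}"
  unfolding homog_ideal_hc
proof (intro conjI ballI allI)
  have id: "ideal A" using A by (rule homog_ideal_ideal)
  show "ideal {c. c * f : A}"
    by (rule rm.subspaceI) (auto simp: ideal_0[OF id] distrib_right mult.assoc intro: ideal_add[OF id] ideal_mult[OF id])
  fix c n assume "c : {c. c * f : A}"
  then show "hc n c : {c. c * f : A}" using homog_idealD[OF A, of "c * f" "n + e"] by (simp add: hc_mult[OF f])
qed

text \<open>A prime filtration by noetherian induction on \<open>A\<close>: zero divisors on
  \<open>A/I\<close> are caught by finitely many primes. If \<open>A\<close> is proper, a maximal
  colon ideal \<open>(A : f)\<close> is prime, and adjoining \<open>f\<close> to \<open>A\<close>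
  costs at most this one prime.\<close>

lemma associated_primes:
  assumes I: "closed_subscheme I"
  shows "EX PP. finite PP & (ALL P:PP. relevant_prime P) & (ALL y. y ~: Union PP --> nzd y I)"
proof -
  have hI: "homog_ideal I" and idI: "ideal I" and sI: "saturation I = I"
    using I by (auto simp: closed_subscheme_def homog_ideal_ideal)
  define Q where "Q A \<longleftrightarrow> homog_ideal A & I \<subseteq> A & (EX PP. finite PP & (ALL P:PP. relevant_prime P) &
      (ALL y. y ~: Union PP --> (ALL f:A. y * f : I --> f : I)))" for A
  have h: "Q I" "ALL A. Q A --> ideal A"
    unfolding Q_def using hI by (auto intro!: exI[of _ "{}"] homog_ideal_ideal)
  obtain A where A: "Q A" "I \<subseteq> A" "ALL J. Q J & A \<subseteq> J --> J = A"
    using noeth_maximal[of Q, OF h] by (elim exE conjE)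
  have hA: "homog_ideal A" and idA: "ideal A" and IA: "I \<subseteq> A" using A(1) by (auto simp: Q_def homog_ideal_ideal)
  obtain PP where PP: "finite PP" "ALL P:PP. relevant_prime P" "ALL y. y ~: Union PP --> (ALL f:A. y * f : I --> f : I)"
    using A(1) unfolding Q_def by (elim conjE exE)
  have "A = UNIV"
  proof (rule ccontr)
    assume "A ~= UNIV"
    then have "1 ~: A" using ideal_UNIV[OF idA] by blast
    define T where "T J \<longleftrightarrow> (EX f e. homog e f & f ~: A & J = {c. c * f : A})" for J
    have T1: "T {c. c * 1 : A}" unfolding T_def using \<open>1 ~: A\<close> homog_1 by blast
    have Tid: "ALL J. T J --> ideal J"
      unfolding T_def using homog_ideal_ideal[OF homog_ideal_colon[OF hA]] by blast
    obtain J where J: "T J" "{c. c * 1 : A} \<subseteq> J" "ALL J'. T J' & J \<subseteq> J' --> J' = J"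
      using noeth_maximal[of T, OF T1 Tid] by (elim exE conjE)
    obtain f e where f: "homog e f" "f ~: A" "J = {c. c * f : A}" using J(1) unfolding T_def by blast
    have hJ: "homog_ideal J" unfolding f(3) by (rule homog_ideal_colon[OF hA f(1)])
    have pJ: "prime_set J"
    proof (rule prime_homogI[OF hJ], rule disjCI)
      fix b a n m assume ab': "homog n b" "homog m a" "b * a : J" "a ~: J"
      then have ab: "homog n b" "homog m a" "a * b : J" "a ~: J" by (simp_all add: mult.commute)
      have "T {c. c * (a * f) : A}" unfolding T_def using ab(4) homog_mult[OF ab(2) f(1)] f(3) by blast
      moreover have "J \<subseteq> {c. c * (a * f) : A}"
      proof
        fix c assume "c : J"
        then show "c : {c. c * (a * f) : A}" using f(3) by (simp add: ideal_mult[OF idA] mult_ac)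
      qed
      ultimately have "{c. c * (a * f) : A} = J" using J(3) by blast
      moreover have "b * (a * f) : A" using ab(3) f(3) by (simp add: mult_ac)
      ultimately show "b : J" by blast
    qed
    have hA': "homog_ideal (gen (insert f A))" by (rule homog_ideal_insert[OF hA f(1)])
    have IA': "I \<subseteq> gen (insert f A)" using IA gen_insert_sup(1)[OF idA] by blast
    have "Q (gen (insert f A))"
    proof (cases "EX i. var i ~: J")
      case True
      then have rJ: "relevant_prime J" using hJ pJ by (simp add: relevant_prime_alt)
      have "g : I" if y: "y ~: Union (insert J PP)" and g: "g : gen (insert f A)" "y * g : I" for y g
      proof -
        obtain c a where ca: "g = c * f + a" "a : A" using g(1) idA by (rule gen_insertE)
        have "y * g - y * a : A" using g(2) IA ideal_diff[OF idA] ideal_mult[OF idA ca(2)] by auto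
        then have "(y * c) * f : A" by (simp add: ca(1) algebra_simps)
        then have "c : J" using f(3) y rp_mult[OF rJ] by auto
        then show "g : I" using ca f(3) PP(3) y g(2) ideal_add[OF idA] by auto
      qed
      then show ?thesis unfolding Q_def using hA' IA' PP(1,2) rJ
        by (intro conjI exI[of _ "insert J PP"]) auto
    next
      \<comment> \<open>\<open>J\<close> contains all variables, so it is no point and is not added.
        Then \<open>var i * g\<close> lies in \<open>A\<close> for every \<open>i\<close>, hence in
        \<open>I\<close>, and saturation of \<open>I\<close> gives \<open>g\<close>.\<close>
      case False
      have "g : I" if y: "y ~: Union PP" and g: "g : gen (insert f A)" "y * g : I" for y g
      proof -
        obtain c a where ca: "g = c * f + a" "a : A" using g(1) idA by (rule gen_insertE)
        have "var i ^ 1 * g : I" for i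
        proof -
          have "c * (var i * f) + var i * a : A" using f(3) ca(2) False ideal_add[OF idA] ideal_mult[OF idA] by auto
          then have "var i * g : A" by (simp add: ca(1) algebra_simps)
          moreover have "y * (var i * g) : I" using ideal_mult[OF idI g(2), of "var i"] by (simp add: mult_ac)
          ultimately show ?thesis using PP(3) y by auto
        qed
        then show ?thesis using sI saturation_def by blast
      qed
      then show ?thesis unfolding Q_def using hA' IA' PP(1,2) by blast
    qed
    then show False by (metis A(3) f(2) gen_insert_sup(1)[OF idA] gen_insert_sup(2)[of f A])
  qed
  then have "ALL y. y ~: Union PP --> nzd y I" using PP(3) by (simp add: nzd_def)
  then show ?thesis using PP(1,2) by (intro exI[of _ PP] conjI)
qed

section \<open>Generic linear forms\<close>

definition idx :: "5 => nat" where
  "idx i = (if i = 0 then 0 else if i = 1 then 1 else if i = 2 then 2 else if i = 3 then 3 else 4)"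

text \<open>The linear forms on the rational normal curve: any five of them are a basis.\<close>

definition lf :: "complex => mpoly" where
  "lf t = (SUM i:UNIV. const (t ^ idx i) * var i)"

lemma lf_expand: "lf t = var 0 + (const t * var 1 + (const (t\<^sup>2) * var 2 + (const (t ^ 3) * var 3 + const (t ^ 4) * var 4)))"
  unfolding lf_def UNIV_5 by (simp add: idx_def)

lemma homog_lf [simp]: "homog (Suc 0) (lf t)"
  unfolding lf_def by (intro homog_sum homog_const_mult homog_var)

text \<open>Invertibility of the Vandermonde matrix, without determinants: division by
  \<open>X - c\<close> leaves a quotient with values \<open>(p(t) - p(c)) / (t - c)\<close> in
  \<open>J\<close> at the remaining points.\<close>

lemma interpolation_subspace:
  fixes p :: "mpoly poly"
  assumes J: "mv.subspace J"
  shows "finite T ==> degree p < card T ==> (!!t. t : T ==> poly p (const t) : J) ==> coeff p k : J"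
proof (induction "degree p" arbitrary: p T k)
  case 0
  then obtain t where t: "t : T" by fastforce
  obtain c where c: "p = [:c:]" using 0(1) by (metis degree_eq_zeroE)
  then show ?case using 0(4)[OF t] mv.subspace_0[OF J] by (cases k) auto
next
  case (Suc n)
  then have "T ~= {}" by auto
  then obtain c where c: "c : T" by blast
  define s where "s = synthetic_div p (const c)"
  have ps: "[:- const c, 1:] * s + [:poly p (const c):] = p" unfolding s_def by (rule synthetic_div_correct')
  have ds: "degree s = n" using Suc(2) by (simp add: s_def degree_synthetic_div)
  have "poly s (const t) : J" if t: "t : T - {c}" for t
  proof -
    have "poly p (const t) = poly ([:- const c, 1:] * s + [:poly p (const c):]) (const t)" using ps by simp
    then have "poly p (const t) - poly p (const c) = (const t - const c) * poly s (const t)"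
      by (simp add: algebra_simps)
    also have "const t - const c = const (t - c)" using const_add[of t "- c"] by (simp add: const_uminus)
    finally have "const (t - c) * poly s (const t) : J" using Suc.prems(3) t c mv.subspace_diff[OF J] by (metis DiffD1)
    then have "const (inverse (t - c)) * (const (t - c) * poly s (const t)) : J" using mv.subspace_scale[OF J] by blast
    moreover have "const (inverse (t - c)) * (const (t - c) * poly s (const t)) = poly s (const t)" using t mult.assoc[symmetric] const_mult[symmetric] by auto
    ultimately show ?thesis by (simp only:)
  qed
  moreover have "n < card (T - {c})" using Suc(2,4) c Suc(3) by simp
  ultimately have cs: "coeff s k : J" for k using Suc(1)[of s "T - {c}" k] ds Suc(3) by auto
  have "coeff p k = (case k of 0 => - (const c * coeff s 0) + poly p (const c) | Suc j => - (const c * coeff s k) + coeff s j)"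
    by (subst ps[symmetric]) (auto split: nat.split)
  moreover have "const c * coeff s i : J" for i
    by (rule mv.subspace_scale[OF J cs])
  ultimately show ?case using cs Suc.prems(3)[OF c] by (auto split: nat.split intro: mv.subspace_diff[OF J])
qed

lemma lf_span:
  assumes J: "mv.subspace J" and T: "finite T" "card T >= 5" "!!t. t : T ==> lf t : J"
  shows "var i : J"
proof -
  define p where "p = [:var 0, var 1, var 2, var 3, var 4:]"
  have "poly p (const t) = lf t" for t
  proof -
    have c: "const (t\<^sup>2) = const t * const t" "const (t ^ 3) = const t * (const t * const t)"
        "const (t ^ 4) = const t * (const t * (const t * const t))"
      by (simp_all only: power2_eq_square power3_eq_cube power4_eq_xxxx const_mult mult.assoc)
    show ?thesis unfolding p_def lf_expand c
      by (simp only: poly_pCons poly_0 mult_zero_right add_0_right distrib_left mult.assoc add.assoc)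
  qed
  then have "coeff p k : J" for k
    using interpolation_subspace[OF J T(1), of p k] T(2,3) by (simp add: p_def)
  from this[of "idx i"] show ?thesis
    using all_5[of "%i. coeff p (idx i) = var i"] by (simp add: p_def idx_def numeral_2_eq_2 numeral_3_eq_3 eval_nat_numeral)
qed

text \<open>Five of these forms span all linear forms, while a relevant prime misses a
  variable.\<close>

lemma finite_lf_prime:
  assumes "relevant_prime P" shows "finite {t. lf t : P}"
proof (rule ccontr)
  assume "~ ?thesis"
  then obtain T where T: "T \<subseteq> {t. lf t : P}" "finite T" "card T = 5" by (meson infinite_arbitrarily_large)
  have "var i : P" for i
    by (rule lf_span[OF ideal_mv[OF rp_ideal[OF assms]] T(2)]) (use T in auto)
  then show False using assms by (auto simp: relevant_prime_def)
qed

lemma generic_nzd: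
  assumes "closed_subscheme I" shows "finite {t. ~ nzd (lf t) I}"
proof -
  obtain PP where PP: "finite PP" "ALL P:PP. relevant_prime P" "ALL y. y ~: Union PP --> nzd y I"
    using associated_primes[OF assms] by blast
  have "{t. ~ nzd (lf t) I} \<subseteq> (UN P:PP. {t. lf t : P})" using PP(3) by blast
  then show ?thesis using PP(1,2) finite_lf_prime by (meson finite_UN finite_subset)
qed

text \<open>Elements \<open>y ^ k * t\<close> with \<open>t\<close> a form outside \<open>P\<close>
  are never in \<open>I\<close>, since \<open>y\<close> is a nonzerodivisor. A prime above
  \<open>I\<close> avoiding them lies inside \<open>P\<close> and misses \<open>y\<close>; thus
  cutting by \<open>y\<close> shortens chains.\<close>

lemma chain_cut:
  assumes I: "closed_subscheme I" and y: "homog e y" "nzd y I" and P: "relevant_prime P" "I \<subseteq> P" "y : P"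
  shows "EX P'. relevant_prime P' & I \<subseteq> P' & P' \<subset> P"
proof -
  define S where "S = {y ^ k * t | k t. (EX e. homog e t) & t ~: P}"
  have hI: "homog_ideal I" using I by (simp add: closed_subscheme_def)
  have 1: "EX e. homog e s" if "s : S" for s
    using that homog_mult[OF homog_power[OF y(1)]] unfolding S_def by blast
  have 2: "s * t : S" if st: "s : S" "t : S" for s t
  proof -
    obtain k a e where a: "s = y ^ k * a" "homog e a" "a ~: P" using st(1) unfolding S_def by blast
    obtain l b e' where b: "t = y ^ l * b" "homog e' b" "b ~: P" using st(2) unfolding S_def by blast
    have "s * t = y ^ (k + l) * (a * b)" by (simp add: a b power_add mult_ac)
    moreover have "a * b ~: P" using a b rp_mult[OF P(1)] by blast
    ultimately show ?thesis unfolding S_def using homog_mult[OF a(2) b(2)] by blast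
  qed
  have memS: "t : S" if "homog e' t" "t ~: P" for t e'
    unfolding S_def using that by (intro CollectI exI[of _ 0] exI[of _ t]) auto
  have 3: "1 : S" by (rule memS[OF homog_1 rp_1[OF P(1)]])
  have 4: "I Int S = {}" using nzd_power[OF y(2)] P(2) unfolding S_def nzd_def by blast
  obtain P' where P': "homog_ideal P'" "prime_set P'" "I \<subseteq> P'" "P' Int S = {}"
    using homog_prime_avoid[OF hI 1 2 3 4] by blast
  have "P' \<subseteq> P"
  proof
    fix f assume f: "f : P'"
    have "hc n f : P" for n using homog_idealD[OF P'(1) f, of n] memS[OF homog_hc, of n f] P'(4) by blast
    then show "f : P" by (rule homog_ideal_memI[OF rp_ideal[OF P(1)]])
  qed
  moreover have "y ~: P'"
  proof -
    have "y ^ 1 * 1 : S" unfolding S_def using homog_1 rp_1[OF P(1)] by blast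
    then show ?thesis using P'(4) by auto
  qed
  moreover have "relevant_prime P'" using P'(1,2) P(1) \<open>P' \<subseteq> P\<close> by (auto simp: relevant_prime_alt)
  ultimately show ?thesis using P'(3) P(3) by blast
qed

lemma has_chain_cut:
  assumes I: "closed_subscheme I" and y: "homog e y" "nzd y I"
    and ch: "has_chain (saturation (gen (insert y I))) n"
  shows "has_chain I (Suc n)"
proof -
  have id: "ideal I" using I by (simp add: closed_subscheme_def homog_ideal_ideal)
  obtain P where P: "!!i. i <= n ==> P i : points (gen (insert y I))" "!!i. i < n ==> P i \<subset> P (Suc i)"
    using ch unfolding has_chain_def points_saturation by blast
  have sub: "Q : points I & y : Q" if "Q : points (gen (insert y I))" for Q
    using that gen_insert_sup(1)[OF id, of y] gen_insert_sup(2)[of y I] unfolding points_def by blast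
  obtain P' where P': "relevant_prime P'" "I \<subseteq> P'" "P' \<subset> P 0"
    using chain_cut[OF I y, of "P 0"] sub[OF P(1)[of 0]] by (auto simp: points_def)
  define R where "R i = (case i of 0 => P' | Suc j => P j)" for i
  have "ALL i<=Suc n. R i : points I"
    using P' sub P(1) by (auto simp: R_def points_def split: nat.split)
  moreover have "ALL i<Suc n. R i \<subset> R (Suc i)" using P' P(2) by (auto simp: R_def split: nat.split)
  ultimately show ?thesis unfolding has_chain_def by blast
qed

lemma no_chain_0: "~ has_chain I 0 ==> points I = {}"
  unfolding has_chain_def by auto

text \<open>Noetherianity is used twice: the saturation is generated in degrees up to
  \<open>n0\<close>, and one exponent \<open>e0\<close> of the variables carries all of it into
  \<open>A\<close>. A member of degree at least \<open>n0 + 5 * e0\<close> is then a combination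
  with coefficients of degree at least \<open>5 * e0\<close>.\<close>

lemma saturation_high:
  assumes A: "homog_ideal A"
  shows "EX m. ALL n>=m. ALL f. homog n f & f : saturation A --> f : A"
proof -
  have id: "ideal A" using A by (rule homog_ideal_ideal)
  define B where "B n = gen {f : saturation A. EX e<=n. homog e f}" for n
  have "ideal (B k) & B k \<subseteq> B (Suc k)" for k
    unfolding B_def by (auto intro!: rm.span_mono simp: le_Suc_eq simp del: rm.span_eq_iff)
  then obtain n0 where n0: "!!k. k >= n0 ==> B k = B n0" using noeth_mpoly unfolding noeth_def by metis
  define C where "C e = {f. ALL i. var i ^ e * f : A}" for e
  have "ideal (C k) & C k \<subseteq> C (Suc k)" for k
  proof
    show "ideal (C k)" unfolding C_def
      by (rule rm.subspaceI) (auto simp: ideal_0[OF id] distrib_left mult.left_commute intro: ideal_add[OF id] ideal_mult[OF id])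
    show "C k \<subseteq> C (Suc k)" unfolding C_def by (auto simp: mult.assoc intro: ideal_mult[OF id])
  qed
  then obtain e0 where e0: "!!k. k >= e0 ==> C k = C e0" using noeth_mpoly unfolding noeth_def by metis
  have sat: "var i ^ e0 * f : A" if fs: "f : saturation A" for f i
  proof -
    obtain N where N: "!!i. var i ^ N * f : A" using saturation_uniform[OF id fs] by blast
    then have "f : C (max N e0)" using saturation_ideal_up[OF id N] C_def by auto
    then show ?thesis using e0[of "max N e0"] C_def by auto
  qed
  have key: "hc n x : A" if "x : B n0" "n >= n0 + 5 * e0" for x n
    using that(1) unfolding B_def
  proof (induction rule: rm.span_induct_alt)
    case base then show ?case by (simp add: ideal_0[OF id])
  next
    case (step c x y)
    then obtain e where e: "e <= n0" "homog e x" "x : saturation A" by blast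
    have "hc n (c * x) = hc (n - e) c * x" using hc_mult'[OF e(2)] e(1) that(2) by simp
    also have "... : A" by (rule homog_high_in_ideal[OF id sat[OF e(3)] homog_hc]) (use e(1) that(2) in simp)
    finally show ?case using step(2) by (simp add: hc_add ideal_add[OF id])
  qed
  show ?thesis
  proof (intro exI[of _ "n0 + 5 * e0"] allI impI)
    fix n f assume n: "n >= n0 + 5 * e0" and f: "homog n f & f : saturation A"
    have "f : B n" unfolding B_def using f by (intro rm.span_base) auto
    then show "f : A" using n f key[of f n] n0[of n] hc_homog[of n f n] by auto
  qed
qed

section \<open>Hilbert functions\<close>

abbreviation cs :: "complex => mpoly => mpoly" where "cs \<equiv> %c f. const c * f"

definition mons :: "nat => mon set" where "mons n = {m. mdeg m = n}"

lemma mdeg_5: "mdeg m = lk m 0 + (lk m 1 + (lk m 2 + (lk m 3 + lk m 4)))"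
  unfolding mdeg_def UNIV_5 by simp

lemma finite_mons [simp]: "finite (mons n)"
proof (rule finite_imageD)
  have "lk m i <= mdeg m" for m :: mon and i unfolding mdeg_def by (rule member_le_sum) simp_all
  then have "lk ` mons n \<subseteq> {f. ALL i. (i : UNIV --> f i : {..n}) & (i ~: UNIV --> f i = 0)}" by (auto simp: mons_def)
  then show "finite (lk ` mons n)" by (rule finite_subset) (intro finite_set_of_finite_funs, simp_all)
  show "inj_on lk (mons n)" by (simp add: inj_on_def lookup_inject)
qed

lemma homog_span_mons: "{f. homog n f} = mv.span ((%m. sng m 1) ` mons n)"
proof
  show "{f. homog n f} \<subseteq> mv.span ((%m. sng m 1) ` mons n)"
  proof
    fix f assume "f : {f. homog n f}"
    then have "(SUM m:supp f. const (lk f m) * sng m 1) : mv.span ((%m. sng m 1) ` mons n)" by (simp add: homog_mdeg mons_def mv.span_sum mv.span_scale mv.span_base)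
    then show "f : mv.span ((%m. sng m 1) ` mons n)" using pm_decomp[of f] by (simp add: const_mult_single)
  qed
  show "mv.span ((%m. sng m 1) ` mons n) \<subseteq> {f. homog n f}"
    by (rule mv.span_minimal[OF _ mv_subspace_homog]) (auto simp: mons_def homog_mdeg)
qed

lemma finite_dim_homog: "EX S. finite S & {f. homog n f} = mv.span S"
  using homog_span_mons[of n] finite_mons by blast

lemma qd_homog_ex:
  assumes "mv.subspace V" "mv.subspace W" "W \<subseteq> V" "V \<subseteq> {f. homog n f}"
  shows "EX k. qd cs V W k"
proof -
  obtain S where S: "finite S" "{f. homog n f} = mv.span S" using finite_dim_homog by blast
  show ?thesis using assms(4) S(2) mv.span_mono[of S "S Un W"] mv.qd_ex_bound[OF S(1) _ assms(2,1,3)] by auto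
qed

lemma hf_qd:
  assumes "ideal I" shows "qd cs {f. homog n f} {f : I. homog n f} (hilbert_function I n)"
proof -
  obtain k where k: "qd cs {f. homog n f} {f : I. homog n f} k"
    using qd_homog_ex[OF mv_subspace_homog mv_subspace_ideal_homog[OF assms]] by blast
  then show ?thesis unfolding hilbert_function_def
    using quotient_dim_qd[OF mv.vector_space_axioms k mv_subspace_ideal_homog[OF assms]] by simp
qed

lemma hf_unique:
  assumes "ideal I" "qd cs {f. homog n f} {f : I. homog n f} k" shows "hilbert_function I n = k"
  using mv.qd_unique[OF hf_qd[OF assms(1)] assms(2) mv_subspace_ideal_homog[OF assms(1)]] .

lemma ideal_zero: "ideal {0}" by (rule rm.subspace_single_0)

lemma homog_ideal_zero: "homog_ideal {0}" by (simp add: homog_ideal_hc ideal_zero)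

lemma hf_split:
  assumes "ideal I" "ideal J" "I \<subseteq> J"
  shows "EX a. qd cs {f : J. homog n f} {f : I. homog n f} a & hilbert_function I n = a + hilbert_function J n"
proof -
  have "{f : I. homog n f} \<subseteq> {f : J. homog n f}" "{f : J. homog n f} \<subseteq> {f. homog n f}" using assms(3) by auto
  from mv.qd_split[OF hf_qd[OF assms(1)] mv_subspace_ideal_homog[OF assms(1)] mv_subspace_ideal_homog[OF assms(2)] mv_subspace_homog this]
  obtain a b where "qd cs {f : J. homog n f} {f : I. homog n f} a" "qd cs {f. homog n f} {f : J. homog n f} b"
      "hilbert_function I n = a + b" by blast
  then show ?thesis using hf_unique[OF assms(2)] by blast
qed

lemma hf_mono: "ideal I ==> ideal J ==> I \<subseteq> J ==> hilbert_function J n <= hilbert_function I n"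
  using hf_split[of I J n] by force

lemma hf_cong:
  assumes "!!f. homog n f ==> f : I \<longleftrightarrow> f : J" shows "hilbert_function I n = hilbert_function J n"
proof -
  have "{f : I. homog n f} = {f : J. homog n f}" using assms by blast
  then show ?thesis by (simp add: hilbert_function_def)
qed

lemma hf_eq_0:
  assumes "ideal I" shows "hilbert_function I n = 0 \<longleftrightarrow> (ALL f. homog n f --> f : I)"
proof
  assume "hilbert_function I n = 0"
  then have "qd cs {f. homog n f} {f : I. homog n f} 0" using hf_qd[OF assms, of n] by (simp only:)
  then obtain B where B: "qindep cs B {f : I. homog n f}" "card B = 0" "{f. homog n f} \<subseteq> mv.span (B Un {f : I. homog n f})"
    unfolding qd_def by blast
  then have "B = {}" using qindep_finite[OF B(1)] by simp
  then show "ALL f. homog n f --> f : I" using B(3) mv.span_eq_iff[THEN iffD2, OF mv_subspace_ideal_homog[OF assms, of n]] Un_empty_left by auto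
next
  assume h: "ALL f. homog n f --> f : I"
  show "hilbert_function I n = 0"
  proof (rule hf_unique[OF assms])
    have "{f : I. homog n f} = {f. homog n f}" using h by blast
    then show "qd cs {f. homog n f} {f : I. homog n f} 0" using mv.qd_self[of "{f. homog n f}"] by simp
  qed
qed

lemma linear_mult: "Vector_Spaces.linear cs cs ((*) f)"
  by (simp add: Vector_Spaces.linear_iff mv.vector_space_axioms distrib_left mult.left_commute)

text \<open>Multiplication by \<open>f\<close> maps forms of degree \<open>n - e\<close> modulo
  \<open>I\<close> isomorphically onto the degree \<open>n\<close> part of \<open>(I, f)\<close>
  modulo \<open>I\<close>. Below degree \<open>e\<close> the latter is zero, which the explicit case
  records.\<close>

lemma hf_nzd:
  assumes I: "homog_ideal I" and f: "homog e f" and z: "!!g. f * g : I ==> g : I"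
  shows "hilbert_function I n = hilbert_function (gen (insert f I)) n + (if e <= n then hilbert_function I (n - e) else 0)"
proof -
  let ?J = "gen (insert f I)"
  have id: "ideal I" using I by (rule homog_ideal_ideal)
  have IJ: "I \<subseteq> ?J" by (rule gen_insert_sup(1)[OF id])
  obtain a where a: "qd cs {f : ?J. homog n f} {f : I. homog n f} a" "hilbert_function I n = a + hilbert_function ?J n"
    using hf_split[OF id ideal_gen IJ] by blast
  have "a = (if e <= n then hilbert_function I (n - e) else 0)"
  proof (cases "e <= n")
    case True
    have hf: "homog n (f * x)" if "homog (n - e) x" for x using homog_mult[OF f that] True by simp
    have fI: "f * x : I \<longleftrightarrow> x : I" for x using z ideal_mult[OF id] by blast
    have fJ: "f * x : ?J" for x using ideal_mult'[OF ideal_gen gen_insert_sup(2)] .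
    have "qd cs {f : ?J. homog n f} {f : I. homog n f} (hilbert_function I (n - e))"
    proof (rule qd_iso[THEN iffD1, OF linear_mult[of f] mv_subspace_homog mv_subspace_ideal_homog[OF ideal_gen]
        mv_subspace_ideal_homog[OF id] _ _ _ _ _ hf_qd[OF id]])
      show "EX x:{f. homog (n - e) f}. x' - f * x : {f : I. homog n f}" if x': "x' : {f : ?J. homog n f}" for x'
      proof -
        obtain c b where "x' = c * f + b" "b : I" "homog n b" "n >= e ==> homog (n - e) c" using x' gen_insert_homogE[OF I f, of x' n] by blast
        then show ?thesis using True by (intro bexI[of _ c]) (auto simp: mult.commute)
      qed
    qed (use IJ in \<open>auto simp: hf fJ fI\<close>)
    then show ?thesis using mv.qd_unique[OF a(1) _ mv_subspace_ideal_homog[OF id]] True by simp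
  next
    case False
    have "{f : ?J. homog n f} \<subseteq> {f : I. homog n f}"
    proof clarify
      fix x assume x: "x : ?J" "homog n x"
      obtain c b where "x = c * f + b" "b : I" "n < e ==> c = 0"
        using gen_insert_homogE[OF I f x] by blast
      then show "x : I" using False by simp
    qed
    then have "{f : ?J. homog n f} = {f : I. homog n f}" using IJ by blast
    then show ?thesis using mv.qd_self[of "{f : ?J. homog n f}"] mv.qd_unique[OF a(1) _ mv_subspace_ideal_homog[OF id]] False by auto
  qed
  then show ?thesis using a(2) by simp
qed

lemma hf_relevant_pos: "relevant_prime P ==> 1 <= hilbert_function P n"
proof -
  assume P: "relevant_prime P"
  then obtain i where "var i ~: P" by (auto simp: relevant_prime_def)
  then have "var i ^ n ~: P" by (simp add: rp_power[OF P])
  then show ?thesis using hf_eq_0[OF rp_ideal[OF P], of n] homog_var_power by auto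
qed

text \<open>Each step of a chain of primes raises the order of growth of the Hilbert function by one.\<close>

lemma hf_prime_step:
  assumes P: "relevant_prime P" "relevant_prime P'" "P \<subset> P'" and A: "A > 0" "!!n. (n div A) choose m <= hilbert_function P' n"
  shows "EX B>0. ALL n. (n div B) choose (Suc m) <= hilbert_function P n"
proof -
  obtain g where g: "g : P'" "g ~: P" using P(3) by blast
  then obtain a where a: "hc a g ~: P" using homog_ideal_memI[OF rp_ideal[OF P(1)]] by blast
  define f where "f = hc a g"
  have f: "homog a f" "f : P'" "f ~: P" using a homog_idealD[OF rp_homog[OF P(2)] g(1)] by (auto simp: f_def)
  have "a ~= 0"
  proof
    assume "a = 0"
    then have c: "f = const (lk f 0)" using f(1) homog_0_const by blast
    have "lk f 0 ~= 0" using f(3) c rp_0[OF P(1)] by auto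
    then have "const (inverse (lk f 0)) * f = 1" by (subst c) (simp flip: const_mult)
    then show False using ideal_mult[OF rp_ideal[OF P(2)] f(2), of "const (inverse (lk f 0))"] rp_1[OF P(2)] by simp
  qed
  \<comment> \<open>The power raises the degree to \<open>B = A * a\<close>, at least
    \<open>A\<close>, so that \<open>n div B <= n div A\<close>; each step of length
    \<open>B\<close> in \<open>n\<close> then adds one term of Pascal's rule.\<close>
  define F where "F = f ^ A" define B where "B = A * a"
  have B: "B > 0" using A(1) \<open>a ~= 0\<close> by (simp add: B_def)
  have F: "homog B F" "F : P'" "F ~: P"
    using homog_power[OF f(1), of A] f A(1) by (auto simp: F_def B_def rp_power[OF P(1)] rp_power[OF P(2)])
  have nz: "F * x : P ==> x : P" for x using F(3) by (simp add: rp_mult[OF P(1)])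
  have step: "hilbert_function P' n + (if B <= n then hilbert_function P (n - B) else 0) <= hilbert_function P n" for n using F P by (simp add: rm.span_minimal rp_ideal[OF P(2)] hf_mono ideal_gen hf_nzd[OF rp_homog[OF P(1)] F(1) nz, of n])
  have "(n div B) choose (Suc m) <= hilbert_function P n" for n
  proof (induction n rule: less_induct)
    case (less n)
    show ?case
    proof (cases "B <= n")
      case True
      define N where "N = (n - B) div B"
      have N: "n div B = Suc N" using True B by (simp add: N_def le_div_geq)
      have "N <= n div A"
      proof -
        have "n div B <= n div A" using A(1) B \<open>a ~= 0\<close> by (intro div_le_mono2) (auto simp: B_def)
        then show ?thesis using N by simp
      qed
      then have "N choose m <= (n div A) choose m" by (rule binomial_right_mono)
      also have "... <= hilbert_function P' n" by (rule A(2))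
      finally have 1: "N choose m <= hilbert_function P' n" .
      have 2: "N choose (Suc m) <= hilbert_function P (n - B)" using less[of "n - B"] True B by (simp add: N_def)
      show ?thesis using step[of n] 1 2 True by (simp add: N)
    next
      case False
      then show ?thesis by simp
    qed
  qed
  then show ?thesis using B by blast
qed

lemma hf_chain:
  assumes "ideal I" "has_chain I m"
  shows "EX A>0. ALL n. (n div A) choose m <= hilbert_function I n"
proof -
  have main: "EX A>0. ALL n. (n div A) choose m <= hilbert_function (Q 0) n"
    if "ALL i<=m. relevant_prime (Q i)" "ALL i<m. Q i \<subset> Q (Suc i)" for Q :: "nat => mpoly set" and m
    using that
  proof (induction m arbitrary: Q)
    case 0
    then show ?case using hf_relevant_pos by (intro exI[of _ 1]) auto
  next
    case (Suc m)
    obtain A where A: "A > 0" "!!n. (n div A) choose m <= hilbert_function (Q (Suc 0)) n" using Suc.IH[of "%i. Q (Suc i)"] Suc.prems by auto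
    show ?case by (rule hf_prime_step[OF _ _ _ A]) (use Suc.prems in auto)
  qed
  obtain P where P: "ALL i<=m. P i : points I" "ALL i<m. P i \<subset> P (Suc i)" using assms(2) unfolding has_chain_def by blast
  then obtain A where A: "A > 0" "ALL n. (n div A) choose m <= hilbert_function (P 0) n"
    using main[of m P] by (auto simp: points_def)
  have "hilbert_function (P 0) n <= hilbert_function I n" for n
    using P(1) by (intro hf_mono[OF assms(1) rp_ideal]) (auto simp: points_def)
  then show ?thesis using A by (meson order_trans)
qed

section \<open>Hilbert polynomials\<close>

definition has_hp :: "mpoly set => real poly => bool" where
  "has_hp I p \<longleftrightarrow> (EX n0. ALL n>=n0. poly p (real n) = real (hilbert_function I n))"

lemma poly_eq_infinite:
  fixes p q :: "real poly"
  assumes "!!n. n >= n0 ==> poly p (real n) = poly q (real n)" shows "p = q"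
proof (rule ccontr)
  assume "p ~= q"
  then have "finite {x. poly (p - q) x = 0}" by (intro poly_roots_finite) simp
  moreover have "real ` {n0..} \<subseteq> {x. poly (p - q) x = 0}" using assms by auto
  ultimately have "finite (real ` {n0..})" using finite_subset by blast
  then show False by (simp add: finite_image_iff inj_on_def infinite_Ici)
qed

lemma has_hp_unique: "has_hp I p ==> has_hp I q ==> p = q"
proof -
  assume "has_hp I p" "has_hp I q"
  then obtain a b where "ALL n>=a. poly p (real n) = real (hilbert_function I n)" "ALL n>=b. poly q (real n) = real (hilbert_function I n)"
    unfolding has_hp_def by blast
  then show ?thesis by (intro poly_eq_infinite[of "max a b"]) auto
qed

lemma hilbert_poly_eq: "has_hp I p ==> hilbert_poly I = p"
  unfolding hilbert_poly_def has_hp_def[symmetric] using has_hp_unique by blast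

lemma proj_degree_eq: "has_hp I p ==> proj_degree I = fact (degree p) * lead_coeff p"
  by (simp add: proj_degree_def hilbert_poly_eq)

text \<open>At the degrees \<open>A * k\<close> the Hilbert function is at least
  \<open>k choose m\<close>, which outgrows every polynomial of degree below \<open>m\<close>.
  Dimensions are bounded from above this way.\<close>

lemma hf_chain_degree:
  assumes I: "ideal I" and ch: "has_chain I m" and hp: "has_hp I p"
  shows "m <= degree p"
proof (rule ccontr)
  assume "~ m <= degree p"
  then have d: "degree p <= m - 1" and m: "m >= 1" by auto
  obtain A where A: "A > 0" "!!n. (n div A) choose m <= hilbert_function I n" using hf_chain[OF I ch] by blast
  obtain n0 where n0: "!!n. n >= n0 ==> poly p (real n) = real (hilbert_function I n)" using hp unfolding has_hp_def by blast
  define K where "K = (SUM i<=degree p. \<bar>coeff p i\<bar>)"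
  have pb: "poly p x <= K * x ^ (m - 1)" if "x >= 1" for x
  proof -
    have "poly p x = (SUM i<=degree p. coeff p i * x ^ i)" by (rule poly_altdef)
    also have "... <= (SUM i<=degree p. \<bar>coeff p i\<bar> * x ^ (m - 1))"
    proof (rule sum_mono)
      fix i assume "i : {..degree p}"
      then show "coeff p i * x ^ i <= \<bar>coeff p i\<bar> * x ^ (m - 1)" using d that by (simp add: power_increasing mult_mono)
    qed
    finally show ?thesis by (simp add: K_def sum_distrib_right)
  qed
  have bound: "real k <= K * real A ^ (m - 1) * real m ^ m" if k: "k >= max (max n0 m) 1" for k
  proof -
    have kA: "A * k >= n0" "A * k >= 1" using k A(1) by (auto intro: order_trans[of _ k])
    have "(real k / real m) ^ m <= real (k choose m)" using k by (intro binomial_ge_n_over_k_pow_k) auto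
    also have "... <= real (hilbert_function I (A * k))" using A(2)[of "A * k"] A(1) by simp
    also have "... = poly p (real (A * k))" using n0[OF kA(1)] by simp
    also have "... <= K * real (A * k) ^ (m - 1)" using kA(2) by (intro pb) (metis of_nat_1 of_nat_le_iff)
    finally have "real k ^ m / real m ^ m <= K * (real A ^ (m - 1) * real k ^ (m - 1))"
      by (simp add: power_divide power_mult_distrib)
    then have "real k ^ m <= K * real A ^ (m - 1) * real m ^ m * real k ^ (m - 1)"
      using m by (simp add: divide_le_eq mult_ac)
    moreover have "real k ^ m = real k * real k ^ (m - 1)" using m by (metis Suc_diff_le diff_Suc_1 power_Suc One_nat_def Suc_pred less_eq_Suc_le)
    moreover have "real k ^ (m - 1) > 0" using k by simp
    ultimately show ?thesis by (metis mult_le_cancel_right_pos)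
  qed
  obtain N where N: "K * real A ^ (m - 1) * real m ^ m < real N" using reals_Archimedean2 by blast
  have "real (max (max (max n0 m) 1) N) <= K * real A ^ (m - 1) * real m ^ m" by (rule bound) simp
  moreover have "real N <= real (max (max (max n0 m) 1) N)" by simp
  ultimately show False using N by linarith
qed

text \<open>Backward difference with step \<open>e\<close>: the effect on a Hilbert polynomial of
  cutting with a nonzerodivisor of degree \<open>e\<close>.\<close>

definition dpoly :: "nat => real poly => real poly" where
  "dpoly e p = p - pcompose p [:- real e, 1:]"

lemma poly_dpoly: "poly (dpoly e p) x = poly p x - poly p (x - real e)"
  by (simp add: dpoly_def poly_pcompose)

lemma pcompose_pow: "pcompose (p ^ n) q = pcompose p q ^ n" for p :: "real poly"
  by (induction n) (simp_all add: pcompose_mult pcompose_1)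

lemma dpoly_monom:
  "degree (dpoly e (monom a (Suc m))) <= m & coeff (dpoly e (monom a (Suc m))) m = a * real e * real (Suc m)"
proof -
  let ?x = "[:0, 1:] :: real poly" let ?y = "[:- real e, 1:]"
  have x: "monom 1 k = ?x ^ k" for k by (simp add: monom_altdef)
  have "dpoly e (monom a (Suc m)) = smult a (?x ^ Suc m - ?y ^ Suc m)"
    by (simp add: dpoly_def monom_altdef pcompose_smult pcompose_mult pcompose_pow pcompose_pCons smult_diff_right del: power_Suc)
  \<comment> \<open>Each of the \<open>m + 1\<close> products in the sum is monic of degree
    \<open>m\<close>, which is the source of the factor \<open>Suc m\<close>.\<close>
  also have "?x ^ Suc m - ?y ^ Suc m = (?x - ?y) * (SUM i<Suc m. ?x ^ i * ?y ^ (m - i))"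
    by (subst power_diff_sumr2) (simp add: mult.commute)
  also have "?x - ?y = [:real e:]" by simp
  finally have e: "dpoly e (monom a (Suc m)) = smult (a * real e) (SUM i<Suc m. ?x ^ i * ?y ^ (m - i))" by simp
  have t: "degree (?x ^ i * ?y ^ (m - i)) <= m & coeff (?x ^ i * ?y ^ (m - i)) m = 1" if "i < Suc m" for i
  proof -
    have dg: "degree (?x ^ i * ?y ^ (m - i)) = m" using that
      by (simp add: degree_mult_eq degree_power_eq)
    have "lead_coeff (?x ^ i * ?y ^ (m - i)) = 1" by (simp add: lead_coeff_mult lead_coeff_power)
    then show ?thesis using dg by simp
  qed
  have "degree (SUM i<Suc m. ?x ^ i * ?y ^ (m - i)) <= m" using t by (intro degree_sum_le) auto
  moreover have "coeff (SUM i<Suc m. ?x ^ i * ?y ^ (m - i)) m = (SUM i<Suc m. 1)"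
    unfolding coeff_sum by (rule sum.cong) (use t in auto)
  ultimately show ?thesis unfolding e using degree_smult_le[of "a * real e"] by (auto intro: order_trans)
qed

lemma dpoly_add: "dpoly e (p + q) = dpoly e p + dpoly e q"
  by (simp add: dpoly_def pcompose_add)

lemma dpoly_const: "dpoly e [:a:] = 0"
  by (simp add: dpoly_def)

lemma dpoly_sum: "dpoly e (SUM i:A. f i) = (SUM i:A. dpoly e (f i))"
  by (induction A rule: infinite_finite_induct) (auto simp: dpoly_add dpoly_const[of _ 0, simplified])

lemma dpoly_degree:
  assumes "degree p = Suc m" "e > 0"
  shows "degree (dpoly e p) = m & lead_coeff (dpoly e p) = lead_coeff p * real e * real (Suc m)"
proof -
  have "dpoly e p = (SUM i<=Suc m. dpoly e (monom (coeff p i) i))"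
    using poly_as_sum_of_monoms[of p] assms(1) by (simp flip: dpoly_sum)
  also have "... = (SUM i<=m. dpoly e (monom (coeff p i) i)) + dpoly e (monom (coeff p (Suc m)) (Suc m))" by simp
  finally have e: "dpoly e p = (SUM i<=m. dpoly e (monom (coeff p i) i)) + dpoly e (monom (coeff p (Suc m)) (Suc m))" .
  have small: "degree (dpoly e (monom a i)) <= m & coeff (dpoly e (monom a i)) m = 0" if i: "i <= m" for a i
  proof (cases i)
    case 0 then show ?thesis by (simp add: dpoly_const monom_0)
  next
    case (Suc j)
    then have "degree (dpoly e (monom a i)) <= j" "j < m" using dpoly_monom[of e a j] i by auto
    then show ?thesis by (simp add: coeff_eq_0)
  qed
  have c: "coeff (dpoly e p) m = coeff p (Suc m) * real e * real (Suc m)"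
    unfolding e coeff_add coeff_sum using small dpoly_monom[of e "coeff p (Suc m)" m] by simp
  have "coeff p (Suc m) ~= 0" using assms(1) by (metis leading_coeff_0_iff degree_0 Zero_not_Suc)
  then have nz: "coeff (dpoly e p) m ~= 0" using c assms(2) by simp
  have "degree (dpoly e p) <= m" unfolding e
    by (intro degree_add_le degree_sum_le) (use small dpoly_monom in auto)
  then show ?thesis using c assms(1) le_degree[OF nz] by auto
qed

lemma has_hp_nzd:
  assumes I: "homog_ideal I" and f: "homog e f" and z: "!!g. f * g : I ==> g : I" and hp: "has_hp I p"
  shows "has_hp (gen (insert f I)) (dpoly e p)"
proof -
  obtain n0 where n0: "!!n. n >= n0 ==> poly p (real n) = real (hilbert_function I n)" using hp unfolding has_hp_def by blast
  show ?thesis unfolding has_hp_def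
  proof (intro exI[of _ "n0 + e"] allI impI)
    fix n assume n: "n >= n0 + e"
    then show "poly (dpoly e p) (real n) = real (hilbert_function (gen (insert f I)) n)" using n hf_nzd[OF I f z, of n] n0[of n] n0[of "n - e"] poly_dpoly by auto
  qed
qed

text \<open>The ideal of a coordinate subspace, generated by the variables in \<open>A\<close>. In
  terms of monomials it is visibly the kernel of \<open>kill A\<close>, hence prime.\<close>

definition Vid :: "5 set => mpoly set" where
  "Vid A = {f. ALL m:supp f. EX i:A. lk m i ~= 0}"

definition kill :: "5 set => mpoly => mpoly" where
  "kill A = ev const (%i. if i : A then 0 else var i)"

lemma kill_rhom: "rhom (kill A)" unfolding kill_def by (rule ev_rhom[OF rhom_const])

lemma kill_part: "kill A f = part (%m. ALL i:A. lk m i = 0) f"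
proof -
  have "const (lk f m) * meval (%i. if i : A then 0 else var i) m = (if ALL i:A. lk m i = 0 then sng m (lk f m) else 0)" for m
  proof (cases "ALL i:A. lk m i = 0")
    case True
    then have "meval (%i. if i : A then 0 else var i) m = meval var m"
      unfolding meval_def by (intro prod.cong) auto
    then show ?thesis using True by (simp add: sng_const_meval)
  next
    case False
    then obtain i where "i : A" "lk m i ~= 0" by blast
    then show ?thesis by (auto simp: meval_def prod_zero bexI[of _ i] False)
  qed
  then have "kill A f = (SUM m:supp f. if ALL i:A. lk m i = 0 then sng m (lk f m) else 0)"
    by (simp add: kill_def ev_def)
  also have "... = part (%m. ALL i:A. lk m i = 0) f" unfolding part_def
    by (rule sum.mono_neutral_cong_right) auto
  finally show ?thesis .
qed

lemma Vid_kill: "f : Vid A \<longleftrightarrow> kill A f = 0"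
proof -
  have "kill A f = 0 \<longleftrightarrow> supp (kill A f) = {}" by simp
  then show ?thesis unfolding kill_part supp_part Vid_def by auto
qed

lemma kill_var: "kill A (var i) = (if i : A then 0 else var i)"
  unfolding kill_def by (rule ev_var[OF rhom_const])

lemma var_Vid: "var i : Vid A \<longleftrightarrow> i : A"
  by (simp add: Vid_kill kill_var)

lemma ideal_Vid: "ideal (Vid A)"
  by (rule rm.subspaceI) (auto simp: Vid_kill rhom_0[OF kill_rhom] rhom_add[OF kill_rhom] rhom_mult[OF kill_rhom])

lemma homog_ideal_Vid: "homog_ideal (Vid A)"
  unfolding homog_ideal_hc using ideal_Vid by (auto simp: Vid_def hc_def supp_part)

lemma prime_Vid: "prime_set (Vid A)"
  by (simp add: prime_set_def Vid_kill rhom_mult[OF kill_rhom])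

lemma relevant_Vid: "A ~= UNIV ==> relevant_prime (Vid A)"
  using var_Vid by (auto simp: relevant_prime_alt homog_ideal_Vid prime_Vid)

lemma Vid_mono: "A \<subset> B ==> Vid A \<subset> Vid B"
proof -
  assume "A \<subset> B"
  then have "Vid A \<subseteq> Vid B" unfolding Vid_def by blast
  moreover obtain i where "i : B" "i ~: A" using \<open>A \<subset> B\<close> by blast
  ultimately show ?thesis using var_Vid by blast
qed

lemma Vid_empty: "Vid {} = {0}" unfolding Vid_def by auto

lemma Vid_insert: "i ~: A ==> Vid (insert i A) = gen (insert (var i) (Vid A))"
proof
  assume i: "i ~: A"
  show "Vid (insert i A) \<subseteq> gen (insert (var i) (Vid A))"
  proof
    fix f assume f: "f : Vid (insert i A)"
    have "sng m (lk f m) : gen (insert (var i) (Vid A))" if m: "m : supp f" for m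
    proof (cases "lk m i = 0")
      case True
      then have "sng m (lk f m) : Vid A" using f m by (auto simp: Vid_def)
      then show ?thesis using gen_insert_sup(1)[OF ideal_Vid] by blast
    next
      case False
      then obtain g where "sng m (lk f m) = g * var i ^ 1" using single_var_split[of 1 m i] by auto
      then show ?thesis using ideal_mult[OF ideal_gen gen_insert_sup(2)] by simp
    qed
    then have "(SUM m:supp f. sng m (lk f m)) : gen (insert (var i) (Vid A))" by (intro ideal_sum ideal_gen)
    then show "f : gen (insert (var i) (Vid A))" by (simp flip: pm_decomp)
  qed
  have "Vid A \<subseteq> Vid (insert i A)" unfolding Vid_def by blast
  then show "gen (insert (var i) (Vid A)) \<subseteq> Vid (insert i A)"
    by (intro rm.span_minimal ideal_Vid) (auto simp: var_Vid)
qed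

lemma hf_Vid_insert:
  assumes i: "i ~: A"
  shows "hilbert_function (Vid A) 0 = hilbert_function (Vid (insert i A)) 0"
    "hilbert_function (Vid A) (Suc n) = hilbert_function (Vid (insert i A)) (Suc n) + hilbert_function (Vid A) n"
proof -
  have z: "var i * f : Vid A ==> f : Vid A" for f using prime_Vid[of A] i var_Vid[of i A] by (auto simp: prime_set_def)
  have "hilbert_function (Vid A) m = hilbert_function (Vid (insert i A)) m + (if 1 <= m then hilbert_function (Vid A) (m - 1) else 0)" for m
    unfolding Vid_insert[OF i] by (rule hf_nzd[OF homog_ideal_Vid _ z]) simp
  from this[of 0] this[of "Suc n"] show "hilbert_function (Vid A) 0 = hilbert_function (Vid (insert i A)) 0"
    "hilbert_function (Vid A) (Suc n) = hilbert_function (Vid (insert i A)) (Suc n) + hilbert_function (Vid A) n" by simp_all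
qed

lemma hf_Vid_UNIV: "hilbert_function (Vid UNIV) n = (if n = 0 then 1 else 0)"
proof (cases "n = 0")
  case True
  have "f = 0" if "f : Vid UNIV" "homog 0 f" for f
  proof -
    have "0 ~: supp f" using that(1) unfolding Vid_def by force
    then have "lk f 0 = 0" by (simp add: in_keys_iff)
    then show ?thesis using homog_0_const[OF that(2)] by (simp add: const_0)
  qed
  then have V: "{f : Vid UNIV. homog 0 f} = {0}" using ideal_0[OF ideal_Vid] by auto
  have "qd cs {f. homog 0 f} {0} 1" unfolding qd_def
  proof (intro exI[of _ "{1}"] conjI)
    show "qindep cs {1} {0}" by (simp add: qindep_def const_eq_0)
    show "{f. homog 0 f} \<subseteq> mv.span ({1} Un {0})"
    proof clarify
      fix f assume "homog 0 f"
      then have "f = const (lk f 0) * 1" using homog_0_const by simp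
      then show "f : mv.span ({1} Un {0})" using mv.span_scale[OF mv.span_base[of 1 "{1} Un {0}"], of "lk f 0"] by simp
    qed
  qed simp_all
  then show ?thesis using True hf_unique[OF ideal_Vid, of 0 UNIV 1] by (simp add: V)
next
  case False
  then have "f : Vid UNIV" if "homog n f" for f
    using that sum.neutral[of UNIV "lk _"] unfolding Vid_def homog_mdeg mdeg_def by fastforce
  then show ?thesis using False by (simp add: hf_eq_0 ideal_Vid)
qed

lemma hf_Vid: "card A + k = 4 ==> hilbert_function (Vid A) n = (n + k) choose k"
proof (induction k arbitrary: A n)
  case 0
  then have "A ~= UNIV" by auto
  then obtain i where i: "i ~: A" by blast
  have "insert i A = UNIV" using 0 i by (intro card_seteq) auto
  then show ?case by (induction n) (simp_all add: hf_Vid_insert[OF i] hf_Vid_UNIV)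
next
  case (Suc k)
  then have "A ~= UNIV" by auto
  then obtain i where i: "i ~: A" by blast
  have "hilbert_function (Vid (insert i A)) m = (m + k) choose k" for m using Suc i by simp
  then show ?case by (induction n) (simp_all add: hf_Vid_insert[OF i])
qed

text \<open>The binomial coefficient \<open>n + 4\<close> over 4 as a polynomial in
  \<open>n\<close>, the Hilbert polynomial of the ambient space.\<close>

definition hp4 :: "real poly" where
  "hp4 = smult (1/24) ([:1, 1:] * ([:2, 1:] * ([:3, 1:] * [:4, 1:])))"

lemma has_hp_zero: "has_hp {0} hp4"
proof -
  have "poly hp4 (real n) = real ((n + 4) choose 4)" for n
  proof -
    have "real ((n + 4) choose 4) = fact (n + 4) / (fact 4 * fact n)" by (subst binomial_fact) auto
    also have "fact (n + 4) = ((real n + 4) * ((real n + 3) * ((real n + 2) * (real n + 1)))) * fact n"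
      by (simp add: numeral_eq_Suc algebra_simps)
    also have "... / (fact 4 * fact n) = ((real n + 4) * ((real n + 3) * ((real n + 2) * (real n + 1)))) / 24"
      by (simp add: fact_numeral)
    finally show ?thesis by (simp add: hp4_def fact_numeral field_simps)
  qed
  then show ?thesis unfolding has_hp_def using hf_Vid[of "{}" 4] by (simp add: Vid_empty)
qed

lemma hp4_degree: "degree hp4 = 4" "lead_coeff hp4 = 1 / 24"
  by (simp_all add: hp4_def degree_mult_eq lead_coeff_mult)

section \<open>Twisted and augmented Cech complexes\<close>

abbreviation emb :: "'a::idom => 'a fract" where "emb f \<equiv> Fract f 1"

definition um :: "5 set => mpoly" where "um J = (PROD j:J. var j)"

lemma um_nz [simp]: "um J ~= 0" by (simp add: um_def)
lemma um_empty [simp]: "um {} = 1" by (simp add: um_def)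
lemma homog_um: "homog (card J) (um J)"
  using homog_prod[of J "%_. Suc 0" var] by (simp add: um_def)
lemma um_insert: "i ~: J ==> um (insert i J) = var i * um J" by (simp add: um_def)
lemma um_subset: "J \<subseteq> J' ==> um J' = um (J' - J) * um J"
  unfolding um_def by (subst prod.subset_diff[of J J']) auto

lemma emb_0 [simp]: "emb 0 = 0" by (simp add: Zero_fract_def)
lemma emb_1 [simp]: "emb 1 = 1" by (simp add: One_fract_def)
lemma emb_mult: "emb (a * b) = emb a * emb b" by simp
lemma emb_add: "emb (a + b) = emb a + emb b" by simp
lemma emb_eq: "emb a = emb b \<longleftrightarrow> a = b" by (simp add: eq_fract)
lemma emb_eq_0: "emb a = 0 \<longleftrightarrow> a = 0" using emb_eq[of a 0] by simp
lemma rhom_emb: "rhom emb" by (simp add: rhom_def)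

text \<open>Sections over the intersection of the \<open>D\<^sub>+(x\<^sub>j)\<close>, \<open>j \<in> J\<close>, of the \<open>n\<close>-th twist of the ideal
  sheaf of \<open>I\<close>; for empty \<open>J\<close> these are the forms of degree \<open>n\<close> in \<open>I\<close>.\<close>

definition sec :: "mpoly set => nat => 5 set => mpoly fract set" where
  "sec I n J = {Fract f (um J ^ k) | f k. f : I & homog (k * card J + n) f}"

lemma secI: "f : I ==> homog (k * card J + n) f ==> Fract f (um J ^ k) : sec I n J"
  unfolding sec_def by blast

text \<open>For nonempty \<open>J\<close> the degree \<open>e\<close> in \<open>sections\<close> is
  forced to be \<open>card J\<close>. For empty \<open>J\<close> no positive degree exists; there
  \<open>sec\<close> is the augmentation instead.\<close>

lemma sections_sec:
  assumes "J ~= {}" shows "sections I (um J) = sec I 0 J"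
proof -
  have "0 < e & homog e (um J) \<longleftrightarrow> e = card J" for e using assms by (auto simp: card_gt_0_iff homog_unique[of e "um J" "card J"] homog_um[of J])
  note c' = this
  show ?thesis
  proof (intro set_eqI iffI)
    fix a assume "a : sections I (um J)"
    then obtain f k e where "a = Fract f (um J ^ k)" "0 < e" "homog e (um J)" "f : I" "homog (k * e) f"
      unfolding sections_def by blast
    then show "a : sec I 0 J" using c'[of e] secI[of f I k J 0] by simp
  next
    fix a assume "a : sec I 0 J"
    then obtain f k where "a = Fract f (um J ^ k)" "f : I" "homog (k * card J + 0) f" unfolding sec_def by blast
    then show "a : sections I (um J)" unfolding sections_def using c'[of "card J"] by auto
  qed
qed

lemma sec_raise:
  assumes I: "ideal I" and a: "a : sec I n J"
  obtains k0 where "!!k. k >= k0 ==> EX f:I. homog (k * card J + n) f & a = Fract f (um J ^ k)"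
proof -
  obtain f k0 where f: "a = Fract f (um J ^ k0)" "f : I" "homog (k0 * card J + n) f" using a unfolding sec_def by blast
  have "EX f:I. homog (k * card J + n) f & a = Fract f (um J ^ k)" if k: "k >= k0" for k
  proof (rule bexI[of _ "um J ^ (k - k0) * f"], rule conjI)
    have "homog ((k - k0) * card J + (k0 * card J + n)) (um J ^ (k - k0) * f)"
      by (intro homog_mult homog_power homog_um f)
    moreover have "(k - k0) * card J + (k0 * card J + n) = k * card J + n"
      using k by (simp add: diff_mult_distrib flip: add.assoc)
    ultimately show "homog (k * card J + n) (um J ^ (k - k0) * f)" by simp
    show "a = Fract (um J ^ (k - k0) * f) (um J ^ k)" using k f(1) by (simp add: power_add[symmetric] eq_fract)
    show "um J ^ (k - k0) * f : I" by (rule ideal_mult[OF I f(2)])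
  qed
  then show thesis by (rule that)
qed

lemma sec_0: "ideal I ==> 0 : sec I n J"
  using secI[of 0 I 0 J n] by (simp add: ideal_0)

lemma sec_add:
  assumes I: "ideal I" and a: "a : sec I n J" and b: "b : sec I n J" shows "a + b : sec I n J"
proof -
  obtain k where k: "!!i. i >= k ==> EX f:I. homog (i * card J + n) f & a = Fract f (um J ^ i)"
    using sec_raise[OF I a] by metis
  obtain l where l: "!!i. i >= l ==> EX f:I. homog (i * card J + n) f & b = Fract f (um J ^ i)"
    using sec_raise[OF I b] by metis
  obtain f where f: "f : I" "homog (max k l * card J + n) f" "a = Fract f (um J ^ max k l)" using k[of "max k l"] by auto
  obtain g where g: "g : I" "homog (max k l * card J + n) g" "b = Fract g (um J ^ max k l)" using l[of "max k l"] by auto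
  have "a + b = Fract (f + g) (um J ^ max k l)" by (simp add: f g eq_fract algebra_simps)
  then show ?thesis using secI[OF ideal_add[OF I f(1) g(1)] homog_add[OF f(2) g(2)]] by simp
qed

lemma sec_mult:
  assumes I: "ideal I" and a: "a : sec I n J" and p: "homog m p" shows "emb p * a : sec I (n + m) J"
proof -
  obtain f k where f: "a = Fract f (um J ^ k)" "f : I" "homog (k * card J + n) f" using a unfolding sec_def by blast
  have "emb p * a = Fract (p * f) (um J ^ k)" by (simp add: f)
  moreover have "homog (k * card J + (n + m)) (p * f)" using homog_mult[OF p f(3)] by (simp add: add_ac)
  ultimately show ?thesis using secI[OF ideal_mult[OF I f(2)]] by metis
qed

lemma sec_scale: "ideal I ==> a : sec I n J ==> emb (const c) * a : sec I n J"
  using sec_mult[of I a n J 0 "const c"] by simp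

lemma sec_uminus: "ideal I ==> a : sec I n J ==> - a : sec I n J"
  using sec_scale[of I a n J "-1"] by (simp add: const_uminus flip: minus_fract)

lemma sec_sum: "ideal I ==> (!!i. i : A ==> f i : sec I n J) ==> sum f A : sec I n J"
  by (induction A rule: infinite_finite_induct) (auto simp: sec_0 sec_add)

lemma sec_sign: "ideal I ==> a : sec I n J ==> (-1) ^ k * a : sec I n J"
  by (induction k) (auto simp: sec_uminus)

lemma sec_mono: "I \<subseteq> I' ==> sec I n J \<subseteq> sec I' n J"
  unfolding sec_def by blast

lemma sec_restrict:
  assumes I: "ideal I" and JJ: "J \<subseteq> J'" and a: "a : sec I n J" shows "a : sec I n J'"
proof -
  obtain f k where f: "a = Fract f (um J ^ k)" "f : I" "homog (k * card J + n) f" using a unfolding sec_def by blast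
  have c: "card J' = card (J' - J) + card J" using JJ by (metis card_Diff_subset card_mono finite le_add_diff_inverse2)
  have "a = Fract (um (J' - J) ^ k * f) (um J' ^ k)"
    by (subst um_subset[OF JJ]) (simp add: f power_mult_distrib eq_fract)
  moreover have "homog (k * card J' + n) (um (J' - J) ^ k * f)"
    using homog_mult[OF homog_power[OF homog_um[of "J' - J"], of k] f(3)] by (simp add: c algebra_simps)
  ultimately show ?thesis using secI[OF ideal_mult[OF I f(2)]] by metis
qed

text \<open>A high power of \<open>var i\<close> cancels \<open>var i\<close> in the denominator, at
  the price of a twist by the same power.\<close>

lemma sec_shrink:
  assumes I: "ideal I" and i: "i ~: J" and a: "a : sec I n (insert i J)"
  shows "EX N0. ALL N>=N0. emb (var i ^ N) * a : sec I (n + N) J"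
proof -
  obtain f k where f: "a = Fract f (um (insert i J) ^ k)" "f : I" "homog (k * card (insert i J) + n) f"
    using a unfolding sec_def by blast
  have "emb (var i ^ N) * a : sec I (n + N) J" if N: "N >= k" for N
  proof -
    have "emb (var i ^ N) * a = Fract (var i ^ (N - k) * f) (um J ^ k)" using N f by (simp add: power_add[symmetric] um_insert[OF i] power_mult_distrib eq_fract mult_ac)
    moreover have "homog (k * card J + (n + N)) (var i ^ (N - k) * f)"
      using homog_mult[OF homog_var_power[of "N - k" i] f(3)] N i by (simp add: algebra_simps)
    ultimately show ?thesis using secI[OF ideal_mult[OF I f(2)]] by metis
  qed
  then show ?thesis by blast
qed

lemma sec_nzd:
  assumes I: "ideal I" and y: "homog 1 y" "nzd y I" and a: "a : sec UNIV n J" "emb y * a : sec I (n + 1) J"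
  shows "a : sec I n J"
proof -
  obtain f k where f: "a = Fract f (um J ^ k)" "homog (k * card J + n) f" using a(1) unfolding sec_def by blast
  obtain g l where g: "emb y * a = Fract g (um J ^ l)" "g : I" using a(2) unfolding sec_def by blast
  have "y * (um J ^ l * f) : I" using g(1) f(1) by (simp add: eq_fract ideal_mult'[OF I g(2), of "um J ^ k"] mult_ac)
  then have m: "um J ^ l * f : I" using y(2) nzdD by blast
  have "homog ((l + k) * card J + n) (um J ^ l * f)"
    using homog_mult[OF homog_power[OF homog_um[of J], of l] f(2)] by (simp add: algebra_simps)
  moreover have "a = Fract (um J ^ l * f) (um J ^ (l + k))" by (simp add: f(1) power_add eq_fract)
  ultimately show ?thesis using secI[OF m] by metis
qed

lemma sec_power_ideal:
  assumes "J ~= {}" "f : I'" "homog (k * card J + n) f" "ideal I" "um J ^ N * f : I"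
  shows "Fract f (um J ^ k) : sec I n J"
proof -
  have "homog ((N + k) * card J + n) (um J ^ N * f)"
    using homog_mult[OF homog_power[OF homog_um[of J], of N] assms(3)] by (simp add: algebra_simps)
  moreover have "Fract f (um J ^ k) = Fract (um J ^ N * f) (um J ^ (N + k))" by (simp add: power_add eq_fract)
  ultimately show ?thesis using secI[OF assms(5)] by metis
qed

lemma um_power_mem:
  assumes "ideal I" "j : J" "var j ^ N * f : I" shows "um J ^ N * f : I"
proof -
  have "um J ^ N * f = um (J - {j}) ^ N * (var j ^ N * f)" using assms(2) um_subset[of "{j}" J] um_def power_mult_distrib mult_ac by auto
  then show ?thesis using ideal_mult[OF assms(1,3), of "um (J - {j}) ^ N"] by (simp only:)
qed

lemma sec_saturation:
  assumes I: "ideal I" and J: "J ~= {}" shows "sec (saturation I) n J = sec I n J"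
proof
  show "sec (saturation I) n J \<subseteq> sec I n J"
  proof
    fix a assume "a : sec (saturation I) n J"
    then obtain f k where f: "a = Fract f (um J ^ k)" "f : saturation I" "homog (k * card J + n) f" unfolding sec_def by blast
    obtain j where j: "j : J" using J by blast
    obtain N where "var j ^ N * f : I" using f(2) unfolding saturation_def by blast
    then show "a : sec I n J" unfolding f(1) using sec_power_ideal[OF J f(2,3) I] um_power_mem[OF I j] by blast
  qed
  show "sec I n J \<subseteq> sec (saturation I) n J" by (rule sec_mono[OF saturation_sup])
qed

lemma sec_irrelevant:
  assumes I: "ideal I" and J: "J ~= {}" and N: "!!i. var i ^ N : I" shows "sec I n J = sec UNIV n J"
proof
  show "sec UNIV n J \<subseteq> sec I n J"
  proof
    fix a assume "a : sec UNIV n J"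
    then obtain f k where f: "a = Fract f (um J ^ k)" "homog (k * card J + n) f" unfolding sec_def by blast
    obtain j where j: "j : J" using J by blast
    show "a : sec I n J" by (metis f(1) ideal_mult'[OF I N] sec_power_ideal[OF J UNIV_I f(2) I] um_power_mem[OF I j])
  qed
  show "sec I n J \<subseteq> sec UNIV n J" by (rule sec_mono) simp
qed

lemma sec_insert:
  assumes I: "homog_ideal I" and y: "homog 1 y" and a: "a : sec (gen (insert y I)) (Suc n) J"
  shows "EX b:sec UNIV n J. a - emb y * b : sec I (Suc n) J"
proof -
  obtain f k where f: "a = Fract f (um J ^ k)" "f : gen (insert y I)" "homog (k * card J + Suc n) f"
    using a unfolding sec_def by blast
  obtain c b where cb: "f = c * y + b" "b : I" "homog (k * card J + Suc n) b"
      "k * card J + Suc n >= 1 ==> homog (k * card J + Suc n - 1) c"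
    using gen_insert_homogE[OF I y f(2,3)] by metis
  have hc: "homog (k * card J + n) c" using cb(4) by simp
  have "a - emb y * Fract c (um J ^ k) = Fract b (um J ^ k)" by (simp add: f(1) cb(1) eq_fract algebra_simps)
  then show ?thesis using secI[OF UNIV_I hc] secI[OF cb(2,3)] by metis
qed

text \<open>Cochains on index sets with \<open>p\<close> elements, so the cohomological degree is
  \<open>p - 1\<close> and \<open>p = 0\<close> is the augmentation by forms of degree
  \<open>n\<close>. Twists are natural numbers: the argument descends from a large twist to 0 and
  goes no further.\<close>

definition CC :: "nat => nat => mpoly set => (5 set => mpoly fract) set" where
  "CC p n I = {c. ALL J. if card J = p then c J : sec I n J else c J = 0}"

abbreviation dd :: "(5 set => mpoly fract) => 5 set => mpoly fract" where "dd \<equiv> cech_diff"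

definition mlt :: "mpoly => (5 set => mpoly fract) => 5 set => mpoly fract" where
  "mlt f c = (%J. emb f * c J)"

abbreviation scl :: "complex => (5 set => mpoly fract) => 5 set => mpoly fract" where
  "scl \<equiv> %z c J. Fract (const z) 1 * c J"

lemma scl_mlt: "(%J. Fract (const z) 1 * a J) = mlt (const z) a" by (simp add: mlt_def)

interpretation cv: vector_space scl
proof (rule vector_space.intro)
  fix a b :: complex and x y :: "5 set => mpoly fract"
  show "scl a (x + y) = scl a x + scl a y" by (rule ext) (simp add: distrib_left)
  show "scl (a + b) x = scl a x + scl b x" by (rule ext) (simp only: const_add emb_add distrib_right plus_fun_apply)
  show "scl a (scl b x) = scl (a * b) x" by (rule ext) (simp only: const_mult emb_mult mult.assoc)
  show "scl 1 x = x" by (rule ext) (simp only: const_1 emb_1 mult_1)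
qed

lemma cech_CC: "cech I k = CC (Suc k) 0 I"
proof -
  have "card J = Suc k ==> sections I (PROD j:J. var j) = sec I 0 J" for J
  proof -
    assume "card J = Suc k"
    then have "J ~= {}" by auto
    from sections_sec[OF this, of I] show ?thesis by (simp add: um_def)
  qed
  then show ?thesis unfolding cech_def CC_def by (intro Collect_cong all_cong if_cong) simp_all
qed

lemma CC_memD: "c : CC p n I ==> card J = p ==> c J : sec I n J"
  unfolding CC_def by (auto split: if_splits)
lemma CC_memD0: "c : CC p n I ==> card J ~= p ==> c J = 0"
  unfolding CC_def by (auto split: if_splits)
lemma CC_I: "(!!J. card J = p ==> c J : sec I n J) ==> (!!J. card J ~= p ==> c J = 0) ==> c : CC p n I"
  unfolding CC_def by auto

lemma CC_0: "ideal I ==> 0 : CC p n I" by (rule CC_I) (auto simp: sec_0)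
lemma CC_add: "ideal I ==> a : CC p n I ==> b : CC p n I ==> a + b : CC p n I"
  by (rule CC_I) (auto simp: CC_memD CC_memD0 sec_add)
lemma CC_mlt: "ideal I ==> homog m f ==> a : CC p n I ==> mlt f a : CC p (n + m) I"
  by (rule CC_I) (auto simp: CC_memD CC_memD0 sec_mult mlt_def)
lemma CC_mlt1: "ideal I ==> homog 1 f ==> a : CC p n I ==> mlt f a : CC p (Suc n) I"
  using CC_mlt[of I 1 f a p n] by simp
lemma CC_scl: "ideal I ==> a : CC p n I ==> scl z a : CC p n I"
  using CC_mlt[of I 0 "const z" a p n] by (simp add: scl_mlt)
lemma CC_subspace: "ideal I ==> cv.subspace (CC p n I)"
  by (rule cv.subspaceI) (auto simp: CC_0 CC_add CC_scl)
lemma CC_diff: "ideal I ==> a : CC p n I ==> b : CC p n I ==> a - b : CC p n I"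
  by (rule cv.subspace_diff[OF CC_subspace])
lemma CC_mono: "I \<subseteq> I' ==> CC p n I \<subseteq> CC p n I'"
proof
  fix c assume h: "I \<subseteq> I'" "c : CC p n I"
  show "c : CC p n I'"
    by (rule CC_I) (use CC_memD[OF h(2)] sec_mono[OF h(1)] CC_memD0[OF h(2)] in blast)+
qed
lemma CC_UNIV: "c : CC p n I ==> c : CC p n UNIV" using CC_mono[of I UNIV] by blast

lemma ideal_UNIV': "ideal UNIV" by simp

lemma dd_CC:
  assumes I: "ideal I" and c: "c : CC p n I" shows "dd c : CC (Suc p) n I"
proof (rule CC_I)
  fix J :: "5 set" assume J: "card J = Suc p"
  show "dd c J : sec I n J" unfolding cech_diff_def
  proof (rule sec_sum[OF I])
    fix j assume "j : J"
    then have "card (J - {j}) = p" using J by simp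
    then show "(-1) ^ card {i : J. i < j} * c (J - {j}) : sec I n J" using sec_restrict[OF I, of "J - {j}" J] CC_memD[OF c] sec_sign[OF I] by auto
  qed
next
  fix J :: "5 set" assume J: "card J ~= Suc p"
  have "c (J - {j}) = 0" if "j : J" for j
    using J that by (intro CC_memD0[OF c]) (metis card_Suc_Diff1 finite)
  then show "dd c J = 0" by (simp add: cech_diff_def)
qed

lemma dd_add: "dd (a + b) = dd a + dd b"
  by (rule ext) (simp add: cech_diff_def distrib_left sum.distrib)
lemma dd_mlt: "dd (mlt f a) = mlt f (dd a)"
  by (rule ext) (simp add: cech_diff_def mlt_def sum_distrib_left mult.left_commute)
lemma dd_scl: "dd (scl z a) = scl z (dd a)" using dd_mlt[of "const z" a] by (simp add: scl_mlt)
lemma dd_0: "dd 0 = 0" by (rule ext) (simp add: cech_diff_def)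
lemma dd_diff: "dd (a - b) = dd a - dd b"
  by (rule ext) (simp add: cech_diff_def right_diff_distrib sum_subtractf)

lemma mlt_add: "mlt f (a + b) = mlt f a + mlt f b" by (rule ext) (simp add: mlt_def distrib_left)
lemma mlt_diff: "mlt f (a - b) = mlt f a - mlt f b" by (rule ext) (simp add: mlt_def right_diff_distrib)
lemma mlt_mult: "mlt (f * g) a = mlt f (mlt g a)" by (rule ext) (simp only: mlt_def emb_mult mult.assoc)
lemma mlt_1: "mlt 1 a = a" by (rule ext) (simp add: mlt_def)
lemma mlt_scl: "mlt f (scl z a) = scl z (mlt f a)" by (simp only: scl_mlt flip: mlt_mult) (simp add: mult.commute)
lemma mlt_sum: "mlt (SUM i:A. f i) a = (SUM i:A. mlt (f i) a)"
proof -
  have 0: "mlt 0 a = 0" by (rule ext) (simp add: mlt_def)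
  have "mlt (f + g) a = mlt f a + mlt g a" for f g by (rule ext) (simp only: mlt_def emb_add distrib_right plus_fun_apply)
  then show ?thesis by (induction A rule: infinite_finite_induct) (auto simp: 0)
qed

section \<open>Signs and the contracting homotopy\<close>

definition eps :: "5 => 5 set => mpoly fract" where "eps i J = (-1) ^ card {a:J. a < i}"

lemma dd_eps: "dd c J = (SUM j:J. eps j J * c (J - {j}))"
  by (simp add: cech_diff_def eps_def)

lemma eps_sq: "eps i J * eps i J = 1"
  unfolding eps_def by (simp flip: power_add power_mult_distrib)

lemma eps_remove_self: "eps i (J - {i}) = eps i J" "eps i (insert i J) = eps i J"
proof -
  have "{a : J - {i}. a < i} = {a : J. a < i}" "{a : insert i J. a < i} = {a : J. a < i}" by auto
  then show "eps i (J - {i}) = eps i J" "eps i (insert i J) = eps i J" by (simp_all add: eps_def)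
qed

lemma eps_remove: "j : J ==> i ~= j ==> eps i (J - {j}) = (if j < i then - eps i J else eps i J)"
proof -
  assume a: "j : J" "i ~= j"
  have s: "{a : J - {j}. a < i} = {a : J. a < i} - {j}" by auto
  show ?thesis
  proof (cases "j < i")
    case True
    then have "card {a : J. a < i} = Suc (card {a : J - {j}. a < i})"
      unfolding s using a by (subst card_Suc_Diff1) auto
    then show ?thesis using True by (simp add: eps_def)
  next
    case False
    then show ?thesis using s False eps_def by auto
  qed
qed

lemma eps_insert: "i ~: J ==> j : J ==> eps j (insert i J) = (if i < j then - eps j J else eps j J)"
proof -
  assume h: "i ~: J" "j : J"
  then have "insert i J - {i} = J" "j ~= i" by auto
  then show ?thesis using eps_remove[of i "insert i J" j] by (cases "i < j") simp_all
qed

lemma two_nz: "(2 :: mpoly fract) ~= 0"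
proof -
  have "(2 :: mpoly fract) = emb (const 2)" by (metis emb_add const_add const_1 emb_1 one_add_one)
  then show ?thesis by (simp only: emb_eq_0 const_eq_0) simp
qed

text \<open>Exchanging the two removed indices changes the sign, so the double sum equals its
  negative, and 2 is invertible.\<close>

lemma dd_dd: "dd (dd c) = 0"
proof (rule ext)
  fix J
  define g where "g j k = eps j J * (eps k (J - {j}) * c (J - {j} - {k}))" for j k
  have anti: "g k j = - g j k" if "j : J" "k : J" "j ~= k" for j k
  proof -
    have "J - {k} - {j} = J - {j} - {k}" by auto
    then show ?thesis unfolding g_def using that eps_remove[of j J k] eps_remove[of k J j]
      by (cases "j < k") auto
  qed
  define T where "T = (SUM j:J. SUM k:J. if j = k then 0 else g j k)"
  have "dd (dd c) J = (SUM j:J. SUM k:J - {j}. g j k)"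
    by (simp add: dd_eps g_def sum_distrib_left)
  also have "... = T" unfolding T_def
  proof (rule sum.cong[OF refl])
    fix j assume "j : J"
    show "(SUM k:J - {j}. g j k) = (SUM k:J. if j = k then 0 else g j k)"
      by (rule sum.mono_neutral_cong_left) auto
  qed
  finally have e: "dd (dd c) J = T" .
  have "T = (SUM k:J. SUM j:J. if j = k then 0 else g j k)" unfolding T_def by (rule sum.swap)
  also have "... = (SUM k:J. SUM j:J. - (if k = j then 0 else g k j))"
  proof (intro sum.cong refl)
    fix k j assume "k : J" "j : J"
    then show "(if j = k then 0 else g j k) = - (if k = j then 0 else g k j)"
      using anti[of k j] by (cases "j = k") simp_all
  qed
  also have "... = - T" by (simp add: T_def sum_negf)
  finally have "2 * T = 0" by (metis add.right_inverse mult_2)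
  then show "dd (dd c) J = 0 J" using two_nz e by simp
qed

text \<open>Contracting homotopy that inserts the index \<open>i\<close>. The factor
  \<open>var i ^ N\<close> clears the denominator in \<open>var i\<close> that the value at
  \<open>insert i J\<close> may have.\<close>

definition hmt :: "5 => nat => (5 set => mpoly fract) => 5 set => mpoly fract" where
  "hmt i N c J = (if i : J then 0 else eps i J * (emb (var i ^ N) * c (insert i J)))"

lemma homotopy: "mlt (var i ^ N) c = dd (hmt i N c) + hmt i N (dd c)"
proof (rule ext)
  fix J
  show "mlt (var i ^ N) c J = (dd (hmt i N c) + hmt i N (dd c)) J"
  proof (cases "i : J")
    case True
    have "dd (hmt i N c) J = (SUM j:{i}. eps j J * hmt i N c (J - {j}))"
      unfolding dd_eps by (rule sum.mono_neutral_right) (use True in \<open>auto simp: hmt_def\<close>)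
    also have "... = (eps i J * eps i J) * (emb (var i ^ N) * c J)"
      using True by (simp add: hmt_def eps_remove_self insert_absorb mult.assoc)
    finally show ?thesis using True by (simp add: eps_sq mlt_def hmt_def)
  next
    case False
    have 1: "dd (hmt i N c) J = (SUM j:J. (eps j J * eps i (J - {j})) * (emb (var i ^ N) * c (insert i (J - {j}))))"
      unfolding dd_eps by (rule sum.cong[OF refl]) (use False in \<open>auto simp: hmt_def mult.assoc\<close>)
    have 2: "hmt i N (dd c) J = (eps i J * eps i J) * (emb (var i ^ N) * c J)
      + (SUM j:J. (eps i J * eps j (insert i J)) * (emb (var i ^ N) * c (insert i J - {j})))" by (simp add: dd_eps False sum.insert hmt_def if_False eps_remove_self distrib_left sum_distrib_left mult_ac)
    have "(eps j J * eps i (J - {j})) * (emb (var i ^ N) * c (insert i (J - {j})))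
       + (eps i J * eps j (insert i J)) * (emb (var i ^ N) * c (insert i J - {j})) = 0" if j: "j : J" for j
    proof -
      have "insert i J - {j} = insert i (J - {j})" using j False by auto
      moreover have "i ~= j" using j False by blast
      ultimately show ?thesis using eps_remove[OF j, of i] eps_insert[OF False j] \<open>i ~= j\<close>
        by (cases "i < j") (simp_all add: mult.commute)
    qed
    then have "(SUM j:J. (eps j J * eps i (J - {j})) * (emb (var i ^ N) * c (insert i (J - {j}))))
       + (SUM j:J. (eps i J * eps j (insert i J)) * (emb (var i ^ N) * c (insert i J - {j}))) = 0"
      by (simp only: sum.distrib[symmetric]) simp
    then show ?thesis using 1 2 by (simp add: eps_sq mlt_def)
  qed
qed

lemma hmt_CC:
  assumes I: "ideal I" and c: "c : CC (Suc p) n I"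
  shows "EX N0. ALL N>=N0. hmt i N c : CC p (n + N) I"
proof -
  have "EX N0. ALL N>=N0. hmt i N c J : sec I (n + N) J" if J: "card J = p" for J
  proof (cases "i : J")
    case True then show ?thesis by (auto simp: hmt_def sec_0[OF I])
  next
    case False
    obtain N0 where "!!N. N >= N0 ==> emb (var i ^ N) * c (insert i J) : sec I (n + N) J" using J by (fastforce simp: False CC_memD[OF c] sec_shrink[OF I False])
    then show ?thesis using False by (auto simp: hmt_def eps_def intro!: exI[of _ N0] sec_sign[OF I])
  qed
  then obtain N0 where N0: "!!J N. card J = p ==> N >= N0 J ==> hmt i N c J : sec I (n + N) J" by metis
  define M where "M = Max (range N0)"
  have M: "N0 J <= M" for J unfolding M_def by (rule Max_ge) auto
  have "hmt i N c : CC p (n + N) I" if N: "N >= M" for N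
  proof (rule CC_I)
    show "hmt i N c J : sec I (n + N) J" if "card J = p" for J using N0[OF that, of N] M[of J] N by simp
    show "hmt i N c J = 0" if J: "card J ~= p" for J using J CC_memD0[OF c, of "insert i J"] hmt_def by auto
  qed
  then show ?thesis by blast
qed

section \<open>Cocycles, coboundaries and torsion\<close>

definition Zs :: "nat => nat => mpoly set => (5 set => mpoly fract) set" where
  "Zs p n I = {c : CC p n UNIV. dd c : CC (Suc p) n I}"

text \<open>Coboundaries of the augmented complex, in positions \<open>p > 0\<close>.\<close>

definition Bs :: "nat => nat => mpoly set => (5 set => mpoly fract) set" where
  "Bs p n I = {a + dd b | a b. a : CC p n I & b : CC (p - 1) n UNIV}"

lemma BsI: "a : CC (Suc q) n I ==> b : CC q n UNIV ==> a + dd b : Bs (Suc q) n I"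
  unfolding Bs_def by auto

lemma BsE:
  assumes "c : Bs (Suc q) n I" obtains a b where "c = a + dd b" "a : CC (Suc q) n I" "b : CC q n UNIV"
  using assms unfolding Bs_def by auto

lemma Zs_subspace: "ideal I ==> cv.subspace (Zs p n I)"
  by (rule cv.subspaceI) (auto simp: Zs_def CC_0 dd_0 CC_add dd_add CC_scl dd_scl)

lemma Bs_subspace:
  assumes I: "ideal I" shows "cv.subspace (Bs (Suc q) n I)"
proof (rule cv.subspaceI)
  show "0 : Bs (Suc q) n I" using BsI[OF CC_0[OF I] CC_0[OF ideal_UNIV'], of q n] by (simp add: dd_0)
  fix x assume "x : Bs (Suc q) n I"
  then obtain a b where x: "x = a + dd b" "a : CC (Suc q) n I" "b : CC q n UNIV" by (rule BsE)
  show "x + y : Bs (Suc q) n I" if "y : Bs (Suc q) n I" for y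
  proof -
    obtain a' b' where y: "y = a' + dd b'" "a' : CC (Suc q) n I" "b' : CC q n UNIV" using \<open>y : _\<close> by (rule BsE)
    have "x + y = (a + a') + dd (b + b')" by (simp add: x y dd_add add_ac)
    then show ?thesis using BsI[OF CC_add[OF I x(2) y(2)] CC_add[OF ideal_UNIV' x(3) y(3)]] by simp
  qed
  show "scl z x : Bs (Suc q) n I" for z using x(1) dd_scl cv.scale_right_distrib BsI[OF CC_scl[OF I x(2)] CC_scl[OF ideal_UNIV' x(3)]] by auto
qed

lemma Bs_mlt:
  assumes I: "ideal I" and f: "homog m f" and c: "c : Bs (Suc q) n I" shows "mlt f c : Bs (Suc q) (n + m) I"
proof -
  obtain a b where x: "c = a + dd b" "a : CC (Suc q) n I" "b : CC q n UNIV" using c by (rule BsE)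
  show ?thesis by (metis x mlt_add dd_mlt BsI[OF CC_mlt[OF I f x(2)] CC_mlt[OF ideal_UNIV' f x(3)]])
qed

lemma Zs_mlt: "ideal I ==> homog m f ==> c : Zs p n I ==> mlt f c : Zs p (n + m) I"
  by (auto simp: Zs_def dd_mlt CC_mlt)

lemma Bs_Zs: "ideal I ==> Bs (Suc q) n I \<subseteq> Zs (Suc q) n I"
proof
  fix c assume I: "ideal I" and "c : Bs (Suc q) n I"
  then obtain a b where x: "c = a + dd b" "a : CC (Suc q) n I" "b : CC q n UNIV" by (metis BsE)
  then show "c : Zs (Suc q) n I" unfolding Zs_def
    using CC_UNIV[OF x(2)] dd_CC[OF ideal_UNIV' x(3)] dd_CC[OF I x(2)] by (simp add: CC_add dd_add dd_dd)
qed

text \<open>By \<open>homotopy\<close> a high power of each variable annihilates the class of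
  \<open>c\<close>, and every monomial of degree at least \<open>5 * N\<close> is divisible by some
  \<open>var i ^ N\<close>. At position 1 this says that a section times a form of high degree is
  the restriction of a form.\<close>

lemma cohomology_torsion:
  assumes I: "ideal I" and c: "c : Zs (Suc q) n I"
  shows "EX N. ALL M>=N. ALL f. homog M f --> mlt f c : Bs (Suc q) (n + M) I"
proof -
  have "EX N0. ALL N>=N0. mlt (var i ^ N) c : Bs (Suc q) (n + N) I" for i
  proof -
    obtain N1 where N1: "!!N. N >= N1 ==> hmt i N c : CC q (n + N) UNIV"
      using hmt_CC[OF ideal_UNIV', of c q n i] c unfolding Zs_def by blast
    obtain N2 where N2: "!!N. N >= N2 ==> hmt i N (dd c) : CC (Suc q) (n + N) I"
      using hmt_CC[OF I, of "dd c" "Suc q" n i] c unfolding Zs_def by blast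
    have "mlt (var i ^ N) c : Bs (Suc q) (n + N) I" if "N >= max N1 N2" for N
      using BsI[OF N2[of N] N1[of N]] that unfolding homotopy by (simp add: add.commute)
    then show ?thesis by blast
  qed
  then obtain N0 where N0: "!!i N. N >= N0 i ==> mlt (var i ^ N) c : Bs (Suc q) (n + N) I" by metis
  define N where "N = Max (range N0)"
  have N: "mlt (var i ^ N) c : Bs (Suc q) (n + N) I" for i using N0 N_def Max_ge by auto
  have "mlt f c : Bs (Suc q) (n + M) I" if M: "M >= 5 * N" and f: "homog M f" for M f
  proof -
    have "mlt (sng m (lk f m)) c : Bs (Suc q) (n + M) I" if m: "m : supp f" for m
    proof -
      have dm: "mdeg m = M" using f m by (simp add: homog_mdeg)
      then obtain i where "N <= lk m i" using monomial_high[of N m] M by auto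
      then obtain g where g: "sng m (lk f m) = g * var i ^ N" using single_var_split by metis
      have "M >= N" using M by simp
      have "sng m (lk f m) = hc M (sng m (lk f m))" using homog_single[of m "lk f m"] dm hc_homog[of M "sng m (lk f m)" M] by simp
      also have "... = hc (M - N) g * var i ^ N" unfolding g by (rule hc_mult'[OF homog_var_power \<open>M >= N\<close>])
      finally have "mlt (sng m (lk f m)) c = mlt (hc (M - N) g) (mlt (var i ^ N) c)" by (simp only: mlt_mult)
      also have "... : Bs (Suc q) (n + N + (M - N)) I" by (rule Bs_mlt[OF I homog_hc N])
      finally show ?thesis using \<open>M >= N\<close> by simp
    qed
    then have "(SUM m:supp f. mlt (sng m (lk f m)) c) : Bs (Suc q) (n + M) I"
      by (rule cv.subspace_sum[OF Bs_subspace[OF I]])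
    then show ?thesis by (simp flip: mlt_sum pm_decomp)
  qed
  then show ?thesis by blast
qed

lemma CC_nzd:
  assumes I: "ideal I" and y: "homog 1 y" "nzd y I" and a: "a : CC p n UNIV" "mlt y a : CC p (Suc n) I"
  shows "a : CC p n I"
proof (rule CC_I)
  show "a J : sec I n J" if "card J = p" for J
    using sec_nzd[OF I y CC_memD[OF a(1) that]] CC_memD[OF a(2) that] by (simp add: mlt_def)
  show "a J = 0" if "card J ~= p" for J by (rule CC_memD0[OF a(1) that])
qed

lemma CC_insert:
  assumes I: "homog_ideal I" and y: "homog 1 y" and a: "a : CC p (Suc n) (gen (insert y I))"
  shows "EX b:CC p n UNIV. a - mlt y b : CC p (Suc n) I"
proof -
  have "EX b. b : sec UNIV n J & a J - emb y * b : sec I (Suc n) J" if "card J = p" for J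
    using sec_insert[OF I y CC_memD[OF a that]] by blast
  then obtain b where b: "!!J. card J = p ==> b J : sec UNIV n J & a J - emb y * b J : sec I (Suc n) J" by metis
  define b' where "b' J = (if card J = p then b J else 0)" for J
  have "b' : CC p n UNIV" by (rule CC_I) (use b in \<open>auto simp: b'_def\<close>)
  moreover have "a - mlt y b' : CC p (Suc n) I"
    by (rule CC_I) (use b CC_memD0[OF a] in \<open>auto simp: b'_def mlt_def\<close>)
  ultimately show ?thesis by blast
qed

lemma CC_saturation: "ideal I ==> CC (Suc p) n (saturation I) = CC (Suc p) n I"
proof -
  assume I: "ideal I"
  have "sec (saturation I) n J = sec I n J" if c: "card J = Suc p" for J
    by (rule sec_saturation[OF I]) (use c in auto)
  then show ?thesis unfolding CC_def by (intro Collect_cong all_cong if_cong) simp_all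
qed

lemma CC_irrelevant: "ideal I ==> (!!i. var i ^ N : I) ==> CC (Suc p) n I = CC (Suc p) n UNIV"
proof -
  assume I: "ideal I" "!!i. var i ^ N : I"
  have "sec I n J = sec UNIV n J" if c: "card J = Suc p" for J
    by (rule sec_irrelevant[OF I(1) _ I(2)]) (use c in auto)
  then show ?thesis unfolding CC_def by (intro Collect_cong all_cong if_cong) simp_all
qed

text \<open>A class killed by \<open>y\<close> vanishes as soon as the cochain \<open>e\<close> witnessing this can be corrected to
  a multiple of \<open>y\<close>.\<close>

lemma cohomology_step:
  assumes I: "ideal I" and y: "homog 1 y" "nzd y I" and c: "c : CC (Suc q) n UNIV"
    and e: "mlt y c - dd e : CC (Suc q) (Suc n) I"
    and e': "e' : CC q n UNIV" "dd (e - mlt y e') : CC (Suc q) (Suc n) I"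
  shows "c : Bs (Suc q) n I"
proof -
  have "mlt y (c - dd e') : CC (Suc q) (Suc n) I" using mlt_diff dd_diff dd_mlt CC_add[OF I e e'(2)] by auto
  then have "(c - dd e') + dd e' : Bs (Suc q) n I" by (metis CC_nzd[OF I y CC_diff[OF ideal_UNIV' c dd_CC[OF ideal_UNIV' e'(1)]]] BsI[OF _ e'(1)])
  then show ?thesis by simp
qed

text \<open>Every class is killed by some \<open>y ^ N\<close>; if \<open>y\<close> is injective on
  classes in all twists from \<open>n\<close> on, the factors can be removed one at a time.\<close>

lemma kill_powers:
  assumes I: "ideal I" and y: "homog 1 y" and c: "c : Zs (Suc q) n I"
    and step: "!!m c. m >= n ==> c : Zs (Suc q) m I ==> mlt y c : Bs (Suc q) (Suc m) I ==> c : Bs (Suc q) m I"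
  shows "c : Bs (Suc q) n I"
proof -
  obtain N where "!!f. homog N f ==> mlt f c : Bs (Suc q) (n + N) I" using cohomology_torsion[OF I c] by blast
  then have "mlt (y ^ N) c : Bs (Suc q) (n + N) I" using homog_power[OF y, of N] by simp
  then show ?thesis
  proof (induction N)
    case 0 then show ?case by (simp add: mlt_1)
  next
    case (Suc N)
    have "mlt (y ^ N) c : Bs (Suc q) (n + N) I" using Zs_mlt[OF I homog_power[OF y, of N] c] Suc.prems mlt_mult step[of "n + N"] by auto
    then show ?case by (rule Suc.IH)
  qed
qed

section \<open>The arithmetic genus and the Hilbert polynomial\<close>

lemma CC0_mem: "c : CC 0 n I \<longleftrightarrow> (EX r:I. homog n r & c = (%J. if J = {} then emb r else 0))"
proof
  assume c: "c : CC 0 n I"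
  obtain r where r: "r : I" "homog n r" "c {} = emb r" using CC_memD[OF c] sec_def by auto
  have "c J = 0" if "J ~= {}" for J by (rule CC_memD0[OF c]) (use that in simp)
  then show "EX r:I. homog n r & c = (%J. if J = {} then emb r else 0)" using r by (intro bexI[of _ r]) auto
next
  assume "EX r:I. homog n r & c = (%J. if J = {} then emb r else 0)"
  then obtain r where r: "r : I" "homog n r" "c = (%J. if J = {} then emb r else 0)" by blast
  have "emb r : sec I n {}" using secI[of r I 0 "{}" n] r by simp
  then show "c : CC 0 n I" by (intro CC_I) (auto simp: r(3))
qed

definition c0 :: "mpoly => 5 set => mpoly fract" where "c0 r = (%J. if J = {} then emb r else 0)"

lemma c0_CC: "r : I ==> homog n r ==> c0 r : CC 0 n I"
  unfolding CC0_mem c0_def by blast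

lemma CC0_E: assumes "c : CC 0 n I" obtains r where "r : I" "homog n r" "c = c0 r"
  using assms unfolding CC0_mem c0_def by blast

lemma c0_add: "c0 (r + s) = c0 r + c0 s" by (rule ext) (simp add: c0_def)
lemma c0_mlt: "c0 (f * r) = mlt f (c0 r)" by (rule ext) (simp add: c0_def mlt_def)
lemma c0_scl: "c0 (const z * r) = scl z (c0 r)" unfolding scl_mlt by (rule c0_mlt)

lemma dd_c0_singleton: "dd (c0 r) {j} = emb r"
  using eps_remove_self(2)[of j "{}"] eps_def dd_eps c0_def by auto

lemma dd_c0_mem:
  assumes I: "ideal I" and d: "dd (c0 r) : CC 1 n I" shows "r : saturation I"
  unfolding saturation_def
proof clarify
  fix j
  obtain f k where f: "emb r = Fract f (um {j} ^ k)" "f : I" using CC_memD[OF d, of "{j}"] dd_c0_singleton sec_def by auto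
  then show "EX n. var j ^ n * r : I" using f(2) by (auto simp: eq_fract um_def mult.commute)
qed

text \<open>\<open>y\<close> cuts the curve with ideal \<open>I\<close> in the finite scheme with ideal \<open>J\<close>, which \<open>z\<close> avoids.\<close>

locale curve_cut =
  fixes I :: "mpoly set" and y z :: mpoly and J :: "mpoly set" and m0 e N :: nat
  assumes I: "homog_ideal I" "saturation I = I"
    and y: "homog 1 y" "nzd y I" and z: "homog 1 z" "nzd z J"
    and J: "J = saturation (gen (insert y I))"
    and irr: "!!i. var i ^ N : gen (insert z J)"
    and cut: "!!n f. m0 <= n ==> homog n f ==> f : gen (insert z J)"
    and high: "!!n f. m0 <= n ==> homog n f ==> f : J ==> f : gen (insert y I)"
    and hfJ: "!!n. m0 <= n ==> hilbert_function J n = e"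
begin

lemma idI: "ideal I" using I by (simp add: homog_ideal_ideal)
lemma hyI: "homog_ideal (gen (insert y I))" by (rule homog_ideal_insert[OF I(1) y(1)])
lemma hJ: "homog_ideal J" unfolding J by (rule homog_ideal_saturation[OF hyI])
lemma idJ: "ideal J" using hJ by (rule homog_ideal_ideal)
lemma satJ: "saturation J = J" unfolding J by (rule saturation_idem[OF ideal_gen])
lemma IJ: "I \<subseteq> J" unfolding J using gen_insert_sup(1)[OF idI] saturation_sup by blast

lemma CCJ: "CC (Suc p) n J = CC (Suc p) n (gen (insert y I))"
  unfolding J by (rule CC_saturation[OF ideal_gen])

lemma mlt_y_J: "a : CC (Suc p) n UNIV ==> mlt y a : CC (Suc p) (Suc n) J"
proof -
  assume a: "a : CC (Suc p) n UNIV"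
  have "emb y * a K : sec (gen (insert y I)) (Suc n) K" if K: "card K = Suc p" for K
  proof -
    obtain f k where f: "a K = Fract f (um K ^ k)" "homog (k * card K + n) f"
      using CC_memD[OF a K] unfolding sec_def by blast
    have "Fract (f * y) (um K ^ k) : sec (gen (insert y I)) (Suc n) K" using secI gen_insertI[OF idI ideal_0[OF idI], of f y] homog_mult[OF f(2) y(1)] by auto
    then show ?thesis by (simp add: f(1) mult.commute)
  qed
  then show ?thesis using CC_I CCJ mlt_def CC_memD0[OF a] by auto
qed

lemma J_split:
  assumes "a : CC (Suc p) (Suc n) J"
  shows "EX b:CC (Suc p) n UNIV. a - mlt y b : CC (Suc p) (Suc n) I"
  using CC_insert[OF I(1) y(1)] assms unfolding CCJ by blast

lemma z_split:
  assumes "a : CC (Suc p) (Suc n) UNIV"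
  shows "EX b:CC (Suc p) n UNIV. a - mlt z b : CC (Suc p) (Suc n) J"
  by (metis assms CC_irrelevant[OF ideal_gen irr] CC_insert[OF hJ z(1)])

lemma z_split0:
  assumes "a : CC 0 (Suc n) UNIV" "m0 <= Suc n"
  shows "EX b:CC 0 n UNIV. a - mlt z b : CC 0 (Suc n) J"
proof -
  obtain r where r: "homog (Suc n) r" "a = c0 r" using assms(1) by (rule CC0_E)
  obtain b c where b: "r = b * z + c" "c : J" "homog (Suc n) c" "Suc n >= 1 ==> homog (Suc n - 1) b" by (metis cut[OF assms(2) r(1)] gen_insert_homogE[OF hJ z(1) _ r(1)])
  show ?thesis using r(2) b(1) b mult.commute[of b z] c0_add c0_mlt c0_CC[OF UNIV_I, of n b] c0_CC[OF b(2,3)] bexI[of _ "c0 b"] by auto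
qed

text \<open>Vanishing for a finite scheme: \<open>z\<close> misses it, so every cochain is a
  multiple of \<open>z\<close> modulo \<open>J\<close>, and a class killed by \<open>z\<close> is
  zero. At position 1 the correcting cochain is a form, for which divisibility is available from
  degree \<open>m0\<close> on.\<close>

lemma H_J:
  assumes c: "c : Zs (Suc q) n J" and q: "q ~= 0 | m0 <= Suc n" shows "c : Bs (Suc q) n J"
proof (rule kill_powers[OF idJ z(1) c])
  fix m c assume m: "n <= m" and c: "c : Zs (Suc q) m J" and zc: "mlt z c : Bs (Suc q) (Suc m) J"
  obtain a e' where ae: "mlt z c = a + dd e'" "a : CC (Suc q) (Suc m) J" "e' : CC q (Suc m) UNIV" using zc by (rule BsE)
  have "EX b:CC q m UNIV. e' - mlt z b : CC q (Suc m) J"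
    using z_split[of e' _ m] z_split0[of e' m] ae(3) q m by (cases q) auto
  then obtain b where b: "b : CC q m UNIV" "e' - mlt z b : CC q (Suc m) J" by blast
  show "c : Bs (Suc q) m J"
    by (rule cohomology_step[OF idJ z _ _ b(1) dd_CC[OF idJ b(2)]]) (use c ae in \<open>auto simp: Zs_def\<close>)
qed

text \<open>Injectivity of \<open>y\<close> in the long exact sequence: the kernel comes from the
  group of the finite scheme one degree lower, and \<open>H\<close> says that this group contributes
  nothing.\<close>

lemma H_I_step:
  assumes c: "c : Zs (Suc (Suc q)) m I" and yc: "mlt y c : Bs (Suc (Suc q)) (Suc m) I"
    and H: "!!e. e : Zs (Suc q) (Suc m) J ==> e : Bs (Suc q) (Suc m) J"
  shows "c : Bs (Suc (Suc q)) m I"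
proof -
  obtain a e' where ae: "mlt y c = a + dd e'" "a : CC (Suc (Suc q)) (Suc m) I" "e' : CC (Suc q) (Suc m) UNIV" using yc by (rule BsE)
  have "c : CC (Suc (Suc q)) m UNIV" using c by (simp add: Zs_def)
  then have "e' : Zs (Suc q) (Suc m) J" using ae(2) ae CC_diff[OF idJ mlt_y_J, of c "Suc q" m a] CC_mono[OF IJ] Zs_def by auto
  then obtain a1 e1 where e1: "e' = a1 + dd e1" "a1 : CC (Suc q) (Suc m) J" by (metis H BsE)
  obtain b where b: "b : CC (Suc q) m UNIV" "a1 - mlt y b : CC (Suc q) (Suc m) I" using J_split[OF e1(2)] by blast
  have b': "dd (e' - mlt y b) : CC (Suc (Suc q)) (Suc m) I" using e1(1) dd_diff dd_add dd_dd dd_CC[OF idI b(2)] by auto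
  show ?thesis by (rule cohomology_step[OF idI y _ _ b(1) b']) (use c ae in \<open>auto simp: Zs_def\<close>)
qed

lemma H_I:
  assumes c: "c : Zs (Suc (Suc q)) n I" and q: "q ~= 0 | m0 <= Suc n" shows "c : Bs (Suc (Suc q)) n I"
proof (rule kill_powers[OF idI y(1) c])
  fix m c assume m: "n <= m" and c: "c : Zs (Suc (Suc q)) m I" and yc: "mlt y c : Bs (Suc (Suc q)) (Suc m) I"
  show "c : Bs (Suc (Suc q)) m I"
    by (rule H_I_step[OF c yc]) (use q m H_J in auto)
qed

text \<open>The correcting form \<open>r\<close> vanishes on the finite scheme, so by
  \<open>high\<close> it is a multiple of \<open>y\<close> modulo \<open>I\<close>. Sections of high
  twist therefore come from forms.\<close>

lemma H0_I:
  assumes c: "c : Zs (Suc 0) n I" and n: "m0 <= Suc n" shows "c : Bs (Suc 0) n I"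
proof (rule kill_powers[OF idI y(1) c])
  fix m c assume m: "n <= m" and c: "c : Zs (Suc 0) m I" and yc: "mlt y c : Bs (Suc 0) (Suc m) I"
  obtain a e' where ae: "mlt y c = a + dd e'" "a : CC (Suc 0) (Suc m) I" "e' : CC 0 (Suc m) UNIV" using yc by (rule BsE)
  obtain r where r: "homog (Suc m) r" "e' = c0 r" using ae(3) by (rule CC0_E)
  have "c : CC (Suc 0) m UNIV" using c by (simp add: Zs_def)
  then have "dd (c0 r) : CC 1 (Suc m) J" using ae(2) ae r CC_diff[OF idJ mlt_y_J, of c 0 m a] CC_mono[OF IJ] by auto
  then have rg: "r : gen (insert y I)" using satJ n m dd_c0_mem[OF idJ] high[OF _ r(1)] by auto
  obtain b d where b: "r = b * y + d" "d : I" "homog (Suc m) d" "Suc m >= 1 ==> homog (Suc m - 1) b"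
    using gen_insert_homogE[OF I(1) y(1) rg r(1)] by metis
  have hb: "homog m b" using b(4) by simp
  have b': "dd (e' - mlt y (c0 b)) : CC (Suc 0) (Suc m) I" using r(2) b(1) mult.commute[of b y] c0_add c0_mlt dd_CC[OF idI c0_CC[OF b(2,3)]] by auto
  show "c : Bs (Suc 0) m I"
    by (rule cohomology_step[OF idI y _ _ c0_CC[OF UNIV_I hb] b']) (use c ae in \<open>auto simp: Zs_def\<close>)
qed

lemma CC_Zs: "ideal A ==> CC p n A \<subseteq> Zs p n A"
  using dd_CC CC_UNIV unfolding Zs_def by blast

lemma qd_H0_high:
  assumes A: "ideal A" "saturation A = A" and H: "!!c. c : Zs (Suc 0) n A ==> c : Bs (Suc 0) n A"
  shows "qd scl (Zs (Suc 0) n A) (CC (Suc 0) n A) (hilbert_function A n)"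
proof (rule qd_iso[THEN iffD1, OF _ mv_subspace_homog Zs_subspace[OF A(1)] CC_subspace[OF A(1)] _ CC_Zs[OF A(1)] _ _ _ hf_qd[OF A(1)]])
  show "Vector_Spaces.linear cs scl (%r. dd (c0 r))"
    by (simp only: Vector_Spaces.linear_iff mv.vector_space_axioms cv.vector_space_axioms c0_add dd_add c0_scl dd_scl) simp
  show "dd (c0 x) : Zs (Suc 0) n A" if "x : {f. homog n f}" for x
    unfolding Zs_def using dd_CC[OF ideal_UNIV' c0_CC[OF UNIV_I, of n x]] that CC_0[OF A(1)] by (simp add: dd_dd)
  show "x : {f : A. homog n f} \<longleftrightarrow> dd (c0 x) : CC (Suc 0) n A" if "x : {f. homog n f}" for x
    using that dd_CC[OF A(1) c0_CC, of x n] dd_c0_mem[OF A(1), of x n] A(2) by auto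
  show "EX x:{f. homog n f}. x' - dd (c0 x) : CC (Suc 0) n A" if "x' : Zs (Suc 0) n A" for x'
  proof -
    obtain a b where ab: "x' = a + dd b" "a : CC (Suc 0) n A" "b : CC 0 n UNIV" using H[OF \<open>x' : _\<close>] by (rule BsE)
    obtain r where r: "homog n r" "b = c0 r" using ab(3) by (rule CC0_E)
    show ?thesis using ab r by (intro bexI[of _ r]) auto
  qed
qed blast

lemma linear_mlt: "Vector_Spaces.linear scl scl (mlt f)"
  by (simp add: Vector_Spaces.linear_iff cv.vector_space_axioms mlt_add mlt_scl)

text \<open>In twist \<open>n + m0\<close> the sections are the forms modulo \<open>J\<close>, of
  dimension \<open>e\<close>. Since \<open>z\<close> is invertible on the scheme, multiplication by
  \<open>z\<close> transports this down to every twist.\<close>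

lemma qd_H0_J: "qd scl (Zs (Suc 0) n J) (CC (Suc 0) n J) e"
proof -
  have down: "qd scl (Zs (Suc 0) n J) (CC (Suc 0) n J) e" if q: "qd scl (Zs (Suc 0) (Suc n) J) (CC (Suc 0) (Suc n) J) e" for n
  proof (rule qd_iso[THEN iffD2, OF linear_mlt[of z] Zs_subspace[OF idJ] Zs_subspace[OF idJ] CC_subspace[OF idJ] CC_Zs[OF idJ] CC_Zs[OF idJ] _ _ _ q])
    show "mlt z x : Zs (Suc 0) (Suc n) J" if "x : Zs (Suc 0) n J" for x using Zs_mlt[OF idJ z(1) that] by simp
    show "x : CC (Suc 0) n J \<longleftrightarrow> mlt z x : CC (Suc 0) (Suc n) J" if "x : Zs (Suc 0) n J" for x
      using that CC_nzd[OF idJ z] CC_mlt1[OF idJ z(1)] by (auto simp: Zs_def)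
    show "EX c:Zs (Suc 0) n J. x - mlt z c : CC (Suc 0) (Suc n) J" if x: "x : Zs (Suc 0) (Suc n) J" for x
    proof -
      obtain b where b: "b : CC (Suc 0) n UNIV" "x - mlt z b : CC (Suc 0) (Suc n) J"
        using z_split[of x 0 n] x unfolding Zs_def by blast
      have "dd x - dd (x - mlt z b) : CC (Suc (Suc 0)) (Suc n) J"
        using x dd_CC[OF idJ b(2)] by (intro CC_diff[OF idJ]) (simp_all add: Zs_def)
      then have "dd b : CC (Suc (Suc 0)) n J" using dd_diff dd_mlt CC_nzd[OF idJ z dd_CC[OF ideal_UNIV' b(1)]] by auto
      then show ?thesis using b by (auto simp: Zs_def)
    qed
  qed
  have "qd scl (Zs (Suc 0) (n + (m0 - k)) J) (CC (Suc 0) (n + (m0 - k)) J) e" if "k <= m0" for k using that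
  proof (induction k)
    case 0
    have "qd scl (Zs (Suc 0) (n + m0) J) (CC (Suc 0) (n + m0) J) (hilbert_function J (n + m0))"
      by (rule qd_H0_high[OF idJ satJ H_J]) auto
    then show ?case using hfJ by simp
  next
    case (Suc k)
    then have "Suc (n + (m0 - Suc k)) = n + (m0 - k)" by simp
    then show ?case using Suc down[of "n + (m0 - Suc k)"] by simp
  qed
  from this[of m0] show ?thesis by simp
qed

text \<open>One step of the long exact sequence for multiplication by \<open>y\<close>.\<close>

lemma euler_step:
  assumes a1: "qd scl (Zs (Suc 0) (Suc n) I) (CC (Suc 0) (Suc n) I) a1"
    and b1: "qd scl (Zs (Suc (Suc 0)) (Suc n) I) (Bs (Suc (Suc 0)) (Suc n) I) b1"
  shows "EX a0 b0. qd scl (Zs (Suc 0) n I) (CC (Suc 0) n I) a0 &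
      qd scl (Zs (Suc (Suc 0)) n I) (Bs (Suc (Suc 0)) n I) b0 & a1 + b0 = a0 + e + b1"
proof -
  let ?W = "CC (Suc 0) (Suc n) I" and ?M = "Zs (Suc 0) (Suc n) I" and ?N0 = "CC (Suc 0) (Suc n) J" and ?N2 = "Zs (Suc 0) (Suc n) J"
  let ?B = "Bs (Suc (Suc 0)) n I" and ?Z = "Zs (Suc (Suc 0)) n I" and ?B' = "Bs (Suc (Suc 0)) (Suc n) I" and ?Z' = "Zs (Suc (Suc 0)) (Suc n) I"
  let ?C2 = "CC (Suc (Suc 0)) (Suc n) I"
  note sub = CC_subspace[OF idI] CC_subspace[OF idJ] Zs_subspace[OF idI] Zs_subspace[OF idJ] Bs_subspace[OF idI]
  have WN0: "?W \<subseteq> ?N0" by (rule CC_mono[OF IJ])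
  have MN2: "?M \<subseteq> ?N2" unfolding Zs_def using CC_mono[OF IJ] by blast
  have N0N2: "?N0 \<subseteq> ?N2" by (rule CC_Zs[OF idJ])
  \<comment> \<open>\<open>M'\<close> consists of the sections vanishing on the finite scheme,
    \<open>N1\<close> of the sections of the finite scheme that lift to the curve, \<open>K\<close>
    of the cocycles whose class is killed by \<open>y\<close>: the kernels and images in the long
    exact sequence.\<close>
  define M' where "M' = {x. x : ?M & x : ?N0}"
  define N1 where "N1 = {x + w | x w. x : ?M & w : ?N0}"
  define K where "K = {ep : ?Z. mlt y ep : ?B'}"
  have M'sub: "cv.subspace M'" unfolding M'_def using cv.subspace_inter[OF sub(3,2)] by (simp add: Int_def)
  have N1sub: "cv.subspace N1" unfolding N1_def by (rule cv.subspace_sums[OF sub(3,2)])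
  have Ksub: "cv.subspace K" unfolding K_def
  proof (rule cv.subspaceI)
    show "0 : {ep : ?Z. mlt y ep : ?B'}" using cv.subspace_0[OF sub(3)] cv.subspace_0[OF sub(5)] mlt_diff[of y 0 0] by auto
    show "a + b : {ep : ?Z. mlt y ep : ?B'}" if "a : {ep : ?Z. mlt y ep : ?B'}" "b : {ep : ?Z. mlt y ep : ?B'}" for a b
      using that cv.subspace_add[OF sub(3)] cv.subspace_add[OF sub(5)] by (auto simp: mlt_add)
    show "scl c a : {ep : ?Z. mlt y ep : ?B'}" if "a : {ep : ?Z. mlt y ep : ?B'}" for a c
      using that cv.subspace_scale[OF sub(3)] cv.subspace_scale[OF sub(5)] unfolding mem_Collect_eq mlt_scl by blast
  qed
  have WM': "?W \<subseteq> M'" unfolding M'_def using WN0 CC_Zs[OF idI] by blast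
  have M'M: "M' \<subseteq> ?M" unfolding M'_def by blast
  have N0N1: "?N0 \<subseteq> N1" unfolding N1_def using cv.subspace_0[OF sub(3)] by force
  have N1N2: "N1 \<subseteq> ?N2" unfolding N1_def using MN2 N0N2 cv.subspace_add[OF sub(4)] by blast
  have BK: "?B \<subseteq> K" unfolding K_def using Bs_Zs[OF idI] Bs_mlt[OF idI y(1)] by fastforce
  have KZ: "K \<subseteq> ?Z" unfolding K_def by blast
  have B'Z': "?B' \<subseteq> ?Z'" by (rule Bs_Zs[OF idI])
  obtain a0 r where a0: "qd scl M' ?W a0" and r: "qd scl ?M M' r" and a1r: "a1 = a0 + r"
    using cv.qd_split[OF a1 sub(1) M'sub sub(3) WM' M'M] by blast
  have H0: "qd scl (Zs (Suc 0) n I) (CC (Suc 0) n I) a0"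
  proof (rule qd_iso[THEN iffD2, OF linear_mlt[of y] sub(3) M'sub sub(1) CC_Zs[OF idI] WM' _ _ _ a0])
    show "mlt y c : M'" if "c : Zs (Suc 0) n I" for c using that Zs_mlt[OF idI y(1) that] mlt_y_J by (simp add: M'_def Zs_def)
    show "c : CC (Suc 0) n I \<longleftrightarrow> mlt y c : ?W" if "c : Zs (Suc 0) n I" for c
      using that CC_nzd[OF idI y] CC_mlt1[OF idI y(1)] by (auto simp: Zs_def)
    show "EX c:Zs (Suc 0) n I. x - mlt y c : ?W" if x: "x : M'" for x
    proof -
      obtain b where b: "b : CC (Suc 0) n UNIV" "x - mlt y b : ?W" using J_split[of x 0 n] x unfolding M'_def by blast
      have "dd x - dd (x - mlt y b) : ?C2" using x M'_def Zs_def dd_CC[OF idI b(2)] CC_diff[OF idI] by auto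
      then have "mlt y (dd b) : ?C2" by (simp add: dd_diff dd_mlt)
      then show ?thesis using b CC_nzd[OF idI y dd_CC[OF ideal_UNIV' b(1)]] Zs_def by auto
    qed
  qed
  obtain r' t where r': "qd scl N1 ?N0 r'" and t: "qd scl ?N2 N1 t" and ert: "e = r' + t"
    using cv.qd_split[OF qd_H0_J sub(2) N1sub sub(4) N0N1 N1N2] by blast
  have "qd scl N1 ?N0 r"
  proof (rule qd_iso[THEN iffD1, OF cv.linear_id sub(3) N1sub sub(2) M'M N0N1 _ _ _ r])
    show "id x : N1" if "x : ?M" for x unfolding N1_def
      by (rule CollectI, rule exI[of _ x], rule exI[of _ 0]) (use that CC_0[OF idJ] in simp)
    show "EX x:?M. x' - id x : ?N0" if "x' : N1" for x' using that unfolding N1_def by force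
  qed (simp add: M'_def)
  then have rr: "r = r'" using r' cv.qd_unique[OF _ _ sub(2)] by blast
  \<comment> \<open>The connecting homomorphism as a relation: \<open>c\<close> and
    \<open>ep\<close> correspond if \<open>dd c\<close> is \<open>y\<close> times \<open>ep\<close>
    modulo \<open>I\<close>.\<close>
  have tK: "qd scl K ?B t"
  proof (rule qd_transfer[OF cv.vector_space_axioms cv.vector_space_axioms N1sub sub(5) sub(4) Ksub N1N2 BK _ _ _ _ _ t,
       where R = "%c ep. dd c - mlt y ep : ?C2"])
    show "dd (u + v) - mlt y (u' + v') : ?C2" if "dd u - mlt y u' : ?C2" "dd v - mlt y v' : ?C2" for u v u' v'
      using CC_add[OF idI that] by (simp add: dd_add mlt_add algebra_simps)
    show "dd (scl c u) - mlt y (scl c u') : ?C2" if "dd u - mlt y u' : ?C2" for c u u'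
      using CC_scl[OF idI that, of c] by (simp only: dd_scl mlt_scl cv.scale_right_diff_distrib)
    show "EX ep:K. dd c - mlt y ep : ?C2" if c: "c : ?N2" for c
    proof -
      obtain ep where ep: "ep : CC (Suc (Suc 0)) n UNIV" "dd c - mlt y ep : ?C2" using c Zs_def J_split by blast
      have "mlt y (dd ep) : CC (Suc (Suc (Suc 0))) (Suc n) I" using CC_diff[OF idI CC_0[OF idI] dd_CC[OF idI ep(2)]] dd_diff dd_dd dd_mlt by auto
      then have Z: "ep : ?Z" using CC_nzd[OF idI y dd_CC[OF ideal_UNIV' ep(1)]] ep Zs_def by auto
      have "(0 - (dd c - mlt y ep)) + dd c : ?B'"
        using CC_diff[OF idI CC_0[OF idI] ep(2)] c by (intro BsI) (auto simp: Zs_def)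
      then show ?thesis using Z K_def ep(2) by auto
    qed
    show "EX c:?N2. dd c - mlt y ep : ?C2" if ep: "ep : K" for ep
    proof -
      obtain a c where ac: "mlt y ep = a + dd c" "a : ?C2" "c : CC (Suc 0) (Suc n) UNIV" using BsE ep K_def by blast
      have "mlt y ep - a : CC (Suc (Suc 0)) (Suc n) J" using ac(2) ep mlt_y_J K_def Zs_def CC_mono[OF IJ] CC_diff[OF idJ] by blast
      then show ?thesis using ac ac(1) Zs_def CC_diff[OF idI CC_0[OF idI] ac(2)] by auto
    qed
    show "c : N1 \<longleftrightarrow> ep : ?B" if "c : ?N2" "ep : K" "dd c - mlt y ep : ?C2" for c ep
    proof
      assume "c : N1"
      then obtain x w where xw: "c = x + w" "x : ?M" "w : ?N0" unfolding N1_def by blast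
      obtain b where b: "b : CC (Suc 0) n UNIV" "w - mlt y b : ?W" using J_split[OF xw(3)] by blast
      have "(dd x + dd (w - mlt y b)) - (dd c - mlt y ep) : ?C2" using xw(2) that(3) Zs_def dd_CC[OF idI b(2)] CC_diff[OF idI CC_add[OF idI]] by auto
      then have "ep - dd b : CC (Suc (Suc 0)) n I" using xw(1) that(2) dd_add dd_diff dd_mlt mlt_diff dd_CC[OF ideal_UNIV' b(1)] CC_diff[OF ideal_UNIV'] K_def Zs_def CC_nzd[OF idI y] by auto
      then have "(ep - dd b) + dd b : ?B" using b(1) by (rule BsI)
      then show "ep : ?B" by simp
    next
      assume "ep : ?B"
      then obtain a b where ab: "ep = a + dd b" "a : CC (Suc (Suc 0)) n I" "b : CC (Suc 0) n UNIV" by (rule BsE)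
      have "(dd c - mlt y ep) + mlt y a : ?C2" using CC_add[OF idI that(3) CC_mlt1[OF idI y(1) ab(2)]] .
      then have "c - mlt y b : ?M" using ab(1) that(1) mlt_add dd_diff dd_mlt CC_mlt1[OF ideal_UNIV' y(1) ab(3)] CC_diff[OF ideal_UNIV'] Zs_def by auto
      then show "c : N1" unfolding N1_def using mlt_y_J[OF ab(3)] by force
    qed
  qed
  \<comment> \<open>Multiplication by \<open>y\<close> is onto in first cohomology because the
    finite scheme has none, by \<open>H_J\<close>.\<close>
  have KZ': "qd scl ?Z K b1"
  proof (rule qd_iso[THEN iffD2, OF linear_mlt[of y] sub(3) sub(3) sub(5) KZ B'Z' _ _ _ b1])
    show "mlt y x : ?Z'" if "x : ?Z" for x using Zs_mlt[OF idI y(1) that] by simp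
    show "EX x:?Z. x' - mlt y x : ?B'" if x': "x' : ?Z'" for x'
    proof -
      have "x' : Bs (Suc (Suc 0)) (Suc n) J" using x' H_J CC_mono[OF IJ] Zs_def by blast
      then obtain a d where ad: "x' = a + dd d" "a : CC (Suc (Suc 0)) (Suc n) J" "d : CC (Suc 0) (Suc n) UNIV" by (rule BsE)
      obtain b where b: "b : CC (Suc (Suc 0)) n UNIV" "a - mlt y b : ?C2" using J_split[OF ad(2)] by blast
      have "dd x' - dd (a - mlt y b) : CC (Suc (Suc (Suc 0))) (Suc n) I" using x' Zs_def dd_CC[OF idI b(2)] CC_diff[OF idI] by auto
      then have "dd b : CC (Suc (Suc (Suc 0))) n I" using ad(1) dd_add dd_dd dd_diff dd_mlt CC_nzd[OF idI y dd_CC[OF ideal_UNIV' b(1)]] by auto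
      then have "b : ?Z" using b by (simp add: Zs_def)
      moreover have "x' - mlt y b : ?B'" using b(2) ad(3) BsI ad(1) by (fastforce simp: algebra_simps)
      ultimately show ?thesis by blast
    qed
  qed (simp add: K_def)
  have "qd scl ?Z ?B (t + b1)" by (rule cv.qd_add[OF tK KZ' sub(5) Ksub BK KZ])
  then show ?thesis using H0 a1r ert rr by (intro exI[of _ a0] exI[of _ "t + b1"]) auto
qed

text \<open>At twist \<open>m0\<close> the sections are the forms and first cohomology is zero; each
  step down lowers the difference by \<open>e\<close>.\<close>

lemma euler_descent:
  "k <= m0 ==> EX a b. qd scl (Zs (Suc 0) (m0 - k) I) (CC (Suc 0) (m0 - k) I) a &
      qd scl (Zs (Suc (Suc 0)) (m0 - k) I) (Bs (Suc (Suc 0)) (m0 - k) I) b &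
      int a - int b = int (hilbert_function I m0) - int e * int k"
proof (induction k)
  case 0
  have 1: "qd scl (Zs (Suc 0) m0 I) (CC (Suc 0) m0 I) (hilbert_function I m0)"
    by (rule qd_H0_high[OF idI I(2)]) (simp add: H0_I)
  have "Zs (Suc (Suc 0)) m0 I = Bs (Suc (Suc 0)) m0 I" using H_I[of _ 0 m0] Bs_Zs[OF idI, of "Suc 0" m0] by auto
  then have 2: "qd scl (Zs (Suc (Suc 0)) m0 I) (Bs (Suc (Suc 0)) m0 I) 0" using cv.qd_self by simp
  show ?case using 1 2 by (intro exI[of _ "hilbert_function I m0"] exI[of _ 0]) simp
next
  case (Suc k)
  then have s: "Suc (m0 - Suc k) = m0 - k" by simp
  obtain a b where ab: "qd scl (Zs (Suc 0) (m0 - k) I) (CC (Suc 0) (m0 - k) I) a"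
      "qd scl (Zs (Suc (Suc 0)) (m0 - k) I) (Bs (Suc (Suc 0)) (m0 - k) I) b"
      "int a - int b = int (hilbert_function I m0) - int e * int k" using Suc by auto
  obtain a0 b0 where "qd scl (Zs (Suc 0) (m0 - Suc k) I) (CC (Suc 0) (m0 - Suc k) I) a0"
      "qd scl (Zs (Suc (Suc 0)) (m0 - Suc k) I) (Bs (Suc (Suc 0)) (m0 - Suc k) I) b0" "a + b0 = a0 + e + b"
    using euler_step[of "m0 - Suc k" a b] ab(1,2) unfolding s by blast
  moreover from this(3) have "int a0 - int b0 = int a - int b - int e" by linarith
  then have "int a0 - int b0 = int (hilbert_function I m0) - int e * int (Suc k)" using ab(3) by (simp add: algebra_simps)
  ultimately show ?case by blast
qed

lemma cohomology_qd_0: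
  assumes "qd scl (Zs (Suc 0) 0 I) (CC (Suc 0) 0 I) a" shows "cohomology_dim I 0 = a"
  using cocycles_def Zs_def cech_CC coboundaries_def cohomology_dim_def quotient_dim_qd[OF cv.vector_space_axioms assms CC_subspace[OF idI]] by auto

lemma cohomology_qd_Suc:
  assumes "qd scl (Zs (Suc (Suc k)) 0 I) (Bs (Suc (Suc k)) 0 I) a" shows "cohomology_dim I (Suc k) = a"
proof -
  have "cocycles I (Suc k) = Zs (Suc (Suc k)) 0 I" by (simp add: cocycles_def Zs_def cech_CC)
  moreover have "coboundaries I (Suc k) = Bs (Suc (Suc k)) 0 I"
    unfolding coboundaries_def Bs_def cech_CC by auto
  ultimately show ?thesis unfolding cohomology_dim_def
    using quotient_dim_qd[OF cv.vector_space_axioms assms Bs_subspace[OF idI]] by simp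
qed

theorem arith_genus_hilbert: "arith_genus I = 1 - (int (hilbert_function I m0) - int e * int m0)"
proof -
  obtain a b where ab: "qd scl (Zs (Suc 0) 0 I) (CC (Suc 0) 0 I) a" "qd scl (Zs (Suc (Suc 0)) 0 I) (Bs (Suc (Suc 0)) 0 I) b"
      "int a - int b = int (hilbert_function I m0) - int e * int m0"
    using euler_descent[of m0] by auto
  have "cohomology_dim I (Suc (Suc k)) = 0" for k
  proof (rule cohomology_qd_Suc)
    have "Zs (Suc (Suc (Suc k))) 0 I = Bs (Suc (Suc (Suc k))) 0 I"
      using H_I[of _ "Suc k" 0] Bs_Zs[OF idI, of "Suc (Suc k)" 0] by auto
    then show "qd scl (Zs (Suc (Suc (Suc k))) 0 I) (Bs (Suc (Suc (Suc k))) 0 I) 0" using cv.qd_self by simp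
  qed
  then show ?thesis using ab(3) cohomology_qd_0[OF ab(1)] cohomology_qd_Suc[OF ab(2)] euler_char_def eval_nat_numeral arith_genus_def by auto
qed

end

section \<open>Generic sections of curves\<close>

text \<open>Two generic linear cuts leave no point, so \<open>(J, z)\<close> contains all forms of
  high degree and the Hilbert function of \<open>J\<close> becomes constant. \<open>m0\<close> lies
  past this and past the degree from which \<open>J\<close> agrees with
  \<open>(I, y)\<close>.\<close>

lemma curve_generic:
  assumes I: "closed_subscheme I" and ch: "~ has_chain I 2"
    and y: "homog 1 y" "nzd y I" and J: "J = saturation (gen (insert y I))" and z: "homog 1 z" "nzd z J"
  shows "EX m0 e N. curve_cut I y z J m0 e N"
proof -
  have hI: "homog_ideal I" and sI: "saturation I = I" using I by (auto simp: closed_subscheme_def)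
  have hyI: "homog_ideal (gen (insert y I))" by (rule homog_ideal_insert[OF hI y(1)])
  have cJ: "closed_subscheme J" unfolding J by (rule closed_saturation[OF hyI])
  have hJ: "homog_ideal J" using cJ by (simp add: closed_subscheme_def)
  have "~ has_chain J 1" using has_chain_cut[OF I y, of 1] ch unfolding J by (auto simp: numeral_2_eq_2)
  then have "points (gen (insert z J)) = {}" using has_chain_cut[OF cJ z, of 0] no_chain_0 points_saturation by auto
  then obtain N where N: "!!i. var i ^ N : gen (insert z J)"
    using irrelevant_power[OF homog_ideal_insert[OF hJ z(1)]] by blast
  have cut: "f : gen (insert z J)" if "5 * N <= n" "homog n f" for n f
    using homog_high_in_ideal[OF ideal_gen, of N 1 "insert z J" n f] N that by simp
  obtain m1 where m1: "!!n f. n >= m1 ==> homog n f ==> f : J ==> f : gen (insert y I)"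
    using saturation_high[OF hyI] unfolding J by blast
  have zJ: "z * g : J ==> g : J" for g using nzdD[OF z(2)] .
  have hf: "hilbert_function J (5 * N + k) = hilbert_function J (5 * N)" for k
  proof (induction k)
    case (Suc k)
    show ?case using Suc hf_eq_0[OF ideal_gen, of "insert z J" "5 * N + Suc k"] cut[of "5 * N + Suc k"] hf_nzd[OF hJ z(1) zJ, of "5 * N + Suc k"] by auto
  qed simp
  have "curve_cut I y z J (max (5 * N) m1) (hilbert_function J (5 * N)) N"
  proof
    show "f : gen (insert z J)" if "max (5 * N) m1 <= n" "homog n f" for n f using cut[of n f] that by simp
    show "f : gen (insert y I)" if "max (5 * N) m1 <= n" "homog n f" "f : J" for n f using m1[of n f] that by simp
    show "hilbert_function J n = hilbert_function J (5 * N)" if "max (5 * N) m1 <= n" for n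
      using hf[of "n - 5 * N"] that by simp
  qed (use hI sI y z J N in auto)
  then show ?thesis by blast
qed

context curve_cut
begin

lemma hf_I_linear: "hilbert_function I (m0 + k) = hilbert_function I m0 + e * k"
proof (induction k)
  case (Suc k)
  have zI: "y * g : I ==> g : I" for g using nzdD[OF y(2)] .
  have "hilbert_function (gen (insert y I)) (m0 + Suc k) = hilbert_function J (m0 + Suc k)"
    by (rule hf_cong) (use high[of "m0 + Suc k"] saturation_sup J in auto)
  then show ?case using Suc hfJ[of "m0 + Suc k"] hf_nzd[OF I(1) y(1) zI, of "m0 + Suc k"] by auto
qed simp

lemma has_hp_I: "has_hp I [:real (hilbert_function I m0) - real e * real m0, real e:]"
  unfolding has_hp_def
proof (intro exI[of _ m0] allI impI)
  fix n assume "m0 <= n"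
  then obtain k where k: "n = m0 + k" using le_Suc_ex by blast
  show "poly [:real (hilbert_function I m0) - real e * real m0, real e:] (real n) = real (hilbert_function I n)"
    unfolding k hf_I_linear by (simp add: algebra_simps)
qed

lemma degree_e:
  assumes "has_chain I 1" "proj_degree I = real d" shows "e = d"
proof -
  have "1 <= degree [:real (hilbert_function I m0) - real e * real m0, real e:]"
    by (rule hf_chain_degree[OF idI assms(1) has_hp_I])
  \<comment> \<open>With \<open>e = 0\<close> the polynomial would be constant, against the chain of
    length 1.\<close>
  then have "real e ~= 0" by (auto split: if_splits)
  then show ?thesis using proj_degree_eq[OF has_hp_I] assms(2) by simp
qed

end

section \<open>The extremal sequence\<close>

text \<open>The first difference of the Hilbert function of \<open>d = m s + ep + 1\<close> points linked to
  \<open>s - ep - 1\<close> collinear ones by plane curves of degree \<open>s\<close> and \<open>m + 1\<close>.\<close>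

definition ext :: "nat => nat => nat => nat => nat" where
  "ext s m ep j = (if j <= m then min (j + 1) s else (s - 1 - (j - m)) + (if j - m <= ep then 1 else 0))"

lemma ext_le: assumes "ep < s" "s <= m + 1" shows "ext s m ep j <= min (j + 1) s"
  using assms by (auto simp: ext_def)

text \<open>After \<open>m\<close> the model falls by at most one per step, except for at most one
  fall by two, where the indicator ends; hence the extra unit.\<close>

lemma ext_drop: assumes "ep < s" shows "ext s m ep a <= ext s m ep (a + i) + i + 1"
  using assms by (auto simp: ext_def)

lemma sum_lin_quad:
  "(SUM i<k. A + B * real i + C * (real i)\<^sup>2) =
     A * real k + B * (real k * (real k - 1) / 2) + C * (real k * (real k - 1) * (2 * real k - 1) / 6)"
proof -
  have 1: "(SUM i<k. real i) = real k * (real k - 1) / 2" by (induction k) (simp_all add: field_simps)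
  have 2: "(SUM i<k. (real i)\<^sup>2) = real k * (real k - 1) * (2 * real k - 1) / 6"
    by (induction k) (simp_all add: field_simps power2_eq_square)
  have "(SUM i<k. A + B * real i + C * (real i)\<^sup>2) = A * real k + B * (SUM i<k. real i) + C * (SUM i<k. (real i)\<^sup>2)"
    by (simp add: sum.distrib sum_distrib_left)
  then show ?thesis by (simp only: 1 2)
qed

lemma sum_min_aux: "s >= 1 ==> (SUM j<=s - 1 + k. real (min (j + 1) s)) = real s * (real s - 1 + real k + 1) - real s * (real s - 1) / 2"
proof (induction k)
  case 0
  have "(SUM j<=s - 1. real (min (j + 1) s)) = (SUM j<s. 1 + 1 * real j + 0 * (real j)\<^sup>2)"
    using 0 by (intro sum.cong) auto
  then show ?case using 0 unfolding sum_lin_quad by (simp add: field_simps)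
next
  case (Suc k)
  have e: "s - 1 + Suc k = Suc (s - 1 + k)" by simp
  have "min (Suc (s - 1 + k) + 1) s = s" using Suc.prems by simp
  then show ?case unfolding e sum.atMost_Suc using Suc.IH[OF Suc.prems] by (simp only:) (simp add: field_simps)
qed

lemma sum_min:
  assumes "s >= 1" "s <= m + 1"
  shows "(SUM j<=m. real (min (j + 1) s)) = real s * (real m + 1) - real s * (real s - 1) / 2"
proof -
  obtain k where k: "m = s - 1 + k" using assms by (metis le_Suc_ex le_diff_conv)
  then show ?thesis using assms of_nat_diff sum_min_aux[OF assms(1), of k] k[symmetric] by auto
qed

lemma sum_min_weighted_aux:
  "s >= 1 ==> (SUM j<=s - 1 + k. real j * real (min (j + 1) s)) =
     real s * (real s - 1 + real k) * (real s + real k) / 2 - real s * (real s - 1) * (real s - 2) / 6"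
proof (induction k)
  case 0
  have "(SUM j<=s - 1. real j * real (min (j + 1) s)) = (SUM j<s. 0 + 1 * real j + 1 * (real j)\<^sup>2)"
    using 0 by (intro sum.cong) (auto simp: power2_eq_square algebra_simps)
  then show ?case using 0 unfolding sum_lin_quad by (simp add: field_simps)
next
  case (Suc k)
  have e: "s - 1 + Suc k = Suc (s - 1 + k)" by simp
  have "min (Suc (s - 1 + k) + 1) s = s" using Suc.prems by simp
  moreover have "real (Suc (s - 1 + k)) = real s + real k" using Suc.prems by (simp add: of_nat_diff)
  ultimately show ?case unfolding e sum.atMost_Suc using Suc.IH[OF Suc.prems] by (simp only:) (simp add: field_simps)
qed

lemma sum_min_weighted:
  assumes "s >= 1" "s <= m + 1"
  shows "(SUM j<=m. real j * real (min (j + 1) s)) =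
     real s * real m * (real m + 1) / 2 - real s * (real s - 1) * (real s - 2) / 6"
proof -
  obtain k where k: "m = s - 1 + k" using assms by (metis le_Suc_ex le_diff_conv)
  then have m: "real m = real s - 1 + real k" using assms by (simp add: of_nat_diff)
  have "real s + real k = real m + 1" using m by simp
  then show ?thesis using sum_min_weighted_aux[OF assms(1), of k] unfolding k[symmetric] m[symmetric] by simp
qed

lemma sum_lessThan_add: "(SUM j<a + b. f j) = (SUM j<a. f j) + (SUM i<b. f (a + i :: nat) :: real)"
  by (induction b) simp_all

lemma sum_ext_split:
  assumes "ep < s" "s <= m + 1"
  shows "(SUM j<m + 1 + s. w j * real (ext s m ep j)) = (SUM j<=m. w j * real (min (j + 1) s))
      + (SUM i<s - 1. w (m + 1 + i) * (real s - 2 - real i)) + (SUM i<ep. w (m + 1 + i))"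
proof -
  have "(SUM j<m + 1 + s. w j * real (ext s m ep j)) = (SUM j<m + 1. w j * real (ext s m ep j))
      + (SUM i<s. w (m + 1 + i) * real (ext s m ep (m + 1 + i)))"
    by (rule sum_lessThan_add)
  also have "(SUM j<m + 1. w j * real (ext s m ep j)) = (SUM j<=m. w j * real (min (j + 1) s))"
    by (rule sum.cong) (auto simp: ext_def)
  also have "(SUM i<s. w (m + 1 + i) * real (ext s m ep (m + 1 + i)))
      = (SUM i<s. w (m + 1 + i) * real (s - 2 - i)) + (SUM i<s. if i < ep then w (m + 1 + i) else 0)"
    by (subst sum.distrib[symmetric], rule sum.cong) (auto simp: ext_def algebra_simps)
  also have "(SUM i<s. w (m + 1 + i) * real (s - 2 - i)) = (SUM i<s - 1. w (m + 1 + i) * (real s - 2 - real i))"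
    by (rule sum.mono_neutral_cong_right) (auto simp: of_nat_diff)
  also have "(SUM i<s. if i < ep then w (m + 1 + i) else 0) = (SUM i<ep. w (m + 1 + i))"
    by (rule sum.mono_neutral_cong_right) (use assms in auto)
  finally show ?thesis by simp
qed

lemma sum_ext:
  assumes "ep < s" "s <= m + 1" shows "(SUM j<m + 1 + s. real (ext s m ep j)) = real (m * s + ep + 1)"
proof -
  have s: "s >= 1" using assms by simp
  have "(SUM i<s - 1. 1 * (real s - 2 - real i)) = (SUM i<s - 1. (real s - 2) + (-1) * real i + 0 * (real i)\<^sup>2)" by simp
  also have "... = (real s - 1) * (real s - 2) / 2" unfolding sum_lin_quad using s by (simp add: of_nat_diff field_simps)
  finally have 1: "(SUM i<s - 1. 1 * (real s - 2 - real i)) = (real s - 1) * (real s - 2) / 2" .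
  have "(SUM j<m + 1 + s. 1 * real (ext s m ep j)) = real s * (real m + 1) - real s * (real s - 1) / 2
      + (real s - 1) * (real s - 2) / 2 + real ep"
    unfolding sum_ext_split[OF assms, of "%_. 1"] 1 using sum_min[OF s assms(2)] by simp
  then show ?thesis by (simp add: field_simps)
qed

lemma sum_ext_weighted:
  assumes "ep < s" "s <= m + 1"
  shows "(SUM j<m + 1 + s. real j * real (ext s m ep j)) =
     real s * real m * (real m + 1) / 2 + real m * (real s - 1) * (real s - 2) / 2 + real m * real ep + real ep * (real ep + 1) / 2"
proof -
  have s: "s >= 1" using assms by simp
  have "(SUM i<s - 1. real (m + 1 + i) * (real s - 2 - real i))
     = (SUM i<s - 1. (real m + 1) * (real s - 2) + (real s - 2 - (real m + 1)) * real i + (-1) * (real i)\<^sup>2)"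
    by (rule sum.cong) (auto simp: algebra_simps power2_eq_square)
  also have "... = real m * (real s - 1) * (real s - 2) / 2 + real s * (real s - 1) * (real s - 2) / 6"
    unfolding sum_lin_quad using s by (simp add: of_nat_diff field_simps)
  finally have 1: "(SUM i<s - 1. real (m + 1 + i) * (real s - 2 - real i)) =
      real m * (real s - 1) * (real s - 2) / 2 + real s * (real s - 1) * (real s - 2) / 6" .
  have "(SUM i<ep. real (m + 1 + i)) = (SUM i<ep. (real m + 1) + 1 * real i + 0 * (real i)\<^sup>2)"
    by (rule sum.cong) auto
  also have "... = real m * real ep + real ep * (real ep + 1) / 2" unfolding sum_lin_quad by (simp add: field_simps)
  finally have 2: "(SUM i<ep. real (m + 1 + i)) = real m * real ep + real ep * (real ep + 1) / 2" .
  have 3: "(SUM j<=m. real j * real (min (j + 1) s)) = real s * real m * (real m + 1) / 2 - real s * (real s - 1) * (real s - 2) / 6"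
    by (rule sum_min_weighted[OF s assms(2)])
  show ?thesis using sum_ext_split[OF assms, of real] unfolding 1 2 3 by simp
qed

text \<open>Abel summation: for a fixed total, larger partial sums mean a smaller weighted
  sum.\<close>

lemma weighted_sum_heads:
  fixes b :: "nat => nat"
  shows "(SUM j<N. j * b j) + (SUM n<N. SUM j<=n. b j) = N * (SUM j<N. b j)"
  by (induction N) (auto simp: algebra_simps lessThan_Suc_atMost[symmetric])

text \<open>All partial sums of \<open>b\<close> are at least those of the model \<open>be\<close>.
  At a first violation, in position \<open>a\<close>, one has \<open>b a < be a\<close>, hence
  \<open>a >= n0\<close>; from there \<open>b\<close> falls at every step and stays below
  \<open>be\<close>, although both have total \<open>d\<close>.\<close>

theorem extremal_bound:
  fixes b :: "nat => nat"
  assumes s: "s >= 1" and d: "d > s * s" and tot: "(SUM j<L. b j) = d" and fin: "!!j. j >= L ==> b j = 0"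
    and low: "!!n. n < n0 ==> min (n + 1) s <= b n" and drop: "!!n. n >= n0 ==> b (Suc n) <= b n - 1"
  shows "1 - real d + real (SUM j<L. j * b j) <= genus_bound d s"
proof -
  define m where "m = (d - 1) div s"
  define ep where "ep = (d - 1) mod s"
  have dm: "d = m * s + ep + 1" using d by (simp add: m_def ep_def)
  have eps: "ep < s" using s by (simp add: ep_def)
  \<comment> \<open>\<open>d > s * s\<close> guarantees that the model reaches height
    \<open>s\<close> before it starts to fall.\<close>
  have ms: "s <= m + 1"
  proof -
    have "s * s <= d - 1" using d by simp
    then have "(s * s) div s <= m" unfolding m_def by (rule div_le_mono)
    then show ?thesis using s by simp
  qed
  define be where "be = ext s m ep"
  define N where "N = max L (m + 1 + s)"
  have bz: "be j = 0" if "j >= m + 1 + s" for j using that eps by (simp add: be_def ext_def)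
  have "(SUM j<m + 1 + s. be j) = d" by (metis dm sum_ext[OF eps ms] be_def of_nat_eq_iff of_nat_sum)
  moreover have "(SUM j<N. be j) = (SUM j<m + 1 + s. be j)"
    by (rule sum.mono_neutral_right) (auto simp: N_def bz)
  ultimately have tb: "(SUM j<N. be j) = d" by simp
  have ta: "(SUM j<N. b j) = d" using fin tot by (auto simp: sum.mono_neutral_right N_def)
  have head: "(SUM j<n. be j) <= (SUM j<n. b j)" if "n <= N" for n
  proof (rule ccontr)
    assume "~ ?thesis"
    then have ex: "EX k. k <= N & (SUM j<k. b j) < (SUM j<k. be j)" using that by (intro exI[of _ n]) simp
    define n1 where "n1 = (LEAST k. k <= N & (SUM j<k. b j) < (SUM j<k. be j))"
    have n1: "n1 <= N" "(SUM j<n1. b j) < (SUM j<n1. be j)" unfolding n1_def using LeastI_ex[OF ex] by auto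
    have min: "(SUM j<k. be j) <= (SUM j<k. b j)" if "k < n1" for k
    proof -
      have "~ (k <= N & (SUM j<k. b j) < (SUM j<k. be j))" using that unfolding n1_def by (rule not_less_Least)
      then show ?thesis using that n1(1) by simp
    qed
    obtain a where a: "n1 = Suc a" using n1(2) by (cases n1) auto
    have ba: "b a < be a" using n1(2) min[of a] by (simp add: a)
    have an: "a >= n0"
    proof (rule ccontr)
      assume "~ ?thesis"
      then have "min (a + 1) s <= b a" using low[of a] by simp
      then show False using ba ext_le[OF eps ms, of a] order_trans[rotated] be_def by auto
    qed
    have dec: "b (a + i) <= b a - i" for i
    proof (induction i)
      case (Suc i)
      then show ?case using drop[of "a + i"] an by simp
    qed simp
    have le: "b k <= be k" if "k >= a" for k
      using dec[of "k - a"] ext_drop[OF eps, of m a "k - a"] ba that by (simp add: be_def)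
    have sp: "(SUM j<N. f j) = (SUM j<n1. f j) + (SUM j=n1..<N. f j)" for f :: "nat => nat"
      using sum.atLeastLessThan_concat[of 0 n1 N f] n1(1) by (simp add: atLeast0LessThan)
    have "(SUM j=n1..<N. b j) <= (SUM j=n1..<N. be j)" by (rule sum_mono) (use le a in auto)
    then show False using sp[of b] sp[of be] ta tb n1(2) by linarith
  qed
  have heads: "(SUM n<N. SUM j<=n. be j) <= (SUM n<N. SUM j<=n. b j)"
  proof (rule sum_mono)
    fix n assume "n : {..<N}"
    then show "(SUM j<=n. be j) <= (SUM j<=n. b j)" using head[of "Suc n"] unfolding lessThan_Suc_atMost by simp
  qed
  have "(SUM j<N. j * b j) <= (SUM j<N. j * be j)"
    using weighted_sum_heads[of b N] weighted_sum_heads[of be N] heads unfolding ta tb by linarith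
  moreover have "(SUM j<N. j * b j) = (SUM j<L. j * b j)" by (rule sum.mono_neutral_right) (auto simp: N_def fin)
  moreover have "(SUM j<N. j * be j) = (SUM j<m + 1 + s. j * be j)" by (rule sum.mono_neutral_right) (auto simp: N_def bz)
  ultimately have "(SUM j<L. j * b j) <= (SUM j<m + 1 + s. j * be j)" by simp
  then have "real (SUM j<L. j * b j) <= real (SUM j<m + 1 + s. j * be j)" by (rule of_nat_mono)
  also have "... = (SUM j<m + 1 + s. real j * real (ext s m ep j))" by (simp add: be_def)
  also have "... = real s * real m * (real m + 1) / 2 + real m * (real s - 1) * (real s - 2) / 2 + real m * real ep + real ep * (real ep + 1) / 2"
    by (rule sum_ext_weighted[OF eps ms])
  finally have "1 - real d + real (SUM j<L. j * b j) <= 1 - real d + (real s * real m * (real m + 1) / 2 + real m * (real s - 1) * (real s - 2) / 2 + real m * real ep + real ep * (real ep + 1) / 2)"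
    by simp
  also have "... = genus_bound d s"
  proof -
    have D: "real d = real m * real s + real ep + 1" using dm by simp
    show ?thesis unfolding genus_bound_def Let_def ep_def[symmetric] D using s
      by (simp add: field_simps power2_eq_square)
  qed
  finally show ?thesis .
qed

section \<open>Hypersurfaces and their divisors\<close>

lemma Vid_chain:
  assumes I: "I \<subseteq> Vid A" and n: "card A + n <= 4" shows "has_chain I n"
proof -
  define B where "B = rec_nat A (%_ S. insert (SOME x. x ~: S) S)"
  have B: "B 0 = A" "B (Suc i) = insert (SOME x. x ~: B i) (B i)" for i by (simp_all add: B_def)
  have ne: "S ~= UNIV" if "card S <= 4" for S :: "5 set" using that by auto
  then have new: "(SOME x. x ~: S) ~: S" if "card S <= 4" for S :: "5 set" using that by (intro someI_ex[of "%x. x ~: S"]) blast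
  have c: "i <= n ==> card (B i) = card A + i" for i
    by (induction i) (use new n in \<open>simp_all add: B\<close>)
  have "A \<subseteq> B i" for i by (induction i) (auto simp: B)
  then have IB: "I \<subseteq> Vid (B i)" for i using I unfolding Vid_def by blast
  show ?thesis unfolding has_chain_def
  proof (intro exI[of _ "%i. Vid (B i)"] conjI allI impI)
    show "Vid (B i) : points I" if "i <= n" for i
      using relevant_Vid[OF ne] IB c[OF that] that n by (simp add: points_def)
    show "Vid (B i) \<subset> Vid (B (Suc i))" if "i < n" for i
      using new[of "B i"] c[of i] that n by (intro Vid_mono) (auto simp: B(2))
  qed
qed

lemma chain_zero_4: "has_chain {0} 4"
  by (rule Vid_chain[of _ "{}"]) (simp_all add: Vid_empty)

lemma gen_single: "f : gen {G} \<longleftrightarrow> G dvd (f :: mpoly)"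
  by (auto simp: rm.span_singleton dvd_def mult.commute)

lemma prime_elem_ideal: "prime_elem G ==> prime_set (gen {G :: mpoly})"
  by (auto simp: prime_set_def gen_single prime_elem_dvd_mult_iff)

lemma gen_insert_zero: "gen (insert x {0}) = gen {x :: mpoly}"
  by (intro equalityI rm.span_minimal ideal_gen) (auto intro: rm.span_base ideal_0[OF ideal_gen])

text \<open>Unique factorization supplies a prime \<open>G\<close> in \<open>X\<close>. If
  \<open>(G)\<close> were smaller than \<open>X\<close>, it would prolong a chain of length 3 to one
  of length 4, while the Hilbert polynomial of a hypersurface has degree 3.\<close>

lemma threefold_principal:
  assumes X: "integral_subscheme X" "has_dim X 3"
  shows "EX G g. homog g G & g > 0 & G ~= 0 & X = gen {G}"
proof -
  have rX: "relevant_prime X" using X by (simp add: integral_subscheme_def)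
  have idX: "ideal X" by (rule rp_ideal[OF rX])
  have "X ~= {0}" using chain_zero_4 X(2) by (auto simp: has_dim_def eval_nat_numeral)
  then obtain f0 where "f0 : X" "f0 ~= 0" using rp_0[OF rX] by blast
  then obtain n where n: "hc n f0 ~= 0" "hc n f0 : X" using hc_eq_0_iff homog_idealD[OF rp_homog[OF rX]] by metis
  obtain G where G: "G : X" "prime_elem G" "G dvd hc n f0"
    using prime_ideal_has_prime_elem[OF idX _ rp_1[OF rX] n(2,1)] rX by (auto simp: relevant_prime_def)
  obtain g where g: "homog g G" using G(3) homog_factor homog_hc n(1) by (metis dvdE)
  have G0: "G ~= 0" using G(2) by auto
  have g0: "g > 0"
  proof (rule ccontr)
    assume "~ ?thesis"
    then have "G = const (lk G 0)" using g homog_0_const by blast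
    moreover from this G0 have "lk G 0 ~= 0" by (metis const_0)
    ultimately have "G * const (inverse (lk G 0)) = 1" by (metis const_1 const_mult right_inverse)
    then show False using G(2) by (metis dvdI prime_elem_not_unit)
  qed
  have hG: "homog_ideal (gen {G})" by (rule homog_ideal_gen) (use g in auto)
  have sub: "gen {G} \<subseteq> X" using G(1) idX by (intro rm.span_minimal) auto
  have "X = gen {G}"
  proof (rule ccontr)
    assume ne: "X ~= gen {G}"
    obtain P where P: "ALL i<=3. P i : points X" "ALL i<3. P i \<subset> P (Suc i)" using X(2) unfolding has_dim_def has_chain_def by blast
    define Q where "Q i = (case i of 0 => gen {G} | Suc j => P j)" for i
    have "relevant_prime (gen {G})" using hG prime_elem_ideal[OF G(2)] sub rX by (auto simp: relevant_prime_alt)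
    then have "ALL i<=4. Q i : points (gen {G})" using P(1) sub by (auto simp: Q_def points_def split: nat.split)
    moreover have "gen {G} \<subset> P 0" using P(1) sub ne by (auto simp: points_def)
    then have "ALL i<4. Q i \<subset> Q (Suc i)" using P(2) by (auto simp: Q_def split: nat.split)
    ultimately have ch: "has_chain (gen {G}) 4" unfolding has_chain_def by blast
    have "has_hp (gen {G}) (dpoly g hp4)" unfolding gen_insert_zero[symmetric]
      by (rule has_hp_nzd[OF homog_ideal_zero g _ has_hp_zero]) (use G0 in auto)
    then have "4 <= degree (dpoly g hp4)" using hf_chain_degree[OF ideal_gen ch] by simp
    then show False using dpoly_degree[of hp4 3 g] hp4_degree g0 by simp
  qed
  then show ?thesis using g g0 G0 by blast
qed

section \<open>Powers of variables and saturation of complete intersections\<close>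

lemma monomial_ideal_2:
  "f : gen {var i ^ N, var j ^ N} \<longleftrightarrow> (ALL m:supp f. N <= lk m i | N <= lk m j)"
proof
  have vp: "!!m. m : supp (var i ^ N) ==> N <= lk m i" for i
  proof -
    fix m assume "m : supp (var i ^ N)"
    moreover have "var i ^ N = sng (sng i N) 1"
      by (induction N) (auto simp: var_def mult_single single_add[symmetric])
    ultimately show "N <= lk m i" by simp
  qed
  assume "f : gen {var i ^ N, var j ^ N}"
  then obtain a b where f: "f = a * var i ^ N + b * var j ^ N" unfolding gen_2 by blast
  show "ALL m:supp f. N <= lk m i | N <= lk m j"
  proof
    fix m assume "m : supp f"
    then have "m : supp (a * var i ^ N) | m : supp (b * var j ^ N)" unfolding f by (rule supp_addD)
    then show "N <= lk m i | N <= lk m j"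
      by (elim disjE) (drule supp_mult, use vp in \<open>force simp: lookup_add\<close>)+
  qed
next
  assume h: "ALL m:supp f. N <= lk m i | N <= lk m j"
  have "sng m (lk f m) : gen {var i ^ N, var j ^ N}" if m: "m : supp f" for m
  proof -
    obtain k where k: "k = i | k = j" "N <= lk m k" using h m by blast
    obtain g where "sng m (lk f m) = g * var k ^ N" using single_var_split[OF k(2)] by blast
    moreover have "var k ^ N : gen {var i ^ N, var j ^ N}" using k(1) by (auto intro: rm.span_base)
    ultimately show ?thesis using ideal_mult[OF ideal_gen] by simp
  qed
  then have "(SUM m:supp f. sng m (lk f m)) : gen {var i ^ N, var j ^ N}" by (intro ideal_sum ideal_gen)
  then show "f : gen {var i ^ N, var j ^ N}" by (simp flip: pm_decomp)
qed

lemma var_power_mult_supp: "m : supp f ==> sng k N + m : supp (var k ^ N * f)"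
proof -
  assume m: "m : supp f"
  have vp: "var k ^ N = sng (sng k N) 1"
    by (induction N) (auto simp: var_def mult_single single_add[symmetric])
  have "var k ^ N * f = (SUM m:supp f. sng (sng k N + m) (lk f m))"
    by (subst (1) pm_decomp[of f]) (simp add: vp sum_distrib_left mult_single)
  then have "lk (var k ^ N * f) (sng k N + m) = (SUM m':supp f. lk (sng (sng k N + m') (lk f m')) (sng k N + m))"
    by (simp add: lookup_sum)
  also have "... = (SUM m':supp f. if m' = m then lk f m else 0)"
    by (rule sum.cong) (auto simp: lookup_single when_def)
  also have "... = lk f m" using m by simp
  finally show ?thesis using m by (simp add: in_keys_iff)
qed

text \<open>Membership in an ideal of two powers is a condition on the exponents of \<open>i\<close>
  and \<open>j\<close> in each monomial, which the variable \<open>k\<close> does not affect. The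
  case \<open>i = j\<close> is allowed and serves for a single power.\<close>

lemma monomial_nzd_2:
  assumes "k ~= i" "k ~= j" "var k ^ N * f : gen {var i ^ M, var j ^ M}"
  shows "f : gen {var i ^ M, var j ^ M}"
  unfolding monomial_ideal_2
proof
  fix m assume "m : supp f"
  then have "sng k N + m : supp (var k ^ N * f)" by (rule var_power_mult_supp)
  then show "M <= lk m i | M <= lk m j" using assms(3) assms(1,2) by (auto simp: monomial_ideal_2 lookup_add lookup_single_not_eq)
qed

lemma gen_same: "gen {a, a :: mpoly} = gen {a}" by simp

text \<open>A complete intersection of two hypersurfaces, one of them integral, has no embedded component
  at the vertex; the proof is the exactness of the Koszul complex of three powers of variables.\<close>

lemma complete_intersection_saturated:
  fixes G q :: mpoly
  assumes P: "prime_set (gen {G})" "G ~= 0" and q: "q ~: gen {G}" and rel: "EX i. var i ~: gen {G}"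
  shows "saturation (gen {q, G}) = gen {q, G}"
proof
  show "saturation (gen {q, G}) \<subseteq> gen {q, G}"
  proof
    fix a assume "a : saturation (gen {q, G})"
    then obtain N where N: "!!i. var i ^ N * a : gen {q, G}" using saturation_uniform[OF ideal_gen] by blast
    obtain i where i: "var i ~: gen {G}" using rel by blast
    have "EX j k. j ~= i & k ~= i & k ~= j"
    proof -
      have "card (UNIV - {i}) = 4" by simp
      then obtain j where j: "j : UNIV - {i}" by (metis card.empty equals0I zero_neq_numeral)
      then have "card (UNIV - {i} - {j}) = 3" by simp
      then obtain k where "k : UNIV - {i} - {j}" by (metis card.empty equals0I zero_neq_numeral)
      then show ?thesis using j by blast
    qed
    then obtain j k where jk: "j ~= i" "k ~= i" "k ~= j" by blast
    have "EX al be. var l ^ N * a = al * q + be * G" for l using N[of l] unfolding gen_2 by blast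
    then obtain al be where ab: "!!l. var l ^ N * a = al l * q + be l * G" by metis
    \<comment> \<open>Compare the two expressions for \<open>var l ^ N * var m ^ N * a\<close> and
      cancel \<open>q\<close>, a nonzerodivisor modulo \<open>(G)\<close>.\<close>
    have rel2: "EX ga. var m ^ N * al l - var l ^ N * al m = G * ga" for l m
    proof -
      have "var m ^ N * (var l ^ N * a) = var l ^ N * (var m ^ N * a)" by (simp add: mult_ac)
      then have "(var m ^ N * al l - var l ^ N * al m) * q = G * (var l ^ N * be m - var m ^ N * be l)"
        unfolding ab by (simp add: algebra_simps)
      then have "(var m ^ N * al l - var l ^ N * al m) * q : gen {G}" by (simp add: gen_single)
      then show ?thesis by (metis P(1) q prime_set_def gen_single dvd_def)
    qed
    obtain g1 where g1: "var j ^ N * al i - var i ^ N * al j = G * g1" using rel2 by blast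
    obtain g2 where g2: "var k ^ N * al i - var i ^ N * al k = G * g2" using rel2 by blast
    obtain g3 where g3: "var k ^ N * al j - var j ^ N * al k = G * g3" using rel2 by blast
    have "G * (var k ^ N * g1) = var k ^ N * (var j ^ N * al i - var i ^ N * al j)" unfolding g1 by (simp add: mult_ac)
    also have "... = var j ^ N * (var k ^ N * al i - var i ^ N * al k) - var i ^ N * (var k ^ N * al j - var j ^ N * al k)"
      by (simp add: algebra_simps)
    also have "... = G * (var j ^ N * g2 - var i ^ N * g3)" unfolding g2 g3 by (simp add: algebra_simps)
    \<comment> \<open>The three quotients satisfy the relation of the Koszul complex, so
      \<open>g1\<close> lies in the ideal of the two other powers.\<close>
    finally have "var k ^ N * g1 = g2 * var j ^ N + (- g3) * var i ^ N" using P(2) by (simp add: mult.commute)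
    then have "var k ^ N * g1 : gen {var j ^ N, var i ^ N}" unfolding gen_2 by blast
    then obtain u v where uv: "g1 = u * var j ^ N + v * var i ^ N" using jk monomial_nzd_2 gen_2 by blast
    have "var j ^ N * (al i - G * u) : gen {var i ^ N, var i ^ N}" using g1 uv by (simp add: algebra_simps gen_same gen_single)
    then obtain w where w: "al i - G * u = var i ^ N * w" by (metis jk(1) monomial_nzd_2 gen_same gen_single dvd_def)
    have "var i ^ N * (a - w * q) = G * (be i + u * q)"
    proof -
      have "al i = var i ^ N * w + G * u" using w by (simp add: algebra_simps)
      then have "var i ^ N * a = (var i ^ N * w + G * u) * q + be i * G" using ab[of i] by simp
      then show ?thesis by (simp add: algebra_simps)
    qed
    then have m: "var i ^ N * (a - w * q) : gen {G}" by (simp add: gen_single)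
    have "x ^ n * f : gen {G} ==> x ~: gen {G} ==> f : gen {G}" for x n f
      using nzd_power[OF nzd_prime[OF P(1)], of x n] unfolding nzd_def by blast
    then obtain t where "a = w * q + t * G" by (metis m i gen_single dvd_def add.commute diff_add_cancel mult.commute)
    then show "a : gen {q, G}" unfolding gen_2 by blast
  qed
qed (rule saturation_sup)

section \<open>Local equations of divisors\<close>

lemma sections_var: "sections I (var j) = sec I 0 {j}"
  using sections_sec[of "{j}" I] by (simp add: um_def)

locale hypersurface =
  fixes X :: "mpoly set" and G :: mpoly and g :: nat
  assumes G: "homog g G" "G ~= 0" "g > 0" and X: "X = gen {G}" and rX: "relevant_prime X"
begin

lemma idX: "ideal X" by (rule rp_ideal[OF rX])
lemma hX: "homog_ideal X" by (rule rp_homog[OF rX])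
lemma GX: "G : X" unfolding X by (simp add: gen_single)

lemma gen_insert_X: "gen (insert q X) = gen {q, G}"
proof
  show "gen (insert q X) \<subseteq> gen {q, G}"
    by (rule rm.span_minimal) (auto simp: X intro: rm.span_base subsetD[OF rm.span_mono[of "{G}" "{q, G}"]])
  show "gen {q, G} \<subseteq> gen (insert q X)" by (rule rm.span_mono) (use GX in auto)
qed

lemma saturated_insert: "q ~: X ==> saturation (gen (insert q X)) = gen (insert q X)"
  unfolding gen_insert_X using complete_intersection_saturated[of G q] rX G(2)
  by (simp add: X relevant_prime_alt)

lemma closed_insert: "q ~: X ==> homog e q ==> closed_subscheme (gen (insert q X))"
  using homog_ideal_insert[OF hX] saturated_insert by (simp add: closed_subscheme_def)

lemma local_generator_var:
  assumes H: "homog k H" "H ~: X"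
  shows "local_generator X (gen (insert H X)) (var j) (Fract H (var j ^ k))"
  unfolding local_generator_def
proof (intro conjI ballI impI)
  let ?D = "gen (insert H X)" let ?phi = "Fract H (var j ^ k)"
  show "basic_open (var j)" unfolding basic_open_def by (auto intro!: exI[of _ 1])
  have f: "?phi : sec UNIV 0 {j}" using secI[OF UNIV_I, of k "{j}" 0 H] H(1) by (simp add: um_def)
  then show "?phi : sections UNIV (var j)" by (simp add: sections_var)
  show "sections ?D (var j) = {a * ?phi + b | a b. a : sections UNIV (var j) & b : sections X (var j)}"
    unfolding sections_var
  proof (intro set_eqI iffI)
    fix x assume "x : sec ?D 0 {j}"
    then obtain f n where fn: "x = Fract f (var j ^ n)" "f : ?D" "homog n f" unfolding sec_def by (auto simp: um_def)
    obtain c b where cb: "f = c * H + b" "b : X" "homog n b" "n >= k ==> homog (n - k) c" "n < k ==> c = 0"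
      using gen_insert_homogE[OF hX H(1) fn(2,3)] by metis
    have bs: "Fract b (var j ^ n) : sec X 0 {j}" using secI[OF cb(2), of n "{j}" 0] cb(3) by (simp add: um_def)
    show "x : {a * ?phi + b | a b. a : sec UNIV 0 {j} & b : sec X 0 {j}}"
    proof (cases "n >= k")
      case True
      then have "x = Fract c (var j ^ (n - k)) * ?phi + Fract b (var j ^ n)" using fn(1) cb(1) by (simp add: power_add[symmetric] eq_fract algebra_simps)
      moreover have "Fract c (var j ^ (n - k)) : sec UNIV 0 {j}" using secI[OF UNIV_I, of "n - k" "{j}" 0 c] cb(4)[OF True] by (simp add: um_def)
      ultimately show ?thesis using bs by blast
    next
      case False
      then have "x = 0 * ?phi + Fract b (var j ^ n)" using cb by (simp add: fn(1))
      then show ?thesis using bs sec_0[OF ideal_UNIV'] by blast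
    qed
  next
    fix x assume "x : {a * ?phi + b | a b. a : sec UNIV 0 {j} & b : sec X 0 {j}}"
    then obtain a b where ab: "x = a * ?phi + b" "a : sec UNIV 0 {j}" "b : sec X 0 {j}" by blast
    obtain c n where cn: "a = Fract c (var j ^ n)" "homog n c" using ab(2) unfolding sec_def by (auto simp: um_def)
    have "a * ?phi = Fract (c * H) (var j ^ (n + k))" by (simp add: cn power_add)
    moreover have "c * H : ?D" by (rule ideal_mult[OF ideal_gen gen_insert_sup(2)])
    ultimately have "a * ?phi : sec ?D 0 {j}" using secI[of "c * H" ?D "n + k" "{j}" 0] homog_mult[OF cn(2) H(1)] by (simp add: um_def)
    then show "x : sec ?D 0 {j}" using ab sec_add[OF ideal_gen] sec_mono[OF gen_insert_sup(1)[OF idX]] by blast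
  qed
  fix a assume a: "a : sections UNIV (var j)" "a * ?phi : sections X (var j)"
  obtain c n where cn: "a = Fract c (var j ^ n)" "homog n c" using a(1) unfolding sections_var sec_def by (auto simp: um_def)
  obtain b m where bm: "a * ?phi = Fract b (var j ^ m)" "b : X" using a(2) unfolding sections_var sec_def by (auto simp: um_def)
  have "H * (var j ^ m * c) : X" using bm(1) cn by (simp add: eq_fract algebra_simps ideal_mult'[OF idX bm(2)])
  then have m: "var j ^ m * c : X" using rp_mult[OF rX] H(2) by blast
  have "a = Fract (var j ^ m * c) (var j ^ (m + n))" by (simp add: cn power_add eq_fract)
  then show "a : sections X (var j)" unfolding sections_var
    using secI[OF m, of "m + n" "{j}" 0] homog_mult[OF homog_var_power[of m j] cn(2)] by (simp add: um_def)
qed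

lemma effective_cartier_insert:
  assumes H: "homog k H" "H ~: X" shows "effective_cartier X (gen (insert H X))"
  unfolding effective_cartier_def subscheme_of_def
proof (intro conjI ballI)
  show "closed_subscheme (gen (insert H X))" by (rule closed_insert[OF H(2,1)])
  show "closed_subscheme X" by (rule rp_closed[OF rX])
  show "X \<subseteq> gen (insert H X)" by (rule gen_insert_sup(1)[OF idX])
  fix P assume "P : points X"
  then obtain j where "var j ~: P" by (auto simp: points_def relevant_prime_def)
  then show "EX u phi. u ~: P & local_generator X (gen (insert H X)) u phi" using local_generator_var[OF H] by blast
qed

lemma generic_max_num: "Fract a b : generic_max X ==> b ~= 0 ==> a : X"
proof -
  assume "Fract a b : generic_max X" "b ~= 0"
  then obtain a' b' where ab: "Fract a b = Fract a' b'" "a' : X" "b' ~: X" unfolding generic_max_def by blast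
  have "b' ~= 0" using ab(3) rp_0[OF rX] by blast
  then have "a * b' : X" by (metis ab(1) \<open>b ~= 0\<close> eq_fract ideal_mult'[OF idX ab(2)])
  then show "a : X" using rp_mult[OF rX] ab(3) by blast
qed

lemma sections_X_num: "Fract a b : sections X u ==> b ~= 0 ==> u ~: X ==> a : X"
proof -
  assume h: "Fract a b : sections X u" "b ~= 0" "u ~: X"
  then obtain f n where f: "Fract a b = Fract f (u ^ n)" "f : X" unfolding sections_def by blast
  have "a * u ^ n = f * b" by (metis h(3) f(1) h(2) rp_power[OF rX] rp_0[OF rX] eq_fract)
  then show "a : X" using h(3) ideal_mult'[OF idX f(2)] rp_mult[OF rX] rp_power[OF rX] by metis
qed

lemma sections_0:
  assumes "basic_open u" "ideal A" shows "0 : sections A u"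
proof -
  obtain e where "e > 0" "homog e u" using assms(1) unfolding basic_open_def by blast
  moreover have "0 = Fract 0 (u ^ 0)" by (simp only: Zero_fract_def power_0)
  ultimately show ?thesis unfolding sections_def using ideal_0[OF assms(2)] homog_0 by blast
qed

lemma local_generator_mem: "local_generator X D u phi ==> phi : sections D u"
proof -
  assume L: "local_generator X D u phi"
  then have u: "basic_open u" by (simp add: local_generator_def)
  then obtain e where e: "e > 0" "homog e u" unfolding basic_open_def by blast
  have "Fract 1 (u ^ 0) : sections UNIV u" unfolding sections_def using e homog_1
    by (intro CollectI exI[of _ 1] exI[of _ 0] exI[of _ e]) auto
  then have "1 : sections UNIV u" by simp
  then show ?thesis using L by (fastforce simp: sections_0[OF u idX] local_generator_def)
qed

lemma Fract_power: "Fract a b ^ n = Fract (a ^ n) (b ^ n :: mpoly)"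
  by (induction n) (simp_all only: power_0 power_Suc mult_fract One_fract_def)

lemma fract_clear:
  fixes A B C :: mpoly
  assumes "Fract A m = Fract B b * Fract C c + x" "m ~= 0" "b ~= 0" "c ~= 0"
  shows "Fract (A * (b * c) - B * C * m) (m * (b * c)) = x"
proof -
  have "x = Fract A m - Fract B b * Fract C c" using assms(1) by simp
  then show ?thesis using assms(2-4) by simp
qed

text \<open>Clears the denominators of a local equation: near \<open>P\<close> the numerator
  \<open>d\<close> generates \<open>D\<close> modulo \<open>X\<close>, in the sense that every form
  of \<open>D\<close> becomes a multiple of \<open>d\<close> after multiplication by some
  \<open>c\<close> outside \<open>P\<close>.\<close>

lemma local_generator_num:
  assumes P: "P : points X" and u: "u ~: P" and L: "local_generator X D u phi" and D: "ideal D"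
  shows "EX d m N. phi = Fract d (u ^ m) & d : D & homog N d & (ALL f:D. ALL n. homog n f --> (EX c a. c ~: P & c * f - a * d : X))"
proof -
  have rP: "relevant_prime P" and XP: "X \<subseteq> P" using P by (auto simp: points_def)
  then have uX: "u ~: X" and u0: "u ~= 0" using u rp_0[OF rX] by auto
  obtain e where e: "e > 0" "homog e u" using L unfolding local_generator_def basic_open_def by blast
  obtain d m where d: "phi = Fract d (u ^ m)" "d : D" "homog (m * e) d"
    using local_generator_mem[OF L] homog_unique[OF _ e(2) u0] unfolding sections_def by blast
  obtain j where j: "var j ~: P" using rP by (auto simp: relevant_prime_def)
  have "EX c a. c ~: P & c * f - a * d : X" if f: "f : D" "homog n f" for f n
  proof -
    \<comment> \<open>This power brings the degree of \<open>f\<close> from \<open>n\<close> to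
      \<open>n * e\<close>, as required for a denominator \<open>u ^ n\<close>, and it lies outside
      \<open>P\<close>.\<close>
    let ?w = "var j ^ (n * (e - 1))"
    have "n * (e - 1) + n = n * e" using e(1) by (cases e) simp_all
    then have "homog (n * e) (?w * f)" using homog_mult[OF homog_var_power[of "n * (e - 1)" j] f(2)] by simp
    then have "Fract (?w * f) (u ^ n) : sections D u" unfolding sections_def using e ideal_mult[OF D f(1)] by blast
    then obtain a x where ax: "Fract (?w * f) (u ^ n) = a * phi + x" "a : sections UNIV u" "x : sections X u"
      using L unfolding local_generator_def by blast
    obtain a' l where a': "a = Fract a' (u ^ l)" using ax(2) unfolding sections_def by blast
    have "?w * f * (u ^ l * u ^ m) - a' * d * u ^ n : X"
      using u0 ax(3) uX fract_clear[OF ax(1)[unfolded a' d(1)]] sections_X_num[of _ "u ^ n * (u ^ l * u ^ m)" u] by auto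
    then have "(?w * u ^ l * u ^ m) * f - (a' * u ^ n) * d : X" by (simp add: mult_ac)
    moreover have "?w * u ^ l * u ^ m ~: P" using u j by (simp add: rp_mult[OF rP] rp_power[OF rP])
    ultimately show ?thesis by blast
  qed
  then show ?thesis using d by blast
qed

text \<open>Both inclusions in the identification of a divisor equivalent to \<open>k H\<close> compare two local
  equations \<open>phi = psi phi'\<close> and \<open>(h / x\<^sub>j)\<^sup>k\<close>; clearing denominators gives these two congruences.\<close>

lemma equiv_local:
  assumes P: "P : points X" and u: "u ~: P" and LD: "local_generator X D u phi" and LE: "local_generator X E u phi'"
    and gm: "phi - Fract p q * phi' : generic_max X" and q: "q ~: X"
    and j: "var j ~: P" and LEj: "local_generator X E (var j) (Fract (h ^ k) (var j ^ k))" and D: "ideal D" and E: "ideal E"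
  shows "EX c s. c ~: P & s : D & (EX t. c * (p * h ^ k) - t * (s * q) : X)"
    and "f : D ==> homog n f ==> EX c a. c ~: P & c * (f * q) - a * (p * h ^ k) : X"
proof -
  let ?v = "var j"
  have rP: "relevant_prime P" and XP: "X \<subseteq> P" using P by (auto simp: points_def)
  have u0: "u ~= 0" and q0: "q ~= 0" using u XP q rp_0[OF rX] by auto
  obtain d m where d: "phi = Fract d (u ^ m)" "d : D" "!!f n. f : D ==> homog n f ==> EX c a. c ~: P & c * f - a * d : X"
    using local_generator_num[OF P u LD D] by blast
  obtain b l N where b: "phi' = Fract b (u ^ l)" "b : E" "homog N b" "!!f n. f : E ==> homog n f ==> EX c a. c ~: P & c * f - a * b : X"
    using local_generator_num[OF P u LE E] by blast
  obtain g i M where g: "Fract (h ^ k) (?v ^ k) = Fract g (?v ^ i)" "g : E" "homog M g" "!!f n. f : E ==> homog n f ==> EX c a. c ~: P & c * f - a * g : X"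
    using local_generator_num[OF P j LEj E] by blast
  have "h ^ k * ?v ^ i - g * ?v ^ k = 0" using g(1) by (simp add: eq_fract)
  then have hv: "h ^ k * ?v ^ i - g * ?v ^ k : X" using ideal_0[OF idX] by simp
  have db: "d * q * u ^ l - p * b * u ^ m : X"
    using d(1) b(1) u0 q0 gm by (simp add: algebra_simps generic_max_num[of _ "u ^ m * (q * u ^ l)"])
  note P_I = rp_mult[OF rP] rp_power[OF rP] u j
  obtain c a where c: "c ~: P" "c * g - a * b : X" using b(4)[OF g(2,3)] by blast
  have "(c * ?v ^ i * u ^ m) * (p * h ^ k) - (a * ?v ^ k * u ^ l) * (d * q) = (u ^ m * p * ?v ^ k) * (c * g - a * b)
      + (- a * ?v ^ k) * (d * q * u ^ l - p * b * u ^ m) + (c * u ^ m * p) * (h ^ k * ?v ^ i - g * ?v ^ k)" by (simp add: algebra_simps)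
  also have "... : X" by (intro ideal_add[OF idX] ideal_mult[OF idX] c(2) db hv)
  finally show "EX c s. c ~: P & s : D & (EX t. c * (p * h ^ k) - t * (s * q) : X)"
    using d(2) c(1) P_I by (intro exI[of _ "c * ?v ^ i * u ^ m"] exI[of _ d]) auto
  show "EX c a. c ~: P & c * (f * q) - a * (p * h ^ k) : X" if f: "f : D" "homog n f"
  proof -
    obtain c a where c: "c ~: P" "c * f - a * d : X" using d(3)[OF f] by blast
    obtain c' a' where c': "c' ~: P" "c' * b - a' * g : X" using g(4)[OF b(2,3)] by blast
    have "(c * u ^ l * c' * ?v ^ k) * (f * q) - (a * u ^ m * a' * ?v ^ i) * (p * h ^ k) = (u ^ l * c' * ?v ^ k * q) * (c * f - a * d)
        + (a * c' * ?v ^ k) * (d * q * u ^ l - p * b * u ^ m) + (a * ?v ^ k * p * u ^ m) * (c' * b - a' * g)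
        + (- a * p * u ^ m * a') * (h ^ k * ?v ^ i - g * ?v ^ k)" by (simp add: algebra_simps)
    also have "... : X" by (intro ideal_add[OF idX] ideal_mult[OF idX] c(2) c'(2) db hv)
    finally have "(c * u ^ l * c' * ?v ^ k) * (f * q) - (a * u ^ m * a' * ?v ^ i) * (p * h ^ k) : X" .
    moreover have "c * u ^ l * c' * ?v ^ k ~: P" using c(1) c'(1) P_I by simp
    ultimately show ?thesis by blast
  qed
qed

text \<open>No point contains all \<open>c\<close> with \<open>c * f\<close> in \<open>A\<close>, so
  these form an ideal with a power of every variable, and \<open>A\<close> is saturated. This passes
  from local to global membership.\<close>

lemma colon_saturated:
  assumes A: "homog_ideal A" "saturation A = A" "X \<subseteq> A" and f: "homog e f"
    and loc: "!!P. P : points X ==> EX c. c ~: P & c * f : A"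
  shows "f : A"
proof -
  have "points {c. c * f : A} = {}" using A(3) loc by (fastforce simp: equals0I ideal_mult'[OF homog_ideal_ideal[OF A(1)]] points_def)
  then obtain N where "!!i. var i ^ N * f : A" using irrelevant_power[OF homog_ideal_colon[OF A(1) f]] by blast
  then show ?thesis using A(2) saturation_def by blast
qed

text \<open>The divisor \<open>D\<close> has local equations \<open>(p / q) h ^ k\<close>, so
  locally \<open>q\<close> divides \<open>p * h ^ k\<close> modulo \<open>X\<close>. Since
  \<open>(q, G)\<close> is saturated the division is global, and its quotient is a form
  \<open>H\<close> of degree \<open>k\<close> cutting out \<open>D\<close>.\<close>

lemma equiv_principal:
  assumes eq: "equiv_hyperplane_multiple X D" and rD: "relevant_prime D"
  shows "EX k H. homog k H & k > 0 & H ~: X & D = gen (insert H X)"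
proof -
  obtain k H0 E where 1: "hyperplane_section X H0" "divisor_sum X {()} (%_. k) (%_. H0) E" "lin_equiv X D E"
    using eq unfolding equiv_hyperplane_multiple_def by blast
  obtain h where h: "homog 1 h" "h ~: X" "H0 = gen (insert h X)"
    using 1(1) saturated_insert unfolding hyperplane_section_def by blast
  have E: "ideal E" using 1(3) by (simp add: lin_equiv_def effective_cartier_def subscheme_of_def closed_subscheme_def homog_ideal_ideal)
  have XD: "X \<subseteq> D" using 1(3) by (simp add: lin_equiv_def effective_cartier_def subscheme_of_def)
  have idD: "ideal D" by (rule rp_ideal[OF rD])
  have LE: "local_generator X E (var j) (Fract (h ^ k) (var j ^ k))" for j
  proof -
    have L: "local_generator X H0 (var j) (Fract h (var j ^ 1))" unfolding h(3) by (rule local_generator_var[OF h(1,2)])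
    then have "basic_open (var j)" by (simp add: local_generator_def)
    moreover have all: "ALL u phi. basic_open u & (ALL i:{()}. local_generator X H0 u (phi i)) --> local_generator X E u (PROD i:{()}. phi i ^ k)"
      by (rule conjunct2[OF 1(2)[unfolded divisor_sum_def]])
    ultimately have "local_generator X E (var j) (PROD i:{()}. Fract h (var j ^ 1) ^ k)"
      using L by (intro all[rule_format, of "var j" "%_. Fract h (var j ^ 1)"]) simp
    then show ?thesis by (simp add: Fract_power)
  qed
  obtain psi where psi: "psi : generic_ring X" "psi ~: generic_max X"
    and loc: "!!P. P : points X ==> EX u phi phi'. u ~: P & local_generator X D u phi & local_generator X E u phi' & phi - psi * phi' : generic_max X"
    using 1(3) unfolding lin_equiv_def by blast
  obtain p q e where pq: "psi = Fract p q" "homog e p" "homog e q" "q ~: X" using psi(1) unfolding generic_ring_def by blast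
  have p: "p ~: X" using psi(2) pq unfolding generic_max_def by blast
  have l1: "EX c s. c ~: P & s : D & (EX t. c * (p * h ^ k) - t * (s * q) : X)"
    and l2: "!!f n. f : D ==> homog n f ==> EX c a. c ~: P & c * (f * q) - a * (p * h ^ k) : X" if P: "P : points X" for P
  proof -
    obtain u phi phi' where u: "u ~: P" "local_generator X D u phi" "local_generator X E u phi'" "phi - Fract p q * phi' : generic_max X"
      using loc[OF P] pq(1) by blast
    obtain j where j: "var j ~: P" using P by (auto simp: points_def relevant_prime_def)
    note el = equiv_local[OF P u pq(4) j LE idD E]
    show "EX c s. c ~: P & s : D & (EX t. c * (p * h ^ k) - t * (s * q) : X)" by (rule el(1))
    show "!!f n. f : D ==> homog n f ==> EX c a. c ~: P & c * (f * q) - a * (p * h ^ k) : X" by (rule el(2))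
  qed
  have hph: "homog (e + k) (p * h ^ k)" using homog_mult[OF pq(2) homog_power[OF h(1), of k]] by simp
  have "p * h ^ k : gen (insert q X)"
  proof (rule colon_saturated[OF homog_ideal_insert[OF hX pq(3)] saturated_insert[OF pq(4)] gen_insert_sup(1)[OF idX] hph])
    fix P assume "P : points X"
    then obtain c s t where cs: "c ~: P" "c * (p * h ^ k) - t * (s * q) : X" using l1 by blast
    have "(t * s) * q + (c * (p * h ^ k) - t * (s * q)) : gen (insert q X)" by (rule gen_insertI[OF idX cs(2)])
    then show "EX c. c ~: P & c * (p * h ^ k) : gen (insert q X)" using cs(1) algebra_simps by auto
  qed
  then obtain H x where Hx: "p * h ^ k = H * q + x" "x : X" "homog k H"
    using gen_insert_homogE[OF hX pq(3) _ hph] by (metis add_diff_cancel_left' le_add1)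
  have HX: "H ~: X" by (metis Hx(1) Hx(2) p h(2) ideal_add[OF idX] ideal_mult'[OF idX] rp_mult[OF rX] rp_power[OF rX])
  have cancel: "w : X" if "q * w : X" for w using that pq(4) by (simp add: rp_mult[OF rX])
  have sub: "H : D"
  proof -
    \<comment> \<open>The local congruence is used at the generic point \<open>D\<close> itself;
      \<open>c\<close> lies outside the prime \<open>D\<close> and can be cancelled.\<close>
    obtain c s t where cs: "c ~: D" "s : D" "c * (p * h ^ k) - t * (s * q) : X" using rD XD l1 points_def by blast
    have "q * (c * H - t * s) = (c * (p * h ^ k) - t * (s * q)) - c * x" unfolding Hx(1) by (simp add: algebra_simps)
    also have "... : X" by (intro ideal_diff[OF idX] cs(3) ideal_mult[OF idX] Hx(2))
    finally have "c * H - t * s : D" using cancel XD by blast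
    then have "(c * H - t * s) + t * s : D" by (intro ideal_add[OF idD] ideal_mult[OF idD] cs(2))
    then show ?thesis using cs(1) by (simp add: rp_mult[OF rD])
  qed
  have "D = gen (insert H X)"
  proof
    show "gen (insert H X) \<subseteq> D" using sub XD by (intro rm.span_minimal idD) auto
    show "D \<subseteq> gen (insert H X)"
    proof
      fix f assume f: "f : D"
      have "hc n f : gen (insert H X)" for n
      proof (rule colon_saturated[OF homog_ideal_insert[OF hX Hx(3)] saturated_insert[OF HX] gen_insert_sup(1)[OF idX] homog_hc])
        fix P assume "P : points X"
        moreover have "hc n f : D" by (rule homog_idealD[OF rp_homog[OF rD] f])
        ultimately obtain c a where ca: "c ~: P" "c * (hc n f * q) - a * (p * h ^ k) : X" using l2 homog_hc by blast
        have "q * (c * hc n f - a * H) = (c * (hc n f * q) - a * (p * h ^ k)) + a * x" unfolding Hx(1) by (simp add: algebra_simps)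
        also have "... : X" by (intro ideal_add[OF idX] ca(2) ideal_mult[OF idX] Hx(2))
        finally have "c * hc n f - a * H : X" by (rule cancel)
        then have "a * H + (c * hc n f - a * H) : gen (insert H X)" by (rule gen_insertI[OF idX])
        then show "EX c. c ~: P & c * hc n f : gen (insert H X)" using ca(1) by (auto intro!: exI[of _ c])
      qed
      then show "f : gen (insert H X)" by (rule homog_ideal_memI[OF ideal_gen])
    qed
  qed
  moreover have "k > 0"
  proof (rule ccontr)
    \<comment> \<open>For \<open>k = 0\<close> the form \<open>H\<close> would be a nonzero constant
      and \<open>D\<close> the unit ideal.\<close>
    assume "~ k > 0"
    then have c: "H = const (lk H 0)" using Hx(3) homog_0_const by blast
    have "lk H 0 ~= 0" by (metis HX c ideal_0[OF idX] const_0)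
    then have "1 : D" by (metis c const_1 const_mult left_inverse ideal_mult[OF idD sub])
    then show False using rp_1[OF rD] by blast
  qed
  ultimately show ?thesis using Hx(3) HX by blast
qed

lemma Fract_prod_power:
  "(PROD i:A. Fract (H i) (v ^ k i) ^ r i) = Fract (PROD i:A. H i ^ r i) (v ^ (SUM i:A. k i * r i) :: mpoly)"
  by (induction A rule: infinite_finite_induct)
    (simp_all add: Fract_power power_add power_mult)

text \<open>On the chart of each \<open>var j\<close> the product, divided by a power of
  \<open>var j\<close>, is the local equation of the sum, so some power of every variable times the
  product lies in \<open>S\<close>.\<close>

lemma divisor_sum_equation:
  assumes ds: "divisor_sum X A r D S" and D: "!!i. i : A ==> D i = gen (insert (H i) X) & homog (k i) (H i) & H i ~: X"
  shows "(PROD i:A. H i ^ r i) : S"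
proof -
  have S: "ideal S" "saturation S = S" using ds by (auto simp: divisor_sum_def effective_cartier_def subscheme_of_def closed_subscheme_def homog_ideal_ideal)
  let ?F = "PROD i:A. H i ^ r i"
  have "EX n. var j ^ n * ?F : S" for j
  proof -
    have "ALL i:A. local_generator X (D i) (var j) (Fract (H i) (var j ^ k i))" using D local_generator_var by simp
    moreover have "basic_open (var j)" unfolding basic_open_def by (auto intro!: exI[of _ 1])
    moreover have all: "ALL u phi. basic_open u & (ALL i:A. local_generator X (D i) u (phi i)) --> local_generator X S u (PROD i:A. phi i ^ r i)"
      by (rule conjunct2[OF ds[unfolded divisor_sum_def]])
    ultimately have "local_generator X S (var j) (PROD i:A. Fract (H i) (var j ^ k i) ^ r i)"
      by (intro all[rule_format, of "var j" "%i. Fract (H i) (var j ^ k i)"]) simp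
    then have "Fract ?F (var j ^ (SUM i:A. k i * r i)) : sections S (var j)" unfolding Fract_prod_power by (rule local_generator_mem)
    then obtain f n where f: "Fract ?F (var j ^ (SUM i:A. k i * r i)) = Fract f (var j ^ n)" "f : S"
      unfolding sections_def by blast
    then have "var j ^ n * ?F : S" by (simp add: eq_fract ideal_mult'[OF S(1) f(2)] mult.commute[of "var j ^ n"])
    then show ?thesis by blast
  qed
  then show ?thesis using S(2) saturation_def by auto
qed

lemma has_hp_X: "has_hp X (dpoly g hp4)"
  unfolding X gen_insert_zero[symmetric]
  by (rule has_hp_nzd[OF homog_ideal_zero G(1) _ has_hp_zero]) (use G(2) in auto)

lemma has_hp_insert: "homog k H ==> H ~: X ==> has_hp (gen (insert H X)) (dpoly k (dpoly g hp4))"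
  by (rule has_hp_nzd[OF hX _ _ has_hp_X]) (use rX in \<open>auto simp: relevant_prime_def\<close>)

lemma dpoly_X: "degree (dpoly g hp4) = 3" "lead_coeff (dpoly g hp4) = real g / 6"
proof -
  have d: "degree hp4 = Suc 3" using hp4_degree by simp
  show "degree (dpoly g hp4) = 3" using dpoly_degree[OF d G(3)] by (rule conjunct1)
  show "lead_coeff (dpoly g hp4) = real g / 6" using dpoly_degree[OF d G(3)] conjunct2 hp4_degree(2) by auto
qed

lemma dpoly_insert:
  assumes k: "k > 0"
  shows "degree (dpoly k (dpoly g hp4)) = 2" "lead_coeff (dpoly k (dpoly g hp4)) = real (g * k) / 2"
proof -
  have d: "degree (dpoly g hp4) = Suc 2" using dpoly_X by simp
  show "degree (dpoly k (dpoly g hp4)) = 2" using dpoly_degree[OF d k] by (rule conjunct1)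
  show "lead_coeff (dpoly k (dpoly g hp4)) = real (g * k) / 2" using dpoly_degree[OF d k] conjunct2 dpoly_X(2) by auto
qed

lemma proj_degree_insert:
  assumes "k > 0" "homog k H" "H ~: X" shows "proj_degree (gen (insert H X)) = real (g * k)"
  using proj_degree_eq[OF has_hp_insert[OF assms(2,3)]] dpoly_insert(2)[OF assms(1)] dpoly_insert(1)[OF assms(1)] by auto

end

theorem divisor_setting_equations:
  assumes ds: "divisor_setting X l D r s S"
  shows "EX G g H k. relevant_prime X & X = gen {G} & homog g G & g > 0 & G ~= 0 & G : S & (PROD i:{1..l}. H i ^ r i) : S &
    (ALL i:{1..l}. homog (k i) (H i) & k i > 0 & H i ~: X & relevant_prime (gen (insert (H i) X)) & s i = g * k i)"
proof -
  have Xi: "integral_subscheme X" "has_dim X 3" and XS: "divisor_sum X {1..l} r D S"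
    and Di: "!!i. i : {1..l} ==> integral_subscheme (D i) & equiv_hyperplane_multiple X (D i) & proj_degree (D i) = real (s i)"
    using ds unfolding divisor_setting_def by blast+
  have rX: "relevant_prime X" using Xi(1) by (simp add: integral_subscheme_def)
  obtain G g where Gg: "homog g G" "g > 0" "G ~= 0" "X = gen {G}" using threefold_principal[OF Xi] by blast
  interpret hypersurface X G g by (rule hypersurface.intro[OF Gg(1,3,2,4) rX])
  have "EX k H. homog k H & k > 0 & H ~: X & D i = gen (insert H X)" if "i : {1..l}" for i
    using equiv_principal Di[OF that] by (simp add: integral_subscheme_def)
  then obtain k H where kH: "!!i. i : {1..l} ==> homog (k i) (H i) & k i > 0 & H i ~: X & D i = gen (insert (H i) X)" by metis
  have "s i = g * k i" if i: "i : {1..l}" for i by (metis Di[OF i] kH[OF i] proj_degree_insert[of "k i" "H i"] of_nat_eq_iff)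
  moreover have "relevant_prime (gen (insert (H i) X))" if "i : {1..l}" for i using Di[OF that] kH[OF that] by (simp add: integral_subscheme_def)
  moreover have "(PROD i:{1..l}. H i ^ r i) : S" by (rule divisor_sum_equation[OF XS]) (use kH in blast)
  moreover have "G : S" using XS GX by (auto simp: divisor_sum_def effective_cartier_def subscheme_of_def)
  ultimately have "relevant_prime X & X = gen {G} & homog g G & g > 0 & G ~= 0 & G : S & (PROD i:{1..l}. H i ^ r i) : S &
    (ALL i:{1..l}. homog (k i) (H i) & k i > 0 & H i ~: X & relevant_prime (gen (insert (H i) X)) & s i = g * k i)"
    using kH by (intro conjI ballI Gg rX) simp_all
  then show ?thesis by (intro exI)
qed

section \<open>Localization at polynomials in few variables\<close>

definition subring :: "'a::comm_ring_1 set => bool" where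
  "subring B \<longleftrightarrow> 0 : B & 1 : B & (ALL a:B. ALL b:B. a + b : B & a * b : B)"

lemma subring_prod: "subring B ==> (!!i. i : A ==> f i : B) ==> prod f A : B"
  by (induction A rule: infinite_finite_induct) (auto simp: subring_def)

lemma subring_sum: "subring B ==> (!!i. i : A ==> f i : B) ==> sum f A : B"
  by (induction A rule: infinite_finite_induct) (auto simp: subring_def)

lemma subring_power: "subring B ==> a : B ==> a ^ n : B"
  by (induction n) (auto simp: subring_def)

lemma subring_range: "rhom h ==> subring (range h)"
  unfolding subring_def by (metis (no_types, lifting) rangeE rangeI rhom_0 rhom_1 rhom_add rhom_mult)

text \<open>The polynomials in the variables of \<open>S\<close>, described by monomials so that
  homogeneous components of a member visibly stay in the subring.\<close>

definition Av :: "5 set => mpoly set" where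
  "Av S = {f. ALL m:supp f. ALL i. i ~: S --> lk m i = 0}"

lemma subring_Av: "subring (Av S)"
proof -
  have "a * b : Av S" if "a : Av S" "b : Av S" for a b
    unfolding Av_def
  proof (intro CollectI ballI allI impI)
    fix m i assume "m : supp (a * b)" "i ~: S"
    moreover from this obtain x y where "x : supp a" "y : supp b" "m = x + y" using supp_mult by blast
    ultimately show "lk m i = 0" using that by (simp add: Av_def lookup_add)
  qed
  moreover have "a + b : Av S" if "a : Av S" "b : Av S" for a b
    using that supp_addD[of _ a b] unfolding Av_def by blast
  moreover have "0 : Av S" by (simp add: Av_def)
  moreover have "1 : Av S" by (simp add: Av_def)
  ultimately show ?thesis unfolding subring_def by blast
qed

lemma Av_const: "const c : Av S" by (auto simp: Av_def const_def)
lemma Av_var: "i : S ==> var i : Av S" by (auto simp: Av_def var_def lookup_single when_def)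

lemma Av_least:
  assumes B: "subring B" "!!c. const c : B" "!!i. i : S ==> var i : B" shows "Av S \<subseteq> B"
proof
  fix f assume f: "f : Av S"
  have "meval var m : B" if m: "m : supp f" for m
    unfolding meval_def
  proof (rule subring_prod[OF B(1)])
    fix i :: 5
    show "var i ^ lk m i : B"
    proof (cases "i : S")
      case True then show ?thesis by (intro subring_power[OF B(1)] B(3))
    next
      case False
      then show ?thesis using f m B(1) by (simp add: Av_def subring_def)
    qed
  qed
  then have "(SUM m:supp f. const (lk f m) * meval var m) : B"
    using B(1,2) by (intro subring_sum) (auto simp: subring_def)
  then show "f : B" by (simp flip: mpoly_expand)
qed

lemma subring_pe: "subring B ==> rhom psi ==> (!!a. psi a : B) ==> x : B ==> pe psi x p : B"
  by (induction p) (auto simp: pe_pCons subring_def)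

section \<open>Fields of fractions inside the rational functions\<close>

definition fext :: "('a::idom => 'b::field) => 'a fract => 'b" where
  "fext h x = (SOME y. EX a b. b ~= 0 & x = Fract a b & y = h a / h b)"

lemma fext_Fract:
  assumes h: "rhom h" "!!a. h a = 0 ==> a = 0" and b: "b ~= 0"
  shows "fext h (Fract a b) = h a / h b"
proof -
  have "EX y. EX a' b'. b' ~= 0 & Fract a b = Fract a' b' & y = h a' / h b'" using b by blast
  then have "EX a' b'. b' ~= 0 & Fract a b = Fract a' b' & fext h (Fract a b) = h a' / h b'"
    unfolding fext_def by (rule someI_ex)
  then obtain a' b' where ab: "b' ~= 0" "Fract a b = Fract a' b'" "fext h (Fract a b) = h a' / h b'" by blast
  have "a * b' = a' * b" using ab(1,2) b by (simp add: eq_fract)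
  then show ?thesis by (metis h(2) b ab(1) ab(3) rhom_mult[OF h(1)] frac_eq_eq)
qed

lemma fext_rhom:
  assumes h: "rhom h" "!!a. h a = 0 ==> a = 0"
  shows "rhom (fext h)"
  unfolding rhom_def
proof (intro conjI allI)
  note F = fext_Fract[OF h]
  have hn: "b ~= 0 ==> h b ~= 0" for b using h(2) by blast
  show "fext h 1 = 1" using F[of 1 1] by (simp add: rhom_1[OF h(1)])
  fix x y :: "'a fract"
  obtain a b where x: "x = Fract a b" "b ~= 0" by (cases x)
  obtain c d where y: "y = Fract c d" "d ~= 0" by (cases y)
  show "fext h (x + y) = fext h x + fext h y"
    using x y hn[of b] hn[of d] by (simp add: F rhom_add[OF h(1)] rhom_mult[OF h(1)] add_frac_eq)
  show "fext h (x * y) = fext h x * fext h y"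
    using x y by (simp add: F rhom_mult[OF h(1)])
qed

lemma emb_divide: "q ~= 0 ==> emb p / emb q = Fract p (q :: 'a::idom)"
  by (simp add: divide_fract)

text \<open>Vector spaces need a type of scalars, so the field of fractions of \<open>A\<close> is
  presented as a type \<open>'k\<close> with an embedding \<open>iota\<close> into the rational
  functions whose image is the set of fractions over \<open>A\<close>.\<close>

locale subfield =
  fixes iota :: "'k::field => mpoly fract" and A :: "mpoly set"
  assumes iota: "rhom iota" and rng: "range iota = {Fract p q | p q. p : A & q : A & q ~= 0}" and A: "subring A"
begin

abbreviation sc :: "'k => mpoly fract => mpoly fract" where "sc c x \<equiv> iota c * x"

sublocale vs: vector_space sc
  by unfold_locales (simp_all add: rhom_add[OF iota] rhom_mult[OF iota] rhom_1[OF iota] algebra_simps)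

lemma A_closed: "0 : A" "1 : A" "a : A ==> b : A ==> a + b : A" "a : A ==> b : A ==> a * b : A"
  using A by (auto simp: subring_def)

lemma scalar: "p : A ==> q : A ==> q ~= 0 ==> EX c. iota c = Fract p q"
  using rng by (auto simp: set_eq_iff image_iff) metis

lemma iota_0: "iota c = 0 \<longleftrightarrow> c = 0" by (rule rhom_field_inj[OF iota]) simp

text \<open>Localization of \<open>M\<close> at the nonzero elements of \<open>A\<close>, realized
  inside the rational functions since \<open>M\<close> is a set of polynomials.\<close>

definition loc :: "mpoly set => mpoly fract set" where
  "loc M = {Fract f q | f q. f : M & q : A & q ~= 0}"

definition submod :: "mpoly set => bool" where
  "submod M \<longleftrightarrow> 0 : M & (ALL a:M. ALL b:M. a + b : M) & (ALL q:A. ALL a:M. q * a : M)"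

lemma submod_sum: "submod M ==> (!!i. i : S ==> f i : M) ==> sum f S : M"
  by (induction S rule: infinite_finite_induct) (auto simp: submod_def)

lemma submod_ideal: "ideal M ==> submod M" by (simp add: submod_def ideal_0 ideal_add ideal_mult)

lemma submod_Int: "submod M ==> submod N ==> submod (M Int N)" by (auto simp: submod_def)

lemma submod_plus: "submod M ==> submod N ==> submod {a + b | a b. a : M & b : N}"
proof -
  assume M: "submod M" and N: "submod N"
  show ?thesis unfolding submod_def
  proof (intro conjI ballI)
    show "0 : {a + b | a b. a : M & b : N}" using M N by (auto simp: submod_def intro!: exI[of _ 0])
    fix x assume "x : {a + b | a b. a : M & b : N}"
    then obtain a b where x: "x = a + b" "a : M" "b : N" by blast
    show "q * x : {a + b | a b. a : M & b : N}" if "q : A" for q using x that M N by (fastforce simp: submod_def distrib_left)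
    fix y assume "y : {a + b | a b. a : M & b : N}"
    then obtain c d where y: "y = c + d" "c : M" "d : N" by blast
    have "x + y = (a + c) + (b + d)" by (simp add: x y)
    then show "x + y : {a + b | a b. a : M & b : N}" using x y M N unfolding submod_def by blast
  qed
qed

lemma emb_loc: "f : M ==> emb f : loc M" unfolding loc_def using A_closed by force

lemma emb_locD: "emb f : loc M ==> EX q:A. q ~= 0 & q * f : M"
proof -
  assume "emb f : loc M"
  then obtain g q where "emb f = Fract g q" "g : M" "q : A" "q ~= 0" unfolding loc_def by blast
  then show ?thesis by (intro bexI[of _ q]) (simp_all add: eq_fract mult.commute)
qed

lemma loc_mono: "M \<subseteq> N ==> loc M \<subseteq> loc N" unfolding loc_def by blast

lemma Fract_scale: "q : A ==> q ~= 0 ==> EX c. Fract f q = sc c (emb f)"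
proof -
  assume q: "q : A" "q ~= 0"
  obtain c where "iota c = Fract 1 q" using scalar[OF A_closed(2) q] by (elim exE)
  then have "Fract f q = sc c (emb f)" by simp
  then show ?thesis by blast
qed

lemma loc_minimal: "vs.subspace V ==> (!!f. f : M ==> emb f : V) ==> loc M \<subseteq> V"
proof
  fix x assume V: "vs.subspace V" "!!f. f : M ==> emb f : V" and "x : loc M"
  then obtain f q where x: "x = Fract f q" "f : M" "q : A" "q ~= 0" unfolding loc_def by blast
  obtain c where "Fract f q = sc c (emb f)" using Fract_scale[OF x(3,4), of f] by (elim exE)
  then show "x : V" using vs.subspace_scale[OF V(1) V(2)[OF x(2)]] x(1) by simp
qed

lemma loc_subspace: assumes M: "submod M" shows "vs.subspace (loc M)"
proof (rule vs.subspaceI)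
  show "0 : loc M" using emb_loc[of 0 M] M by (simp add: submod_def)
  fix x assume "x : loc M"
  then obtain f q where x: "x = Fract f q" "f : M" "q : A" "q ~= 0" unfolding loc_def by blast
  show "sc c x : loc M" for c
  proof -
    obtain p r where pr: "iota c = Fract p r" "p : A" "r : A" "r ~= 0" using rng by blast
    show ?thesis using pr x M by (fastforce simp: A_closed submod_def loc_def)
  qed
  fix y assume "y : loc M"
  then obtain g r where y: "y = Fract g r" "g : M" "r : A" "r ~= 0" unfolding loc_def by blast
  have "x + y = Fract (r * f + q * g) (q * r)" using x y by (simp add: mult.commute)
  moreover have "r * f + q * g : M" "q * r : A" "q * r ~= 0" using x y M A_closed by (auto simp: submod_def)
  ultimately show "x + y : loc M" unfolding loc_def by blast
qed

text \<open>A relation with fractional coefficients becomes one over \<open>A\<close> after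
  multiplication by a common denominator \<open>t\<close>; membership in \<open>loc M\<close> costs
  one further factor \<open>q\<close>.\<close>

lemma qindep_loc:
  assumes M: "submod M" and B: "finite B"
  shows "qindep sc (emb ` B) (loc M) \<longleftrightarrow> (ALL q. (ALL b:B. q b : A) & (SUM b:B. q b * b) : M --> (ALL b:B. q b = 0))"
    (is "?L \<longleftrightarrow> ?R")
proof
  have inj: "inj_on emb B" by (rule inj_onI) (simp add: emb_eq)
  assume L: ?L
  show ?R
  proof (intro allI impI ballI)
    fix q b assume q: "(ALL b:B. q b : A) & (SUM b:B. q b * b) : M" and b: "b : B"
    have "EX c. ALL b:B. iota (c b) = emb (q b)"
      using scalar[of "q _" 1] q A_closed by (intro bchoice) auto
    then obtain c where c: "!!b. b : B ==> iota (c b) = emb (q b)" by blast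
    define c' where "c' x = c (the_inv_into B emb x)" for x
    have c': "c' (emb b) = c b" if "b : B" for b unfolding c'_def using the_inv_into_f_f[OF inj that] by simp
    have "(SUM x:emb ` B. sc (c' x) x) = (SUM b:B. emb (q b) * emb b)"
      unfolding sum.reindex[OF inj] by (rule sum.cong) (simp_all add: c c')
    also have "... = emb (SUM b:B. q b * b)" unfolding rhom_sum[OF rhom_emb] by simp
    also have "... : loc M" using q emb_loc by blast
    finally have "c' (emb b) = 0" using qindepD[OF L] b by blast
    then show "q b = 0" using c[OF b] c'[OF b] rhom_0[OF iota] by (simp add: emb_eq_0)
  qed
next
  have inj: "inj_on emb B" by (rule inj_onI) (simp add: emb_eq)
  assume R: ?R
  show ?L unfolding qindep_def
  proof (intro conjI allI impI)
    show "finite (emb ` B)" using B by simp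
    fix c assume c: "(SUM b:emb ` B. sc (c b) b) : loc M"
    have "EX p r. iota (c (emb b)) = Fract p r & p : A & r : A & r ~= 0" for b
      using rng by (auto simp: set_eq_iff image_iff)
    then obtain p r where pr: "!!b. iota (c (emb b)) = Fract (p b) (r b) & p b : A & r b : A & r b ~= 0" by metis
    define s where "s b = (PROD b':B - {b}. r b')" for b
    define t where "t = (PROD b':B. r b')"
    have t: "t = r b * s b" if "b : B" for b unfolding t_def s_def by (rule prod.remove[OF B that])
    have sA: "s b : A" "s b ~= 0" for b unfolding s_def using pr B by (auto intro!: subring_prod[OF A])
    have t0: "t : A" "t ~= 0" unfolding t_def using pr B by (auto intro!: subring_prod[OF A])
    have "(SUM b:emb ` B. sc (c b) b) = (SUM b:B. Fract (p b) (r b) * emb b)"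
      unfolding sum.reindex[OF inj] by (rule sum.cong) (simp_all add: pr)
    also have "... = (SUM b:B. Fract 1 t * emb (p b * s b * b))"
      using t pr sA by (intro sum.cong) (auto simp: eq_fract)
    also have "... = Fract (SUM b:B. p b * s b * b) t"
      unfolding sum_distrib_left[symmetric] rhom_sum[OF rhom_emb, symmetric] by simp
    finally obtain f q where f: "Fract (SUM b:B. p b * s b * b) t = Fract f q" "f : M" "q : A" "q ~= 0"
      using c unfolding loc_def by auto
    have "(SUM b:B. p b * s b * b) * q = t * f" using f t0 by (simp add: eq_fract mult.commute)
    then have "(SUM b:B. (q * (p b * s b)) * b) = t * f" unfolding sum_distrib_right by (simp add: mult_ac)
    also have "... : M" using f(2) t0(1) M by (simp add: submod_def)
    finally have m: "(SUM b:B. (q * (p b * s b)) * b) : M" .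
    have "ALL b:B. q * (p b * s b) : A" using pr sA(1) by (intro ballI A_closed(4) f(3)) blast+
    then have "ALL b:B. q * (p b * s b) = 0" using m R[THEN spec, of "%b. q * (p b * s b)"] by (elim mp) (rule conjI)
    then have "iota (c (emb b)) = 0" if "b : B" for b using that sA f(4) pr fract_collapse by auto
    then show "ALL b:emb ` B. c b = 0" using iota_0 by blast
  qed
qed

end

lemma subfield_fext:
  fixes h :: "'a::idom => mpoly"
  assumes h: "rhom h" "!!a. h a = 0 ==> a = 0" and A: "range h = A"
  shows "subfield (fext (%p. emb (h p))) A"
proof
  have r: "rhom (%p. emb (h p))" by (rule rhom_comp[OF rhom_emb h(1)])
  have i: "emb (h a) = 0 ==> a = 0" for a using h(2) by (simp add: emb_eq_0)
  show "rhom (fext (%p. emb (h p)))" by (rule fext_rhom[OF r i])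
  show "subring A" unfolding A[symmetric] by (rule subring_range[OF h(1)])
  have F: "fext (%p. emb (h p)) (Fract a b) = Fract (h a) (h b)" if b: "b ~= 0" for a b
  proof -
    have "h b ~= 0" using h(2) b by blast
    have "fext (%p. emb (h p)) (Fract a b) = emb (h a) / emb (h b)" by (rule fext_Fract[OF r]) (use i b in auto)
    also have "... = Fract (h a) (h b)" by (rule emb_divide[OF \<open>h b ~= 0\<close>])
    finally show ?thesis .
  qed
  show "range (fext (%p. emb (h p))) = {Fract p q | p q. p : A & q : A & q ~= 0}"
  proof
    show "range (fext (%p. emb (h p))) \<subseteq> {Fract p q | p q. p : A & q : A & q ~= 0}"
    proof
      fix y assume "y : range (fext (%p. emb (h p)))"
      then obtain x where y: "y = fext (%p. emb (h p)) x" by blast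
      obtain a b where x: "x = Fract a b" "b ~= 0" by (cases x)
      then show "y : {Fract p q | p q. p : A & q : A & q ~= 0}" using F h(2) y A[symmetric] by blast
    qed
    show "{Fract p q | p q. p : A & q : A & q ~= 0} \<subseteq> range (fext (%p. emb (h p)))"
    proof
      fix y assume "y : {Fract p q | p q. p : A & q : A & q ~= 0}"
      then obtain a b where y: "y = Fract (h a) (h b)" "h b ~= 0" unfolding A[symmetric] by blast
      then have "y = fext (%p. emb (h p)) (Fract a b)" by (metis F y rhom_0[OF h(1)])
      then show "y : range (fext (%p. emb (h p)))" by blast
    qed
  qed
qed

abbreviation mo :: "mon => mpoly" where "mo m \<equiv> sng m 1"

lemma lk_mult_mo: "lk (f * mo mu) (nu + mu) = lk (f :: mpoly) nu"
proof -
  have "f * mo mu = (SUM m:supp f. sng (m + mu) (lk f m))"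
    by (subst (1) pm_decomp[of f]) (simp add: sum_distrib_right mult_single)
  then have "lk (f * mo mu) (nu + mu) = (SUM m:supp f. lk (sng (m + mu) (lk f m)) (nu + mu))" by (simp add: lookup_sum)
  also have "... = (SUM m:supp f. if m = nu then lk f nu else 0)"
    by (rule sum.cong) (auto simp: lookup_single when_def)
  also have "... = lk f nu" by (auto simp: in_keys_iff)
  finally show ?thesis .
qed

locale monofield = subfield iota "Av S" for iota :: "'k::field => mpoly fract" and S
begin

definition inn :: "mon => mon" where "inn m = part (%i. i : S) m"
definition out :: "mon => mon" where "out m = part (%i. i ~: S) m"

lemma lk_inn: "lk (inn m) i = (if i : S then lk m i else 0)" by (simp add: inn_def lk_part)
lemma lk_out: "lk (out m) i = (if i : S then 0 else lk m i)" by (simp add: out_def lk_part)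

lemma inn_out: "inn m + out m = m"
  by (rule poly_mapping_eqI) (simp add: lookup_add lk_inn lk_out)

lemma sng_inn_out: "sng m c = sng (inn m) c * mo (out m)" by (simp add: mult_single inn_out)

lemma sng_inn_Av: "sng (inn m) c : Av S" by (auto simp: Av_def lk_inn)

text \<open>For monomials \<open>B\<close> without variables of \<open>S\<close> this is the
  \<open>Av S\<close>-module they span: the inner part of each monomial goes into the coefficient,
  \<open>out\<close> records the rest.\<close>

definition over :: "mon set => mpoly set" where "over B = {f. ALL m:supp f. out m : B}"

lemma scale_mem: "vs.subspace V ==> q : Av S ==> emb f : V ==> emb (q * f) : V"
proof -
  assume V: "vs.subspace V" and q: "q : Av S" and f: "emb f : V"
  obtain c where "iota c = Fract q 1" using scalar[OF q A_closed(2)] by auto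
  then have "emb (q * f) = sc c (emb f)" by simp
  then show ?thesis using vs.subspace_scale[OF V f] by simp
qed

lemma mono_span:
  assumes V: "vs.subspace V" and f: "!!m. m : supp f ==> emb (mo (out m)) : V"
  shows "emb f : V"
proof -
  have "emb f = (SUM m:supp f. emb (sng m (lk f m)))"
    by (subst (1) pm_decomp[of f]) (rule rhom_sum[OF rhom_emb])
  also have "... : V"
    by (rule vs.subspace_sum[OF V]) (subst sng_inn_out, intro scale_mem[OF V] sng_inn_Av f)
  finally show ?thesis .
qed

lemma inj_emb_mo: "inj_on (%m. emb (mo m)) B"
  by (rule inj_onI) (metis emb_eq keys_single lookup_single_eq one_neq_zero singletonD singletonI)

lemma qindep_mono:
  assumes M: "submod M" and B: "finite B" "!!m i. m : B ==> i : S ==> lk m i = 0"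
  shows "qindep sc (emb ` mo ` B) (loc M) \<longleftrightarrow> (ALL f:M. f : over B --> f = 0)"
proof -
  have fin: "finite (mo ` B)" using B(1) by simp
  show ?thesis unfolding qindep_loc[OF M fin]
  proof (intro iffI ballI impI allI)
    fix f assume R: "ALL q. (ALL b:mo ` B. q b : Av S) & (SUM b:mo ` B. q b * b) : M --> (ALL b:mo ` B. q b = 0)"
      and f: "f : M" "f : over B"
    define q where "q b = (SUM m:{m:supp f. mo (out m) = b}. sng (inn m) (lk f m))" for b
    have "(SUM b:mo ` B. q b * b) = (SUM b:mo ` B. SUM m:{m:supp f. mo (out m) = b}. sng m (lk f m))"
      unfolding q_def sum_distrib_right
    proof (intro sum.cong refl)
      fix b m assume "m : {m : supp f. mo (out m) = b}"
      then show "sng (inn m) (lk f m) * b = sng m (lk f m)" using sng_inn_out[of m "lk f m"] by simp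
    qed
    also have "... = (SUM m:supp f. sng m (lk f m))"
      by (rule sum.group) (use fin f(2) in \<open>auto simp: over_def\<close>)
    also have "... = f" by (rule pm_decomp[symmetric])
    finally have s: "(SUM b:mo ` B. q b * b) = f" .
    have "q b : Av S" for b unfolding q_def by (intro subring_sum subring_Av sng_inn_Av)
    then have "ALL b:mo ` B. q b = 0" by (intro R[THEN spec, of q, THEN mp] conjI ballI) (simp_all only: s f(1))
    then show "f = 0" using s by (simp add: sum.neutral)
  next
    fix q b assume R: "ALL f:M. f : over B --> f = 0" and q: "(ALL b:mo ` B. q b : Av S) & (SUM b:mo ` B. q b * b) : M" and "b : mo ` B"
    then obtain mu where b: "b = mo mu" "mu : B" by blast
    have inj: "inj_on mo B" by (rule inj_onI) (metis keys_single one_neq_zero singletonD singletonI)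
    define f where "f = (SUM mu:B. q (mo mu) * mo mu)"
    have f: "f : M" using q unfolding f_def by (simp add: sum.reindex[OF inj])
    have sp: "EX nu:supp (q (mo mu)). m = nu + mu & out m = mu" if m: "m : supp (q (mo mu) * mo mu)" and mu: "mu : B" for m mu
    proof -
      obtain nu where n: "nu : supp (q (mo mu))" "m = nu + mu" using supp_mult[OF m] by auto
      have "lk (out m) i = lk mu i" for i
        using n q mu B(2)[OF mu, of i] by (auto simp: lk_out lookup_add Av_def)
      then show ?thesis by (metis n poly_mapping_eqI)
    qed
    have "f : over B" unfolding over_def f_def
    proof (intro CollectI ballI)
      fix m assume "m : supp (SUM mu:B. q (mo mu) * mo mu)"
      then have "EX mu:B. m : supp (q (mo mu) * mo mu)" by (rule supp_sumD)
      then obtain mu where m: "mu : B" "m : supp (q (mo mu) * mo mu)" by (elim bexE)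
      obtain nu where "out m = mu" using sp[OF m(2,1)] by (elim bexE conjE)
      then show "out m : B" using m(1) by simp
    qed
    then have f0: "f = 0" using R f by blast
    have "lk (q (mo mu)) nu = 0" for nu
    proof (rule ccontr)
      assume nz: "lk (q (mo mu)) nu ~= 0"
      have o: "out (nu + mu) = mu" using sp[OF _ b(2), of "nu + mu"] nz lk_mult_mo[of "q (mo mu)" mu nu] by (auto simp: in_keys_iff)
      have "lk f (nu + mu) = (SUM mu':B. lk (q (mo mu') * mo mu') (nu + mu))" by (simp add: f_def lookup_sum)
      also have "... = (SUM mu':B. if mu' = mu then lk (q (mo mu)) nu else 0)"
      proof (rule sum.cong[OF refl])
        fix mu' assume "mu' : B"
        then show "lk (q (mo mu') * mo mu') (nu + mu) = (if mu' = mu then lk (q (mo mu)) nu else 0)" by (metis o sp[of "nu + mu" mu'] in_keys_iff lk_mult_mo)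
      qed
      also have "... = lk (q (mo mu)) nu" using B(1) b(2) by simp
      finally show False using nz f0 by simp
    qed
    then show "q b = 0" unfolding b(1) by (intro poly_mapping_eqI) simp
  qed
qed

text \<open>A basis can be selected from any spanning set, so it may consist of monomials. Later
  counts and lifts rely on explicit monomial representatives.\<close>

lemma mono_basis:
  assumes B: "finite B" and V: "submod M" "submod N" "mo ` B \<subseteq> M"
    and sp: "!!f. f : M ==> emb f : vs.span (emb ` mo ` B Un loc N)"
  shows "EX B'<=B. qindep sc (emb ` mo ` B') (loc N) & loc M \<subseteq> vs.span (emb ` mo ` B' Un loc N) & qd sc (loc M) (loc N) (card B')"
proof -
  let ?S = "(%m. emb (mo m)) ` B"
  have im: "emb ` mo ` X = (%m. emb (mo m)) ` X" for X by (simp add: image_image)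
  have "?S \<subseteq> loc M" using V(3) emb_loc by blast
  moreover have "loc M \<subseteq> vs.span (?S Un loc N)" using sp unfolding im by (intro loc_minimal vs.subspace_span)
  ultimately obtain C where C: "C \<subseteq> ?S" "qindep sc C (loc N)" "loc M \<subseteq> vs.span (C Un loc N)"
    using vs.qd_exists[of ?S "loc M" "loc N"] B loc_subspace[OF V(2)] by blast
  obtain B' where B': "B' \<subseteq> B" "C = (%m. emb (mo m)) ` B'" using C(1) by (auto simp: subset_image_iff)
  have "card C = card B'" unfolding B'(2) by (rule card_image[OF inj_emb_mo])
  moreover have "C \<subseteq> loc M" using C(1) \<open>?S \<subseteq> loc M\<close> by blast
  ultimately show ?thesis using B' C unfolding qd_def im by blast
qed

lemma loc_Int: "submod M ==> submod N ==> loc M Int loc N \<subseteq> loc (M Int N)"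
proof
  fix x assume M: "submod M" and N: "submod N" and "x : loc M Int loc N"
  then obtain f q g r where x: "x = Fract f q" "f : M" "q : Av S" "q ~= 0" "x = Fract g r" "g : N" "r : Av S" "r ~= 0"
    unfolding loc_def by blast
  have e: "r * f = q * g" using x by (simp add: eq_fract mult.commute)
  have "r * f : M" using M x by (simp add: submod_def)
  moreover have "r * f : N" unfolding e using N x by (simp add: submod_def)
  moreover have "x = Fract (r * f) (r * q)" using x by (simp add: eq_fract)
  moreover have "r * q : Av S" "r * q ~= 0" using x A_closed by auto
  ultimately show "x : loc (M Int N)" unfolding loc_def by blast
qed

end

text \<open>Fractions in x0, x1 as constants of the iterated polynomial ring; \<open>iota2\<close>
  does the same for x0, x1, x2. The inner variables of \<open>T5\<close> are the scalars.\<close>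

definition iota1 :: "complex poly poly fract => mpoly fract" where
  "iota1 = fext (%p. emb (from5 [:[:[:p:]:]:]))"

definition iota2 :: "complex poly poly poly fract => mpoly fract" where
  "iota2 = fext (%p. emb (from5 [:[:p:]:]))"

lemma from5_0: "from5 p = 0 ==> p = 0" by (metis rhom_0[OF rhom_to5] to5_from5)

lemma pe_const_var: "pe const (var 0) [:c:] = const c" "pe const (var 0) [:0, 1:] = var 0"
  by (simp_all add: pe_pCons[OF rhom_const])

interpretation f1: monofield iota1 "{0, 1}"
  unfolding iota1_def
proof (intro monofield.intro subfield_fext)
  note r1 = pe_rhom[OF rhom_const, of "var 0"]
  have e: "(%p. from5 [:[:[:p:]:]:]) = pe (pe const (var 0)) (var 1)"
    by (rule ext) (simp add: from5_def pe_const pe_rhom rhom_const)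
  show "rhom (%p. from5 [:[:[:p:]:]:])" unfolding e by (intro pe_rhom rhom_const)
  show "a = 0" if "from5 [:[:[:a:]:]:] = 0" for a using from5_0[OF that] by simp
  show "range (%p. from5 [:[:[:p:]:]:]) = Av {0, 1}" unfolding e
  proof
    show "range (pe (pe const (var 0)) (var 1)) \<subseteq> Av {0, 1}"
      by (auto intro!: subring_pe subring_Av Av_const Av_var pe_rhom rhom_const)
    show "Av {0, 1} \<subseteq> range (pe (pe const (var 0)) (var 1))"
    proof (rule Av_least)
      show "subring (range (pe (pe const (var 0)) (var 1)))" by (intro subring_range pe_rhom rhom_const)
      show "const c : range (pe (pe const (var 0)) (var 1))" for c
        by (rule range_eqI[of _ _ "[:[:c:]:]"]) (simp add: pe_const[OF r1] pe_const_var)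
      show "var i : range (pe (pe const (var 0)) (var 1))" if i: "i : {0, 1}" for i
      proof (cases "i = 0")
        case True
        then show ?thesis by (intro range_eqI[of _ _ "[:[:0, 1:]:]"]) (simp add: pe_const[OF r1] pe_const_var)
      next
        case False
        then have "i = 1" using i by simp
        then show ?thesis by (intro range_eqI[of _ _ "[:0, 1:]"]) (simp add: pe_pCons[OF r1] rhom_0[OF r1] rhom_1[OF r1])
      qed
    qed
  qed
qed

interpretation f2: monofield iota2 "{0, 1, 2}"
  unfolding iota2_def
proof (intro monofield.intro subfield_fext)
  note r1 = pe_rhom[OF rhom_const, of "var 0"]
  note r2 = pe_rhom[OF r1, of "var 1"]
  have e: "(%p. from5 [:[:p:]:]) = pe (pe (pe const (var 0)) (var 1)) (var 2)"
    by (rule ext) (simp add: from5_def pe_const pe_rhom rhom_const)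
  show "rhom (%p. from5 [:[:p:]:])" unfolding e by (intro pe_rhom rhom_const)
  show "a = 0" if "from5 [:[:a:]:] = 0" for a using from5_0[OF that] by simp
  show "range (%p. from5 [:[:p:]:]) = Av {0, 1, 2}" unfolding e
  proof
    show "range (pe (pe (pe const (var 0)) (var 1)) (var 2)) \<subseteq> Av {0, 1, 2}"
      by (auto intro!: subring_pe subring_Av Av_const Av_var pe_rhom rhom_const)
    show "Av {0, 1, 2} \<subseteq> range (pe (pe (pe const (var 0)) (var 1)) (var 2))"
    proof (rule Av_least)
      show "subring (range (pe (pe (pe const (var 0)) (var 1)) (var 2)))" by (intro subring_range pe_rhom rhom_const)
      show "const c : range (pe (pe (pe const (var 0)) (var 1)) (var 2))" for c
        by (rule range_eqI[of _ _ "[:[:[:c:]:]:]"]) (simp add: pe_const[OF r2] pe_const[OF r1] pe_const_var)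
      show "var i : range (pe (pe (pe const (var 0)) (var 1)) (var 2))" if i: "i : {0, 1, 2}" for i
      proof -
        consider "i = 0" | "i = 1" | "i = 2" using i by blast
        then show ?thesis
        proof cases
          case 1
          then show ?thesis by (intro range_eqI[of _ _ "[:[:[:0, 1:]:]:]"]) (simp add: pe_const[OF r2] pe_const[OF r1] pe_const_var)
        next
          case 2
          then show ?thesis by (intro range_eqI[of _ _ "[:[:0, 1:]:]"])
            (simp add: pe_const[OF r2] pe_pCons[OF r1] rhom_0[OF r1] rhom_1[OF r1])
        next
          case 3
          then show ?thesis by (intro range_eqI[of _ _ "[:0, 1:]"]) (simp add: pe_pCons[OF r2] rhom_0[OF r2] rhom_1[OF r2])
        qed
      qed
    qed
  qed
qed

section \<open>The generic section of the curve by a pencil of hyperplanes\<close>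

text \<open>Degree in the variables that are not scalars: x2, x3, x4 over the field of x0, x1, and
  for \<open>w2\<close> only x3, x4 once x2 is a scalar too.\<close>

definition w3 :: "mon => nat" where "w3 m = lk m 2 + lk m 3 + lk m 4"
definition w2 :: "mon => nat" where "w2 m = lk m 3 + lk m 4"

lemma w3_add: "w3 (a + b) = w3 a + w3 b" by (simp add: w3_def lookup_add)
lemma w2_add: "w2 (a + b) = w2 a + w2 b" by (simp add: w2_def lookup_add)
lemma w3_le_mdeg: "w3 m <= mdeg m" by (simp add: w3_def mdeg_5)
lemma w2_le_w3: "w2 m <= w3 m" by (simp add: w3_def w2_def)

text \<open>The bound is strict: level \<open>n + 1\<close> holds weight at most \<open>n\<close>,
  and level 0 is the zero space, which starts the inductions.\<close>

definition wlt :: "(mon => nat) => nat => mpoly set" where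
  "wlt w n = {f. ALL m:supp f. w m < n}"

lemma wlt_0 [simp]: "0 : wlt w n" by (simp add: wlt_def)
lemma wlt_zero: "wlt w 0 = {0}" by (auto simp: wlt_def)
lemma wlt_add: "a : wlt w n ==> b : wlt w n ==> a + b : wlt w n"
  unfolding wlt_def using supp_addD[of _ a b] by blast
lemma wlt_uminus: "a : wlt w n ==> - a : wlt w n" by (simp add: wlt_def in_keys_iff)
lemma wlt_diff: "a : wlt w n ==> b : wlt w n ==> a - b : wlt w n" using wlt_add[of a w n "- b"] wlt_uminus by simp
lemma wlt_mono: "n <= k ==> wlt w n \<subseteq> wlt w k" unfolding wlt_def by force
lemma wlt_mult:
  assumes "!!a b. w (a + b) = w a + w b" "a : wlt w n" "ALL m:supp b. w m <= k" shows "b * a : wlt w (n + k)"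
  unfolding wlt_def
proof (intro CollectI ballI)
  fix m assume "m : supp (b * a)"
  then obtain x y where "x : supp b" "y : supp a" "m = x + y" using supp_mult by blast
  then show "w m < n + k" using assms by (force simp: wlt_def)
qed

lemma submod_wlt3: "f1.submod (wlt w3 n)"
  unfolding f1.submod_def
proof (intro conjI ballI wlt_0 wlt_add)
  fix q a assume "q : Av {0, 1}" "a : wlt w3 n"
  then show "q * a : wlt w3 n" using wlt_mult[of w3, OF w3_add, of a n q 0] by (simp add: Av_def w3_def)
qed

lemma submod_wlt2: "f2.submod (wlt w2 n)"
  unfolding f2.submod_def
proof (intro conjI ballI wlt_0 wlt_add)
  fix q a assume "q : Av {0, 1, 2}" "a : wlt w2 n"
  then show "q * a : wlt w2 n" using wlt_mult[of w2, OF w2_add, of a n q 0] by (simp add: Av_def w2_def)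
qed

lemma homog_wlt3: "homog n f ==> f : wlt w3 (Suc n)"
proof -
  assume h: "homog n f"
  have "w3 m < Suc n" if "m : supp f" for m using h that w3_le_mdeg[of m] by (simp add: homog_mdeg)
  then show ?thesis by (simp add: wlt_def)
qed

definition M3 :: "nat => mon set" where "M3 n = {m. lk m 0 = 0 & lk m 1 = 0 & w3 m = n}"

lemma M3_mdeg: "m : M3 n ==> mdeg m = n" by (simp add: M3_def mdeg_5 w3_def)
lemma finite_M3: "finite (M3 n)"
  by (rule finite_subset[OF _ finite_mons[of n]]) (use M3_mdeg in \<open>auto simp: mons_def\<close>)

text \<open>Modulo x0 a form in x0, x1 is a multiple of a power of x1. The clause for
  \<open>e = 0\<close> stops the descent, as \<open>e - 1\<close> is truncated.\<close>

lemma split_x1: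
  assumes f: "f : Av {0, 1}" "homog e f"
  shows "EX c g. f = const c * var 1 ^ e + var 0 * g & g : Av {0, 1} & homog (e - 1) g & (e = 0 --> g = 0)"
proof -
  have one: "m = sng 1 e" if m: "m : supp f" "lk m 0 = 0" for m
  proof (rule poly_mapping_eqI)
    fix i
    have "mdeg m = e" using f(2) m(1) by (simp add: homog_mdeg)
    moreover have z: "j ~: {0, 1} ==> lk m j = 0" for j using f(1) m(1) by (auto simp: Av_def)
    ultimately have "lk m 1 = e" using m(2) z[of 2] z[of 3] z[of 4] by (simp add: mdeg_5)
    then show "lk m i = lk (sng 1 e) i" using z[of i] m(2) by (cases "i = 1"; cases "i = 0") (auto simp: lookup_single)
  qed
  let ?K = "{m : supp f. lk m 0 ~= 0}"
  define g where "g = (SUM m:?K. sng (m - sng 0 1) (lk f m))"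
  have x0: "var 0 * sng (m - sng 0 1) c = sng m c" if "lk m 0 ~= 0" for m c
  proof -
    have "sng 0 1 + (m - sng 0 1) = m"
      by (rule poly_mapping_eqI) (use that in \<open>auto simp: lookup_add lookup_minus lookup_single when_def\<close>)
    then show ?thesis by (simp add: var_def mult_single)
  qed
  have "part (%m. lk m 0 ~= 0) f = var 0 * g"
    unfolding part_def g_def sum_distrib_left by (rule sum.cong[OF refl], rule x0[symmetric]) simp
  moreover have "part (%m. ~ lk m 0 ~= 0) f = const (lk f (sng 1 e)) * var 1 ^ e"
  proof -
    have v: "var 1 ^ e = mo (sng 1 e)" using sng_meval[of "sng 1 e"] by (simp add: meval_single)
    show ?thesis
    proof (rule poly_mapping_eqI)
      fix m
      show "lk (part (%m. ~ lk m 0 ~= 0) f) m = lk (const (lk f (sng 1 e)) * var 1 ^ e) m"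
        unfolding v const_mult_single lk_part using one[of m] by (auto simp: lookup_single when_def in_keys_iff)
    qed
  qed
  ultimately have "f = const (lk f (sng 1 e)) * var 1 ^ e + var 0 * g" using part_split[of f "%m. lk m 0 ~= 0"] by (simp add: add.commute)
  moreover have "g : Av {0, 1}" unfolding g_def
    by (intro subring_sum subring_Av) (use f(1) in \<open>auto simp: Av_def lookup_minus\<close>)
  moreover have "homog (e - 1) g" unfolding g_def
  proof (rule homog_sum)
    fix m assume m: "m : ?K"
    then have "mdeg (m - sng 0 1) = e - 1" using f(2) m by (simp add: homog_mdeg mdeg_5 lookup_minus lookup_single)
    then show "homog (e - 1) (sng (m - sng 0 1) (lk f m))" using homog_single by metis
  qed
  moreover have "e = 0 --> g = 0"
  proof
    assume "e = 0"
    then have "?K = {}" using f(2) by (auto simp: homog_mdeg mdeg_5)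
    then show "g = 0" unfolding g_def by (simp only: sum.empty)
  qed
  ultimately show ?thesis by blast
qed

text \<open>The curve in coordinates where x0 cuts it in a scheme of length \<open>d\<close> that x1
  avoids. \<open>x1\<close> and \<open>hf0\<close> are asked only from degree \<open>m0\<close> on
  because \<open>(I, x0)\<close> need not be saturated; \<open>c0\<close> is the constant term of
  the Hilbert polynomial.\<close>

locale pencil =
  fixes I :: "mpoly set" and d m0 :: nat and c0 :: int
  assumes I: "homog_ideal I" and x0: "nzd (var 0) I" and x2: "nzd (var 2) I"
    and x1: "!!n f. m0 <= n ==> homog n f ==> var 1 * f : gen (insert (var 0) I) ==> f : gen (insert (var 0) I)"
    and hf0: "!!n. m0 <= n ==> hilbert_function (gen (insert (var 0) I)) n = d"
    and hfI: "!!n. m0 <= n ==> int (hilbert_function I n) = int d * int n + c0"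
begin

lemma idI: "ideal I" using I by (rule homog_ideal_ideal)

text \<open>Equations of weight below \<open>n\<close>. In \<open>QQ\<close>, the choice
  \<open>y = 1\<close> compares two consecutive filtration levels, \<open>y = var 2\<close> reduces
  a level modulo x2; both quotients have the same dimension.\<close>

definition JJ :: "nat => mpoly set" where "JJ n = I Int wlt w3 n"
definition QQ :: "mpoly => nat => mpoly set" where
  "QQ y n = {a + b | a b. a : JJ (Suc n) & b : (*) y ` wlt w3 n}"

lemma submod_JJ: "f1.submod (JJ n)" unfolding JJ_def by (intro f1.submod_Int f1.submod_ideal idI submod_wlt3)

lemma submod_image: "f1.submod M ==> f1.submod ((*) y ` M)"
  unfolding f1.submod_def
proof (intro conjI ballI; elim conjE)
  assume M: "0 : M" "ALL a:M. ALL b:M. a + b : M" "ALL q:Av {0, 1}. ALL a:M. q * a : M"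
  show "0 : (*) y ` M" using M(1) by (intro image_eqI[of _ _ 0]) auto
  fix a assume "a : (*) y ` M"
  then obtain a' where a: "a = y * a'" "a' : M" by blast
  show "q * a : (*) y ` M" if "q : Av {0, 1}" for q
    using M(3) that a by (intro image_eqI[of _ _ "q * a'"]) (auto simp: mult_ac)
  fix b assume "b : (*) y ` M"
  then obtain b' where b: "b = y * b'" "b' : M" by blast
  show "a + b : (*) y ` M" using M(2) a b by (intro image_eqI[of _ _ "a' + b'"]) (auto simp: distrib_left)
qed

lemma submod_QQ: "f1.submod (QQ y n)"
  unfolding QQ_def by (intro f1.submod_plus submod_JJ submod_image submod_wlt3)

lemma JJ_QQ: "JJ (Suc n) \<subseteq> QQ y n"
proof
  fix a assume "a : JJ (Suc n)"
  moreover have "0 : (*) y ` wlt w3 n" using wlt_0 by (intro image_eqI[of _ _ 0]) auto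
  ultimately show "a : QQ y n" unfolding QQ_def by (intro CollectI exI[of _ a] exI[of _ 0]) simp
qed

lemma mult_QQ: "f : wlt w3 n ==> y * f : QQ y n"
  unfolding QQ_def using submod_JJ[of "Suc n"] by (intro CollectI exI[of _ 0] exI[of _ "y * f"]) (auto simp: f1.submod_def)

lemma mult_wlt3: "ALL m:supp y. w3 m <= 1 ==> f : wlt w3 n ==> y * f : wlt w3 (Suc n)"
  using wlt_mult[of w3, OF w3_add, of f n y 1] by simp

lemma QQ_wlt: "ALL m:supp y. w3 m <= 1 ==> QQ y n \<subseteq> wlt w3 (Suc n)"
  unfolding QQ_def JJ_def using mult_wlt3 wlt_add by blast

text \<open>Multiplication by \<open>y\<close> is injective modulo \<open>I\<close>, so
  \<open>QQ y n\<close> modulo \<open>JJ (Suc n)\<close> repeats level \<open>n\<close>. The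
  increase \<open>k\<close> is therefore the same for every such \<open>y\<close>, in particular for
  1 and x2.\<close>

lemma hilbert_step:
  assumes y: "nzd y I" "ALL m:supp y. w3 m <= 1" and h: "qd f1.sc (f1.loc (wlt w3 n)) (f1.loc (JJ n)) h"
    and k: "qd f1.sc (f1.loc (wlt w3 (Suc n))) (f1.loc (QQ y n)) k"
  shows "qd f1.sc (f1.loc (wlt w3 (Suc n))) (f1.loc (JJ (Suc n))) (h + k)"
proof -
  note sJ = f1.loc_subspace[OF submod_JJ]
  have "qd f1.sc (f1.loc (QQ y n)) (f1.loc (JJ (Suc n))) h"
  proof (rule qd_iso[THEN iffD1, OF _ f1.loc_subspace[OF submod_wlt3] f1.loc_subspace[OF submod_QQ] sJ _ _ _ _ _ h])
    show "Vector_Spaces.linear f1.sc f1.sc ((*) (emb y))"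
      by (simp add: Vector_Spaces.linear_iff f1.vs.vector_space_axioms distrib_left mult.left_commute)
    show "f1.loc (JJ n) \<subseteq> f1.loc (wlt w3 n)" by (rule f1.loc_mono) (simp add: JJ_def)
    show "f1.loc (JJ (Suc n)) \<subseteq> f1.loc (QQ y n)" by (rule f1.loc_mono[OF JJ_QQ])
    show "emb y * x : f1.loc (QQ y n)" if "x : f1.loc (wlt w3 n)" for x
    proof -
      obtain f q where f: "x = Fract f q" "f : wlt w3 n" "q : Av {0, 1}" "q ~= 0" using \<open>x : _\<close> unfolding f1.loc_def by blast
      then show ?thesis unfolding f1.loc_def using mult_QQ[OF f(2), of y] by auto
    qed
    show "EX x:f1.loc (wlt w3 n). x' - emb y * x : f1.loc (JJ (Suc n))" if "x' : f1.loc (QQ y n)" for x'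
    proof -
      obtain f q where f: "x' = Fract f q" "f : QQ y n" "q : Av {0, 1}" "q ~= 0" using \<open>x' : _\<close> unfolding f1.loc_def by blast
      then obtain a b where ab: "f = a + y * b" "a : JJ (Suc n)" "b : wlt w3 n" unfolding QQ_def by blast
      have "x' - emb y * Fract b q = Fract a q" using f(4) by (simp add: f(1) ab(1) eq_fract algebra_simps)
      moreover have "Fract a q : f1.loc (JJ (Suc n))" "Fract b q : f1.loc (wlt w3 n)" unfolding f1.loc_def using ab f by blast+
      ultimately show ?thesis by (intro bexI[of _ "Fract b q"]) simp_all
    qed
    show "x : f1.loc (JJ n) \<longleftrightarrow> emb y * x : f1.loc (JJ (Suc n))" if x: "x : f1.loc (wlt w3 n)" for x
    proof
      assume "x : f1.loc (JJ n)"
      then obtain f q where f: "x = Fract f q" "f : JJ n" "q : Av {0, 1}" "q ~= 0" unfolding f1.loc_def by blast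
      then show "emb y * x : f1.loc (JJ (Suc n))" using f by (fastforce simp: JJ_def mult_wlt3[OF y(2)] ideal_mult[OF idI] f1.loc_def)
    next
      assume "emb y * x : f1.loc (JJ (Suc n))"
      then obtain i r where i: "emb y * x = Fract i r" "i : I" "r : Av {0, 1}" "r ~= 0" unfolding f1.loc_def JJ_def by blast
      obtain f q where f: "x = Fract f q" "f : wlt w3 n" "q : Av {0, 1}" "q ~= 0" using x unfolding f1.loc_def by blast
      have "y * (r * f) = i * q" using i f by (simp add: eq_fract mult_ac)
      then have "r * f : I" by (metis ideal_mult'[OF idI i(2)] nzdD[OF y(1)])
      moreover have "r * f : wlt w3 n" using submod_wlt3[of n] f(2) i(3) by (simp add: f1.submod_def)
      moreover have "x = Fract (r * f) (r * q)" using f i(4) by (simp add: eq_fract)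
      moreover have "r * q : Av {0, 1}" "r * q ~= 0" using f i f1.A_closed by auto
      ultimately show "x : f1.loc (JJ n)" unfolding f1.loc_def JJ_def by blast
    qed
  qed
  then show ?thesis
    by (rule f1.vs.qd_add[OF _ k sJ f1.loc_subspace[OF submod_QQ]])
      (intro f1.loc_mono JJ_QQ QQ_wlt[OF y(2)])+
qed

lemma basis_ex:
  "EX B<=M3 n. qindep f1.sc (emb ` mo ` B) (f1.loc (QQ 1 n)) & f1.loc (wlt w3 (Suc n)) \<subseteq> f1.vs.span (emb ` mo ` B Un f1.loc (QQ 1 n))
     & qd f1.sc (f1.loc (wlt w3 (Suc n))) (f1.loc (QQ 1 n)) (card B)"
proof (rule f1.mono_basis[OF finite_M3 submod_wlt3 submod_QQ])
  show "mo ` M3 n \<subseteq> wlt w3 (Suc n)" by (auto simp: wlt_def M3_def)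
  fix f assume f: "f : wlt w3 (Suc n)"
  show "emb f : f1.vs.span (emb ` mo ` M3 n Un f1.loc (QQ 1 n))"
  proof (rule f1.mono_span[OF f1.vs.subspace_span])
    fix m assume "m : supp f"
    then have w: "w3 (f1.out m) <= n" using f by (force simp: wlt_def w3_def f1.lk_out)
    show "emb (mo (f1.out m)) : f1.vs.span (emb ` mo ` M3 n Un f1.loc (QQ 1 n))"
    proof (cases "w3 (f1.out m) = n")
      case True
      then show ?thesis using M3_def f1.lk_out f1.vs.span_base by auto
    next
      case False
      then have "mo (f1.out m) : wlt w3 n" using w by (simp add: wlt_def)
      then have "emb (1 * mo (f1.out m)) : f1.loc (QQ 1 n)" by (intro f1.emb_loc mult_QQ)
      then show ?thesis by (intro f1.vs.span_base) simp
    qed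
  qed
qed

text \<open>Monomials of degree \<open>n\<close> in x2, x3, x4 representing a basis of what level
  \<open>n + 1\<close> adds to level \<open>n\<close>; their number is the first difference of the
  Hilbert function of the generic section.\<close>

definition BB :: "nat => mon set" where
  "BB n = (SOME B. B \<subseteq> M3 n & qindep f1.sc (emb ` mo ` B) (f1.loc (QQ 1 n)) & f1.loc (wlt w3 (Suc n)) \<subseteq> f1.vs.span (emb ` mo ` B Un f1.loc (QQ 1 n))
     & qd f1.sc (f1.loc (wlt w3 (Suc n))) (f1.loc (QQ 1 n)) (card B))"

lemma BB: "BB n \<subseteq> M3 n" "qindep f1.sc (emb ` mo ` BB n) (f1.loc (QQ 1 n))"
    "qd f1.sc (f1.loc (wlt w3 (Suc n))) (f1.loc (QQ 1 n)) (card (BB n))"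
  using someI_ex[OF basis_ex[of n]] unfolding BB_def[symmetric] by blast+

lemma finite_BB: "finite (BB n)" using finite_subset[OF BB(1) finite_M3] .

lemma hilbert_sum: "qd f1.sc (f1.loc (wlt w3 n)) (f1.loc (JJ n)) (SUM j<n. card (BB j))"
proof (induction n)
  case 0
  show ?case using JJ_def wlt_zero ideal_0[OF idI] f1.vs.qd_self by auto
next
  case (Suc n)
  have "nzd 1 I" by (simp add: nzd_def)
  moreover have "ALL m:supp 1. w3 m <= 1" by (simp add: w3_def)
  ultimately show ?case using hilbert_step[OF _ _ Suc BB(3)] by simp
qed

lemma BB_card:
  assumes "nzd y I" "ALL m:supp y. w3 m <= 1" "qd f1.sc (f1.loc (wlt w3 (Suc n))) (f1.loc (QQ y n)) k"
  shows "k = card (BB n)"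
  using f1.vs.qd_unique[OF hilbert_step[OF assms(1,2) hilbert_sum assms(3)] hilbert_sum f1.loc_subspace[OF submod_JJ]] by simp

text \<open>The part \<open>g\<close> of top weight \<open>j\<close> differs from the equation
  \<open>f\<close> by lower weight, so it lies in \<open>QQ 1 j\<close>; being supported on
  \<open>BB j\<close>, it vanishes.\<close>

lemma over_BB_zero:
  assumes f: "f : I" "f : f1.over (UN j. BB j)" shows "f = 0"
proof (rule ccontr)
  assume "f ~= 0"
  then have ne: "supp f ~= {}" by simp
  define j where "j = Max (w3 ` supp f)"
  have le: "w3 m <= j" if "m : supp f" for m using that by (simp add: j_def)
  have "Max (w3 ` supp f) : w3 ` supp f" by (rule Max_in) (use ne in simp_all)
  then obtain m where m: "m : supp f" "w3 m = j" unfolding j_def by (elim imageE) simp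
  define g where "g = part (%m. w3 m = j) f"
  have fg: "f - g = part (%m. ~ w3 m = j) f" unfolding g_def using part_split[of f "%m. w3 m = j"] by (metis add_diff_cancel_left')
  have "w3 m < j" if "m : supp f" "w3 m ~= j" for m using le[OF that(1)] that(2) by simp
  then have "1 * - (f - g) : (*) 1 ` wlt w3 j" using fg by (simp add: wlt_def supp_part wlt_uminus)
  moreover have "f : JJ (Suc j)" using f(1) le by (auto simp: JJ_def wlt_def less_Suc_eq_le)
  moreover have "g = f + 1 * - (f - g)" by simp
  ultimately have gQ: "g : QQ 1 j" unfolding QQ_def by blast
  have "g : f1.over (BB j)" unfolding f1.over_def
  proof (intro CollectI ballI)
    fix m assume "m : supp g"
    then have m: "m : supp f" "w3 m = j" by (auto simp: g_def supp_part)
    obtain i where i: "f1.out m : BB i" using f(2) m(1) by (auto simp: f1.over_def)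
    then have "i = j" using m(2) BB(1)[of i] M3_def w3_def f1.lk_out by auto
    then show "f1.out m : BB j" using i by simp
  qed
  moreover have "lk m i = 0" if "m : BB j" "i : {0, 1}" for m i using that BB(1)[of j] by (auto simp: M3_def)
  ultimately have "g = 0" using f1.qindep_mono[OF submod_QQ finite_BB, of j 1 j] BB(2)[of j] gQ by blast
  moreover have "lk g m = lk f m" by (simp add: g_def lk_part m)
  ultimately show False using m(1) by (simp add: in_keys_iff)
qed

text \<open>A monomial \<open>mu\<close> of \<open>BB j\<close> gives \<open>n - j + 1\<close>
  monomials of degree \<open>n\<close>, its products with \<open>x0^a x1^(n-j-a)\<close>. By
  \<open>over_BB_zero\<close> all of these together are independent modulo \<open>I\<close>.\<close>

lemma hilbert_lower:
  assumes "L <= Suc n" shows "(SUM j<L. card (BB j) * (Suc n - j)) <= hilbert_function I n"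
proof -
  define T where "T = Sigma (Sigma {..<L} BB) (%(j, mu). {..n - j})"
  define phi where "phi = (%((j, mu), a). sng 0 a + sng 1 (n - j - a) + mu :: mon)"
  have lk: "lk (phi ((j, mu), a)) 0 = a" "f1.out (phi ((j, mu), a)) = mu" "mdeg (phi ((j, mu), a)) = n"
    if "((j, mu), a) : T" for j mu a
  proof -
    have mu: "lk mu 0 = 0" "lk mu 1 = 0" "mdeg mu = j" "j <= n" "a <= n - j"
      using that BB(1)[of j] M3_mdeg[of mu j] assms by (auto simp: T_def M3_def)
    show "lk (phi ((j, mu), a)) 0 = a" using mu by (simp add: phi_def lookup_add lookup_single)
    show "mdeg (phi ((j, mu), a)) = n" using mu by (simp add: phi_def mdeg_add mdeg_single)
    show "f1.out (phi ((j, mu), a)) = mu"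
      by (rule poly_mapping_eqI) (use mu in \<open>auto simp: phi_def f1.lk_out lookup_add lookup_single when_def\<close>)
  qed
  have inj: "inj_on phi T"
  proof (rule inj_onI)
    fix x y assume xy: "x : T" "y : T" "phi x = phi y"
    obtain j mu a where x: "x = ((j, mu), a)" by (metis surj_pair)
    obtain i nu b where y: "y = ((i, nu), b)" by (metis surj_pair)
    have "a = b" "mu = nu" using lk[of j mu a] lk[of i nu b] xy by (simp_all add: x y)
    moreover have "mdeg mu = j" "mdeg nu = i" using xy BB(1)[of j] BB(1)[of i] M3_mdeg by (auto simp: x y T_def)
    ultimately show "x = y" by (simp add: x y)
  qed
  have fT: "finite T" unfolding T_def using finite_BB by auto
  have cardT: "card T = (SUM j<L. card (BB j) * (Suc n - j))"
  proof -
    have "card T = (SUM p:Sigma {..<L} BB. card (case p of (j, mu) => {..n - j}))"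
      unfolding T_def by (rule card_SigmaI) (use finite_BB in auto)
    also have "... = (SUM j<L. SUM mu:BB j. Suc (n - j))"
      by (subst sum.Sigma) (use finite_BB in \<open>auto intro!: sum.cong\<close>)
    also have "... = (SUM j<L. card (BB j) * (Suc n - j))" using assms by (auto intro!: sum.cong simp: Suc_diff_le)
    finally show ?thesis .
  qed
  have injmo: "inj_on mo (phi ` T)" by (rule inj_onI) (metis keys_single one_neq_zero singletonD singletonI)
  have "qindep cs (mo ` phi ` T) {f : I. homog n f}" unfolding qindep_def
  proof (intro conjI allI impI ballI)
    show "finite (mo ` phi ` T)" using fT by simp
    fix c b assume c: "(SUM b:mo ` phi ` T. const (c b) * b) : {f : I. homog n f}" and "b : mo ` phi ` T"
    then obtain m where m: "b = mo m" "m : phi ` T" by blast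
    define f where "f = (SUM m:phi ` T. sng m (c (mo m)))"
    have fI: "f : I" using c by (simp add: f_def sum.reindex[OF injmo] const_mult_single)
    have lkf: "lk f m = (if m : phi ` T then c (mo m) else 0)" for m
      unfolding f_def lookup_sum lookup_single using fT by (simp add: when_def)
    have "f : f1.over (UN j. BB j)" unfolding f1.over_def
    proof (intro CollectI ballI)
      fix m assume "m : supp f"
      then have "m : phi ` T" by (metis lkf in_keys_iff)
      then obtain j mu a where t: "((j, mu), a) : T" "m = phi ((j, mu), a)" by auto
      then show "f1.out m : (UN j. BB j)" using lk(2) T_def by auto
    qed
    then have "f = 0" using over_BB_zero fI by blast
    then show "c b = 0" using lkf[of m] m by simp
  qed
  moreover have "mo ` phi ` T \<subseteq> {f. homog n f}"
  proof
    fix b assume "b : mo ` phi ` T"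
    then obtain j mu a where t: "((j, mu), a) : T" "b = mo (phi ((j, mu), a))" by auto
    then show "b : {f. homog n f}" using homog_single[of "phi ((j, mu), a)" 1] lk(3)[OF t(1)] by simp
  qed
  ultimately have "card (mo ` phi ` T) <= hilbert_function I n"
    by (rule mv.qindep_le_qd[OF _ _ hf_qd[OF idI] mv_subspace_ideal_homog[OF idI]])
  then show ?thesis by (simp add: card_image[OF injmo] card_image[OF inj] cardT)
qed

lemma x1_power: "m0 <= n ==> homog n f ==> var 1 ^ e * f : gen (insert (var 0) I) ==> f : gen (insert (var 0) I)"
proof (induction e)
  case (Suc e)
  have "homog (e + n) (var 1 ^ e * f)" by (rule homog_mult[OF homog_var_power Suc.prems(2)])
  moreover have "var 1 * (var 1 ^ e * f) : gen (insert (var 0) I)" using Suc.prems(3) by (simp add: mult.assoc)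
  ultimately have "var 1 ^ e * f : gen (insert (var 0) I)" using x1[of "e + n"] Suc.prems(1) by simp
  then show ?case using Suc by blast
qed simp

text \<open>Forms independent on the section x0 = 0 stay independent on the curve over polynomials
  in x0, x1: modulo x0 only a multiple of \<open>x1^e\<close> survives, which can be cancelled, and
  what remains is divisible by x0 and has coefficients of lower degree.\<close>

lemma section_independent:
  assumes B: "qindep cs B {f : gen (insert (var 0) I). homog n f}" "B \<subseteq> {f. homog n f}" and n: "m0 <= n"
  shows "(ALL b:B. p b : Av {0, 1} & homog e (p b)) ==> (SUM b:B. p b * b) : I ==> b : B ==> p b = 0"
proof (induction e arbitrary: p b rule: less_induct)
  case (less e)
  have "EX c g. ALL b:B. p b = const (c b) * var 1 ^ e + var 0 * g b & g b : Av {0, 1} & homog (e - 1) (g b) & (e = 0 --> g b = 0)"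
  proof -
    have "ALL b:B. EX x. p b = const (fst x) * var 1 ^ e + var 0 * snd x & snd x : Av {0, 1} & homog (e - 1) (snd x) & (e = 0 --> snd x = 0)"
    proof
      fix b assume "b : B"
      then obtain c g where "p b = const c * var 1 ^ e + var 0 * g & g : Av {0, 1} & homog (e - 1) g & (e = 0 --> g = 0)"
        using split_x1[of "p b" e] less.prems(1) by blast
      then show "EX x. p b = const (fst x) * var 1 ^ e + var 0 * snd x & snd x : Av {0, 1} & homog (e - 1) (snd x) & (e = 0 --> snd x = 0)"
        by (intro exI[of _ "(c, g)"]) simp
    qed
    then obtain x where "ALL b:B. p b = const (fst (x b)) * var 1 ^ e + var 0 * snd (x b) & snd (x b) : Av {0, 1} & homog (e - 1) (snd (x b)) & (e = 0 --> snd (x b) = 0)"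
      by (rule bchoice[THEN exE])
    then show ?thesis by (intro exI[of _ "%b. fst (x b)"] exI[of _ "%b. snd (x b)"])
  qed
  then obtain c g where cg: "!!b. b : B ==> p b = const (c b) * var 1 ^ e + var 0 * g b & g b : Av {0, 1} & homog (e - 1) (g b) & (e = 0 --> g b = 0)"
    by blast
  have "(SUM b:B. p b * b) = (SUM b:B. var 1 ^ e * (const (c b) * b) + (g b * b) * var 0)"
    by (rule sum.cong) (use cg in \<open>auto simp: algebra_simps\<close>)
  then have s: "(SUM b:B. p b * b) = var 1 ^ e * (SUM b:B. const (c b) * b) + (SUM b:B. g b * b) * var 0"
    by (simp only: sum.distrib sum_distrib_left sum_distrib_right)
  have h: "homog n (SUM b:B. const (c b) * b)" using B(2) by (intro homog_sum homog_const_mult) blast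
  have "(- (SUM b:B. g b * b)) * var 0 + (SUM b:B. p b * b) : gen (insert (var 0) I)" by (rule gen_insertI[OF idI less.prems(2)])
  then have "var 1 ^ e * (SUM b:B. const (c b) * b) : gen (insert (var 0) I)" unfolding s by simp
  then have c0: "c b = 0" if "b : B" for b using h that x1_power[OF n h] qindepD[OF B(1)] by auto
  then have "(SUM b:B. const (c b) * b) = 0" by (intro sum.neutral) simp
  then have "var 0 * (SUM b:B. g b * b) : I" using less.prems(2) unfolding s by (simp add: mult.commute)
  then have gI: "(SUM b:B. g b * b) : I" using nzdD[OF x0] by blast
  have "g b = 0"
  proof (cases "e = 0")
    case True then show ?thesis using cg less.prems(3) by blast
  next
    case False
    then show ?thesis using cg gI less.IH[of "e - 1" g b] less.prems(3) by auto
  qed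
  then show ?case using cg[OF less.prems(3)] c0[OF less.prems(3)] by simp
qed

text \<open>A basis of the degree \<open>m0\<close> part of the section x0 = 0 stays independent
  over the field of x0, x1, and it lies in level \<open>m0 + 1\<close>.\<close>

lemma degree_le: "EX L. d <= (SUM j<L. card (BB j))"
proof -
  let ?K = "gen (insert (var 0) I)"
  have "qd cs {f. homog m0 f} {f : ?K. homog m0 f} d" using hf_qd[OF ideal_gen[of "insert (var 0) I"], of m0] hf0 by simp
  then obtain B where B: "B \<subseteq> {f. homog m0 f}" "qindep cs B {f : ?K. homog m0 f}" "card B = d" unfolding qd_def by blast
  note fB = qindep_finite[OF B(2)]
  have "qindep f1.sc (emb ` B) (f1.loc (JJ (Suc m0)))"
    unfolding f1.qindep_loc[OF submod_JJ fB]
  proof (intro allI impI ballI)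
    fix q b assume q: "(ALL b:B. q b : Av {0, 1}) & (SUM b:B. q b * b) : JJ (Suc m0)" and b: "b : B"
    have "hc e (q b) = 0" for e
    proof (rule section_independent[OF B(2,1) order_refl _ _ b, of "%b. hc e (q b)" e])
      show "ALL b:B. hc e (q b) : Av {0, 1} & homog e (hc e (q b))"
        using q by (auto simp: Av_def hc_def supp_part) (auto simp flip: hc_def)
      have "(SUM b:B. hc e (q b) * b) = hc (e + m0) (SUM b:B. q b * b)"
        unfolding hc_sum by (rule sum.cong) (use B(1) hc_mult in auto)
      also have "... : I" using q homog_idealD[OF I] by (simp add: JJ_def)
      finally show "(SUM b:B. hc e (q b) * b) : I" .
    qed
    then show "q b = 0" using hc_eq_0_iff by blast
  qed
  moreover have "emb ` B \<subseteq> f1.loc (wlt w3 (Suc m0))" using B(1) homog_wlt3 f1.emb_loc by blast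
  ultimately have "card (emb ` B) <= (SUM j<Suc m0. card (BB j))"
    by (rule f1.vs.qindep_le_qd[OF _ _ hilbert_sum f1.loc_subspace[OF submod_JJ]])
  moreover have "card (emb ` B) = d" unfolding B(3)[symmetric] by (rule card_image) (auto simp: inj_on_def emb_eq)
  ultimately show ?thesis by (intro exI[of _ "Suc m0"]) simp
qed

lemma hilbert_lower_int:
  assumes "L <= Suc n" shows "int (SUM j<L. card (BB j)) * (int n + 1) - int (SUM j<L. j * card (BB j)) <= int (hilbert_function I n)"
proof -
  have "int (SUM j<L. card (BB j)) * (int n + 1) - int (SUM j<L. j * card (BB j)) = int (SUM j<L. card (BB j) * (Suc n - j))"
    unfolding of_nat_sum sum_distrib_right sum_subtractf[symmetric]
  proof (rule sum.cong[OF refl])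
    fix j assume "j : {..<L}"
    then have e: "int (Suc n - j) = int n + 1 - int j" using assms by (simp add: of_nat_diff)
    show "int (card (BB j)) * (int n + 1) - int (j * card (BB j)) = int (card (BB j) * (Suc n - j))"
      unfolding of_nat_mult e by (simp add: algebra_simps)
  qed
  also have "... <= int (hilbert_function I n)" using hilbert_lower[OF assms] by (simp only: of_nat_le_iff)
  finally show ?thesis .
qed

text \<open>By \<open>hilbert_lower\<close> a sum above \<open>d\<close> would make the Hilbert
  function of the curve grow with slope above \<open>d\<close>; \<open>n\<close> is taken large
  enough to beat the constant terms.\<close>

lemma degree_ge: "(SUM j<L. card (BB j)) <= d"
proof (rule ccontr)
  assume "~ ?thesis"
  then have b: "int (SUM j<L. card (BB j)) >= int d + 1" by linarith
  let ?B = "int (SUM j<L. card (BB j))" let ?s = "int (SUM j<L. j * card (BB j))"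
  define n where "n = max (max L m0) (nat (c0 + ?s))"
  have "?B * (int n + 1) - ?s <= int d * int n + c0" using hilbert_lower_int[of L n] hfI[of n] by (simp add: n_def)
  moreover have "(int d + 1) * (int n + 1) <= ?B * (int n + 1)" by (rule mult_right_mono[OF b]) simp
  ultimately have "int n + int d + 1 <= c0 + ?s" by (simp add: algebra_simps)
  moreover have "c0 + ?s <= int n" unfolding n_def by simp
  ultimately show False by simp
qed

theorem pencil_hilbert:
  obtains L where "(SUM j<L. card (BB j)) = d" "!!j. j >= L ==> card (BB j) = 0"
    "int d - int (SUM j<L. j * card (BB j)) <= c0"
proof -
  obtain L where L: "d <= (SUM j<L. card (BB j))" using degree_le by blast
  then have e: "(SUM j<L. card (BB j)) = d" using degree_ge by (simp add: le_antisym)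
  have z: "card (BB j) = 0" if "j >= L" for j
  proof -
    have "(SUM j<L. card (BB j)) + card (BB j) = (SUM j:insert j {..<L}. card (BB j))" using that by simp
    also have "... <= (SUM j<Suc j. card (BB j))" by (rule sum_mono2) (use that in auto)
    also have "... <= d" by (rule degree_ge)
    finally show ?thesis using e by simp
  qed
  define n where "n = max L m0"
  have "int d * (int n + 1) - int (SUM j<L. j * card (BB j)) <= int d * int n + c0"
    using hilbert_lower_int[of L n] hfI[of n] by (simp add: n_def e)
  then show ?thesis using that e z by (simp add: algebra_simps)
qed

end

text \<open>A sequence may repeat a vector, whereas \<open>qindep\<close> speaks of sets; a
  repetition is itself a relation.\<close>

lemma (in vector_space) qd_dependent:
  assumes q: "qd scale V W h" and W: "subspace W" and u: "!!i. u i : V"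
  shows "EX c. (EX i<=h. c i ~= 0) & (SUM i<=h. scale (c i) (u i)) : W"
proof (cases "inj_on u {..h}")
  case True
  have "~ qindep scale (u ` {..h}) W"
  proof
    assume "qindep scale (u ` {..h}) W"
    then have "card (u ` {..h}) <= h" by (rule qindep_le_qd[OF _ _ q W]) (use u in blast)
    then show False by (simp add: card_image[OF True])
  qed
  then obtain c x where c: "(SUM x:u ` {..h}. scale (c x) x) : W" "x : u ` {..h}" "c x ~= 0"
    unfolding qindep_def by blast
  then obtain i where "i <= h" "c (u i) ~= 0" by blast
  moreover have "(SUM i<=h. scale (c (u i)) (u i)) : W" using c(1) by (simp add: sum.reindex[OF True])
  ultimately show ?thesis by (intro exI[of _ "%i. c (u i)"]) blast
next
  case False
  then obtain i j where ij: "i <= h" "j <= h" "i ~= j" "u i = u j" unfolding inj_on_def by blast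
  define c where "c k = (if k = i then 1 else if k = j then -1 else 0 :: 'a)" for k
  have "(SUM k<=h. scale (c k) (u k)) = (SUM k:{i, j}. scale (c k) (u k))"
    by (rule sum.mono_neutral_right) (use ij in \<open>auto simp: c_def\<close>)
  also have "... = 0" using ij by (simp add: c_def)
  finally have "(SUM k<=h. scale (c k) (u k)) : W" using subspace_0[OF W] by simp
  moreover have "c i ~= 0" by (simp add: c_def)
  ultimately show ?thesis using ij(1) by blast
qed

section \<open>From the specialization x2 = 0 to transcendental x2\<close>

lemma split_var: "EX g. f = part (%m. lk m i = 0) f + var i * g & (ALL m:supp g. m + sng i 1 : supp f)"
proof -
  let ?K = "{m : supp f. ~ lk m i = 0}"
  define g where "g = (SUM m:?K. sng (m - sng i 1) (lk f m))"
  have p: "sng i 1 + (m - sng i 1) = m" if "lk m i ~= 0" for m :: mon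
    by (rule poly_mapping_eqI) (use that in \<open>auto simp: lookup_add lookup_minus lookup_single when_def\<close>)
  have x: "var i * sng (m - sng i 1) c = sng m c" if "lk m i ~= 0" for m c
    using p[OF that] by (simp add: var_def mult_single)
  have "part (%m. ~ lk m i = 0) f = var i * g"
    unfolding part_def g_def sum_distrib_left by (rule sum.cong[OF refl], rule x[symmetric]) simp
  then have "f = part (%m. lk m i = 0) f + var i * g" using part_split[of f "%m. lk m i = 0"] by simp
  moreover have "m + sng i 1 : supp f" if "m : supp g" for m
  proof -
    have "EX m':?K. m : supp (sng (m' - sng i 1) (lk f m'))" using that unfolding g_def by (rule supp_sumD)
    then obtain m' where "m' : ?K" "m : supp (sng (m' - sng i 1) (lk f m'))" by (elim bexE)
    then have "m' : ?K" "m = m' - sng i 1" by (auto split: if_splits)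
    then show ?thesis using p[of m'] by (simp add: add.commute)
  qed
  ultimately show ?thesis by blast
qed

lemma supp_mult_var: "m : supp h ==> m + sng i 1 : supp (var i * h)"
  using lk_mult_mo[of h "sng i 1" m] by (simp add: in_keys_iff var_def mult.commute)

lemma wlt3_cancel: "var 2 * h : wlt w3 (Suc n) ==> h : wlt w3 n"
proof -
  assume h: "var 2 * h : wlt w3 (Suc n)"
  have "w3 m < n" if "m : supp h" for m
  proof -
    have "w3 (m + sng 2 1) < Suc n" using h supp_mult_var[OF that, of 2] by (simp add: wlt_def)
    then show ?thesis by (simp add: w3_def lookup_add lookup_single)
  qed
  then show ?thesis by (simp add: wlt_def)
qed

lemma wlt3_wlt2: "wlt w3 n \<subseteq> wlt w2 n"
  unfolding wlt_def using w2_le_w3 by (auto intro: le_less_trans)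

lemma Av_mono: "S \<subseteq> T ==> Av S \<subseteq> Av T" unfolding Av_def by blast

lemma iota12: "EX c'. iota1 c = iota2 c'"
proof -
  obtain p q where pq: "iota1 c = Fract p q" "p : Av {0, 1}" "q : Av {0, 1}" "q ~= 0" using f1.rng by blast
  then have "p : Av {0, 1, 2}" "q : Av {0, 1, 2}" using Av_mono[of "{0, 1}" "{0, 1, 2}"] by blast+
  then show ?thesis using f2.scalar[of p q] pq by metis
qed

lemma loc12: "f1.loc M \<subseteq> f2.loc M"
  unfolding f1.loc_def f2.loc_def using Av_mono[of "{0, 1}" "{0, 1, 2}"] by blast

definition M2 :: "nat => mon set" where "M2 n = {m. lk m 0 = 0 & lk m 1 = 0 & lk m 2 = 0 & w2 m <= n}"

lemma finite_M2: "finite (M2 n)"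
proof (rule finite_subset)
  show "M2 n \<subseteq> (UN j<=n. mons j)" by (auto simp: M2_def mons_def mdeg_5 w2_def)
qed simp

context pencil
begin

text \<open>The module over polynomials in x0, x1, x2 generated by \<open>JJ n\<close>: sums of
  \<open>x2^i a_i\<close> in Horner form. The bound on the weight concerns each \<open>a_i\<close>,
  not the sum.\<close>

inductive_set AA :: "nat => mpoly set" for n where
  base: "a : JJ n ==> a : AA n"
| step: "a : JJ n ==> f : AA n ==> a + var 2 * f : AA n"

lemma JJ_closed: "0 : JJ n" "a : JJ n ==> b : JJ n ==> a + b : JJ n" "q : Av {0, 1} ==> a : JJ n ==> q * a : JJ n"
  using submod_JJ[of n] by (auto simp: f1.submod_def)

lemma AA_split: "f : AA n ==> EX a:JJ n. EX g:AA n. f = a + var 2 * g"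
proof (induction rule: AA.cases)
  case (base a)
  then show ?case using AA.base[OF JJ_closed(1)] by (intro bexI[of _ f] bexI[of _ 0]) auto
qed blast

lemma AA_add: "f : AA n ==> g : AA n ==> f + g : AA n"
proof (induction arbitrary: g rule: AA.induct)
  case (base a)
  obtain b h where bh: "b : JJ n" "h : AA n" "g = b + var 2 * h" using AA_split[OF base(2)] by blast
  then have "(a + b) + var 2 * h : AA n" using base(1) by (intro AA.step JJ_closed)
  then show ?case by (simp add: bh(3) add.assoc)
next
  case (step a f)
  obtain b h where bh: "b : JJ n" "h : AA n" "g = b + var 2 * h" using AA_split[OF step(4)] by blast
  then have "(a + b) + var 2 * (f + h) : AA n" using step by (intro AA.step JJ_closed) auto
  then show ?case by (simp add: bh(3) algebra_simps)
qed

lemma AA_mult1: "f : AA n ==> q : Av {0, 1} ==> q * f : AA n"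
proof (induction rule: AA.induct)
  case (step a f)
  then have "q * a + var 2 * (q * f) : AA n" by (intro AA.step JJ_closed) auto
  then show ?case by (simp add: algebra_simps)
qed (intro AA.base JJ_closed)

lemma submod_AA: "f2.submod (AA n)"
proof -
  define T where "T = {q. ALL f:AA n. q * f : AA n}"
  have z: "0 : AA n" by (rule AA.base[OF JJ_closed(1)])
  have "subring T" unfolding subring_def T_def using AA_add z by (auto simp: distrib_right mult.assoc)
  moreover have "const c : T" for c unfolding T_def using AA_mult1 Av_const by blast
  moreover have "var i : T" if "i : {0, 1, 2}" for i
  proof (cases "i = 2")
    case True
    have "0 + var 2 * f : AA n" if "f : AA n" for f by (rule AA.step[OF JJ_closed(1) that])
    then show ?thesis unfolding T_def True by simp
  next
    case False
    then show ?thesis using that Av_var T_def AA_mult1 by auto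
  qed
  ultimately have "Av {0, 1, 2} \<subseteq> T" by (rule Av_least)
  then show ?thesis unfolding f2.submod_def T_def using AA_add z by blast
qed

lemma AA_wlt: "f : AA n ==> f : wlt w2 n"
proof (induction rule: AA.induct)
  case (base a) then show ?case using wlt3_wlt2 by (auto simp: JJ_def)
next
  case (step a f)
  have "a : wlt w2 n" using step(1) wlt3_wlt2 by (auto simp: JJ_def)
  moreover have "var 2 * f : wlt w2 n" using submod_wlt2[of n] step(3) Av_var[of 2 "{0, 1, 2}"] by (simp add: f2.submod_def)
  ultimately show ?case by (rule wlt_add)
qed

text \<open>By \<open>hilbert_step\<close> with \<open>y = var 2\<close> the same count is attained
  by monomials without x2, of degree at most \<open>n\<close> in x3, x4.\<close>

lemma basis2_ex:
  "EX B<=M2 n. card B = card (BB n) & qindep f1.sc (emb ` mo ` B) (f1.loc (QQ (var 2) n)) &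
     f1.loc (wlt w3 (Suc n)) \<subseteq> f1.vs.span (emb ` mo ` B Un f1.loc (QQ (var 2) n))"
proof -
  have "EX B<=M2 n. qindep f1.sc (emb ` mo ` B) (f1.loc (QQ (var 2) n)) &
     f1.loc (wlt w3 (Suc n)) \<subseteq> f1.vs.span (emb ` mo ` B Un f1.loc (QQ (var 2) n)) &
     qd f1.sc (f1.loc (wlt w3 (Suc n))) (f1.loc (QQ (var 2) n)) (card B)"
  proof (rule f1.mono_basis[OF finite_M2 submod_wlt3 submod_QQ])
    show "mo ` M2 n \<subseteq> wlt w3 (Suc n)" by (auto simp: wlt_def M2_def w2_def w3_def)
    fix f assume f: "f : wlt w3 (Suc n)"
    show "emb f : f1.vs.span (emb ` mo ` M2 n Un f1.loc (QQ (var 2) n))"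
    proof (rule f1.mono_span[OF f1.vs.subspace_span])
      fix m assume "m : supp f"
      then have w: "w3 (f1.out m) <= n" using f by (force simp: wlt_def w3_def f1.lk_out)
      show "emb (mo (f1.out m)) : f1.vs.span (emb ` mo ` M2 n Un f1.loc (QQ (var 2) n))"
      proof (cases "lk (f1.out m) 2 = 0")
        case True
        then show ?thesis using w M2_def f1.lk_out w3_def w2_def f1.vs.span_base by auto
      next
        case False
        obtain g where g: "mo (f1.out m) = part (%m. lk m 2 = 0) (mo (f1.out m)) + var 2 * g" using split_var by blast
        have "part (%m. lk m 2 = 0) (mo (f1.out m)) = 0" by (rule part_none) (use False in simp)
        then have e: "mo (f1.out m) = var 2 * g" using g by simp
        have "mo (f1.out m) : wlt w3 (Suc n)" using w by (simp add: wlt_def)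
        then have "g : wlt w3 n" unfolding e by (rule wlt3_cancel)
        then show ?thesis using e f1.emb_loc mult_QQ f1.vs.span_base by auto
      qed
    qed
  qed
  moreover have "ALL m:supp (var 2). w3 m <= 1" by (simp add: var_def w3_def lookup_single)
  ultimately show ?thesis using BB_card[OF x2] by metis
qed

text \<open>Independence at x2 = 0 implies independence for transcendental x2: the part of
  \<open>f\<close> without x2 lies in \<open>QQ (var 2) n\<close> and is supported on
  \<open>B\<close>, so it is zero. Dividing by x2 leaves an element of the same kind with lower
  degree in x2.\<close>

lemma over_AA_zero:
  assumes B: "B \<subseteq> M2 n" "qindep f1.sc (emb ` mo ` B) (f1.loc (QQ (var 2) n))"
  shows "(!!m. m : supp f ==> lk m 2 < D) ==> f : AA (Suc n) ==> f : f2.over B ==> f = 0"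
proof (induction D arbitrary: f)
  case 0
  then have "supp f = {}" by blast
  then show ?case by simp
next
  case (Suc D)
  have fB: "finite B" using finite_subset[OF B(1) finite_M2] .
  obtain a f' where af: "a : JJ (Suc n)" "f' : AA (Suc n)" "f = a + var 2 * f'" using AA_split[OF Suc.prems(2)] by blast
  define f0 where "f0 = part (%m. lk m 2 = 0) f"
  obtain g where g: "f = f0 + var 2 * g" "!!m. m : supp g ==> m + sng 2 1 : supp f"
    using split_var[of f 2] unfolding f0_def by blast
  have o: "f1.out m = f2.out m" "f2.out m : B" if "m : supp f0" for m
  proof -
    have m: "m : supp f" "lk m 2 = 0" using that by (simp_all add: f0_def supp_part)
    show "f1.out m = f2.out m" by (rule poly_mapping_eqI) (use m(2) in \<open>auto simp: f1.lk_out f2.lk_out\<close>)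
    show "f2.out m : B" using Suc.prems(3) m(1) by (simp add: f2.over_def)
  qed
  have w0: "f0 : wlt w3 (Suc n)" unfolding wlt_def
  proof (intro CollectI ballI)
    fix m assume m: "m : supp f0"
    then have "lk m 2 = 0" by (simp add: f0_def supp_part)
    moreover have "w2 (f2.out m) <= n" using o(2)[OF m] B(1) by (auto simp: M2_def)
    ultimately show "w3 m < Suc n" by (simp add: w3_def w2_def f2.lk_out)
  qed
  have d: "var 2 * (f' - g) = f0 - a" using af(3) g(1) by (simp add: algebra_simps)
  have "f0 - a : wlt w3 (Suc n)" using w0 af(1) by (intro wlt_diff) (simp_all add: JJ_def)
  then have fg: "f' - g : wlt w3 n" unfolding d[symmetric] by (rule wlt3_cancel)
  have "f0 = a + var 2 * (f' - g)" using d by simp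
  then have "f0 : QQ (var 2) n" using af(1) fg unfolding QQ_def by blast
  moreover have "f0 : f1.over B" using o by (simp add: f1.over_def)
  moreover have "lk m i = 0" if "m : B" "i : {0, 1}" for m i using that B(1) by (auto simp: M2_def)
  ultimately have f0: "f0 = 0" using f1.qindep_mono[OF submod_QQ fB, of "var 2" n] B(2) by blast
  \<comment> \<open>Since x2 is a nonzerodivisor, \<open>g - f'\<close> is an equation again, so
    \<open>g\<close> differs from \<open>f'\<close> by a member of
    \<open>JJ (Suc n)\<close>.\<close>
  have a: "a = var 2 * (g - f')" using d f0 by (simp add: algebra_simps)
  have "g - f' : I" using af(1) a[symmetric] JJ_def nzdD[OF x2] by auto
  moreover have "g - f' : wlt w3 (Suc n)" using wlt_uminus[OF fg] wlt_mono[of n "Suc n" w3] by auto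
  ultimately have "f' + (g - f') : AA (Suc n)" by (intro AA_add[OF af(2)] AA.base) (simp add: JJ_def)
  then have gA: "g : AA (Suc n)" by simp
  have "g = 0"
  proof (rule Suc.IH[OF _ gA])
    show "lk m 2 < D" if "m : supp g" for m using Suc.prems(1)[OF g(2)[OF that]] by (simp add: lookup_add)
    show "g : f2.over B" unfolding f2.over_def
    proof (intro CollectI ballI)
      fix m assume "m : supp g"
      then have "f2.out (m + sng 2 1) : B" using g(2) Suc.prems(3) by (simp add: f2.over_def)
      moreover have "f2.out (m + sng 2 1) = f2.out m"
        by (rule poly_mapping_eqI) (auto simp: f2.lk_out lookup_add lookup_single when_def)
      ultimately show "f2.out m : B" by simp
    qed
  qed
  then show ?case using g(1) f0 by simp
qed

text \<open>Spanning at x2 = 0 writes \<open>u\<close> as \<open>v + x2^i u_i\<close> with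
  \<open>v\<close> in \<open>V\<close>, for every \<open>i\<close>. The \<open>u_i\<close> live in a
  finite-dimensional quotient, so a relation among them gives a nonzero polynomial \<open>s\<close>
  in x2 with \<open>s * u\<close> in \<open>V\<close>, and \<open>s\<close> is a scalar of the
  larger field.\<close>

lemma generic_spanning:
  assumes sp: "f1.loc (wlt w3 (Suc n)) \<subseteq> f1.vs.span (emb ` mo ` B Un f1.loc (QQ (var 2) n))"
    and V: "V = f2.vs.span (emb ` mo ` B Un f2.loc (AA (Suc n)))" and u: "u : f1.loc (wlt w3 (Suc n))"
  shows "u : V"
proof -
  let ?P = "f1.loc (wlt w3 (Suc n))" let ?Y = "emb (var 2)"
  have sV: "f2.vs.subspace V" unfolding V by (rule f2.vs.subspace_span)
  have V1: "iota1 c * x : V" if "x : V" for c x using iota12[of c] f2.vs.subspace_scale[OF sV that] by metis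
  obtain cY where cY: "iota2 cY = ?Y" using f2.scalar[of "var 2" 1] Av_var[of 2 "{0, 1, 2}"] f2.A_closed(2) by auto
  have YV: "?Y * x : V" if "x : V" for x using f2.vs.subspace_scale[OF sV that, of cY] by (simp add: cY)
  note sP = f1.loc_subspace[OF submod_wlt3, of "Suc n"]
  have JV: "f1.loc (JJ (Suc n)) \<subseteq> V" using V f2.vs.span_superset loc12 f2.loc_mono[of "JJ (Suc n)" "AA (Suc n)"] AA.base by blast
  let ?T = "{x. EX u':?P. x - ?Y * u' : V}"
  have "f1.vs.subspace ?T"
  proof (rule f1.vs.subspaceI)
    show "0 : ?T" using f1.vs.subspace_0[OF sP] f2.vs.subspace_0[OF sV] by (intro CollectI bexI[of _ 0]) auto
    show "x + y : ?T" if xy: "x : ?T" "y : ?T" for x y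
    proof -
      obtain s t where "s : ?P" "x - ?Y * s : V" "t : ?P" "y - ?Y * t : V" using xy by blast
      then show ?thesis using f1.vs.subspace_add[OF sP, of s t] f2.vs.subspace_add[OF sV, of "x - ?Y * s" "y - ?Y * t"]
        by (intro CollectI bexI[of _ "s + t"]) (simp_all add: algebra_simps)
    qed
    show "iota1 c * x : ?T" if x: "x : ?T" for c x
    proof -
      obtain s where s: "s : ?P" "x - ?Y * s : V" using x by blast
      have "iota1 c * (x - ?Y * s) : V" by (rule V1[OF s(2)])
      then show ?thesis using f1.vs.subspace_scale[OF sP s(1), of c]
        by (intro CollectI bexI[of _ "iota1 c * s"]) (simp_all add: algebra_simps)
    qed
  qed
  moreover have "emb ` mo ` B \<subseteq> ?T"
    using f1.vs.subspace_0[OF sP] f2.vs.span_superset[of "emb ` mo ` B Un f2.loc (AA (Suc n))"] unfolding V[symmetric]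
    by (intro subsetI CollectI bexI[of _ 0]) auto
  moreover have "f1.loc (QQ (var 2) n) \<subseteq> ?T"
  proof
    fix x assume "x : f1.loc (QQ (var 2) n)"
    then obtain f q where f: "x = Fract f q" "f : QQ (var 2) n" "q : Av {0, 1}" "q ~= 0" unfolding f1.loc_def by blast
    then obtain a b where ab: "f = a + var 2 * b" "a : JJ (Suc n)" "b : wlt w3 n" unfolding QQ_def by blast
    have "x - ?Y * Fract b q = Fract a q" using f(4) by (simp add: f(1) ab(1) eq_fract algebra_simps)
    moreover have "Fract a q : V" using JV ab(2) f unfolding f1.loc_def by blast
    moreover have "Fract b q : ?P" using ab(3) wlt_mono[of n "Suc n" w3] f unfolding f1.loc_def by auto
    ultimately show "x : ?T" by (intro CollectI bexI[of _ "Fract b q"]) simp_all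
  qed
  ultimately have "f1.vs.span (emb ` mo ` B Un f1.loc (QQ (var 2) n)) \<subseteq> ?T" by (intro f1.vs.span_minimal) auto
  then have nx: "EX u':?P. x - ?Y * u' : V" if "x : ?P" for x using sp that by blast
  then obtain nxt where nxt: "!!x. x : ?P ==> nxt x : ?P & x - ?Y * nxt x : V" by metis
  have Yp: "?Y ^ k * x : V" if "x : V" for k x by (induction k) (use YV that in \<open>simp_all add: mult.assoc\<close>)
  define us where "us i = (nxt ^^ i) u" for i
  have us: "us i : ?P" for i by (induction i) (use u nxt in \<open>auto simp: us_def\<close>)
  have ud: "u - ?Y ^ i * us i : V" for i
  proof (induction i)
    case 0 then show ?case using f2.vs.subspace_0[OF sV] by (simp add: us_def)
  next
    case (Suc i)
    have "us i - ?Y * us (Suc i) : V" using nxt[OF us[of i]] by (simp add: us_def)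
    then have "(u - ?Y ^ i * us i) + ?Y ^ i * (us i - ?Y * us (Suc i)) : V" by (metis Yp f2.vs.subspace_add[OF sV Suc])
    then show ?case by (simp add: algebra_simps)
  qed
  obtain h where h: "qd f1.sc ?P (f1.loc (JJ (Suc n))) h" using hilbert_sum by blast
  obtain c where "(EX i<=h. c i ~= 0) & (SUM i<=h. iota1 (c i) * us i) : f1.loc (JJ (Suc n))"
    using f1.vs.qd_dependent[of ?P _ h us, OF h f1.loc_subspace[OF submod_JJ] us] by (rule exE)
  then have c: "EX i<=h. c i ~= 0" "(SUM i<=h. iota1 (c i) * us i) : f1.loc (JJ (Suc n))" by (rule conjunct1, rule conjunct2)
  \<comment> \<open>Modulo \<open>V\<close>, \<open>u_i\<close> stands for \<open>u / x2^i\<close>;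
    the exponent \<open>h - i\<close> clears these denominators in the relation.\<close>
  define s where "s = (SUM i<=h. iota1 (c i) * ?Y ^ (h - i))"
  have "s * u : V"
  proof -
    have "s * u = (SUM i<=h. ?Y ^ (h - i) * (iota1 (c i) * (u - ?Y ^ i * us i))) + ?Y ^ h * (SUM i<=h. iota1 (c i) * us i)"
    proof -
      have "iota1 (c i) * ?Y ^ (h - i) * u = ?Y ^ (h - i) * (iota1 (c i) * (u - ?Y ^ i * us i)) + ?Y ^ h * (iota1 (c i) * us i)" if "i <= h" for i
      proof -
        have "?Y ^ h = ?Y ^ (h - i) * ?Y ^ i" using that by (metis le_add_diff_inverse2 power_add)
        then show ?thesis by (simp add: algebra_simps)
      qed
      then show ?thesis unfolding s_def sum_distrib_right sum_distrib_left sum.distrib[symmetric] by (intro sum.cong) auto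
    qed
    also have "... : V"
    proof (rule f2.vs.subspace_add[OF sV f2.vs.subspace_sum[OF sV]])
      show "?Y ^ (h - i) * (iota1 (c i) * (u - ?Y ^ i * us i)) : V" for i by (intro Yp V1 ud)
      show "?Y ^ h * (SUM i<=h. iota1 (c i) * us i) : V" using c(2) JV by (intro Yp) blast
    qed
    finally show ?thesis .
  qed
  \<comment> \<open>Powers of x2 are independent over the field of x0, x1.\<close>
  moreover have "s ~= 0"
  proof
    assume s0: "s = 0"
    let ?B = "(%i. sng 2 (h - i) :: mon) ` {..h}"
    have "qindep f1.sc (emb ` mo ` ?B) (f1.loc {0})"
      by (subst f1.qindep_mono) (auto simp: f1.submod_def lookup_single)
    then have qi: "qindep f1.sc ((%i. emb (mo (sng 2 (h - i)))) ` {..h}) (f1.loc {0})" by (simp add: image_image)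
    have inj: "inj_on (%i. emb (mo (sng 2 (h - i)))) {..h}"
    proof (rule inj_onI)
      fix i j assume ij: "i : {..h}" "j : {..h}" "emb (mo (sng 2 (h - i))) = emb (mo (sng 2 (h - j)))"
      then have "h - i = h - j" by (metis emb_eq keys_single one_neq_zero singletonD singletonI lookup_single_eq)
      then show "i = j" using ij(1,2) by simp
    qed
    define c' where "c' x = c (the_inv_into {..h} (%i. emb (mo (sng 2 (h - i)))) x)" for x
    have c': "c' (emb (mo (sng 2 (h - i)))) = c i" if "i <= h" for i
      unfolding c'_def using the_inv_into_f_f[OF inj, of i] that by simp
    have Ye: "?Y ^ k = emb (mo (sng 2 k))" for k
      using sng_meval[of "sng 2 k"] by (simp add: meval_single rhom_power[OF rhom_emb, symmetric])
    have "(SUM x:(%i. emb (mo (sng 2 (h - i)))) ` {..h}. iota1 (c' x) * x) = s"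
      unfolding sum.reindex[OF inj] s_def by (rule sum.cong) (simp_all add: c' Ye)
    then have m: "(SUM x:(%i. emb (mo (sng 2 (h - i)))) ` {..h}. iota1 (c' x) * x) : f1.loc {0}"
      using s0 f1.emb_loc[of 0 "{0}"] by simp
    obtain i where i: "i <= h" "c i ~= 0" using c(1) by blast
    then show False using i qindepD[OF qi m] c'[OF i(1)] by auto
  qed
  moreover have "EX t. iota2 t = s"
  proof -
    note sr = subring_range[OF f2.iota]
    have "iota1 x : range iota2" for x using iota12[of x] by blast
    moreover have "?Y ^ k : range iota2" for k by (rule subring_power[OF sr]) (use cY in \<open>metis rangeI\<close>)
    ultimately have "iota1 (c i) * ?Y ^ (h - i) : range iota2" for i using sr unfolding subring_def by blast
    then have "s : range iota2" unfolding s_def by (intro subring_sum[OF sr])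
    then show ?thesis by blast
  qed
  ultimately obtain t where t: "iota2 t * u : V" "t ~= 0" using f2.iota_0 by metis
  have "iota2 (inverse t) * (iota2 t * u) : V" by (rule f2.vs.subspace_scale[OF sV t(1)])
  moreover have "iota2 (inverse t) * iota2 t = 1" using t(2) by (simp add: rhom_mult[OF f2.iota, symmetric] rhom_1[OF f2.iota])
  ultimately show ?thesis by (simp flip: mult.assoc)
qed

theorem generic_hilbert: "qd f2.sc (f2.loc (wlt w2 (Suc n))) (f2.loc (AA (Suc n))) (card (BB n))"
proof -
  obtain B where B: "B \<subseteq> M2 n" "card B = card (BB n)" "qindep f1.sc (emb ` mo ` B) (f1.loc (QQ (var 2) n))"
     "f1.loc (wlt w3 (Suc n)) \<subseteq> f1.vs.span (emb ` mo ` B Un f1.loc (QQ (var 2) n))" using basis2_ex by blast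
  have fB: "finite B" using finite_subset[OF B(1) finite_M2] .
  define V where "V = f2.vs.span (emb ` mo ` B Un f2.loc (AA (Suc n)))"
  have sV: "f2.vs.subspace V" unfolding V_def by (rule f2.vs.subspace_span)
  have z: "lk m i = 0" if "m : B" "i : {0, 1, 2}" for m i using that B(1) by (auto simp: M2_def)
  have "f = 0" if f: "f : AA (Suc n)" "f : f2.over B" for f
  proof (rule over_AA_zero[OF B(1,3) _ f])
    show "lk m 2 < Suc (tdeg f)" if "m : supp f" for m using tdeg_ge[OF that] by (simp add: mdeg_5)
  qed
  then have "qindep f2.sc (emb ` mo ` B) (f2.loc (AA (Suc n)))" using f2.qindep_mono[OF submod_AA fB z] by blast
  moreover have "f2.loc (wlt w2 (Suc n)) \<subseteq> V"
  proof (rule f2.loc_minimal[OF sV], rule f2.mono_span[OF sV])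
    fix f m assume f: "f : wlt w2 (Suc n)" "m : supp f"
    then show "emb (mo (f2.out m)) : V" using wlt_def w3_def w2_def f2.lk_out generic_spanning[OF B(4) V_def] f1.emb_loc by auto
  qed
  moreover have "emb ` mo ` B \<subseteq> f2.loc (wlt w2 (Suc n))"
    using B(1) by (auto simp: M2_def wlt_def intro!: f2.emb_loc)
  moreover have "card (emb ` mo ` B) = card (BB n)"
    unfolding B(2)[symmetric] image_image by (rule card_image[OF f2.inj_emb_mo])
  ultimately show ?thesis unfolding qd_def V_def by blast
qed

end

section \<open>Complete intersections over the field of rational functions\<close>

text \<open>Setting x0 = x1 = x2 = 0. For a form of degree \<open>e\<close> this is its part of
  weight \<open>e\<close> in x3, x4, so \<open>bar\<close> takes leading forms over the larger
  field.\<close>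

abbreviation bar :: "mpoly => mpoly" where "bar \<equiv> kill {0, 1, 2}"

lemma bar_bar: "bar (bar f) = bar f"
  unfolding kill_part[of "{0, 1, 2}" "bar f"] by (rule part_id) (simp add: kill_part supp_part)

lemma bar_Vid: "f - g : Vid {0, 1, 2} \<longleftrightarrow> bar f = bar g"
  by (simp add: Vid_kill rhom_diff[OF kill_rhom])

lemma part_compl: "f - part Q f = part (%m. ~ Q m) (f :: mpoly)"
  by (rule diff_eq_eq[THEN iffD2], subst add.commute, rule part_split)

lemma part_uminus: "part Q (- f) = - part Q (f :: mpoly)"
  by (rule poly_mapping_eqI) (simp add: lk_part)

lemma bar_w2: "homog e f ==> m : supp (bar f) ==> w2 m = e"
proof -
  assume "homog e f" "m : supp (bar f)"
  then show ?thesis by (auto simp: kill_part supp_part homog_mdeg mdeg_5 w2_def)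
qed

lemma bar_lower: "homog e f ==> f - bar f : wlt w2 e"
proof -
  assume f: "homog e f"
  have "f - bar f = part (%m. ~ (ALL i:{0, 1, 2}. lk m i = 0)) f"
    unfolding kill_part by (rule part_compl)
  moreover have "w2 m < e" if "m : supp f" "~ (ALL i:{0, 1, 2}. lk m i = 0)" for m using f that(1) that(2) homog_mdeg mdeg_5 w2_def by auto
  ultimately show ?thesis by (simp add: wlt_def supp_part)
qed

text \<open>No form of positive degree divides powers of both x3 and x4; this keeps the leading
  forms of a complete intersection from vanishing.\<close>

lemma coprime_forms_nonzero:
  assumes "var 3 ^ N = al * A" "var 4 ^ N = al' * A" "homog g A" "g > 0" shows False
proof -
  have A0: "A ~= 0" using assms(1) by (metis mult_zero_right power_not_zero var_nz)
  have "A * (var 4 ^ N * al - var 3 ^ N * al') = var 4 ^ N * (al * A) - var 3 ^ N * (al' * A)" by (simp add: algebra_simps)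
  also have "... = 0" unfolding assms(1,2)[symmetric] by simp
  finally have e: "var 4 ^ N * al = var 3 ^ N * al'" using A0 by simp
  have "var 4 ^ N * al : gen {var 3 ^ N, var 3 ^ N}" unfolding e gen_same gen_single by simp
  then have "al : gen {var 3 ^ N, var 3 ^ N}" by (rule monomial_nzd_2[rotated 2]) simp_all
  then obtain c where "al = var 3 ^ N * c" unfolding gen_same gen_single dvd_def by blast
  then have "var 3 ^ N * (c * A) = al * A" by (simp only: mult_ac)
  also have "... = var 3 ^ N * 1" using assms(1) by simp
  finally have "c * A = 1" by simp
  moreover have "hc 0 (c * A) = 0" by (rule hc_mult_small[OF assms(3,4)])
  moreover have "hc 0 1 = 1" using hc_homog[OF homog_1, of 0] by simp
  ultimately show False by simp
qed

text \<open>Powers of x3 and x4 lie in \<open>(A, B)\<close>, so \<open>x3^N a\<close> and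
  \<open>x4^N a\<close> are multiples of \<open>B\<close>; comparing the two quotients makes
  \<open>a\<close> itself a multiple.\<close>

lemma trivial_syzygy:
  assumes A: "var 3 ^ N = al * A + be * B" "var 4 ^ N = al' * A + be' * B" and B: "B ~= 0" and s: "A * a + B * b = 0"
  shows "EX c. a = c * B & b = - c * A"
proof -
  have s': "A * a = - (B * b)" using s by (simp add: eq_neg_iff_add_eq_0)
  have e3: "var 3 ^ N * a = B * (be * a - al * b)"
  proof -
    have "var 3 ^ N * a = al * (A * a) + be * B * a" unfolding A(1) by (simp add: algebra_simps)
    then show ?thesis unfolding s' by (simp add: algebra_simps)
  qed
  have e4: "var 4 ^ N * a = B * (be' * a - al' * b)"
  proof -
    have "var 4 ^ N * a = al' * (A * a) + be' * B * a" unfolding A(2) by (simp add: algebra_simps)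
    then show ?thesis unfolding s' by (simp add: algebra_simps)
  qed
  let ?ga = "be * a - al * b" let ?ga' = "be' * a - al' * b"
  have "B * (var 4 ^ N * ?ga) = var 4 ^ N * (var 3 ^ N * a)" unfolding e3 by (simp only: mult_ac)
  also have "... = var 3 ^ N * (var 4 ^ N * a)" by (simp only: mult_ac)
  also have "... = B * (var 3 ^ N * ?ga')" unfolding e4 by (simp only: mult_ac)
  finally have e: "var 4 ^ N * ?ga = var 3 ^ N * ?ga'" using B by simp
  have "var 4 ^ N * ?ga : gen {var 3 ^ N, var 3 ^ N}" unfolding e gen_same gen_single by simp
  then have "?ga : gen {var 3 ^ N, var 3 ^ N}" by (rule monomial_nzd_2[rotated 2]) simp_all
  then obtain c where c: "?ga = var 3 ^ N * c" unfolding gen_same gen_single dvd_def by blast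
  then have a: "a = c * B" using e3 c mult_ac by auto
  then have "B * b = B * (- c * A)" using s by (simp add: algebra_simps add_eq_0_iff)
  then show ?thesis by (metis B a mult_cancel_left)
qed

text \<open>Degrees are written as \<open>w2 m + t = M\<close>, so that components of negative index
  vanish without truncated subtraction.\<close>

lemma part_shift:
  assumes h: "!!m. m : supp h ==> w2 m = e"
  shows "part (%m. w2 m + t = M) (a * h) = part (%m. w2 m + (t + e) = M) a * (h :: mpoly)"
proof (cases "t + e <= M")
  case True
  then obtain j where j: "M = (j + e) + t" using le_Suc_ex by (metis add.commute add.assoc)
  show ?thesis using j part_mult[OF w2_add h] by auto
next
  case False
  then have r: "part (%m. w2 m + (t + e) = M) a = 0" by (intro part_none) auto
  have "part (%m. w2 m + t = M) (a * h) = 0"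
  proof (rule part_none)
    fix m assume "m : supp (a * h)"
    then obtain x y where "y : supp h" "m = x + y" using supp_mult by blast
    then show "~ w2 m + t = M" using h[of y] False by (simp add: w2_add)
  qed
  then show ?thesis using r by simp
qed

text \<open>\<open>irr\<close> says that the common zeros of \<open>G\<close> and \<open>F\<close>
  miss the line x0 = x1 = x2 = 0, so their leading forms in x3, x4 are a regular sequence.\<close>

locale ci_pair =
  fixes G F :: mpoly and g k N :: nat
  assumes G: "homog g G" "g > 0" and F: "homog k F" "k > 0"
    and irr: "!!i. var i ^ N : gen (insert F (gen (insert G (Vid {0, 1, 2}))))"
begin

lemma power_bar: "i ~: {0, 1, 2} ==> EX al be. var i ^ N = al * bar G + be * bar F"
proof -
  assume i: "i ~: {0, 1, 2}"
  obtain b y where 1: "var i ^ N = b * F + y" "y : gen (insert G (Vid {0, 1, 2}))" using irr gen_insertE[OF _ ideal_gen] by metis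
  obtain a v where 2: "y = a * G + v" "v : Vid {0, 1, 2}" using gen_insertE[OF 1(2) ideal_Vid] by metis
  have "bar (var i ^ N) = bar a * bar G + bar b * bar F"
    unfolding 1(1) 2(1) using 2(2) by (simp add: rhom_add[OF kill_rhom] rhom_mult[OF kill_rhom] Vid_kill)
  moreover have "bar (var i ^ N) = var i ^ N" using i by (simp add: rhom_power[OF kill_rhom] kill_var)
  ultimately show ?thesis by metis
qed

lemma bar_homog: "homog e f ==> homog e (bar f)"
  by (simp add: kill_part homog_def supp_part)

lemma bar_nz: "bar F ~= 0" "bar G ~= 0"
proof -
  obtain al be where 3: "var 3 ^ N = al * bar G + be * bar F" using power_bar[of 3] by auto
  obtain al' be' where 4: "var 4 ^ N = al' * bar G + be' * bar F" using power_bar[of 4] by auto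
  show "bar F ~= 0" using coprime_forms_nonzero[OF _ _ bar_homog[OF G(1)] G(2), of N al al'] 3 4 by auto
  show "bar G ~= 0" using coprime_forms_nonzero[OF _ _ bar_homog[OF F(1)] F(2), of N be be'] 3 4 by auto
qed

lemma syzygy: "bar G * a + bar F * b = 0 ==> EX c. a = c * bar F & b = - c * bar G"
proof -
  assume s: "bar G * a + bar F * b = 0"
  obtain al be where 3: "var 3 ^ N = al * bar G + be * bar F" using power_bar[of 3] by auto
  obtain al' be' where 4: "var 4 ^ N = al' * bar G + be' * bar F" using power_bar[of 4] by auto
  show ?thesis by (rule trivial_syzygy[OF 3 4 bar_nz(1) s])
qed

text \<open>On the line, the Hilbert function of \<open>G\<close> is \<open>g\<close> from degree
  \<open>g - 1\<close> on, and cutting with \<open>F\<close> subtracts the same value shifted by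
  \<open>k\<close>: nothing is left from degree \<open>g + k - 1\<close> on.\<close>

lemma high_degree:
  assumes n: "g + k <= Suc n" and f: "homog n f"
  shows "f : gen (insert F (gen (insert G (Vid {0, 1, 2}))))"
proof -
  let ?V = "Vid {0, 1, 2}" let ?VG = "gen (insert G ?V)"
  have z: "h : ?V" if "G * h : ?V" for h using that bar_nz(2) by (simp add: Vid_kill rhom_mult[OF kill_rhom])
  have VG: "hilbert_function ?VG j = g" if "g <= Suc j" for j
    using hf_nzd[OF homog_ideal_Vid[of "{0, 1, 2}"] G(1) z, of j] hf_Vid[of "{0, 1, 2}" 1] that by (cases "g <= j") auto
  have z2: "h : ?VG" if "F * h : ?VG" for h
  proof -
    obtain a v where av: "F * h = a * G + v" "v : ?V" using gen_insertE[OF \<open>F * h : _\<close> ideal_Vid] by metis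
    have "bar G * bar a + bar F * (- bar h) = 0" using av(2) arg_cong[OF av(1), of bar] rhom_add[OF kill_rhom] rhom_mult[OF kill_rhom] Vid_kill mult.commute by auto
    then obtain c where "- bar h = - c * bar G" using syzygy by blast
    then have "bar (bar h) = bar (c * bar G)" using arg_cong by auto
    then have "c * G + (h - c * G) : ?VG" by (metis bar_bar rhom_mult[OF kill_rhom] gen_insertI ideal_Vid bar_Vid)
    then show ?thesis by simp
  qed
  have "hilbert_function (gen (insert F ?VG)) n = 0" using n G(2) hf_nzd[OF homog_ideal_insert[OF homog_ideal_Vid G(1)] F(1) z2] VG[of n] VG[of "n - k"] by auto
  then show ?thesis using hf_eq_0[OF ideal_gen] f by blast
qed

text \<open>Members of \<open>(G, F)\<close> with a representation that stays within the level;
  \<open>regular\<close> shows that every member of low weight has one.\<close>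

definition RR :: "nat => mpoly set" where
  "RR n = {G * a + F * b | a b. a : wlt (%m. w2 m + g) n & b : wlt (%m. w2 m + k) n}"

lemma reduce_top:
  assumes "g + k <= Suc n" "w2 mu = n" "!!i. i : {0, 1, 2} ==> lk mu i = 0"
  shows "EX v:wlt w2 n. mo mu - v : RR (Suc n)"
proof -
  have h: "homog n (mo mu)" using homog_single[of mu 1] assms(2) assms(3)[of 0] assms(3)[of 1] assms(3)[of 2] by (simp add: mdeg_5 w2_def)
  obtain b y where 1: "mo mu = b * F + y" "y : gen (insert G (Vid {0, 1, 2}))" "homog n y" "n >= k ==> homog (n - k) b" "n < k ==> b = 0"
    using gen_insert_homogE[OF homog_ideal_insert[OF homog_ideal_Vid G(1)] F(1) high_degree[OF assms(1) h] h] by metis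
  obtain a v where 2: "y = a * G + v" "v : Vid {0, 1, 2}" "homog n v" "n >= g ==> homog (n - g) a" "n < g ==> a = 0"
    using gen_insert_homogE[OF homog_ideal_Vid G(1) 1(2,3)] by metis
  have "w2 m < n" if "m : supp v" for m
  proof -
    have "EX i:{0, 1, 2}. lk m i ~= 0" using 2(2) that by (simp only: Vid_def mem_Collect_eq)
    then have "lk m 0 ~= 0 | lk m 1 ~= 0 | lk m 2 ~= 0" by simp
    moreover have "mdeg m = n" using 2(3) that by (simp add: homog_mdeg)
    ultimately show ?thesis unfolding mdeg_5 w2_def by linarith
  qed
  then have "v : wlt w2 n" by (simp add: wlt_def)
  moreover have low: "c : wlt (%m. w2 m + e) (Suc n)" if "n >= e ==> homog (n - e) c" "n < e ==> c = 0" for c e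
  proof (cases "n >= e")
    case True
    have "w2 m <= n - e" if "m : supp c" for m
      using \<open>n >= e ==> homog (n - e) c\<close>[OF True] that w2_le_w3[of m] w3_le_mdeg[of m] by (simp add: homog_mdeg)
    then show ?thesis using True by (force simp: wlt_def)
  qed (use that(2) in simp)
  have "mo mu - v = G * a + F * b" unfolding 1(1) 2(1) by (simp add: algebra_simps)
  then have "mo mu - v : RR (Suc n)" unfolding RR_def using low[OF 2(4,5)] low[OF 1(4,5)] by blast
  ultimately show ?thesis by blast
qed

lemma submod_RR: "f2.submod (RR n)"
proof -
  have s: "f2.submod (wlt (%m. w2 m + e) n)" for e
  proof -
    have "q * a : wlt (%m. w2 m + e) n" if "q : Av {0, 1, 2}" "a : wlt (%m. w2 m + e) n" for q a
      unfolding wlt_def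
    proof (intro CollectI ballI)
      fix m assume "m : supp (q * a)"
      then obtain x y where "x : supp q" "y : supp a" "m = x + y" using supp_mult by blast
      then show "w2 m + e < n" using that by (simp add: w2_add Av_def wlt_def) (simp add: w2_def)
    qed
    then show ?thesis unfolding f2.submod_def using wlt_add by auto
  qed
  show ?thesis unfolding f2.submod_def
  proof (intro conjI ballI)
    show "0 : RR n" unfolding RR_def by (intro CollectI exI[of _ 0]) simp
    fix x assume "x : RR n"
    then obtain a b where x: "x = G * a + F * b" "a : wlt (%m. w2 m + g) n" "b : wlt (%m. w2 m + k) n" unfolding RR_def by blast
    show "q * x : RR n" if "q : Av {0, 1, 2}" for q
    proof -
      have "q * x = G * (q * a) + F * (q * b)" by (simp add: x(1) algebra_simps)
      moreover have "q * a : wlt (%m. w2 m + g) n" "q * b : wlt (%m. w2 m + k) n"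
        using s x(2,3) that unfolding f2.submod_def by blast+
      ultimately show ?thesis unfolding RR_def by blast
    qed
    fix y assume "y : RR n"
    then obtain c d where y: "y = G * c + F * d" "c : wlt (%m. w2 m + g) n" "d : wlt (%m. w2 m + k) n" unfolding RR_def by blast
    have "x + y = G * (a + c) + F * (b + d)" by (simp add: x(1) y(1) algebra_simps)
    then show "x + y : RR n" unfolding RR_def using x y wlt_add by blast
  qed
qed

lemma wlt_mult_shift:
  assumes "h : wlt w2 e" "!!m. m : supp a ==> w2 m + (t + e) <= M"
  shows "a * h : wlt (%m. w2 m + t) M"
  unfolding wlt_def
proof (intro CollectI ballI)
  fix m assume "m : supp (a * h)"
  then obtain x y where "x : supp a" "y : supp h" "m = x + y" using supp_mult by blast
  then show "w2 m + t < M" using assms(1) assms(2)[of x] by (fastforce simp: wlt_def w2_add)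
qed

lemma part_top:
  assumes h: "homog e h" and a: "a : wlt (%m. w2 m + e) (Suc M)"
  shows "part (%m. w2 m = M) (h * a) = part (%m. w2 m + e = M) a * bar h"
proof -
  have "part (%m. w2 m = M) (a * bar h) = part (%m. w2 m + e = M) a * bar h"
    using part_shift[of "bar h" e 0 M a, OF bar_w2[OF h]] by simp
  moreover have "part (%m. w2 m = M) (a * (h - bar h)) = 0"
  proof (rule part_none)
    have "a * (h - bar h) : wlt (%m. w2 m + 0) M"
      by (rule wlt_mult_shift[OF bar_lower[OF h]]) (use a in \<open>auto simp: wlt_def less_Suc_eq_le\<close>)
    then show "~ w2 m = M" if "m : supp (a * (h - bar h))" for m using that by (force simp: wlt_def)
  qed
  moreover have "h * a = a * bar h + a * (h - bar h)" by (simp add: algebra_simps)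
  ultimately show ?thesis by (simp only: part_add) simp
qed

text \<open>The excess \<open>M\<close> of the representation over the level is removed step by
  step. Its leading terms cancel, so they form a syzygy of the leading forms of \<open>G\<close> and
  \<open>F\<close>, a multiple of the trivial one; subtracting that multiple lowers the
  excess.\<close>

lemma regular_aux:
  "f : wlt w2 n ==> f = G * a + F * b ==> a : wlt (%m. w2 m + g) (n + M) ==> b : wlt (%m. w2 m + k) (n + M) ==> f : RR n"
proof (induction M arbitrary: a b)
  case 0
  then show ?case unfolding RR_def by auto
next
  case (Suc M)
  let ?M = "n + M"
  have a: "a : wlt (%m. w2 m + g) (Suc ?M)" and b: "b : wlt (%m. w2 m + k) (Suc ?M)" using Suc.prems by simp_all
  define a1 where "a1 = part (%m. w2 m + g = ?M) a"
  define b1 where "b1 = part (%m. w2 m + k = ?M) b"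
  have "part (%m. w2 m = ?M) f = 0" by (rule part_none) (use Suc.prems(1) in \<open>force simp: wlt_def\<close>)
  then have "bar G * a1 + bar F * b1 = 0"
    unfolding Suc.prems(2) part_add part_top[OF G(1) a] part_top[OF F(1) b] a1_def b1_def by (simp add: mult.commute)
  then obtain c where c: "a1 = c * bar F" "b1 = - c * bar G" using syzygy by blast
  define c1 where "c1 = part (%m. w2 m + (g + k) = ?M) c"
  have "part (%m. w2 m + g = ?M) a1 = a1" unfolding a1_def by (rule part_id) (simp add: supp_part)
  then have "a1 = part (%m. w2 m + g = ?M) (c * bar F)" unfolding c(1) by (rule sym)
  also have "... = c1 * bar F" unfolding c1_def by (rule part_shift[OF bar_w2[OF F(1)]])
  finally have a1: "a1 = c1 * bar F" .
  have "part (%m. w2 m + k = ?M) b1 = b1" unfolding b1_def by (rule part_id) (simp add: supp_part)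
  then have "b1 = part (%m. w2 m + k = ?M) (- c * bar G)" unfolding c(2) by (rule sym)
  also have "... = - c1 * bar G" unfolding c1_def part_uminus[symmetric] add.commute[of g k] by (rule part_shift[OF bar_w2[OF G(1)]])
  finally have b1: "b1 = - c1 * bar G" .
  have pa: "a - a1 : wlt (%m. w2 m + g) ?M" using a by (auto simp: a1_def part_compl wlt_def supp_part less_Suc_eq)
  have pb: "b - b1 : wlt (%m. w2 m + k) ?M" using b by (auto simp: b1_def part_compl wlt_def supp_part less_Suc_eq)
  have cF: "c1 * (F - bar F) : wlt (%m. w2 m + g) ?M"
    by (rule wlt_mult_shift[OF bar_lower[OF F(1)]]) (simp add: c1_def supp_part)
  have cG: "c1 * (G - bar G) : wlt (%m. w2 m + k) ?M"
    by (rule wlt_mult_shift[OF bar_lower[OF G(1)]]) (simp add: c1_def supp_part)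
  have "f = G * ((a - a1) - c1 * (F - bar F)) + F * ((b - b1) + c1 * (G - bar G))"
    unfolding a1 b1 Suc.prems(2) by (simp add: algebra_simps)
  then show ?case using Suc.IH[OF Suc.prems(1)] wlt_diff[OF pa cF] wlt_add[OF pb cG] by blast
qed

lemma regular: "f : wlt w2 n ==> f = G * a + F * b ==> f : RR n"
proof -
  assume f: "f : wlt w2 n" "f = G * a + F * b"
  have t: "c : wlt (%m. w2 m + e) (n + (tdeg a + tdeg b + g + k + 1))" if "tdeg c <= tdeg a + tdeg b" "e <= g + k" for c e
    unfolding wlt_def
  proof (intro CollectI ballI)
    fix m assume "m : supp c"
    then show "w2 m + e < n + (tdeg a + tdeg b + g + k + 1)" using that tdeg_ge[of m c] w2_le_w3[of m] w3_le_mdeg[of m] by auto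
  qed
  show ?thesis by (rule regular_aux[OF f t t]) simp_all
qed

end

context monofield
begin

lemma submod_over: "submod (over B)"
  unfolding submod_def
proof (intro conjI ballI)
  show "0 : over B" by (simp add: over_def)
  fix a assume a: "a : over B"
  show "a + b : over B" if "b : over B" for b using a that supp_addD[of _ a b] unfolding over_def by blast
  show "q * a : over B" if q: "q : Av S" for q
    unfolding over_def
  proof (intro CollectI ballI)
    fix m assume "m : supp (q * a)"
    then obtain x y where xy: "x : supp q" "y : supp a" "m = x + y" using supp_mult by blast
    have "out m = out y" by (rule poly_mapping_eqI) (use xy q in \<open>auto simp: lk_out lookup_add Av_def\<close>)
    then show "out m : B" using a xy(2) by (simp add: over_def)
  qed
qed

lemma hc_over: "f : over B ==> hc n f : over B"
  by (simp add: over_def hc_def supp_part)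

lemma out_id: "(!!i. i : S ==> lk m i = 0) ==> out m = m"
  by (rule poly_mapping_eqI) (simp add: lk_out)

lemma span_loc:
  assumes N: "submod N" and B: "!!m i. m : B ==> i : S ==> lk m i = 0"
  shows "vs.span (emb ` mo ` B Un loc N) \<subseteq> loc {a + b | a b. a : over B & b : N}" (is "_ \<subseteq> loc ?M")
proof (rule vs.span_minimal)
  show "vs.subspace (loc ?M)" by (intro loc_subspace submod_plus submod_over N)
  have "emb (mo mu) : loc ?M" if mu: "mu : B" for mu
  proof -
    have "mo mu : over B" using mu out_id[OF B[OF mu]] by (simp add: over_def)
    then have "mo mu + 0 : ?M" using N unfolding submod_def by blast
    then show ?thesis using emb_loc[of "mo mu + 0" ?M] by simp
  qed
  moreover have "loc N \<subseteq> loc ?M"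
  proof (rule loc_mono, rule subsetI)
    fix b assume "b : N"
    moreover have "0 : over B" using submod_over[of B] by (simp add: submod_def)
    ultimately have "0 + b : ?M" by blast
    then show "b : ?M" by simp
  qed
  ultimately show "emb ` mo ` B Un loc N \<subseteq> loc ?M" by blast
qed

end

section \<open>Surfaces finite over the plane\<close>

definition MN :: "nat => mon set" where
  "MN N = {m. lk m 0 = 0 & lk m 1 = 0 & lk m 2 = 0 & lk m 3 < N & lk m 4 < N}"

lemma MN_out: "m : MN N ==> i : {0, 1, 2} ==> lk m i = 0" by (auto simp: MN_def)

lemma finite_MN: "finite (MN N)"
  by (rule finite_subset[OF _ finite_M2[of "N + N"]]) (auto simp: MN_def M2_def w2_def)

lemma poly_le_coeff:
  fixes p q :: "real poly"
  assumes "degree p = 2" "degree q <= 2" "!!n. n >= n0 ==> poly p (real n) <= poly q (real n)"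
  shows "coeff p 2 <= coeff q 2"
proof (rule ccontr)
  assume "~ coeff p 2 <= coeff q 2"
  then have c: "coeff (p - q) 2 > 0" by simp
  have "degree (p - q) = 2" using assms(1,2) c by (simp add: degree_diff_le le_degree le_antisym)
  then obtain x where x: "ALL y>=x. poly (p - q) y >= lead_coeff (p - q)" using poly_pinfty_gt_lc[of "p - q"] c by auto
  obtain n where "real n >= x" using real_arch_simple by blast
  then have "real (max n n0) >= x" by simp
  then show False using x c \<open>degree (p - q) = 2\<close> assms(3)[of "max n n0"] by auto
qed

text \<open>The Hilbert function of a plane curve of degree \<open>e\<close> grows at most
  linearly.\<close>

lemma binomial_diff_bound:
  assumes "e > 0" shows "((j + 2) choose 2) <= (if e <= j then (j - e + 2) choose 2 else 0) + e * (j + 2)"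
proof -
  have c: "2 * ((x + 2) choose 2) = (x + 2) * (x + 1)" for x :: nat
    by (simp add: choose_two)
  show ?thesis
  proof (cases "e <= j")
    case True
    then obtain i where j: "j = i + e" using le_Suc_ex by (metis add.commute)
    have "2 * ((j + 2) choose 2) <= 2 * ((i + 2) choose 2) + 2 * (e * (j + 2))"
      unfolding c j by (simp add: algebra_simps)
    then show ?thesis using True by (simp add: j)
  next
    case False
    then have "(j + 2) * (j + 1) <= (j + 2) * (2 * e)" by (intro mult_le_mono) auto
    then have "2 * ((j + 2) choose 2) <= 2 * (e * (j + 2))" unfolding c by (simp add: algebra_simps)
    then show ?thesis using False by simp
  qed
qed

text \<open>An integral surface of degree \<open>s\<close> missing the line x0 = x1 = x2 = 0. By
  \<open>fin\<close> its coordinate ring is a finite module over the polynomials in x0, x1, x2, and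
  over their field of fractions it becomes a finite extension field.\<close>

locale generic_prime =
  fixes pp :: "mpoly set" and N s :: nat and hp :: "real poly"
  assumes p: "homog_ideal pp" "prime_set pp"
    and hp: "has_hp pp hp" "degree hp = 2" "lead_coeff hp = real s / 2" and s: "s >= 1"
    and fin: "!!i. EX v:Vid {0, 1, 2}. var i ^ N - v : pp"
begin

lemma idp: "ideal pp" by (rule homog_ideal_ideal[OF p(1)])

lemma submod_p: "f2.submod pp" by (rule f2.submod_ideal[OF idp])

definition SS :: "mon set => mpoly set" where "SS B = {a + b | a b. a : f2.over B & b : pp}"

lemma submod_SS: "f2.submod (SS B)" unfolding SS_def by (intro f2.submod_plus f2.submod_over submod_p)

lemma over_SS: "a : f2.over B ==> a : SS B"
  unfolding SS_def using ideal_0[OF idp] by (intro CollectI exI[of _ a] exI[of _ 0]) simp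

lemma p_SS: "a : pp ==> a : SS B"
  unfolding SS_def using f2.submod_over[of B] by (intro CollectI exI[of _ 0] exI[of _ a]) (simp add: f2.submod_def)

lemma hc_SS: "f : SS B ==> EX a b. hc n f = a + b & a : f2.over B & homog n a & b : pp & homog n b"
proof -
  assume "f : SS B"
  then obtain a b where "f = a + b" "a : f2.over B" "b : pp" unfolding SS_def by blast
  then show ?thesis using f2.hc_over homog_idealD[OF p(1)] by (intro exI[of _ "hc n a"] exI[of _ "hc n b"]) (simp add: hc_add)
qed

text \<open>A monomial without x0, x1, x2 and outside \<open>MN N\<close> contains some
  \<open>var i ^ N\<close>, which \<open>fin\<close> trades for multiples of x0, x1, x2. Splitting
  off such a variable lowers the degree, and the induction applies.\<close>

lemma monomial_SS: "mdeg m = n ==> sng m c : SS (MN N)"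
proof (induction n arbitrary: m c rule: less_induct)
  case (less n)
  have low: "sng m c : SS (MN N)" if "mdeg m = n" "lk m i ~= 0" "i : {0, 1, 2}" for m c i
  proof -
    have e: "m = sng i 1 + (m - sng i 1)"
      by (rule poly_mapping_eqI) (use that(2) in \<open>auto simp: lookup_add lookup_minus lookup_single when_def\<close>)
    then have "mdeg m = 1 + mdeg (m - sng i 1)" by (metis mdeg_add mdeg_single)
    then have "mdeg (m - sng i 1) < n" using that(1) by simp
    then have "var i * sng (m - sng i 1) c : SS (MN N)" by (metis less.IH[OF _ refl] submod_SS Av_var[OF that(3)] f2.submod_def)
    moreover have "var i * sng (m - sng i 1) c = sng m c" using e by (simp add: var_def mult_single)
    ultimately show ?thesis by simp
  qed
  show ?case
  proof (cases "EX i:{0, 1, 2}. lk m i ~= 0")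
    case True then show ?thesis using low less.prems by blast
  next
    case False
    show ?thesis
    proof (cases "m : MN N")
      case True
      have "f2.out m = m" by (rule f2.out_id) (use False in blast)
      then show ?thesis using True by (intro over_SS) (simp add: f2.over_def)
    next
      case outside: False
      then have "EX i. N <= lk m i" using False by (auto simp: MN_def not_less)
      then obtain i where i: "N <= lk m i" by blast
      obtain g where g: "sng m c = g * var i ^ N" using single_var_split[OF i] by blast
      obtain v where v: "v : Vid {0, 1, 2}" "var i ^ N - v : pp" using fin by blast
      have gv: "g * v : Vid {0, 1, 2}" by (rule ideal_mult[OF ideal_Vid v(1)])
      have "sng m c = g * v + g * (var i ^ N - v)" unfolding g by (simp add: algebra_simps)
      moreover have "hc n (sng m c) = sng m c" using hc_homog[OF homog_single[of m c], of n] less.prems by simp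
      ultimately have e: "sng m c = hc n (g * v) + hc n (g * (var i ^ N - v))" by (metis hc_add)
      have "sng m' (lk (hc n (g * v)) m') : SS (MN N)" if m': "m' : supp (hc n (g * v))" for m' using m' gv low by (auto simp: hc_def supp_part Vid_def mem_Collect_eq)
      then have "(SUM m':supp (hc n (g * v)). sng m' (lk (hc n (g * v)) m')) : SS (MN N)" by (rule f2.submod_sum[OF submod_SS])
      then have "hc n (g * v) : SS (MN N)" by (simp flip: pm_decomp)
      moreover have "hc n (g * (var i ^ N - v)) : SS (MN N)"
        by (intro p_SS homog_idealD[OF p(1)] ideal_mult[OF idp v(2)])
      ultimately show ?thesis unfolding e using submod_SS by (simp add: f2.submod_def)
    qed
  qed
qed

lemma all_SS: "f : SS (MN N)"
proof -
  have "(SUM m:supp f. sng m (lk f m)) : SS (MN N)" by (rule f2.submod_sum[OF submod_SS]) (rule monomial_SS[OF refl])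
  then show ?thesis by (simp flip: pm_decomp)
qed

text \<open>Forms over \<open>B\<close> are spanned by products of a form in x0, x1, x2 with a
  monomial of \<open>B\<close>. Members of \<open>K\<close> give factors that annihilate these
  monomials modulo \<open>pp\<close>, so the Hilbert function of \<open>K\<close> counts the factors
  needed.\<close>

lemma over_bound:
  assumes B: "B \<subseteq> MN N" and K: "ideal K" "!!f mu. f : K ==> mu : B ==> kill {3, 4} f * mo mu : pp"
  shows "EX S. finite S & card S <= (SUM mu:B. if mdeg mu <= n then hilbert_function K (n - mdeg mu) else 0) &
    (ALL f:f2.over B. homog n f --> f : mv.span (S Un {f : pp. homog n f}))"
proof -
  let ?k = "kill {3, 4}"
  have fB: "finite B" by (rule finite_subset[OF B finite_MN])
  have "ALL j. EX C. C \<subseteq> {f. homog j f} & qindep cs C {f : K. homog j f} & card C = hilbert_function K j & {f. homog j f} \<subseteq> mv.span (C Un {f : K. homog j f})"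
    using hf_qd[OF K(1)] unfolding qd_def by blast
  from choice[OF this] obtain C where C: "C j \<subseteq> {f. homog j f}" "qindep cs (C j) {f : K. homog j f}" "card (C j) = hilbert_function K j"
    "{f. homog j f} \<subseteq> mv.span (C j Un {f : K. homog j f})" for j by blast
  define S where "S = (UN mu:B. if mdeg mu <= n then (%c. ?k c * mo mu) ` C (n - mdeg mu) else {})"
  define V where "V = mv.span (S Un {f : pp. homog n f})"
  have sV: "mv.subspace V" unfolding V_def by (rule mv.subspace_span)
  have kc: "?k (const c) = const c" for c unfolding kill_part by (rule part_id) (auto simp: const_def split: if_splits)
  have "sng m (lk f m) : V" if f: "f : f2.over B" "homog n f" and m: "m : supp f" for f m
  proof -
    define mu where "mu = f2.out m"
    have mu: "mu : B" using f(1) m by (simp add: mu_def f2.over_def)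
    have d: "mdeg (f2.inn m) + mdeg mu = n" using f(2) m f2.inn_out[of m] unfolding mu_def by (metis homog_mdeg mdeg_add)
    let ?T = "{f. ?k f * mo mu : V}"
    have sT: "mv.subspace ?T"
      using mv.subspace_0[OF sV] mv.subspace_add[OF sV] mv.subspace_scale[OF sV]
      by (intro mv.subspaceI) (simp_all add: rhom_0[OF kill_rhom] rhom_add[OF kill_rhom] rhom_mult[OF kill_rhom] kc distrib_right mult.assoc)
    have "?k c * mo mu : V" if "c : C (n - mdeg mu)" for c
      unfolding V_def S_def by (intro mv.span_base) (use that mu d in auto)
    moreover have "?k g * mo mu : V" if g: "g : K" "homog (n - mdeg mu) g" for g
    proof -
      have "homog (n - mdeg mu) (?k g)" using g(2) by (simp add: kill_part homog_def supp_part)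
      then show ?thesis using d homog_mult[OF _ homog_single[of mu 1]] add_diff_cancel_right' V_def K(2)[OF g(1) mu] mv.span_base by auto
    qed
    ultimately have "mv.span (C (n - mdeg mu) Un {f : K. homog (n - mdeg mu) f}) \<subseteq> ?T" by (intro mv.span_minimal sT) blast
    moreover have "homog (n - mdeg mu) (sng (f2.inn m) (lk f m))" using homog_single[of "f2.inn m"] d by (metis add_diff_cancel_right')
    ultimately have "?k (sng (f2.inn m) (lk f m)) * mo mu : V" using C(4) by blast
    moreover have "?k (sng (f2.inn m) (lk f m)) = sng (f2.inn m) (lk f m)"
      unfolding kill_part by (rule part_id) (auto simp: f2.lk_inn split: if_splits)
    ultimately show ?thesis unfolding mu_def by (simp flip: f2.sng_inn_out)
  qed
  then have "(SUM m:supp f. sng m (lk f m)) : V" if "f : f2.over B" "homog n f" for f using that by (intro mv.subspace_sum[OF sV])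
  then have "ALL f:f2.over B. homog n f --> f : V" by (simp flip: pm_decomp)
  moreover have "card S <= (SUM mu:B. if mdeg mu <= n then hilbert_function K (n - mdeg mu) else 0)"
    unfolding S_def C(3)[symmetric]
    by (rule order_trans[OF card_UN_le[OF fB] sum_mono]) (auto intro!: card_image_le qindep_finite[OF C(2)])
  moreover have "finite S" unfolding S_def using fB qindep_finite[OF C(2)] by auto
  ultimately show ?thesis unfolding V_def by blast
qed

text \<open>Compare the leading coefficients \<open>s / 2\<close> and \<open>t / 2\<close>; the
  shift \<open>e\<close> and the linear term do not affect them.\<close>

lemma poly_hp_bound:
  assumes "!!n. hilbert_function pp n <= t * ((n + e + 2) choose 2) + E * (n + 2)" shows "s <= t"
proof -
  define Q where "Q = smult (real t / 2) ([:real e + 2, 1:] * [:real e + 1, 1:]) + smult (real E) [:2, 1:]"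
  obtain n0 where n0: "!!n. n >= n0 ==> poly hp (real n) = real (hilbert_function pp n)" using hp(1) unfolding has_hp_def by blast
  have "coeff hp 2 <= coeff Q 2"
  proof (rule poly_le_coeff[OF hp(2)])
    show "degree Q <= 2" unfolding Q_def by (intro degree_add_le order.trans[OF degree_smult_le]) simp_all
    fix n assume "n >= n0"
    then have "poly hp (real n) <= real (t * ((n + e + 2) choose 2) + E * (n + 2))" unfolding n0[OF \<open>n >= n0\<close>] using assms by (simp only: of_nat_le_iff)
    also have "... = real t * real ((n + e + 2) choose 2) + real E * (real n + 2)" by (simp only: of_nat_mult of_nat_add of_nat_numeral)
    also have "real ((n + e + 2) choose 2) = (real n + real e + 2) * (real n + real e + 1) / 2"
    proof -
      have "2 * ((n + e + 2) choose 2) = (n + e + 2) * (n + e + 1)" by (simp add: choose_two)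
      from arg_cong[OF this, of real] show ?thesis by (simp only: of_nat_mult of_nat_add of_nat_numeral of_nat_1)
    qed
    also have "real t * ((real n + real e + 2) * (real n + real e + 1) / 2) + real E * (real n + 2) = poly Q (real n)"
      by (simp add: Q_def algebra_simps)
    finally show "poly hp (real n) <= poly Q (real n)" .
  qed
  moreover have "coeff Q 2 = real t / 2" by (simp add: Q_def eval_nat_numeral)
  ultimately show ?thesis using hp(2,3) by simp
qed

lemma hilbert_le_card:
  assumes "finite S" "!!f. homog n f ==> f : mv.span (S Un {f : pp. homog n f})"
  shows "hilbert_function pp n <= card S"
proof -
  have "EX x<=card S. qd cs {f. homog n f} {f : pp. homog n f} x"
    by (intro mv.qd_ex_bound[OF assms(1)] mv_subspace_ideal_homog[OF idp]) (use assms(2) in auto)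
  then show ?thesis using hf_unique[OF idp] by blast
qed

text \<open>A relation among x0, x1, x2 on the surface would replace the plane by a plane curve in
  the count of \<open>over_bound\<close>, and the Hilbert function would grow only linearly.\<close>

lemma p_cap: "q : pp ==> q : Av {0, 1, 2} ==> q = 0"
proof (rule ccontr)
  assume q: "q : pp" "q : Av {0, 1, 2}" "q ~= 0"
  obtain e where e: "hc e q ~= 0" using q(3) hc_eq_0_iff by blast
  \<comment> \<open>The factor \<open>var 0\<close> makes the degree positive, as
    \<open>binomial_diff_bound\<close> requires.\<close>
  define h where "h = hc e q * var 0"
  have h: "h : pp" "h ~= 0" "homog (Suc e) h"
    using e ideal_mult'[OF idp homog_idealD[OF p(1) q(1)]] homog_mult[OF homog_hc homog_var, of e q 0] by (simp_all add: h_def)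
  have "h : Av {0, 1, 2}" using q(2) Av_var[of 0 "{0, 1, 2}"] unfolding h_def by (intro f2.A_closed(4)) (auto simp: Av_def hc_def supp_part)
  then have kh: "kill {3, 4} h = h" unfolding kill_part by (intro part_id) (auto simp: Av_def)
  let ?V = "Vid {3, 4}" let ?K = "gen (insert h ?V)"
  have "kill {3, 4} f * mo mu : pp" if "f : ?K" for f mu
  proof -
    obtain a v where "f = a * h + v" "v : ?V" using gen_insertE[OF \<open>f : ?K\<close> ideal_Vid] by metis
    then show ?thesis using kh rhom_add[OF kill_rhom] rhom_mult[OF kill_rhom] Vid_kill ideal_mult'[OF idp ideal_mult[OF idp h(1)]] by auto
  qed
  note ob = over_bound[OF order_refl ideal_gen this]
  have z: "f : ?V" if "h * f : ?V" for f by (metis kh h(2) that Vid_kill prime_Vid[of "{3, 4}"] prime_set_def)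
  have hK: "hilbert_function ?K j <= Suc e * (j + 2)" for j
    using hf_nzd[OF homog_ideal_Vid[of "{3, 4}"] h(3) z, of j] binomial_diff_bound[of "Suc e" j] by (simp add: hf_Vid[of _ 2] split: if_splits)
  have "s <= 0"
  proof (rule poly_hp_bound[of 0 0 "card (MN N) * Suc e"])
    fix n
    obtain S where S: "finite S" "card S <= (SUM mu:MN N. if mdeg mu <= n then hilbert_function ?K (n - mdeg mu) else 0)"
      "ALL f:f2.over (MN N). homog n f --> f : mv.span (S Un {f : pp. homog n f})" using ob by meson
    have "f : mv.span (S Un {f : pp. homog n f})" if f: "homog n f" for f using S(3) hc_homog[OF f] hc_SS[OF all_SS, of n f] mv.span_add mv.span_base by auto
    then have "hilbert_function pp n <= card S" by (rule hilbert_le_card[OF S(1)])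
    also have "... <= (SUM mu:MN N. Suc e * (n + 2))"
    proof (rule order_trans[OF S(2) sum_mono])
      fix mu
      have "Suc e * (n - mdeg mu + 2) <= Suc e * (n + 2)" by (intro mult_le_mono2) simp
      then show "(if mdeg mu <= n then hilbert_function ?K (n - mdeg mu) else 0) <= Suc e * (n + 2)" using hK[of "n - mdeg mu"] by simp
    qed
    finally show "hilbert_function pp n <= 0 * ((n + 0 + 2) choose 2) + card (MN N) * Suc e * (n + 2)" by (simp add: mult.assoc del: mult_Suc mult_Suc_right)
  qed
  then show False using s by simp
qed

text \<open>The form \<open>hc e Q\<close> in x0, x1, x2 is a common denominator: multiplied by it,
  every polynomial falls into the module over \<open>B\<close> plus \<open>pp\<close>. This
  multiplication is injective modulo \<open>pp\<close>, so \<open>card B\<close> copies of the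
  polynomial ring in three variables, shifted by \<open>e\<close>, dominate the Hilbert function,
  and \<open>s <= card B\<close>.\<close>

theorem generic_degree: "EX t>=s. qd f2.sc (f2.loc UNIV) (f2.loc pp) t"
proof -
  have "EX B<=MN N. qindep f2.sc (emb ` mo ` B) (f2.loc pp) & f2.loc UNIV \<subseteq> f2.vs.span (emb ` mo ` B Un f2.loc pp) &
     qd f2.sc (f2.loc UNIV) (f2.loc pp) (card B)"
  proof (rule f2.mono_basis[OF finite_MN _ submod_p])
    show "f2.submod UNIV" by (simp add: f2.submod_def)
    fix f :: mpoly
    obtain a b where ab: "f = a + b" "a : f2.over (MN N)" "b : pp" using all_SS[of f] unfolding SS_def by blast
    let ?V = "f2.vs.span (emb ` mo ` MN N Un f2.loc pp)"
    have "emb a : ?V"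
      by (rule f2.mono_span[OF f2.vs.subspace_span]) (use ab(2) in \<open>auto simp: f2.over_def intro!: f2.vs.span_base\<close>)
    moreover have "emb b : ?V" using f2.emb_loc[OF ab(3)] by (intro f2.vs.span_base) blast
    ultimately show "emb f : ?V" unfolding ab(1) emb_add by (rule f2.vs.span_add)
  qed simp
  then obtain B where B: "B \<subseteq> MN N" "f2.loc UNIV \<subseteq> f2.vs.span (emb ` mo ` B Un f2.loc pp)" "qd f2.sc (f2.loc UNIV) (f2.loc pp) (card B)" by blast
  have "EX q. q : Av {0, 1, 2} & q ~= 0 & q * mo mu : SS B" for mu
  proof -
    have z: "lk m i = 0" if "m : B" "i : {0, 1, 2}" for m i by (rule MN_out[OF subsetD[OF B(1) that(1)] that(2)])
    have "emb (mo mu) : f2.loc UNIV" by (rule f2.emb_loc) simp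
    then have "emb (mo mu) : f2.loc (SS B)" using subsetD[OF B(2)] SS_def subsetD[OF f2.span_loc[OF submod_p z], rotated 2] by auto
    then show ?thesis using f2.emb_locD by blast
  qed
  then obtain q where q: "!!mu. q mu : Av {0, 1, 2} & q mu ~= 0 & q mu * mo mu : SS B" by metis
  define Q where "Q = (PROD mu:MN N. q mu)"
  obtain e where e: "hc e Q ~= 0" using q by (fastforce simp: finite_MN Q_def hc_eq_0_iff)
  have QA: "hc e Q : Av {0, 1, 2}"
    using subring_prod[OF subring_Av, of "MN N" q "{0, 1, 2}"] q by (auto simp: Q_def Av_def hc_def supp_part)
  have QS: "hc e Q * mo mu : SS B" if mu: "mu : MN N" for mu
  proof -
    have e: "Q * mo mu = (PROD nu:MN N - {mu}. q nu) * (q mu * mo mu)" unfolding Q_def prod.remove[OF finite_MN mu] by (simp only: mult_ac)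
    have "Q * mo mu : SS B" by (metis q e subring_prod subring_Av submod_SS[of B] f2.submod_def)
    from hc_SS[OF this, of "e + mdeg mu"] show ?thesis unfolding hc_mult[OF homog_single] SS_def by blast
  qed
  have QS': "hc e Q * f : SS B" for f
  proof -
    obtain a b where ab: "f = a + b" "a : f2.over (MN N)" "b : pp" using all_SS[of f] unfolding SS_def by blast
    have "hc e Q * sng m (lk a m) : SS B" if m: "m : supp a" for m
    proof -
      have "sng (f2.inn m) (lk a m) * (hc e Q * mo (f2.out m)) : SS B" using ab(2) m QS f2.over_def submod_SS f2.sng_inn_Av f2.submod_def by auto
      then show ?thesis by (subst f2.sng_inn_out) (simp add: mult_ac)
    qed
    then have "(SUM m:supp a. hc e Q * sng m (lk a m)) : SS B" by (rule f2.submod_sum[OF submod_SS])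
    then have "hc e Q * a : SS B" by (subst pm_decomp) (simp add: sum_distrib_left)
    moreover have "hc e Q * b : SS B" by (intro p_SS ideal_mult[OF idp ab(3)])
    ultimately show ?thesis using submod_SS[of B] by (simp add: ab(1) distrib_left f2.submod_def)
  qed
  have "s <= card B"
  proof (rule poly_hp_bound[of _ e 0])
    fix n
    have "kill {3, 4} f * mo mu : pp" if "f : Vid {3, 4}" for f mu using that ideal_0[OF idp] by (simp add: Vid_kill)
    from over_bound[OF B(1) ideal_Vid this] obtain S where S: "finite S"
      "card S <= (SUM mu:B. if mdeg mu <= n + e then hilbert_function (Vid {3, 4}) (n + e - mdeg mu) else 0)"
      "ALL f:f2.over B. homog (n + e) f --> f : mv.span (S Un {f : pp. homog (n + e) f})" by meson
    obtain X where X: "X \<subseteq> {f. homog n f}" "qindep cs X {f : pp. homog n f}" "card X = hilbert_function pp n"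
      using hf_qd[OF idp, of n] unfolding qd_def by blast
    let ?q = "%f. hc e Q * f"
    have inj: "inj_on ?q X" using e by (intro inj_onI) simp
    have hq: "homog (n + e) (?q f)" if "homog n f" for f using homog_mult[OF homog_hc that, of e Q] by (simp add: add.commute)
    have "qindep cs (?q ` X) {f : pp. homog (n + e) f}" unfolding qindep_def
    proof (intro conjI allI impI)
      show "finite (?q ` X)" using qindep_finite[OF X(2)] by simp
      fix c assume "(SUM b:?q ` X. const (c b) * b) : {f : pp. homog (n + e) f}"
      then have "hc e Q * (SUM b:X. const (c (?q b)) * b) : pp" by (simp add: sum.reindex[OF inj] sum_distrib_left mult.left_commute)
      then have "(SUM b:X. const (c (?q b)) * b) : pp" using p(2) p_cap[OF _ QA] e unfolding prime_set_def by blast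
      moreover have "homog n (SUM b:X. const (c (?q b)) * b)" using X(1) by (intro homog_sum homog_const_mult) blast
      ultimately show "ALL b:?q ` X. c b = 0" using qindepD[OF X(2), of "%b. c (?q b)"] by blast
    qed
    moreover have "?q ` X \<subseteq> mv.span (S Un {f : pp. homog (n + e) f})"
    proof
      fix y assume "y : ?q ` X"
      then obtain f where f: "y = ?q f" "homog n f" using X(1) by blast
      obtain a b where ab: "y = a + b" "a : f2.over B" "homog (n + e) a" "b : pp" "homog (n + e) b" by (metis f(1) hc_homog[OF hq[OF f(2)]] hc_SS[OF QS'[of f], of "n + e"])
      then show "y : mv.span (S Un {f : pp. homog (n + e) f})" using S(3) unfolding ab(1) by (intro mv.span_add) (auto intro: mv.span_base)
    qed
    ultimately have "card (?q ` X) <= card S" by (intro mv.qindep_card_le[OF _ mv_subspace_ideal_homog[OF idp] S(1)])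
    also have "... <= (SUM mu:B. (n + e + 2) choose 2)"
      by (rule order_trans[OF S(2) sum_mono]) (auto simp: hf_Vid[of _ 2] intro: binomial_right_mono)
    finally show "hilbert_function pp n <= card B * ((n + e + 2) choose 2) + 0 * (n + 2)" by (simp add: card_image[OF inj] X(3))
  qed
  then show ?thesis using B(3) by blast
qed

text \<open>The powers of \<open>x\<close> are dependent over the field. Primeness cancels the
  lowest power in a relation, and what remains expresses a nonzero scalar as a multiple of
  \<open>x\<close>.\<close>

lemma generic_inverse:
  assumes x: "x ~: pp" shows "EX y q. q : Av {0, 1, 2} & q ~= 0 & q - x * y : pp"
proof -
  obtain t where t: "qd f2.sc (f2.loc UNIV) (f2.loc pp) t" using generic_degree by blast
  have "emb (x ^ i) : f2.loc UNIV" for i by (rule f2.emb_loc) simp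
  note dep = f2.vs.qd_dependent[of "f2.loc UNIV" "f2.loc pp" t "%i. emb (x ^ i)", OF t f2.loc_subspace[OF submod_p] this]
  obtain c where "(EX i<=t. c i ~= 0) & (SUM i<=t. iota2 (c i) * emb (x ^ i)) : f2.loc pp" using dep by (rule exE)
  then have c: "EX i<=t. c i ~= 0" "(SUM i<=t. iota2 (c i) * emb (x ^ i)) : f2.loc pp" by (rule conjunct1, rule conjunct2)
  define j where "j = (LEAST i. c i ~= 0)"
  obtain i where i: "i <= t" "c i ~= 0" using c(1) by blast
  have j: "c j ~= 0" unfolding j_def by (rule LeastI[of "%i. c i ~= 0", OF i(2)])
  have jt: "j <= t" unfolding j_def using Least_le[of "%i. c i ~= 0", OF i(2)] i(1) by simp
  have jl: "c i = 0" if "i < j" for i using that not_less_Least unfolding j_def by blast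
  define Y where "Y = (SUM i:{Suc j..t}. iota2 (c i) * emb (x ^ (i - Suc j)))"
  have "(SUM i<=t. iota2 (c i) * emb (x ^ i)) = (SUM i:{j..t}. iota2 (c i) * emb (x ^ i))"
    by (rule sum.mono_neutral_right) (auto simp: jl rhom_0[OF f2.iota])
  also have "... = iota2 (c j) * emb (x ^ j) + (SUM i:{Suc j..t}. iota2 (c i) * emb (x ^ i))"
    by (rule sum.atLeast_Suc_atMost[OF jt])
  also have "(SUM i:{Suc j..t}. iota2 (c i) * emb (x ^ i)) = emb (x ^ j) * (emb x * Y)"
    unfolding Y_def sum_distrib_left
  proof (rule sum.cong[OF refl])
    fix i assume "i : {Suc j..t}"
    then have "i = j + (1 + (i - Suc j))" by simp
    then have "x ^ i = x ^ j * (x * x ^ (i - Suc j))" by (metis power_add power_one_right)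
    then show "iota2 (c i) * emb (x ^ i) = emb (x ^ j) * (emb x * (iota2 (c i) * emb (x ^ (i - Suc j))))" using emb_mult mult_ac by auto
  qed
  finally have sm: "emb (x ^ j) * (iota2 (c j) + emb x * Y) : f2.loc pp" using c(2) by (simp only: distrib_left mult.commute)
  have sU: "f2.vs.subspace (f2.loc UNIV)" by (rule f2.loc_subspace) (simp add: f2.submod_def)
  have "Y : f2.loc UNIV" unfolding Y_def
    by (intro f2.vs.subspace_sum[OF sU] f2.vs.subspace_scale[OF sU] f2.emb_loc) simp
  then obtain y r where y: "Y = Fract y r" "r : Av {0, 1, 2}" "r ~= 0" unfolding f2.loc_def by blast
  obtain a b where ab: "iota2 (c j) = Fract a b" "a : Av {0, 1, 2}" "b : Av {0, 1, 2}" "b ~= 0" using f2.rng by blast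
  have a0: "a ~= 0" using ab(1) j f2.iota_0[of "c j"] by (auto simp: fract_collapse)
  have "iota2 (c j) + emb x * Y = Fract (a * r + x * (y * b)) (b * r)" using y ab by (simp add: algebra_simps)
  then obtain f q where f: "Fract (x ^ j * (a * r + x * (y * b))) (b * r) = Fract f q" "f : pp" "q : Av {0, 1, 2}" "q ~= 0" using sm f2.loc_def by auto
  have "x ^ j * (q * (a * r + x * (y * b))) = f * (b * r)" using f y ab by (simp add: eq_fract mult_ac)
  then have m: "x ^ j * (q * (a * r + x * (y * b))) : pp" using ideal_mult'[OF idp f(2)] by simp
  have pr: "v : pp" if "u * v : pp" "u ~: pp" for u v using p(2) that unfolding prime_set_def by blast
  have "1 ~: pp" using p_cap f2.A_closed(2) by force
  then have "x ^ j ~: pp" by (induction j) (use x pr in auto)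
  then have "a * r + x * (y * b) : pp" by (metis m pr f(3,4) p_cap)
  then have "a * r - x * (- (y * b)) : pp" by simp
  moreover have "a * r : Av {0, 1, 2}" "a * r ~= 0" using ab y a0 f2.A_closed(4) by auto
  ultimately show ?thesis by blast
qed

end

section \<open>The genus of a curve on a surface\<close>

lemma Av_UNIV: "f : Av UNIV" by (simp add: Av_def)

text \<open>x0, x1, x2 act as scalars, so closure under x3 and x4 is all that an ideal asks
  for.\<close>

lemma ideal_of_subspace:
  assumes V: "f2.vs.subspace V" and 34: "!!i f. i : {3, 4} ==> emb f : V ==> emb (var i * f) : V"
  shows "ideal {f. emb f : V}"
proof -
  have ea: "emb (x + y) : V" if "emb x : V" "emb y : V" for x y
    unfolding emb_add by (rule f2.vs.subspace_add[OF V that])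
  have e0: "emb 0 : V" using f2.vs.subspace_0[OF V] by simp
  define T where "T = {r. ALL f. emb f : V --> emb (r * f) : V}"
  have "subring T" unfolding subring_def T_def using e0 by (auto simp: distrib_right mult.assoc intro!: ea)
  moreover have A: "r : T" if "r : Av {0, 1, 2}" for r unfolding T_def using f2.scale_mem[OF V that] by blast
  moreover have "var i : T" for i
  proof (cases "i : {0, 1, 2}")
    case True then show ?thesis by (intro A Av_var)
  next
    case False
    then have "i : {3, 4}" using UNIV_5 by auto
    then show ?thesis unfolding T_def using 34 by blast
  qed
  moreover have "const c : T" for c by (rule A[OF Av_const])
  ultimately have "Av UNIV \<subseteq> T" by (intro Av_least)
  then have T: "emb (r * f) : V" if "emb f : V" for r f using that Av_UNIV unfolding T_def by blast
  show ?thesis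
    by (rule rm.subspaceI) (use e0 in \<open>auto simp del: add_fract intro: T ea\<close>)
qed

lemma (in subfield) Fract_loc: "f : M ==> q : A ==> q ~= 0 ==> Fract f q : loc M"
  unfolding loc_def by blast

lemma subspace_unit:
  assumes V: "f2.vs.subspace V" and q: "q : Av {0, 1, 2}" "q ~= 0" "emb q : V" shows "emb 1 : V"
proof -
  obtain c where c: "iota2 c = Fract 1 q" using f2.scalar[OF f2.A_closed(2) q(1,2)] by blast
  have "iota2 c * emb q : V" by (rule f2.vs.subspace_scale[OF V q(3)])
  moreover have "iota2 c * emb q = Fract q q" by (simp add: c)
  moreover have "Fract q q = emb 1" using q(2) by (subst eq_fract) simp_all
  ultimately show ?thesis by simp
qed

context generic_prime
begin

definition WP :: "nat => mpoly set" where "WP n = {a + b | a b. a : wlt w2 n & b : pp}"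

lemma submod_WP: "f2.submod (WP n)" unfolding WP_def by (intro f2.submod_plus submod_wlt2 submod_p)

lemma wlt_WP: "wlt w2 n \<subseteq> WP n"
proof
  fix a assume "a : wlt w2 n"
  then show "a : WP n" unfolding WP_def using ideal_0[OF idp] by (intro CollectI exI[of _ a] exI[of _ 0]) simp
qed

lemma p_WP: "pp \<subseteq> WP n"
proof
  fix b assume "b : pp"
  then show "b : WP n" unfolding WP_def by (intro CollectI exI[of _ 0] exI[of _ b]) simp
qed

lemma WP_mono: "n <= k ==> WP n \<subseteq> WP k" unfolding WP_def using wlt_mono[of n k w2] by blast

text \<open>Modulo \<open>pp\<close> the levels grow by at least one dimension per step until two of
  them coincide. That space is then stable under x3 and x4 and contains 1, so it is everything and
  has dimension at least \<open>s\<close>.\<close>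

lemma WP_dim: "qd f2.sc (f2.loc (WP n)) (f2.loc pp) r ==> min n s <= r"
proof (induction n arbitrary: r)
  case (Suc n)
  note sW = f2.loc_subspace[OF submod_WP] and sp = f2.loc_subspace[OF submod_p]
  have sU: "f2.vs.subspace (f2.loc UNIV)" by (rule f2.loc_subspace) (simp add: f2.submod_def)
  have sub: "f2.loc pp \<subseteq> f2.loc (WP n)" "f2.loc (WP n) \<subseteq> f2.loc (WP (Suc n))" "f2.loc (WP (Suc n)) \<subseteq> f2.loc UNIV"
    by (intro f2.loc_mono p_WP WP_mono; simp)+
  obtain a b where ab: "qd f2.sc (f2.loc (WP n)) (f2.loc pp) a" "qd f2.sc (f2.loc (WP (Suc n))) (f2.loc (WP n)) b" "r = a + b"
    using f2.vs.qd_split[OF Suc.prems sp sW sW sub(1,2)] by blast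
  show ?case
  proof (cases "b = 0")
    case False then show ?thesis using Suc.IH[OF ab(1)] ab(3) by simp
  next
    case True
    then have le: "f2.loc (WP (Suc n)) \<subseteq> f2.loc (WP n)" using ab(2) by (auto simp: qindep_finite qd_def f2.vs.span_eq_iff[THEN iffD2, OF sW[of n]])
    have "ideal {f. emb f : f2.loc (WP n)}"
    proof (rule ideal_of_subspace[OF sW])
      fix i :: 5 and f assume i: "i : {3, 4}" and "emb f : f2.loc (WP n)"
      then obtain q where q: "q : Av {0, 1, 2}" "q ~= 0" "q * f : WP n" using f2.emb_locD by blast
      then obtain x y where xy: "q * f = x + y" "x : wlt w2 n" "y : pp" unfolding WP_def by blast
      have "ALL m:supp (var i). w2 m <= 1" using i by (auto simp: var_def w2_def lookup_single)
      then have "var i * x : wlt w2 (Suc n)" using wlt_mult[of w2, OF w2_add xy(2), of "var i" 1] by simp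
      moreover have "var i * y : pp" by (rule ideal_mult[OF idp xy(3)])
      moreover have "q * (var i * f) = var i * x + var i * y" using arg_cong[OF xy(1), of "(*) (var i)"] by (simp add: algebra_simps)
      ultimately have "q * (var i * f) : WP (Suc n)" unfolding WP_def by blast
      then have "Fract (q * (var i * f)) q : f2.loc (WP (Suc n))" unfolding f2.loc_def using q by blast
      moreover have "Fract (q * (var i * f)) q = emb (var i * f)" using q(2) by (simp add: eq_fract)
      ultimately show "emb (var i * f) : f2.loc (WP n)" using le by auto
    qed
    moreover have "1 : wlt w2 (Suc n)" by (simp add: wlt_def w2_def)
    then have "emb 1 : f2.loc (WP n)" using le wlt_WP f2.emb_loc by blast
    ultimately have all: "{f. emb f : f2.loc (WP n)} = UNIV" by (intro ideal_UNIV) simp_all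
    have e: "f2.loc UNIV = f2.loc (WP n)" using all f2.loc_minimal[OF sW] f2.loc_mono[of "WP n" UNIV] by blast
    obtain t where "t >= s" "qd f2.sc (f2.loc UNIV) (f2.loc pp) t" using generic_degree by blast
    then show ?thesis using e ab(3) f2.vs.qd_unique[OF ab(1) _ sp] by auto
  qed
qed simp

lemma WP_dim_ex: "EX r. qd f2.sc (f2.loc (WP n)) (f2.loc pp) r"
proof -
  obtain t where t: "qd f2.sc (f2.loc UNIV) (f2.loc pp) t" using generic_degree by blast
  have sU: "f2.vs.subspace (f2.loc UNIV)" by (rule f2.loc_subspace) (simp add: f2.submod_def)
  have "f2.loc (WP n) \<subseteq> f2.loc UNIV" by (rule f2.loc_mono) simp
  then show ?thesis
    using f2.vs.qd_split[OF t f2.loc_subspace[OF submod_p] f2.loc_subspace[OF submod_WP] sU f2.loc_mono[OF p_WP]] by blast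
qed

end

context pencil
begin

text \<open>If the equations of bounded degree lie in \<open>pp\<close>, so does
  \<open>AA (Suc n)\<close>, and a basis modulo \<open>AA (Suc n)\<close> also spans level
  \<open>n + 1\<close> modulo \<open>pp\<close>.\<close>

lemma rank_lower:
  assumes gp: "generic_prime pp N s hp" and J: "JJ (Suc n) \<subseteq> pp" shows "min (n + 1) s <= card (BB n)"
proof -
  interpret p: generic_prime pp N s hp by (rule gp)
  have AAp: "AA (Suc n) \<subseteq> pp"
  proof
    fix f assume "f : AA (Suc n)"
    then show "f : pp" by (induction rule: AA.induct) (use J in \<open>auto intro: ideal_add[OF p.idp] ideal_mult[OF p.idp]\<close>)
  qed
  obtain r where r: "qd f2.sc (f2.loc (p.WP (Suc n))) (f2.loc pp) r" using p.WP_dim_ex by blast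
  obtain A where A: "A \<subseteq> f2.loc (p.WP (Suc n))" "qindep f2.sc A (f2.loc pp)" "card A = r" using r unfolding qd_def by blast
  obtain B where B: "qindep f2.sc B (f2.loc (AA (Suc n)))" "card B = card (BB n)" "f2.loc (wlt w2 (Suc n)) \<subseteq> f2.vs.span (B Un f2.loc (AA (Suc n)))"
    using generic_hilbert[of n] unfolding qd_def by blast
  let ?V = "f2.vs.span (B Un f2.loc pp)"
  have "f2.vs.span (B Un f2.loc (AA (Suc n))) \<subseteq> ?V" by (rule f2.vs.span_mono) (use f2.loc_mono[OF AAp] in blast)
  then have 1: "f2.loc (wlt w2 (Suc n)) \<subseteq> ?V" using B(3) by blast
  have "f2.loc (p.WP (Suc n)) \<subseteq> ?V"
  proof (rule f2.loc_minimal[OF f2.vs.subspace_span])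
    fix f assume "f : p.WP (Suc n)"
    then obtain a b where ab: "f = a + b" "a : wlt w2 (Suc n)" "b : pp" unfolding p.WP_def by blast
    have "emb a : ?V" using 1 f2.emb_loc[OF ab(2)] by blast
    moreover have "emb b : ?V" using f2.emb_loc[OF ab(3)] by (intro f2.vs.span_base) blast
    ultimately show "emb f : ?V" unfolding ab(1) emb_add by (rule f2.vs.span_add)
  qed
  then have "A \<subseteq> ?V" using A(1) by blast
  then show ?thesis using A(3) B(2) f2.vs.qindep_card_le[OF A(2) f2.loc_subspace[OF p.submod_p] qindep_finite[OF B(1)]] p.WP_dim[OF r] by auto
qed

text \<open>The representatives without x2 are determined by their exponents of x3 and x4, both at
  most \<open>n\<close>.\<close>

lemma BB_crude: "card (BB n) <= (n + 1) * (n + 1)"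
proof -
  obtain B where B: "B \<subseteq> M2 n" "card B = card (BB n)" using basis2_ex by blast
  have inj: "inj_on (%m. (lk m 3, lk m 4)) (M2 n)"
  proof (rule inj_onI)
    fix x y assume xy: "x : M2 n" "y : M2 n" "(lk x 3, lk x 4) = (lk y 3, lk y 4)"
    then have "ALL i. lk x i = lk y i" unfolding all_5 by (simp add: M2_def)
    then show "x = y" by (intro poly_mapping_eqI) blast
  qed
  have "(%m. (lk m 3, lk m 4)) ` M2 n \<subseteq> {..n} \<times> {..n}" by (auto simp: M2_def w2_def)
  then have "card (M2 n) <= card ({..n} \<times> {..n})" by (intro card_inj_on_le[OF inj]) auto
  then show ?thesis using card_mono[OF finite_M2 B(1)] B(2) by simp
qed

lemma JJ_mono: "n <= k ==> JJ n \<subseteq> JJ k" unfolding JJ_def using wlt_mono[of n k w3] by blast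

lemma AA_var: "i : {3, 4} ==> f : AA n ==> var i * f : AA (Suc n)"
proof -
  assume i: "i : {3, 4}"
  have w: "ALL m:supp (var i). w3 m <= 1" using i by (auto simp: var_def w3_def lookup_single)
  have J: "var i * a : JJ (Suc n)" if "a : JJ n" for a
    using that mult_wlt3[OF w] ideal_mult[OF idI] by (simp add: JJ_def)
  show "f : AA n ==> var i * f : AA (Suc n)"
  proof (induction rule: AA.induct)
    case (base a) then show ?case using J AA.base by blast
  next
    case (step a f)
    have "var i * a + var 2 * (var i * f) : AA (Suc n)" by (rule AA.step[OF J[OF step(1)] step(3)])
    then show ?case by (simp add: algebra_simps)
  qed
qed

end

section \<open>The two ranges of the sequence\<close>

lemma prod_power_cong:
  assumes I: "ideal I" and xy: "!!i. i : A ==> x i - y i : I"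
  shows "(PROD i:A. x i ^ r i) - (PROD i:A. y i ^ r i) : (I :: mpoly set)"
proof -
  have m: "a * c - b * e : I" if "a - b : I" "c - e : I" for a b c e
  proof -
    have "a * c - b * e = c * (a - b) + b * (c - e)" by (simp add: algebra_simps)
    then show ?thesis using ideal_add[OF I] ideal_mult[OF I] that by simp
  qed
  have p: "a ^ n - b ^ n : I" if "a - b : I" for a b n
    by (induction n) (use m that ideal_0[OF I] in auto)
  show ?thesis using xy
    by (induction A rule: infinite_finite_induct) (use m p ideal_0[OF I] in auto)
qed

lemma sum_decreasing:
  fixes f :: "nat => nat"
  assumes "!!i. f (Suc i) <= f i - 1" shows "(SUM i<m. f i) <= f 0 * f 0"
proof -
  have le: "f i <= f 0 - i" for i
  proof (induction i)
    case (Suc i) then show ?case using assms[of i] by simp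
  qed simp
  have "(SUM i<m. f i) <= (SUM i<m. if i < f 0 then f 0 else 0)"
  proof (rule sum_mono)
    show "f i <= (if i < f 0 then f 0 else 0)" for i using le[of i] by (cases "i < f 0") simp_all
  qed
  also have "... <= (SUM i<max m (f 0). if i < f 0 then f 0 else 0)" by (rule sum_mono2) auto
  also have "... = (SUM i<f 0. f 0)" by (rule sum.mono_neutral_cong_right) auto
  finally show ?thesis by simp
qed

text \<open>\<open>g * k\<close> is the degree of the surface \<open>G = F = 0\<close>, and
  \<open>s\<close> bounds the degrees of its components from below. The bound on \<open>d\<close> is
  spent in \<open>early_unital_bound\<close> and on \<open>d > s * s\<close>.\<close>

locale curve_on_surface = pencil I d m0 c0 + ci_pair G F g k N
  for I d m0 c0 G F g k N +
  fixes H :: "nat => mpoly" and r :: "nat => nat" and l s :: nat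
  assumes GI: "G : I" and FI: "F : I" and F_prod: "F = (PROD i:{1..l}. H i ^ r i)"
    and primes: "!!i. i : {1..l} ==> EX s' hp. s <= s' & generic_prime (gen (insert (H i) (gen {G}))) N s' hp"
    and s: "1 <= s" "s <= g * k" and d: "2 * (g * k) ^ 4 < d"
begin

text \<open>In each monomial of a coefficient the factors x0, x1, x2 are scalars; the remaining
  factor times the form \<open>G\<close> or \<open>F\<close> has total degree below
  \<open>n\<close>, so it is an equation in \<open>JJ n\<close>.\<close>

lemma RR_AA: "RR n \<subseteq> AA n"
proof
  have J: "h * a : AA n" if h: "homog e h" "h : I" and a: "a : wlt (%m. w2 m + e) n" for h e a
  proof -
    have "sng m (lk a m) * h : AA n" if m: "m : supp a" for m
    proof -
      have "w2 (f2.out m) + e < n" using a m by (auto simp: wlt_def w2_def f2.lk_out)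
      moreover have hm: "homog (mdeg (f2.out m) + e) (mo (f2.out m) * h)" by (rule homog_mult[OF homog_single h(1)])
      moreover have "mdeg (f2.out m) = w2 (f2.out m)" by (simp add: mdeg_5 w2_def f2.lk_out)
      ultimately have "mo (f2.out m) * h : wlt w3 n" using homog_wlt3[OF hm] wlt_mono[of "Suc (mdeg (f2.out m) + e)" n w3] by auto
      then have "sng (f2.inn m) (lk a m) * (mo (f2.out m) * h) : AA n" using ideal_mult[OF idI h(2)] JJ_def submod_AA f2.sng_inn_Av AA.base f2.submod_def by auto
      then show ?thesis by (simp only: f2.sng_inn_out[of m "lk a m"] mult.assoc)
    qed
    then have "(SUM m:supp a. sng m (lk a m) * h) : AA n" by (rule f2.submod_sum[OF submod_AA])
    moreover have "h * a = (SUM m:supp a. sng m (lk a m) * h)"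
      by (subst (1) pm_decomp[of a]) (simp add: sum_distrib_left mult.commute)
    ultimately show ?thesis by simp
  qed
  fix f assume "f : RR n"
  then obtain a b where "f = G * a + F * b" "a : wlt (%m. w2 m + g) n" "b : wlt (%m. w2 m + k) n" unfolding RR_def by blast
  then show "f : AA n" using J[OF G(1) GI] J[OF F(1) FI] AA_add by blast
qed

lemma RR_gen: "RR n \<subseteq> gen {G, F}"
  unfolding RR_def gen_2 by (auto simp: mult.commute)

lemma submod_uminus: "f2.submod M ==> a : M ==> - a : M"
proof -
  assume M: "f2.submod M" "a : M"
  then have "const (-1) * a : M" using Av_const unfolding f2.submod_def by blast
  then show ?thesis by simp
qed

lemma reduce:
  assumes n: "g + k <= Suc n" and u: "u : wlt w2 (Suc n)"
  shows "EX w:wlt w2 n. u - w : RR (Suc n)"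
proof -
  let ?M = "{a + b | a b. a : wlt w2 n & b : RR (Suc n)}"
  have sM: "f2.submod ?M" by (intro f2.submod_plus submod_wlt2 submod_RR)
  have "sng m (lk u m) : ?M" if m: "m : supp u" for m
  proof -
    have o: "mo (f2.out m) : ?M"
    proof (cases "w2 m = n")
      case True
      have "EX v:wlt w2 n. mo (f2.out m) - v : RR (Suc n)"
        by (rule reduce_top[OF n]) (use True in \<open>auto simp: w2_def f2.lk_out\<close>)
      then obtain v where v: "v : wlt w2 n" "mo (f2.out m) - v : RR (Suc n)" by blast
      have "mo (f2.out m) = v + (mo (f2.out m) - v)" by simp
      then show ?thesis using v by blast
    next
      case False
      then have "mo (f2.out m) : wlt w2 n" using u m by (auto simp: wlt_def w2_def f2.lk_out)
      moreover have "0 : RR (Suc n)" using submod_RR by (simp add: f2.submod_def)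
      ultimately have "mo (f2.out m) + 0 : ?M" by blast
      then show ?thesis by simp
    qed
    then have "sng (f2.inn m) (lk u m) * mo (f2.out m) : ?M" using sM f2.sng_inn_Av unfolding f2.submod_def by blast
    then show ?thesis by (simp flip: f2.sng_inn_out)
  qed
  then have "(SUM m:supp u. sng m (lk u m)) : ?M" by (rule f2.submod_sum[OF sM])
  then obtain a b where "u = a + b" "a : wlt w2 n" "b : RR (Suc n)" by (auto simp: pm_decomp[symmetric])
  then show ?thesis by (intro bexI[of _ a]) simp_all
qed

text \<open>The unit ideal over the field of x0, x1, x2, expressed without denominators by a nonzero
  scalar polynomial.\<close>

definition unital :: "nat => bool" where
  "unital n \<longleftrightarrow> (EX q:gen (JJ (Suc n) Un {G, F}). q : Av {0, 1, 2} & q ~= 0)"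

lemma unital_mono: "unital n ==> n <= j ==> unital j"
  unfolding unital_def using rm.span_mono[of "JJ (Suc n) Un {G, F}" "JJ (Suc j) Un {G, F}"] JJ_mono[of "Suc n" "Suc j"] by blast

text \<open>Otherwise for each \<open>i\<close> some equation misses the prime of the
  \<open>i\<close>-th divisor and is invertible modulo it, so a nonzero scalar is a multiple of
  \<open>H i\<close> modulo the ideal. The product of these scalars with exponents
  \<open>r i\<close> is then a multiple of \<open>F\<close>, hence lies in the ideal.\<close>

lemma not_unital:
  assumes "~ unital n" shows "EX i:{1..l}. JJ (Suc n) \<subseteq> gen (insert (H i) (gen {G}))"
proof (rule ccontr)
  assume neg: "~ ?thesis"
  let ?A = "gen (JJ (Suc n) Un {G, F})"
  have GA: "G : ?A" and FA: "F : ?A" and JA: "x : JJ (Suc n) ==> x : ?A" for x by (auto intro: rm.span_base)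
  have "EX q b. q : Av {0, 1, 2} & q ~= 0 & q - H i * b : ?A" if i: "i : {1..l}" for i
  proof -
    obtain s' hp where "generic_prime (gen (insert (H i) (gen {G}))) N s' hp" using primes[OF i] by blast
    then interpret p: generic_prime "gen (insert (H i) (gen {G}))" N s' hp .
    obtain x where x: "x : JJ (Suc n)" "x ~: gen (insert (H i) (gen {G}))" using neg i by blast
    obtain y q where q: "q : Av {0, 1, 2}" "q ~= 0" "q - x * y : gen (insert (H i) (gen {G}))" using p.generic_inverse[OF x(2)] by blast
    obtain b v where bv: "q - x * y = b * H i + v" "v : gen {G}" using gen_insertE[OF q(3) ideal_gen] by metis
    have "x * y + v : ?A" using bv(2) rm.span_mono[of "{G}" "JJ (Suc n) Un {G, F}"] ideal_add[OF ideal_gen] ideal_mult'[OF ideal_gen JA[OF x(1)]] by blast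
    moreover have "q - H i * b = x * y + v" using bv(1) by (simp add: algebra_simps)
    ultimately show ?thesis using q by metis
  qed
  then have "EX z. ALL i:{1..l}. fst (z i) : Av {0, 1, 2} & fst (z i) ~= 0 & fst (z i) - H i * snd (z i) : ?A" by (fastforce intro: bchoice)
  then obtain z where z: "!!i. i : {1..l} ==> fst (z i) : Av {0, 1, 2} & fst (z i) ~= 0 & fst (z i) - H i * snd (z i) : ?A" by blast
  let ?Q = "PROD i:{1..l}. fst (z i) ^ r i"
  have "?Q - (PROD i:{1..l}. (H i * snd (z i)) ^ r i) : ?A" by (rule prod_power_cong[OF ideal_gen]) (use z in blast)
  moreover have "(PROD i:{1..l}. (H i * snd (z i)) ^ r i) = F * (PROD i:{1..l}. snd (z i) ^ r i)"
    by (simp add: F_prod power_mult_distrib prod.distrib)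
  then have "(PROD i:{1..l}. (H i * snd (z i)) ^ r i) : ?A" using ideal_mult'[OF ideal_gen FA] by simp
  ultimately have "(?Q - (PROD i:{1..l}. (H i * snd (z i)) ^ r i)) + (PROD i:{1..l}. (H i * snd (z i)) ^ r i) : ?A"
    by (rule ideal_add[OF ideal_gen])
  then have "?Q : ?A" by simp
  moreover have "?Q : Av {0, 1, 2}" using z by (intro subring_prod subring_power subring_Av) blast
  moreover have "?Q ~= 0" using z by simp
  ultimately show False using assms unfolding unital_def by blast
qed

lemma qd_0: "f2.vs.subspace W ==> qd f2.sc V W 0 ==> V \<subseteq> W"
proof -
  assume W: "f2.vs.subspace W" and q: "qd f2.sc V W 0"
  obtain B where B: "qindep f2.sc B W" "card B = 0" "V \<subseteq> f2.vs.span (B Un W)" using q unfolding qd_def by blast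
  show ?thesis using B(2) B(3) qindep_finite[OF B(1)] f2.vs.span_eq_iff[THEN iffD2, OF W] by auto
qed

text \<open>Modulo \<open>(G, F)\<close> level \<open>n + 2\<close> reduces to level
  \<open>n + 1\<close>, so \<open>card (BB (Suc n))\<close> is \<open>card (BB n)\<close> minus the
  number \<open>x\<close> of new equations of low weight. If \<open>x = 0\<close>, the equations
  together with \<open>(G, F)\<close> are closed under x3 and x4, hence unital already at this
  level; \<open>regular\<close> then puts the whole level into \<open>AA (Suc n)\<close>, and
  \<open>card (BB n)\<close> is zero.\<close>

lemma hilbert_drop:
  assumes n: "g + k <= n + 2" and un: "unital n" shows "card (BB (Suc n)) <= card (BB n) - 1"
proof -
  let ?W = "f2.loc (wlt w2 (Suc n))" let ?W' = "f2.loc (wlt w2 (Suc (Suc n)))"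
  let ?U = "f2.loc (AA (Suc n))" let ?U' = "f2.loc (AA (Suc (Suc n)))"
  let ?X = "f2.loc (wlt w2 (Suc n) Int AA (Suc (Suc n)))"
  note sW = f2.loc_subspace[OF submod_wlt2] and sU = f2.loc_subspace[OF submod_AA]
  have sX: "f2.vs.subspace ?X" by (intro f2.loc_subspace f2.submod_Int submod_wlt2 submod_AA)
  have AA_mono: "f : AA (Suc n) ==> f : AA (Suc (Suc n))" for f
    by (induction rule: AA.induct) (use JJ_mono[of "Suc n" "Suc (Suc n)"] in \<open>auto intro: AA.intros\<close>)
  have UX: "?U \<subseteq> ?X" by (rule f2.loc_mono) (use AA_wlt AA_mono in blast)
  have XW: "?X \<subseteq> ?W" by (rule f2.loc_mono) blast
  obtain x y where xy: "qd f2.sc ?X ?U x" "qd f2.sc ?W ?X y" "card (BB n) = x + y"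
    using f2.vs.qd_split[OF generic_hilbert[of n] sU sX sW UX XW] by blast
  have red: "EX w:wlt w2 (Suc n). u - w : RR (Suc (Suc n))" if "u : wlt w2 (Suc (Suc n))" for u
    by (rule reduce[OF _ that]) (use n in simp)
  have "qd f2.sc ?W' ?U' y"
  proof (rule qd_iso[THEN iffD1, OF f2.vs.linear_id sW sW sU XW _ _ _ _ xy(2)])
    show "?U' \<subseteq> ?W'" by (rule f2.loc_mono) (use AA_wlt in blast)
    show "id v : ?W'" if "v : ?W" for v
      using that f2.loc_mono[of "wlt w2 (Suc n)" "wlt w2 (Suc (Suc n))"] wlt_mono[of "Suc n" "Suc (Suc n)" w2] by auto
    show "EX v:?W. v' - id v : ?U'" if v': "v' : ?W'" for v'
    proof -
      obtain f q where f: "v' = Fract f q" "f : wlt w2 (Suc (Suc n))" "q : Av {0, 1, 2}" "q ~= 0" using v' unfolding f2.loc_def by blast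
      obtain w where w: "w : wlt w2 (Suc n)" "f - w : RR (Suc (Suc n))" using red[OF f(2)] by blast
      have "v' - Fract w q = Fract (f - w) q" using f(4) by (simp add: f(1) eq_fract algebra_simps)
      moreover have "Fract (f - w) q : ?U'" using w(2) RR_AA f(3,4) unfolding f2.loc_def by blast
      moreover have "Fract w q : ?W" using w(1) f(3,4) unfolding f2.loc_def by blast
      ultimately show ?thesis by (intro bexI[of _ "Fract w q"]) simp_all
    qed
    show "v : ?X \<longleftrightarrow> id v : ?U'" if "v : ?W" for v using that f2.loc_Int[OF submod_wlt2 submod_AA] f2.loc_mono[OF Int_lower2] by fastforce
  qed
  then have y: "card (BB (Suc n)) = y" using f2.vs.qd_unique[OF generic_hilbert _ sU] by blast
  show ?thesis
  proof (cases "x = 0")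
    case False then show ?thesis using xy(3) y by simp
  next
    case True
    then have XU: "?X \<subseteq> ?U" using qd_0[OF sU] xy(1) by blast
    let ?M = "{a + b | a b. a : AA (Suc n) & b : gen {G, F}}"
    have sM: "f2.submod ?M" using f2.submod_ideal[OF ideal_gen] f2.submod_plus submod_AA by auto
    note sV = f2.loc_subspace[OF sM]
    have UM: "f : ?M" if "f : AA (Suc n)" for f
      using that ideal_0[OF ideal_gen, of "{G, F}"] by (intro CollectI exI[of _ f] exI[of _ 0]) simp
    have gM: "f : ?M" if "f : gen {G, F}" for f
      using that submod_AA[of "Suc n"] by (intro CollectI exI[of _ 0] exI[of _ f]) (simp add: f2.submod_def)
    have UV: "?U \<subseteq> f2.loc ?M" by (rule f2.loc_mono) (use UM in blast)
    have id: "ideal {f. emb f : f2.loc ?M}"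
    proof (rule ideal_of_subspace[OF sV])
      fix i :: 5 and f assume i: "i : {3, 4}" and "emb f : f2.loc ?M"
      then obtain q where q: "q : Av {0, 1, 2}" "q ~= 0" "q * f : ?M" using f2.emb_locD by blast
      then obtain a b where ab: "q * f = a + b" "a : AA (Suc n)" "b : gen {G, F}" by blast
      let ?u = "var i * a"
      have u: "?u : AA (Suc (Suc n))" by (rule AA_var[OF i ab(2)])
      obtain w where w: "w : wlt w2 (Suc n)" "?u - w : RR (Suc (Suc n))" using red[OF AA_wlt[OF u]] by blast
      have "?u + - (?u - w) : AA (Suc (Suc n))" using w(2) RR_AA by (intro AA_add[OF u] submod_uminus[OF submod_AA]) blast
      then have "emb w : f2.loc ?M" using w(1) XU UV by (fastforce simp: f2.emb_loc)
      moreover have "emb ((?u - w) + var i * b) : f2.loc ?M" using w(2) gM RR_gen ideal_add[OF ideal_gen] ideal_mult[OF ideal_gen ab(3)] f2.emb_loc by blast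
      ultimately have "emb w + emb ((?u - w) + var i * b) : f2.loc ?M" by (rule f2.vs.subspace_add[OF sV])
      moreover have "emb w + emb ((?u - w) + var i * b) = emb (q * (var i * f))" using arg_cong[OF ab(1), of "(*) (var i)"] by (simp add: algebra_simps)
      ultimately have "emb (q * (var i * f)) : f2.loc ?M" by simp
      then obtain q' where q': "q' : Av {0, 1, 2}" "q' ~= 0" "q' * (q * (var i * f)) : ?M" using f2.emb_locD by blast
      have "Fract (q' * (q * (var i * f))) (q' * q) : f2.loc ?M"
        by (intro f2.Fract_loc q'(3) f2.A_closed(4) q'(1) q(1)) (use q(2) q'(2) in simp)
      moreover have "Fract (q' * (q * (var i * f))) (q' * q) = emb (var i * f)" using q(2) q'(2) by (simp add: eq_fract)
      ultimately show "emb (var i * f) : f2.loc ?M" by simp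
    qed
    have "JJ (Suc n) Un {G, F} \<subseteq> {f. emb f : f2.loc ?M}"
    proof -
      have "{G, F} \<subseteq> gen {G, F}" by (rule rm.span_superset)
      moreover have "emb f : f2.loc ?M" if "f : gen {G, F}" for f by (rule f2.emb_loc[OF gM[OF that]])
      moreover have "emb f : f2.loc ?M" if "f : JJ (Suc n)" for f by (rule f2.emb_loc[OF UM[OF AA.base[OF that]]])
      ultimately show ?thesis by (intro Un_least subsetI CollectI) auto
    qed
    then have "gen (JJ (Suc n) Un {G, F}) \<subseteq> {f. emb f : f2.loc ?M}" by (rule rm.span_minimal[OF _ id])
    then obtain q where "q : Av {0, 1, 2}" "q ~= 0" "emb q : f2.loc ?M" using un unfolding unital_def by blast
    then have all: "{f. emb f : f2.loc ?M} = UNIV" using id subspace_unit[OF sV] ideal_UNIV by blast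
    have "?W \<subseteq> ?U"
    proof (rule f2.loc_minimal[OF sU])
      fix w assume w: "w : wlt w2 (Suc n)"
      have "emb w : f2.loc ?M" using all by blast
      then obtain q where q: "q : Av {0, 1, 2}" "q ~= 0" "q * w : ?M" using f2.emb_locD by blast
      then obtain a b where ab: "q * w = a + b" "a : AA (Suc n)" "b : gen {G, F}" by blast
      have "q * w - a : wlt w2 (Suc n)" using submod_wlt2[of "Suc n"] q(1) w by (intro wlt_diff AA_wlt[OF ab(2)]) (simp add: f2.submod_def)
      then have bw: "b : wlt w2 (Suc n)" using ab(1) by simp
      obtain al be where "b = al * G + be * F" using ab(3) unfolding gen_2 by blast
      then have "b = G * al + F * be" by simp
      then have "b : AA (Suc n)" using regular[OF bw] RR_AA by blast
      then have "Fract (q * w) q : ?U" using ab(1) ab(2) q by (fastforce simp: AA_add f2.loc_def)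
      moreover have "Fract (q * w) q = emb w" using q(2) by (simp add: eq_fract)
      ultimately show "emb w : ?U" by simp
    qed
    then have "?W = ?U" using UX XW by blast
    then show ?thesis using xy(3) y f2.vs.qd_self[of ?U] f2.vs.qd_unique[OF generic_hilbert _ sU] by auto
  qed
qed

text \<open>Values before \<open>n\<close> are at most \<open>(n + 1)^2\<close>, and from
  \<open>n\<close> on they decrease strictly from such a value, so the total \<open>d\<close> is at
  most \<open>2 (n + 1)^4\<close>, while \<open>n + 1 = g + k - 1 <= g * k\<close>.\<close>

lemma early_unital_bound:
  assumes u: "unital n" and n: "n + 2 = g + k" shows False
proof -
  obtain L where L: "(SUM j<L. card (BB j)) = d" by (rule pencil_hilbert)
  let ?b = "%j. card (BB j)"
  have "d <= (SUM j<n + L. ?b j)" unfolding L[symmetric] by (rule sum_mono2) auto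
  also have "... = (SUM j<n. ?b j) + (SUM i<L. ?b (n + i))" by (induction L) simp_all
  also have "(SUM i<L. ?b (n + i)) <= ?b (n + 0) * ?b (n + 0)"
  proof (rule sum_decreasing)
    show "?b (n + Suc i) <= ?b (n + i) - 1" for i
      using hilbert_drop[of "n + i"] unital_mono[OF u, of "n + i"] n by simp
  qed
  also have "?b (n + 0) * ?b (n + 0) <= ((n + 1) * (n + 1)) * ((n + 1) * (n + 1))" using BB_crude[of n] by (intro mult_mono) simp_all
  also have "(SUM j<n. ?b j) <= (SUM j<n. (n + 1) * (n + 1))"
  proof (rule sum_mono)
    fix j assume "j : {..<n}"
    then have "(j + 1) * (j + 1) <= (n + 1) * (n + 1)" by (intro mult_mono) auto
    then show "?b j <= (n + 1) * (n + 1)" using BB_crude[of j] by simp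
  qed
  also have "(SUM j<n. (n + 1) * (n + 1)) <= (n + 1) * ((n + 1) * (n + 1))" by simp
  also have "... <= (n + 1) * ((n + 1) * (n + 1)) * (n + 1)" by simp
  finally have "d <= 2 * (n + 1) ^ 4" by (simp add: eval_nat_numeral algebra_simps)
  also have "n + 1 <= g * k"
  proof -
    obtain g' k' where "g = Suc g'" "k = Suc k'" using G(2) F(2) by (metis gr0_implies_Suc)
    then show ?thesis using n by simp
  qed
  then have "2 * (n + 1) ^ 4 <= 2 * (g * k) ^ 4" by (intro mult_left_mono power_mono) simp_all
  finally show False using d by simp
qed

theorem genus_bound_c0: "1 - real_of_int c0 <= genus_bound d s"
proof -
  obtain L where L: "(SUM j<L. card (BB j)) = d" "!!j. j >= L ==> card (BB j) = 0" "int d - int (SUM j<L. j * card (BB j)) <= c0"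
    by (rule pencil_hilbert) blast
  have low: "min (n + 1) s <= card (BB n)" if nu: "~ unital n" for n
  proof -
    obtain i where i: "i : {1..l}" "JJ (Suc n) \<subseteq> gen (insert (H i) (gen {G}))" using not_unital[OF nu] by blast
    obtain s' hp where s': "s <= s'" "generic_prime (gen (insert (H i) (gen {G}))) N s' hp" using primes[OF i(1)] by blast
    show ?thesis using s'(1) rank_lower[OF s'(2) i(2)] by auto
  qed
  \<comment> \<open>Beyond \<open>L\<close> all values vanish, while a level that is not unital has
    value at least 1.\<close>
  have "unital L" using low[of L] L(2)[of L] s(1) by (cases "unital L") auto
  define n0 where "n0 = (LEAST n. unital n)"
  have n0: "unital n0" unfolding n0_def using \<open>unital L\<close> by (rule LeastI)
  have lt: "~ unital n" if "n < n0" for n using that not_less_Least unfolding n0_def by blast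
  \<comment> \<open>\<open>g + k - 2\<close> is the first level to which \<open>hilbert_drop\<close>
    applies. An earlier \<open>n0\<close> would make that level unital by monotonicity, which
    \<open>early_unital_bound\<close> excludes.\<close>
  have gk: "g + k <= n0 + 2"
  proof (rule ccontr)
    assume "~ ?thesis"
    then show False by (fastforce intro: early_unital_bound[of "g + k - 2"] unital_mono[OF n0, of "g + k - 2"])
  qed
  have dss: "d > s * s"
  proof -
    have "s * s <= (g * k) * (g * k)" by (intro mult_mono s) simp_all
    also have "... <= (g * k) * (g * k) * ((g * k) * (g * k))" using s by simp
    also have "... <= 2 * (g * k) ^ 4" by (simp add: eval_nat_numeral)
    finally show ?thesis using d by simp
  qed
  have "1 - real d + real (SUM j<L. j * card (BB j)) <= genus_bound d s"
  proof (rule extremal_bound[OF s(1) dss L(1,2), of n0])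
    show "min (n + 1) s <= card (BB n)" if "n < n0" for n by (rule low[OF lt[OF that]])
    show "card (BB (Suc n)) <= card (BB n) - 1" if "n >= n0" for n
      using hilbert_drop[of n] unital_mono[OF n0 that] gk that by simp
  qed
  moreover have "real_of_int (int d - int (SUM j<L. j * card (BB j))) <= real_of_int c0" using L(3) by (simp only: of_int_le_iff)
  ultimately show ?thesis by simp
qed

end

section \<open>Linear changes of coordinates\<close>

locale linear_change =
  fixes th rho :: "mpoly => mpoly"
  assumes th: "rhom th" "!!c. th (const c) = const c" "!!n f. homog n f ==> homog n (th f)"
    and rho: "rhom rho" "!!c. rho (const c) = const c" "!!n f. homog n f ==> homog n (rho f)"
    and inv: "!!f. th (rho f) = f" "!!f. rho (th f) = f"
begin

abbreviation pull :: "mpoly set => mpoly set" where "pull A \<equiv> th -` A"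

lemma th_hc: "th (hc n f) = hc n (th f)"
proof -
  have "th f = (SUM i<=max n (tdeg f). th (hc i f))" unfolding rhom_sum[OF th(1), symmetric] by (simp flip: sum_hc)
  then have "hc n (th f) = (SUM i<=max n (tdeg f). hc n (th (hc i f)))" by (simp add: hc_sum)
  also have "... = (SUM i<=max n (tdeg f). if i = n then th (hc n f) else 0)"
    by (rule sum.cong) (auto simp: hc_homog[OF th(3)[OF homog_hc]])
  also have "... = th (hc n f)" by simp
  finally show ?thesis ..
qed

lemma pull_ideal: "ideal A ==> ideal (pull A)"
  by (rule rm.subspaceI)
    (auto simp: rhom_0[OF th(1)] rhom_add[OF th(1)] rhom_mult[OF th(1)] intro: ideal_0 ideal_add ideal_mult)

lemma pull_homog_ideal: "homog_ideal A ==> homog_ideal (pull A)"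
  unfolding homog_ideal_hc using pull_ideal by (auto simp: th_hc)

lemma pull_prime: "prime_set A ==> prime_set (pull A)"
  by (simp add: prime_set_def rhom_mult[OF th(1)])

lemma pull_nzd: "nzd (th y) A ==> nzd y (pull A)"
  by (simp add: nzd_def rhom_mult[OF th(1)])

lemma pull_gen_insert:
  assumes A: "ideal A" shows "pull (gen (insert (th f) A)) = gen (insert f (pull A))"
proof
  show "pull (gen (insert (th f) A)) \<subseteq> gen (insert f (pull A))"
  proof
    fix x assume "x : pull (gen (insert (th f) A))"
    then obtain a b where ab: "th x = a * th f + b" "b : A" unfolding gen_insert[OF A] by blast
    have "x = rho (th x)" by (simp add: inv)
    also have "... = rho a * f + rho b" unfolding ab(1) by (simp add: rhom_add[OF rho(1)] rhom_mult[OF rho(1)] inv)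
    finally have "x = rho a * f + rho b" .
    moreover have "rho b : pull A" using ab(2) by (simp add: inv)
    ultimately show "x : gen (insert f (pull A))" unfolding gen_insert[OF pull_ideal[OF A]] by blast
  qed
  show "gen (insert f (pull A)) \<subseteq> pull (gen (insert (th f) A))"
    using gen_insert_sup(1)[OF A] gen_insert_sup(2)[of "th f" A] by (intro rm.span_minimal pull_ideal ideal_gen) auto
qed

lemma pull_gen_single: "pull (gen {th f}) = gen {f}"
proof -
  have z: "pull {0} = {0}" using inv(2) by (auto simp: rhom_0[OF th(1)]) (metis rhom_0[OF rho(1)])
  show ?thesis using pull_gen_insert[OF ideal_zero, of f] unfolding z gen_insert_zero .
qed

lemma pull_hilbert: "ideal A ==> hilbert_function (pull A) n = hilbert_function A n"
proof (rule hf_unique[OF pull_ideal])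
  assume A: "ideal A"
  show "qd cs {f. homog n f} {f : pull A. homog n f} (hilbert_function A n)"
  proof (rule qd_iso[THEN iffD2, OF _ mv_subspace_homog mv_subspace_homog mv_subspace_ideal_homog[OF A] _ _ _ _ _ hf_qd[OF A]])
    show "Vector_Spaces.linear cs cs th"
      by (simp add: Vector_Spaces.linear_iff mv.vector_space_axioms rhom_add[OF th(1)] rhom_mult[OF th(1)] th(2))
    show "EX x:{f. homog n f}. x' - th x : {f : A. homog n f}" if "x' : {f. homog n f}" for x'
      using that rho(3) ideal_0[OF A] by (intro bexI[of _ "rho x'"]) (simp_all add: inv)
  qed (auto simp: th(3))
qed

lemma pull_has_hp: "ideal A ==> has_hp A p ==> has_hp (pull A) p"
  by (simp add: has_hp_def pull_hilbert)

end

definition lsub :: "(5 => complex) => mpoly => mpoly" where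
  "lsub t = ev const (%i. lf (t i))"

lemma homog_ev: assumes phi: "!!i. homog 1 (phi i)" and f: "homog n f" shows "homog n (ev const phi f)"
  unfolding ev_def
proof (rule homog_sum)
  fix m assume "m : supp f"
  then have n: "mdeg m = n" using f by (simp add: homog_mdeg)
  have "homog (SUM i:UNIV. lk m i * 1) (meval phi m)" unfolding meval_def by (intro homog_prod homog_power phi)
  then show "homog n (const (lk f m) * meval phi m)" using n by (intro homog_const_mult) (simp add: mdeg_def)
qed

text \<open>Five forms \<open>lf (t i)\<close> span the linear forms, so the substitution has a
  right inverse \<open>rho\<close>. It is then surjective in every degree, hence injective there by
  equality of finite dimensions.\<close>

lemma linear_change_ex:
  assumes t: "inj t" shows "EX rho. linear_change (lsub t) rho"
proof -
  let ?th = "lsub t"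
  have r: "rhom ?th" and c: "?th (const c) = const c" and v: "?th (var i) = lf (t i)" for c i
    unfolding lsub_def by (rule ev_rhom[OF rhom_const], rule ev_const[OF rhom_const], rule ev_var[OF rhom_const])
  have h: "homog n f ==> homog n (?th f)" for n f unfolding lsub_def by (rule homog_ev) simp_all
  have sub: "mv.subspace (?th ` {f. homog 1 f})"
  proof (rule mv.subspaceI)
    show "0 : ?th ` {f. homog 1 f}" by (rule image_eqI[of _ _ 0]) (simp_all add: rhom_0[OF r])
    fix x assume "x : ?th ` {f. homog 1 f}"
    then obtain x' where x: "x = ?th x'" "homog 1 x'" by blast
    show "const a * x : ?th ` {f. homog 1 f}" for a
      by (rule image_eqI[of _ _ "const a * x'"]) (use x in \<open>simp_all add: rhom_mult[OF r] c homog_const_mult\<close>)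
    fix y assume "y : ?th ` {f. homog 1 f}"
    then obtain y' where y: "y = ?th y'" "homog 1 y'" by blast
    show "x + y : ?th ` {f. homog 1 f}"
      by (rule image_eqI[of _ _ "x' + y'"]) (use x y in \<open>simp_all add: rhom_add[OF r] homog_add\<close>)
  qed
  have "var i : ?th ` {f. homog 1 f}" for i
  proof (rule lf_span[OF sub, of "range t"])
    show "card (range t) >= 5" using card_image[OF t] by simp
    show "lf s : ?th ` {f. homog 1 f}" if "s : range t" for s using that v by (auto simp: v[symmetric])
  qed simp
  then have "EX w. homog 1 w & ?th w = var i" for i by (metis (mono_tags, lifting) imageE mem_Collect_eq)
  then obtain w where w: "!!i. homog 1 (w i)" "!!i. ?th (w i) = var i" by metis
  define rho where "rho = ev const w"
  have rho: "rhom rho" "rho (const a) = const a" "rho (var i) = w i" for a i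
    unfolding rho_def by (rule ev_rhom[OF rhom_const], rule ev_const[OF rhom_const], rule ev_var[OF rhom_const])
  have hrho: "homog n f ==> homog n (rho f)" for n f unfolding rho_def by (rule homog_ev[OF w(1)])
  have inv: "?th (rho f) = f" for f
    by (rule rhom_ext[OF rhom_comp[OF r rho(1)] rhom_id]) (simp_all add: rho c w)
  have "ideal_kernel": "f = 0" if f: "homog n f" "?th f = 0" for n f
  proof -
    let ?R = "{f. homog n f}" let ?W = "{f. homog n f & ?th f = 0}"
    have sW: "mv.subspace ?W"
      by (rule mv.subspaceI) (auto simp: rhom_0[OF r] rhom_add[OF r] rhom_mult[OF r] c homog_add homog_const_mult)
    have s0: "mv.subspace {0}" by (rule mv.subspace_single_0)
    define D where "D = hilbert_function {0} n"
    have e: "{f : {0}. homog n f} = {0}" by auto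
    have D: "qd cs ?R {0} D" using hf_qd[OF ideal_zero, of n] unfolding D_def e .
    have "qd cs ?R ?W D"
    proof (rule qd_iso[THEN iffD2, OF _ mv_subspace_homog mv_subspace_homog s0 _ _ _ _ _ D])
      show "Vector_Spaces.linear cs cs ?th"
        by (simp add: Vector_Spaces.linear_iff mv.vector_space_axioms rhom_add[OF r] rhom_mult[OF r] c)
      show "EX x:?R. x' - ?th x : {0}" if "x' : ?R" for x' using that hrho by (intro bexI[of _ "rho x'"]) (simp_all add: inv)
    qed (auto simp: h)
    moreover obtain x y where xy: "qd cs ?W {0} x" "qd cs ?R ?W y" "D = x + y"
      using mv.qd_split[OF D s0 sW mv_subspace_homog] by (auto simp: rhom_0[OF r])
    ultimately have "D = y" using mv.qd_unique[OF _ xy(2) sW] by blast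
    then obtain B where B: "qindep cs B {0}" "card B = 0" "?W \<subseteq> mv.span (B Un {0})" using xy(3) xy(1) by (auto simp: qd_def)
    show "f = 0" using B(2) B(3) f qindep_finite[OF B(1)] mv.span_eq_iff[THEN iffD2, OF s0] by auto
  qed
  have inv2: "rho (?th (var i)) = var i" for i
  proof -
    have "homog 1 (rho (?th (var i)) - var i)" by (intro homog_diff hrho h) simp_all
    moreover have "?th (rho (?th (var i)) - var i) = 0" by (simp add: rhom_diff[OF r] inv)
    ultimately show ?thesis using ideal_kernel by fastforce
  qed
  have "rho (?th f) = f" for f
    by (rule rhom_ext[OF rhom_comp[OF rho(1) r] rhom_id]) (simp_all add: rho c inv2)
  then have "linear_change ?th rho" using r c h rho hrho inv by unfold_locales auto
  then show ?thesis by blast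
qed

lemma avoid_finite: "finite A ==> EX t::complex. t ~: A"
  using ex_new_if_finite infinite_UNIV_char_0 by blast

text \<open>Each cut shortens chains, so three cuts of a surface leave no points, while
  \<open>P\<close> would survive all of them.\<close>

lemma three_cuts:
  assumes Q: "closed_subscheme Q" "~ has_chain Q 3"
    and y: "homog 1 y0" "homog 1 y1" "homog 1 y2" "nzd y0 Q" "nzd y1 (saturation (gen (insert y0 Q)))"
      "nzd y2 (saturation (gen (insert y1 (saturation (gen (insert y0 Q))))))"
    and P: "P : points Q" "y0 : P" "y1 : P" "y2 : P"
  shows False
proof -
  let ?Q1 = "saturation (gen (insert y0 Q))"
  let ?Q2 = "saturation (gen (insert y1 ?Q1))"
  let ?Q3 = "saturation (gen (insert y2 ?Q2))"
  have cl: "closed_subscheme (saturation (gen (insert y A)))" if "closed_subscheme A" "homog 1 y" for y A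
    using that homog_ideal_insert by (intro closed_saturation) (auto simp: closed_subscheme_def)
  have c1: "closed_subscheme ?Q1" by (rule cl[OF Q(1) y(1)])
  have c2: "closed_subscheme ?Q2" by (rule cl[OF c1 y(2)])
  have e: "points ?Q3 = {}" using Q(2) has_chain_cut[OF Q(1) y(1,4), of 2] eval_nat_numeral has_chain_cut[OF c1 y(2,5), of 1] has_chain_cut[OF c2 y(3,6), of 0] no_chain_0 by auto
  have step: "P : points (saturation (gen (insert y A)))" if "P : points A" "y : P" for y A
  proof -
    have "gen (insert y A) \<subseteq> P" using that by (simp add: points_def rp_ideal rm.span_minimal)
    then show ?thesis using that(1) unfolding points_saturation by (simp add: points_def)
  qed
  show False using step P e by blast
qed

section \<open>The upper bound\<close>

theorem genus_upper_bound:
  assumes ds: "divisor_setting X l D r s S" and C: "curve C" "subscheme_of C S" "proj_degree C = real d"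
    and big: "d > 30 * (SUM i=1..l. r i * s i) ^ 7"
  shows "real_of_int (arith_genus C) <= genus_bound d (s 1)"
proof -
  obtain G g H k where eqs: "relevant_prime X" "X = gen {G}" "homog g G" "g > 0" "G ~= 0" "G : S" "(PROD i:{1..l}. H i ^ r i) : S"
    and Hi: "!!i. i : {1..l} ==> homog (k i) (H i) & k i > 0 & H i ~: X & relevant_prime (gen (insert (H i) X)) & s i = g * k i"
    using divisor_setting_equations[OF ds] by (elim exE conjE) blast
  interpret hypersurface X G g by (rule hypersurface.intro[OF eqs(3,5,4,2,1)])
  have l: "1 : {1..l}" and rpos: "!!i. i : {1..l} ==> r i > 0" and smono: "mono_on {1..l} s"
    using ds unfolding divisor_setting_def by auto
  define F where "F = (PROD i:{1..l}. H i ^ r i)"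
  define K where "K = (SUM i:{1..l}. r i * k i)"
  have hF: "homog K F" unfolding F_def K_def by (intro homog_prod homog_power) (use Hi in blast)
  have K1: "k 1 <= K"
  proof -
    have "k 1 <= r 1 * k 1" using rpos[OF l] by simp
    also have "... <= K" unfolding K_def by (rule member_le_sum[OF l]) simp_all
    finally show ?thesis .
  qed
  then have K0: "K > 0" using Hi[OF l] by simp
  have gK: "g * K = (SUM i=1..l. r i * s i)"
    unfolding K_def sum_distrib_left by (rule sum.cong) (use Hi in \<open>simp_all add: mult_ac\<close>)
  have FX: "F ~: X" unfolding F_def using Hi by (auto simp: rp_prod[OF rX] rp_power[OF rX])
  let ?Q = "gen (insert F X)"
  have clQ: "closed_subscheme ?Q" by (rule closed_insert[OF FX hF])
  have Q3: "~ has_chain ?Q 3"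
  proof
    assume "has_chain ?Q 3"
    then have "3 <= degree (dpoly K (dpoly g hp4))" by (rule hf_chain_degree[OF ideal_gen _ has_hp_insert[OF hF FX]])
    then show False unfolding dpoly_insert(1)[OF K0] by simp
  qed
  have clC: "closed_subscheme C" and ch1: "has_chain C 1" and ch2: "~ has_chain C 2"
    using C(1) by (simp_all add: curve_def has_dim_def eval_nat_numeral)
  have SC: "S \<subseteq> C" using C(2) by (simp add: subscheme_of_def)
  \<comment> \<open>The parameters are chosen one after the other, each outside a finite bad set:
    the forms cut both the curve and the surface \<open>(F, G)\<close> properly, and five distinct
    parameters give a coordinate system.\<close>
  obtain t0 where t0: "nzd (lf t0) C" "nzd (lf t0) ?Q"
    using avoid_finite[OF finite_UnI[OF generic_nzd[OF clC] generic_nzd[OF clQ]]] by blast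
  let ?J = "saturation (gen (insert (lf t0) C))" let ?Q1 = "saturation (gen (insert (lf t0) ?Q))"
  have cl: "closed_subscheme (saturation (gen (insert (lf t) A)))" if "closed_subscheme A" for t A
    using that by (intro closed_saturation homog_ideal_insert[of _ 1]) (simp_all add: closed_subscheme_def)
  obtain t1 where t1: "nzd (lf t1) ?J" "nzd (lf t1) ?Q1" "t1 ~= t0"
    using avoid_finite[OF finite.insertI[OF finite_UnI[OF generic_nzd[OF cl[OF clC]] generic_nzd[OF cl[OF clQ]]], of t0]] by blast
  let ?Q2 = "saturation (gen (insert (lf t1) ?Q1))"
  obtain t2 where t2: "nzd (lf t2) C" "nzd (lf t2) ?Q2" "t2 ~: {t0, t1}"
    using avoid_finite[OF finite_UnI[OF finite_UnI[OF generic_nzd[OF clC] generic_nzd[OF cl[OF cl[OF clQ]]]], of "{t0, t1}"]] by auto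
  obtain t3 where t3: "t3 ~: {t0, t1, t2}" using avoid_finite[of "{t0, t1, t2}"] by auto
  obtain t4 where t4: "t4 ~: {t0, t1, t2, t3}" using avoid_finite[of "{t0, t1, t2, t3}"] by auto
  define t where "t i = (if i = 0 then t0 else if i = 1 then t1 else if i = 2 then t2 else if i = 3 then t3 else t4)" for i :: 5
  have tv: "t 0 = t0" "t 1 = t1" "t 2 = t2" by (simp_all add: t_def)
  have "inj t" unfolding inj_def all_5 using t1(3) t2(3) t3 t4 by (auto simp: t_def)
  then obtain rho where "linear_change (lsub t) rho" using linear_change_ex by blast
  then interpret lc: linear_change "lsub t" rho .
  have thv: "lsub t (var i) = lf (t i)" for i unfolding lsub_def by (rule ev_var[OF rhom_const])
  obtain m0 e M where "curve_cut C (lf t0) (lf t1) ?J m0 e M"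
    using curve_generic[OF clC ch2 _ t0(1) refl _ t1(1)] by auto
  then interpret cc: curve_cut C "lf t0" "lf t1" ?J m0 e M .
  have ed: "e = d" by (rule cc.degree_e[OF ch1 C(3)])
  define c0 where "c0 = int (hilbert_function C m0) - int d * int m0"
  have genus: "arith_genus C = 1 - c0" using cc.arith_genus_hilbert unfolding c0_def ed .
  let ?I = "lc.pull C"
  have idI: "ideal ?I" by (rule lc.pull_ideal[OF cc.idI])
  have g0: "lc.pull (gen (insert (lf t0) C)) = gen (insert (var 0) ?I)"
    using lc.pull_gen_insert[OF cc.idI, of "var 0"] by (simp add: thv tv)
  have pencil: "pencil ?I d m0 c0"
  proof
    show "homog_ideal ?I" by (rule lc.pull_homog_ideal[OF cc.I(1)])
    show "nzd (var 0) ?I" by (rule lc.pull_nzd) (simp add: thv tv t0)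
    show "nzd (var 2) ?I" by (rule lc.pull_nzd) (simp add: thv tv t2)
    show "f : gen (insert (var 0) ?I)" if "m0 <= n" "homog n f" "var 1 * f : gen (insert (var 0) ?I)" for n f
    proof -
      have "lf t1 * lsub t f : gen (insert (lf t0) C)" using that(3) unfolding g0[symmetric] by (simp add: rhom_mult[OF lc.th(1)] thv tv)
      then show ?thesis using nzdD[OF t1(1)] saturation_sup cc.high[OF that(1) lc.th(3)[OF that(2)]] g0[symmetric] by auto
    qed
    show "hilbert_function (gen (insert (var 0) ?I)) n = d" if "m0 <= n" for n
    proof -
      have "hilbert_function (gen (insert (lf t0) C)) n = hilbert_function ?J n"
        by (rule hf_cong) (use cc.high[OF that] saturation_sup in blast)
      then show ?thesis unfolding g0[symmetric] lc.pull_hilbert[OF ideal_gen] using cc.hfJ[OF that] ed by simp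
    qed
    show "int (hilbert_function ?I n) = int d * int n + c0" if "m0 <= n" for n
    proof -
      obtain j where n: "n = m0 + j" using \<open>m0 <= n\<close> le_Suc_ex by blast
      show ?thesis unfolding lc.pull_hilbert[OF cc.idI] n cc.hf_I_linear c0_def ed by (simp add: algebra_simps)
    qed
  qed
  let ?G = "rho G" and ?F = "rho F"
  let ?B = "gen (insert ?F (gen (insert ?G (Vid {0, 1, 2}))))"
  have hB: "homog_ideal ?B"
    by (rule homog_ideal_insert[OF homog_ideal_insert[OF homog_ideal_Vid lc.rho(3)[OF eqs(3)]] lc.rho(3)[OF hF]])
  have lc': "linear_change rho (lsub t)" using lc.linear_change_axioms unfolding linear_change_def by blast
  \<comment> \<open>Back in the original coordinates the chosen forms \<open>lf t0\<close>,
    \<open>lf t1\<close>, \<open>lf t2\<close> lie in \<open>?A\<close>, so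
    \<open>three_cuts\<close> shows that the surface misses the line they define.\<close>
  let ?A = "rho -` ?B"
  have hA: "homog_ideal ?A" by (rule linear_change.pull_homog_ideal[OF lc' hB])
  have memA: "lsub t f : ?A \<longleftrightarrow> f : ?B" for f by (simp add: lc.inv)
  have VB: "var i : ?B" if "i : {0, 1, 2}" for i by (metis that var_Vid subsetD[OF gen_insert_sup(1)[OF ideal_gen]] subsetD[OF gen_insert_sup(1)[OF ideal_Vid]])
  have GB: "?G : ?B" by (rule subsetD[OF gen_insert_sup(1)[OF ideal_gen] gen_insert_sup(2)])
  have FB: "?F : ?B" by (rule gen_insert_sup(2))
  have "points ?A = {}"
  proof (rule equals0I)
    fix P assume P: "P : points ?A"
    have "insert F X \<subseteq> P" using GB FB P eqs(2) rp_ideal points_def subsetD[OF rm.span_minimal[of "{G}" P]] by auto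
    then have PQ: "P : points ?Q" using P by (simp add: rm.span_minimal points_def rp_ideal)
    have "lf t0 : ?A" "lf t1 : ?A" "lf t2 : ?A" using memA[of "var 0"] memA[of "var 1"] memA[of "var 2"] VB by (simp_all add: thv tv)
    then show False using P points_def three_cuts[OF clQ Q3 _ _ _ t0(2) t1(2) t2(2) PQ, rotated 3] by auto
  qed
  then obtain N0 where N0: "!!i. var i ^ N0 : ?A" using irrelevant_power[OF hA] by blast
  \<comment> \<open>A form of degree \<open>5 * N0\<close>, such as a power of
    \<open>lf (t i)\<close>, is a combination of the powers \<open>var j ^ N0\<close>.\<close>
  define N where "N = 5 * N0"
  have irr: "var i ^ N : ?B" for i
  proof -
    have h: "homog N (lf (t i) ^ N)" using homog_power[OF homog_lf, of N "t i"] by simp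
    have "lf (t i) ^ N * 1 : ?A"
      by (rule homog_high_in_ideal[where N = N0, OF homog_ideal_ideal[OF hA] _ h]) (use N0 in \<open>simp_all add: N_def\<close>)
    then show ?thesis using memA by (fastforce simp: rhom_power[OF lc.th(1)] thv)
  qed
  have Fp: "?F = (PROD i:{1..l}. rho (H i) ^ r i)" unfolding F_def by (simp add: rhom_prod[OF lc.rho(1)] rhom_power[OF lc.rho(1)])
  have gX: "lc.pull X = gen {?G}" using lc.pull_gen_single[of ?G] by (simp add: lc.inv eqs(2))
  have pr: "generic_prime (gen (insert (rho (H i)) (gen {?G}))) N (s i) (dpoly (k i) (dpoly g hp4))" if i: "i : {1..l}" for i
  proof -
    have e: "lc.pull (gen (insert (H i) X)) = gen (insert (rho (H i)) (gen {?G}))"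
      using lc.pull_gen_insert[OF idX, of "rho (H i)"] by (simp add: lc.inv gX)
    have H: "homog (k i) (H i)" "k i > 0" "H i ~: X" "relevant_prime (gen (insert (H i) X))" "s i = g * k i" using Hi[OF i] by blast+
    show ?thesis unfolding e[symmetric]
    proof
      show "homog_ideal (lc.pull (gen (insert (H i) X)))" by (rule lc.pull_homog_ideal[OF rp_homog[OF H(4)]])
      show "prime_set (lc.pull (gen (insert (H i) X)))" using H(4) by (intro lc.pull_prime) (simp add: relevant_prime_alt)
      show "has_hp (lc.pull (gen (insert (H i) X))) (dpoly (k i) (dpoly g hp4))" by (rule lc.pull_has_hp[OF ideal_gen has_hp_insert[OF H(1,3)]])
      show "degree (dpoly (k i) (dpoly g hp4)) = 2" by (rule dpoly_insert(1)[OF H(2)])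
      show "lead_coeff (dpoly (k i) (dpoly g hp4)) = real (s i) / 2" unfolding H(5) by (rule dpoly_insert(2)[OF H(2)])
      show "1 <= s i" using H(2) eqs(4) by (simp add: H(5))
      fix j
      obtain b y where 1: "var j ^ N = b * ?F + y" "y : gen (insert ?G (Vid {0, 1, 2}))" using gen_insertE[OF irr ideal_gen] by metis
      obtain a v where 2: "y = a * ?G + v" "v : Vid {0, 1, 2}" using gen_insertE[OF 1(2) ideal_Vid] by metis
      \<comment> \<open>Positive multiplicity makes \<open>?F\<close> a multiple of each
        \<open>rho (H i)\<close>, so finiteness passes from the complete intersection to each
        component.\<close>
      have "?F = rho (H i) * (rho (H i) ^ (r i - 1) * (PROD j:{1..l} - {i}. rho (H j) ^ r j))" using Fp i by (simp add: rpos[OF i] power_Suc[symmetric] prod.remove)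
      then have "?F : gen (insert (rho (H i)) (gen {?G}))" by (simp only: ideal_mult'[OF ideal_gen gen_insert_sup(2)])
      moreover have "?G : gen (insert (rho (H i)) (gen {?G}))" using gen_insert_sup(1)[OF ideal_gen] rm.span_base[of ?G "{?G}"] by blast
      ultimately have "b * ?F + a * ?G : gen (insert (rho (H i)) (gen {?G}))" by (intro ideal_add[OF ideal_gen] ideal_mult[OF ideal_gen])
      moreover have "var j ^ N - v = b * ?F + a * ?G" unfolding 1(1) 2(1) by simp
      ultimately show "EX v:Vid {0, 1, 2}. var j ^ N - v : lc.pull (gen (insert (H i) X))" unfolding e using 2(2) by (intro bexI[of _ v]) simp_all
    qed
  qed
  have s1: "s 1 = g * k 1" using Hi[OF l] by blast
  have "curve_on_surface ?I d m0 c0 ?G ?F g K N (%i. rho (H i)) r l (s 1)"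
  proof (intro curve_on_surface.intro pencil curve_on_surface_axioms.intro)
    show "ci_pair ?G ?F g K N" by unfold_locales (intro lc.rho(3) eqs(3,4) hF K0 irr)+
    show "?G : ?I" "?F : ?I" using eqs(6,7) SC by (auto simp: lc.inv F_def)
    show "?F = (PROD i:{1..l}. rho (H i) ^ r i)" by (rule Fp)
    show "EX s' hp. s 1 <= s' & generic_prime (gen (insert (rho (H i)) (gen {?G}))) N s' hp" if i: "i : {1..l}" for i using i mono_onD[OF smono l i] pr[OF i] by auto
    show "1 <= s 1" using Hi[OF l] eqs(4) by simp
    show "s 1 <= g * K" unfolding s1 using K1 by simp
    \<comment> \<open>\<open>g * K\<close> is the degree of \<open>S\<close>, so the hypothesis on
      \<open>d\<close> supplies the bound \<open>2 (g K)^4 < d\<close> of the locale.\<close>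
    have "(g * K) ^ 4 <= (g * K) ^ 7" using eqs(4) K0 by (simp add: power_increasing)
    then show "2 * (g * K) ^ 4 < d" using big gK by auto
  qed
  then show ?thesis using curve_on_surface.genus_bound_c0 genus by auto
qed

section \<open>Sharpness\<close>

text \<open>The extremal example is the plane curve \<open>x\<^sub>2\<^sup>3\<^sup>1 = 0\<close>, of degree 31 and genus 435, on a plane in a
  hyperplane, so that \<open>deg S = 1\<close>.\<close>

definition hyp :: "mpoly set" where "hyp = Vid {4}"
definition plane :: "mpoly set" where "plane = Vid {3, 4}"
definition thick :: "mpoly set" where "thick = gen (insert (var 2 ^ 31) plane)"

lemma plane_insert: "plane = gen (insert (var 3) hyp)"
  unfolding plane_def hyp_def by (rule Vid_insert) simp

lemma rp_hyp: "relevant_prime hyp" and rp_plane: "relevant_prime plane"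
proof -
  have "card {4 :: 5} ~= card (UNIV :: 5 set)" "card {3, 4 :: 5} ~= card (UNIV :: 5 set)" by simp_all
  then show "relevant_prime hyp" "relevant_prime plane" unfolding hyp_def plane_def by (metis relevant_Vid)+
qed

interpretation ex: hypersurface hyp "var 4" 1
proof
  have "Vid {4} = gen (insert (var 4) {0})" unfolding Vid_empty[symmetric] by (rule Vid_insert) simp
  then show "hyp = gen {var 4}" unfolding hyp_def gen_insert_zero .
qed (simp_all add: rp_hyp)

lemma v3: "homog 1 (var 3)" "var 3 ~: hyp" by (simp_all add: hyp_def var_Vid)

lemma dim_hyp: "has_dim hyp 3"
  unfolding has_dim_def
proof
  show "has_chain hyp 3" by (rule Vid_chain[of _ "{4}"]) (simp_all add: hyp_def)
  show "~ has_chain hyp (Suc 3)" using hf_chain_degree[OF ex.idX _ ex.has_hp_X] ex.dpoly_X(1) by fastforce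
qed

lemma dim_plane: "has_dim plane 2"
  unfolding has_dim_def
proof
  show "has_chain plane 2" by (rule Vid_chain[of _ "{3, 4}"]) (simp_all add: plane_def)
  show "~ has_chain plane (Suc 2)"
    using hf_chain_degree[OF ideal_gen _ ex.has_hp_insert[OF v3]] ex.dpoly_insert(1)[of 1] unfolding plane_insert by fastforce
qed

lemma divisor_sum_plane: "divisor_sum hyp {i} (%_. 1) (%_. plane) plane"
  unfolding divisor_sum_def using ex.effective_cartier_insert[OF v3] by (simp flip: plane_insert)

lemma hyperplane_plane: "hyperplane_section hyp plane"
  unfolding hyperplane_section_def using v3 ex.saturated_insert[OF v3(2)] plane_insert by metis

text \<open>The plane is itself a hyperplane section, so the rational function 1 witnesses the
  equivalence, with the same local equation on both sides.\<close>

lemma equiv_plane: "equiv_hyperplane_multiple hyp plane"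
  unfolding equiv_hyperplane_multiple_def
proof (intro exI conjI)
  show "hyperplane_section hyp plane" by (rule hyperplane_plane)
  show "divisor_sum hyp {()} (%_. 1) (%_. plane) plane" by (rule divisor_sum_plane)
  have ec: "effective_cartier hyp plane" using ex.effective_cartier_insert[OF v3] by (simp flip: plane_insert)
  have one: "1 ~: hyp" by (rule rp_1[OF rp_hyp])
  have "1 : generic_ring hyp" unfolding generic_ring_def
    by (intro CollectI exI[of _ 1] exI[of _ 0]) (simp add: one)
  moreover have "1 ~: generic_max hyp" using ex.generic_max_num[of 1 1] one by auto
  moreover have "0 : generic_max hyp" unfolding generic_max_def
    by (intro CollectI exI[of _ 0] exI[of _ 1] exI[of _ "0::nat"]) (simp add: one rp_0[OF rp_hyp])
  moreover have "EX u phi phi'. u ~: P & local_generator hyp plane u phi & local_generator hyp plane u phi' & phi - 1 * phi' : generic_max hyp"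
    if P: "P : points hyp" for P
  proof -
    obtain u phi where "u ~: P" "local_generator hyp plane u phi" using ec P unfolding effective_cartier_def by blast
    then show ?thesis using \<open>0 : generic_max hyp\<close> by (intro exI[of _ u] exI[of _ phi]) simp
  qed
  ultimately show "lin_equiv hyp plane plane" unfolding lin_equiv_def using ec by blast
qed

lemma setting: "divisor_setting hyp 1 (%_. plane) (%_. 1) (%_. 1) plane"
proof -
  have "proj_degree plane = 1" using ex.proj_degree_insert[OF _ v3] by (simp flip: plane_insert)
  moreover have "effective_cartier hyp plane" using ex.effective_cartier_insert[OF v3] by (simp flip: plane_insert)
  ultimately show ?thesis
    unfolding divisor_setting_def integral_subscheme_def
    using rp_hyp rp_plane rp_closed dim_hyp dim_plane equiv_plane hyperplane_plane divisor_sum_plane[of "1::nat"]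
    by (simp add: mono_on_def)
qed

lemma hom31: "homog 31 (var 2 ^ 31)" by (rule homog_var_power)

lemma homog_thick: "homog_ideal thick" unfolding thick_def plane_def
  by (rule homog_ideal_insert[OF homog_ideal_Vid hom31])

text \<open>Setting x3 = x4 = 0 reduces the claim to divisibility by \<open>x2^31\<close>, which the
  factor x0 does not affect.\<close>

lemma nzd_thick: "nzd (var 0) thick"
  unfolding nzd_def
proof (intro allI impI)
  fix f assume "var 0 * f : thick"
  then obtain a v where av: "var 0 * f = a * var 2 ^ 31 + v" "v : plane"
    unfolding thick_def plane_def by (elim gen_insertE[OF _ ideal_Vid])
  let ?k = "kill {3, 4}"
  have kk: "?k (?k f) = ?k f"
    unfolding kill_part[of "{3, 4}" "?k f"] by (rule part_id) (simp add: kill_part supp_part)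
  have "var 0 ^ 1 * ?k f = ?k a * var 2 ^ 31"
    using arg_cong[OF av(1), of ?k] av(2)
    by (simp add: plane_def Vid_kill rhom_mult[OF kill_rhom] rhom_add[OF kill_rhom] rhom_power[OF kill_rhom] kill_var)
  then have "var 0 ^ 1 * ?k f : gen {var 2 ^ 31, var 2 ^ 31}" unfolding gen_same gen_single by simp
  then have "?k f : gen {var 2 ^ 31, var 2 ^ 31}" by (rule monomial_nzd_2[rotated 2]) simp_all
  then obtain b where b: "?k f = b * var 2 ^ 31" unfolding gen_same gen_single dvd_def by auto
  have "b * var 2 ^ 31 + (f - ?k f) : thick" using kk by (simp add: Vid_kill rhom_diff[OF kill_rhom] thick_def plane_def gen_insertI[OF ideal_Vid])
  then show "f : thick" unfolding b by simp
qed

lemma closed_thick: "closed_subscheme thick"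
proof -
  have "f : thick" if "f : saturation thick" for f
  proof -
    have "EX n. var 0 ^ n * f : thick" using that unfolding saturation_def by simp
    then show ?thesis using nzdD[OF nzd_power[OF nzd_thick]] by (elim exE)
  qed
  then show ?thesis using homog_thick saturation_sup unfolding closed_subscheme_def by blast
qed

lemma plane_power: "var 2 ^ 31 * f : plane ==> f : plane"
  using rp_mult[OF rp_plane] rp_power[OF rp_plane] by (simp add: plane_def var_Vid)

lemma hp_thick: "has_hp thick (dpoly 31 (dpoly 1 (dpoly 1 hp4)))"
  unfolding thick_def
  by (rule has_hp_nzd[OF _ hom31 plane_power]) (use rp_homog[OF rp_plane] ex.has_hp_insert[OF v3] in \<open>simp_all flip: plane_insert\<close>)

lemma hp_thick_degree: "degree (dpoly 31 (dpoly 1 (dpoly 1 hp4))) = 1" "lead_coeff (dpoly 31 (dpoly 1 (dpoly 1 hp4))) = 31"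
proof -
  have d: "degree (dpoly 1 (dpoly 1 hp4)) = Suc 1" using ex.dpoly_insert(1)[of 1] by simp
  show "degree (dpoly 31 (dpoly 1 (dpoly 1 hp4))) = 1" using dpoly_degree[OF d, of 31] by simp
  have "lead_coeff (dpoly 31 (dpoly 1 (dpoly 1 hp4))) = lead_coeff (dpoly 1 (dpoly 1 hp4)) * real 31 * real (Suc 1)"
    by (rule conjunct2[OF dpoly_degree[OF d]]) simp
  also have "lead_coeff (dpoly 1 (dpoly 1 hp4)) = real (1 * 1) / 2" by (rule ex.dpoly_insert(2)) simp
  finally show "lead_coeff (dpoly 31 (dpoly 1 (dpoly 1 hp4))) = 31" by simp
qed

lemma degree_thick: "proj_degree thick = 31"
  unfolding proj_degree_eq[OF hp_thick] hp_thick_degree(2) unfolding hp_thick_degree(1) by simp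

lemma dim_thick: "has_dim thick 1"
  unfolding has_dim_def
proof
  have "var 2 ^ 31 : Vid {2, 3, 4}" using ideal_mult'[OF ideal_Vid, of "var 2" _ "var 2 ^ 30"] by (simp add: var_Vid flip: power_Suc)
  moreover have "plane \<subseteq> Vid {2, 3, 4}" unfolding plane_def Vid_def by blast
  ultimately have "thick \<subseteq> Vid {2, 3, 4}" unfolding thick_def by (intro rm.span_minimal ideal_Vid) simp
  then show "has_chain thick 1" by (rule Vid_chain) simp
  show "~ has_chain thick (Suc 1)"
    using hf_chain_degree[OF homog_ideal_ideal[OF homog_thick] _ hp_thick] hp_thick_degree(1) by fastforce
qed

lemma hf_plane: "hilbert_function plane n = (n + 2) choose 2"
  unfolding plane_def by (rule hf_Vid) simp

text \<open>The difference of two binomial coefficients; 434 is \<open>31 * 28 / 2\<close>, so that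
  the genus will be \<open>434 + 1\<close>.\<close>

lemma hf_thick: "int (hilbert_function thick (n + 31)) = 31 * int (n + 31) - 434"
proof -
  have hp: "homog_ideal plane" by (rule rp_homog[OF rp_plane])
  have "hilbert_function plane (n + 31) = hilbert_function thick (n + 31) + (if 31 <= n + 31 then hilbert_function plane (n + 31 - 31) else 0)"
    unfolding thick_def by (rule hf_nzd[OF hp hom31 plane_power])
  then have e: "(n + 31 + 2) choose 2 = hilbert_function thick (n + 31) + ((n + 2) choose 2)" by (simp add: hf_plane)
  have c: "2 * ((x + 2) choose 2) = (x + 2) * (x + 1)" for x :: nat by (simp add: choose_two)
  have "(n + 31 + 2) * (n + 31 + 1) = 2 * hilbert_function thick (n + 31) + (n + 2) * (n + 1)"
    using e c[of "n + 31"] c[of n] by linarith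
  then show ?thesis by (simp add: algebra_simps)
qed

lemma genus_thick: "arith_genus thick = 435"
proof -
  let ?J = "saturation (gen (insert (var 0) thick))"
  have cl: "closed_subscheme ?J" by (intro closed_saturation homog_ideal_insert[OF homog_thick, of 1]) simp
  obtain t where t: "nzd (lf t) ?J" using avoid_finite[OF generic_nzd[OF cl]] by blast
  have "~ has_chain thick 2" using dim_thick by (simp add: has_dim_def eval_nat_numeral)
  then obtain m0 e M where "curve_cut thick (var 0) (lf t) ?J m0 e M"
    using curve_generic[OF closed_thick _ _ nzd_thick refl _ t] by auto
  then interpret cc: curve_cut thick "var 0" "lf t" ?J m0 e M .
  have "e = 31" using dim_thick has_dim_def cc.degree_e degree_thick by auto
  moreover have "int (hilbert_function thick (m0 + 31)) = 31 * int (m0 + 31) - 434" by (rule hf_thick)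
  ultimately show ?thesis using cc.arith_genus_hilbert cc.hf_I_linear[of 31] by simp
qed

theorem genus_bound_attained:
  "divisor_setting hyp 1 (%_. plane) (%_. 1) (%_. 1) plane" "curve thick" "subscheme_of thick plane"
  "proj_degree thick = real 31" "real_of_int (arith_genus thick) = genus_bound 31 1" using setting curve_def closed_thick dim_thick conjI thick_def gen_insert_sup(1)[OF rp_ideal[OF rp_plane]] subscheme_of_def rp_closed[OF rp_plane] degree_thick genus_thick genus_bound_def by auto

theorem corollary2p14:
  shows
    "(\<forall>X l D r s S C d.
        divisor_setting X l D r s S \<and> curve C \<and> subscheme_of C S \<and>
        proj_degree C = real d \<and> d > 30 * (\<Sum>i=1..l. r i * s i) ^ 7
        \<longrightarrow> real_of_int (arith_genus C) \<le> genus_bound d (s 1)) \<and>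
     (\<exists>X l D r s S C d.
        divisor_setting X l D r s S \<and> curve C \<and> subscheme_of C S \<and>
        proj_degree C = real d \<and> d > 30 * (\<Sum>i=1..l. r i * s i) ^ 7 \<and>
        real_of_int (arith_genus C) = genus_bound d (s 1))"
proof
  show "ALL X l D r s S C d.
        divisor_setting X l D r s S & curve C & subscheme_of C S &
        proj_degree C = real d & d > 30 * (SUM i=1..l. r i * s i) ^ 7
        --> real_of_int (arith_genus C) <= genus_bound d (s 1)"
    using genus_upper_bound by blast
  show "EX X l D r s S C d.
        divisor_setting X l D r s S & curve C & subscheme_of C S &
        proj_degree C = real d & d > 30 * (SUM i=1..l. r i * s i) ^ 7 &
        real_of_int (arith_genus C) = genus_bound d (s 1)"
    by (intro exI[of _ hyp] exI[of _ "1::nat"] exI[of _ "%_. plane"] exI[of _ "%_. 1::nat"] exI[of _ plane]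
        exI[of _ thick] exI[of _ "31::nat"] conjI genus_bound_attained) simp
qed

end
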